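(* Let $n,d\ge 1$, let $\alpha\in\{\mathrm D,\mathrm N,\mathrm R\}$, and suppose $u_\alpha^*\in\mathcal B^{2n+3}(\Omega)$ is a solution of $\Delta^n u=f$ in $\Omega$ satisfying the Dirichlet ($\alpha=\mathrm D$), Neumann ($\alpha=\mathrm N$) or Robin ($\alpha=\mathrm R$) boundary condition with data $\boldsymbol g_\alpha$; when $\alpha=\mathrm N$ let $\int_\Omega u^*_{\mathrm N}\,\mathrm dx=0$. Let $\mathcal F_{\mathrm{ReCU},m}$ be the class of two-layer networks associated with $u^*=u_\alpha^*$, let the number $N$ of interior sample points and the number $\widehat N$ of boundary sample points satisfy that $\widehat N$ is of order $N/d^2$, and let $$\hat{\boldsymbol v}_\theta=(\hat\varphi_0,\dots,\hat\varphi_{n-1})\in\arg\min_{\boldsymbol v_\theta\in\mathcal F_{\mathrm{ReCU},m}}\widehat{\mathcal L}^*_\alpha(\boldsymbol v_\theta).$$ Then there is a constant $C>0$, independent of $m$, $N$ and $u_\alpha^*$, such that: (i) for $\alpha=\mathrm N,\mathrm R$, $$\sum_{k=0}^{n-1}\Big(\mathbb E\|\hat\varphi_k-\Delta^k u_\alpha^*\|_{H^1(\Omega)}^2+\mathbb E\|\nabla\hat\varphi_k-\nabla\Delta^k u_\alpha^*\|_{H(\mathrm{div};\Omega)}^2\Big)\le C\Big(\frac{\|u_\alpha^*\|_{\mathcal B^{2n+3}(\Omega)}^2}{m}+\frac{\|u_\alpha^*\|_{\mathcal B^{2n+3}(\Omega)}^2}{\sqrt N}\Big);$$ (ii) for $\alpha=\mathrm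 D$, $$\sum_{k=0}^{n-1}\Big(\mathbb E\|\hat\varphi_k-\Delta^k u_{\mathrm D}^*\|_{H^1(\Omega)}^2+\mathbb E\|\nabla\hat\varphi_k-\nabla\Delta^k u_{\mathrm D}^*\|_{H(\mathrm{div};\Omega)}^2\Big)\le C\Big(\frac{\|u_{\mathrm D}^*\|_{\mathcal B^{2n+3}(\Omega)}^2}{\sqrt m}+\frac{\|u_{\mathrm D}^*\|_{\mathcal B^{2n+3}(\Omega)}^2}{\sqrt[4]{N}}\Big).$$ Here the expectation is over the random sampling of the training points in $\Omega$ and on $\partial\Omega$.
   Context: $\Omega=[0,1]^d$, $\boldsymbol n$ is the outer unit normal of $\partial\Omega$. Boundary conditions on $\partial\Omega$. Dirichlet: $(u,\Delta u,\dots,\Delta^{n-1}u)=\boldsymbol g_{\mathrm D}$. Neumann: $(\partial_{\boldsymbol n}u,\partial_{\boldsymbol n}\Delta u,\dots,\partial_{\boldsymbol n}\Delta^{n-1}u)=\boldsymbol g_{\mathrm N}$. Robin: $(u+\partial_{\boldsymbol n}u,\dots,\Delta^{n-1}u+\partial_{\boldsymbol n}\Delta^{n-1}u)=\boldsymbol g_{\mathrm R}$. Spectral Barron space. For $\boldsymbol k\in\mathbb N_0^d$ let $\Phi_{\boldsymbol k}(x)=\prod_{i=1}^d\cos(\pi k_ix_i)$, and let $\hat u(\boldsymbol k)$ be the expansion coefficients of $u\in L^1(\Omega)$ in $\{\Phi_{\boldsymbol k}\}$; $|\boldsymbol k|_1=\sum_i|k_i|$. Then $\mathcal B^s(\Omega)$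 is the set of $u\in L^1(\Omega)$ with $\|u\|_{\mathcal B^s(\Omega)}:=\sum_{\boldsymbol k\in\mathbb N_0^d}(1+\pi^s|\boldsymbol k|_1^s)|\hat u(\boldsymbol k)|<\infty$. Also write $\|\cdot\|_{\mathcal B^s}$. Networks. $\mathrm{ReCU}(t)=t^3$ for $t\ge0$ and $0$ for $t<0$. $\mathcal F_{\mathrm{ReCU},m}$ associated with $u^*$ is the set of functions $x\mapsto \boldsymbol c+\sum_{i=1}^m\boldsymbol a_i\,\mathrm{ReCU}(W_ix+b_i)\in\mathbb R^{n}$, $x\in\mathbb R^d$, with $\boldsymbol c,\boldsymbol a_i\in\mathbb R^{n}$, $W_i\in\mathbb R^{1\times d}$, $b_i\in\mathbb R$ and $|\boldsymbol c|\le2\|u^*\|_{\mathcal B^{2n+3}}$, $|W_i|_2\le1$, $|b_i|\le1$, $\sum_{i=1}^m|\boldsymbol a_i|\le4\|u^*\|_{\mathcal B^{2n+3}}$. An element is written $\boldsymbol v_\theta=(\varphi_0,\dots,\varphi_{n-1})$. Operators. $\boldsymbol f=(0,\dots,0,f)^T\in\mathbb R^{n}$; $\mathcal P^*\boldsymbol v=(\Delta\varphi_0-\varphi_1,\ \Delta\varphi_1-\varphi_2,\dots,\Delta\varphi_{n-2}-\varphi_{n-1},\ \Delta\varphi_{n-1})$. Boundary operators: $S^*_{\mathrm D}\boldsymbol v=(\varphi_0,\dots,\varphi_{n-1})$, $S^*_{\mathrm N}\boldsymbol v=(\partial_{\boldsymbol n}\varphi_0,\dots,\partial_{\boldsymbol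 n}\varphi_{n-1})$, $S^*_{\mathrm R}=S^*_{\mathrm D}+S^*_{\mathrm N}$. Empirical loss. $\{X_j\}_{j=1}^N$ and $\{\widehat X_j\}_{j=1}^{\widehat N}$ are independent uniformly distributed random points in $\Omega$ and on $\partial\Omega$; $\lambda,\mu>0$ are fixed penalty constants. For $\alpha=\mathrm D,\mathrm R$, $$\widehat{\mathcal L}^*_\alpha(\boldsymbol v_\theta)=\frac{|\Omega|}{N}\sum_{j=1}^N|(\mathcal P^*\boldsymbol v_\theta-\boldsymbol f)(X_j)|^2+\frac{|\partial\Omega|}{\widehat N}\sum_{j=1}^{\widehat N}\lambda|(S^*_\alpha\boldsymbol v_\theta-\boldsymbol g_\alpha)(\widehat X_j)|^2,$$ and for $\alpha=\mathrm N$ the term $\mu\big|\frac{|\Omega|}{N}\sum_{j=1}^N\varphi_0(X_j)\big|^2$ is added to this expression. Norm. $\|\boldsymbol v\|_{H(\mathrm{div};\Omega)}=(\|\boldsymbol v\|_{L^2(\Omega)}^2+\|\mathrm{div}\,\boldsymbol v\|_{L^2(\Omega)}^2)^{1/2}$. "$\widehat N$ is of order $N/d^2$" means $c_1N/d^2\le\widehat N\le c_2N/d^2$ for fixed constants $c_1,c_2>0$. The constant $C$ may depend on $n,d,\lambda,\mu,c_1,c_2$. *)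

theory Defs
  imports "HOL-Probability.Probability"
begin

definition cube :: "(real^'d) set" where
  "cube = cbox 0 One"


section \<open>Differential operators on the closed cube\<close>

text \<open>
  All derivatives are classical and are taken within the closed cube (one-sided on the
  faces), so that for points of the cube they depend only on the values of the function there.
\<close>

definition partial_deriv :: "'d \<Rightarrow> (real^'d \<Rightarrow> real) \<Rightarrow> real^'d \<Rightarrow> real" where
  "partial_deriv i v x =
     vector_derivative (\<lambda>t. v (x + t *\<^sub>R axis i 1))
       (at 0 within {t. x + t *\<^sub>R axis i 1 \<in> cube})"

definition gradient :: "(real^'d \<Rightarrow> real) \<Rightarrow> real^'d \<Rightarrow> real^'d" where
  "gradient v x = (\<chi> i. partial_deriv i v x)"

definition divergence :: "(real^'d \<Rightarrow> real^'d) \<Rightarrow> real^'d \<Rightarrow> real" where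
  "divergence w x = (\<Sum>i\<in>UNIV. partial_deriv i (\<lambda>y. w y $ i) x)"

definition laplacian :: "(real^'d \<Rightarrow> real) \<Rightarrow> real^'d \<Rightarrow> real" where
  "laplacian v = divergence (gradient v)"


section \<open>The boundary of the cube\<close>

text \<open>
  The outer unit normal exists exactly at the points in the relative interior of a face, that is,
  where exactly one coordinate lies in \<open>{0, 1}\<close>. The remaining boundary points form a null set for
  the surface measure; the value of \<open>outer_normal\<close> there has no meaning.
\<close>

definition regular_boundary :: "(real^'d) set" where
  "regular_boundary = {x \<in> frontier cube. \<exists>!i. x $ i = 0 \<or> x $ i = 1}"

definition outer_normal :: "real^'d \<Rightarrow> real^'d" where
  "outer_normal x = (\<chi> i. if x $ i = 1 then 1 else if x $ i = 0 then - 1 else 0)"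

definition normal_deriv :: "(real^'d \<Rightarrow> real) \<Rightarrow> real^'d \<Rightarrow> real" where
  "normal_deriv v x = outer_normal x \<bullet> gradient v x"

text \<open>
  The \<open>(d-1)\<close>-dimensional surface measure: on the face where the \<open>i\<close>-th coordinate is \<open>s\<close> it is the
  image of Lebesgue measure on the cube under the projection that sets the \<open>i\<close>-th coordinate to
  \<open>s\<close>, and the contributions of the \<open>2 d\<close> faces are added. For \<open>d = 1\<close> this is the counting measure
  on \<open>{0, 1}\<close>.
\<close>

definition surface_measure :: "(real^'d) measure" where
  "surface_measure =
     distr (restrict_space lborel cube \<Otimes>\<^sub>M count_space (UNIV \<times> {0, 1})) borel
       (\<lambda>(x, i, s). \<chi> j. if j = i then s else x $ j)"


section \<open>Boundary conditions\<close>

datatype bc = Dirichlet | Neumann | Robin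

fun boundary_op :: "bc \<Rightarrow> (real^'d \<Rightarrow> real) \<Rightarrow> real^'d \<Rightarrow> real" where
  "boundary_op Dirichlet v x = v x"
| "boundary_op Neumann v x = normal_deriv v x"
| "boundary_op Robin v x = v x + normal_deriv v x"

text \<open>
  Vectors in \<open>\<real>\<^sup>n\<close> are functions on \<open>nat\<close> of which only the components \<open>k < n\<close> matter, and
  \<open>L2_set a {..<n}\<close> is the Euclidean norm. The boundary data \<open>g k\<close>, \<open>k < n\<close>, are
  prescribed where the normal exists, i.e. up to a null set of the boundary.
\<close>

definition solves_bvp ::
  "bc \<Rightarrow> nat \<Rightarrow> (real^'d \<Rightarrow> real) \<Rightarrow> (real^'d \<Rightarrow> real) \<Rightarrow> (nat \<Rightarrow> real^'d \<Rightarrow> real) \<Rightarrow> bool" where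
  "solves_bvp \<alpha> n u f g \<longleftrightarrow>
     (\<forall>x\<in>interior cube. (laplacian ^^ n) u x = f x) \<and>
     (\<forall>k<n. \<forall>x\<in>regular_boundary. boundary_op \<alpha> ((laplacian ^^ k) u) x = g k x)"


section \<open>The spectral Barron space\<close>

definition cos_basis :: "nat^'d \<Rightarrow> real^'d \<Rightarrow> real" where
  "cos_basis k x = (\<Prod>i\<in>UNIV. cos (pi * real (k $ i) * x $ i))"

text \<open>The functions \<open>cos_basis k\<close> are orthogonal but not normalised in \<open>L\<^sup>2\<close>.\<close>

definition cos_coeff :: "(real^'d \<Rightarrow> real) \<Rightarrow> nat^'d \<Rightarrow> real" where
  "cos_coeff u k =
     (LINT x:cube|lborel. u x * cos_basis k x) / (LINT x:cube|lborel. (cos_basis k x)\<^sup>2)"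

definition barron_weight :: "nat \<Rightarrow> nat^'d \<Rightarrow> real" where
  "barron_weight s k = 1 + pi ^ s * (\<Sum>i\<in>UNIV. real (k $ i)) ^ s"

definition barron_space :: "nat \<Rightarrow> (real^'d \<Rightarrow> real) set" where
  "barron_space s =
     {u. set_integrable lborel cube u \<and>
         (\<lambda>k. barron_weight s k * \<bar>cos_coeff u k\<bar>) summable_on UNIV}"

definition barron_norm :: "nat \<Rightarrow> (real^'d \<Rightarrow> real) \<Rightarrow> real" where
  "barron_norm s u = (\<Sum>\<^sub>\<infinity>k. barron_weight s k * \<bar>cos_coeff u k\<bar>)"


section \<open>Two-layer ReCU networks\<close>

definition ReCU :: "real \<Rightarrow> real" where
  "ReCU t = (if t \<ge> 0 then t ^ 3 else 0)"

text \<open>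
  The class of networks \<open>x \<mapsto> (v 0 x, \<dots>, v (n-1) x)\<close> of width \<open>m\<close>; the parameter \<open>B\<close> stands for
  the Barron norm of the target function.
\<close>

definition ReCU_nets :: "nat \<Rightarrow> nat \<Rightarrow> real \<Rightarrow> (nat \<Rightarrow> real^'d \<Rightarrow> real) set" where
  "ReCU_nets n m B =
     {v. \<exists>(c :: nat \<Rightarrow> real) (a :: nat \<Rightarrow> nat \<Rightarrow> real) (W :: nat \<Rightarrow> real^'d) (b :: nat \<Rightarrow> real).
           L2_set c {..<n} \<le> 2 * B \<and>
           (\<forall>i<m. norm (W i) \<le> 1 \<and> \<bar>b i\<bar> \<le> 1) \<and>
           (\<Sum>i<m. L2_set (a i) {..<n}) \<le> 4 * B \<and>
           (\<forall>k<n. \<forall>x. v k x = c k + (\<Sum>i<m. a i k * ReCU (W i \<bullet> x + b i)))}"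


section \<open>Empirical loss\<close>

definition P_op :: "nat \<Rightarrow> (nat \<Rightarrow> real^'d \<Rightarrow> real) \<Rightarrow> nat \<Rightarrow> real^'d \<Rightarrow> real" where
  "P_op n v k x = (if Suc k < n then laplacian (v k) x - v (Suc k) x else laplacian (v k) x)"

definition f_vec :: "nat \<Rightarrow> (real^'d \<Rightarrow> real) \<Rightarrow> nat \<Rightarrow> real^'d \<Rightarrow> real" where
  "f_vec n f k x = (if Suc k = n then f x else 0)"

definition empirical_loss ::
  "bc \<Rightarrow> nat \<Rightarrow> real \<Rightarrow> real \<Rightarrow> (real^'d \<Rightarrow> real) \<Rightarrow> (nat \<Rightarrow> real^'d \<Rightarrow> real) \<Rightarrow>
   nat \<Rightarrow> (nat \<Rightarrow> real^'d) \<Rightarrow> nat \<Rightarrow> (nat \<Rightarrow> real^'d) \<Rightarrow> (nat \<Rightarrow> real^'d \<Rightarrow> real) \<Rightarrow> real" where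
  "empirical_loss \<alpha> n lam mu f g N x N' x' v =
     measure lborel (cube :: (real^'d) set) / real N *
       (\<Sum>j<N. (L2_set (\<lambda>k. P_op n v k (x j) - f_vec n f k (x j)) {..<n})\<^sup>2) +
     measure surface_measure (frontier cube :: (real^'d) set) / real N' *
       (\<Sum>j<N'. lam * (L2_set (\<lambda>k. boundary_op \<alpha> (v k) (x' j) - g k (x' j)) {..<n})\<^sup>2) +
     (if \<alpha> = Neumann
      then mu * (measure lborel (cube :: (real^'d) set) / real N * (\<Sum>j<N. v 0 (x j)))\<^sup>2
      else 0)"

text \<open>
  The points \<open>X j\<close>, \<open>j < N\<close>, and \<open>X' j\<close>, \<open>j < N'\<close>, are jointly independent and uniformly
  distributed in the cube and on its boundary, respectively.
\<close>

definition sample_points ::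
  "'w measure \<Rightarrow> nat \<Rightarrow> (nat \<Rightarrow> 'w \<Rightarrow> real^'d) \<Rightarrow> nat \<Rightarrow> (nat \<Rightarrow> 'w \<Rightarrow> real^'d) \<Rightarrow> bool" where
  "sample_points M N X N' X' \<longleftrightarrow>
     prob_space M \<and>
     prob_space.indep_vars M (\<lambda>_. borel) (case_sum X X') ({..<N} <+> {..<N'}) \<and>
     (\<forall>j<N. distr M borel (X j) = uniform_measure lborel cube) \<and>
     (\<forall>j<N'. distr M borel (X' j) = uniform_measure surface_measure (frontier cube))"


section \<open>Norms\<close>

definition L2_norm_cube :: "(real^'d \<Rightarrow> 'b::real_normed_vector) \<Rightarrow> real" where
  "L2_norm_cube w = sqrt (LINT x:cube|lborel. (norm (w x))\<^sup>2)"

definition H1_norm :: "(real^'d \<Rightarrow> real) \<Rightarrow> real" where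
  "H1_norm v = sqrt ((L2_norm_cube v)\<^sup>2 + (L2_norm_cube (gradient v))\<^sup>2)"

definition Hdiv_norm :: "(real^'d \<Rightarrow> real^'d) \<Rightarrow> real" where
  "Hdiv_norm w = sqrt ((L2_norm_cube w)\<^sup>2 + (L2_norm_cube (divergence w))\<^sup>2)"

text \<open>
  The sum over \<open>k < n\<close> of the expected squared errors of \<open>v k\<close> as an approximation of the \<open>k\<close>-th
  iterated Laplacian of \<open>u\<close>. The expectations are taken in the extended nonnegative reals, so a
  finite bound includes integrability.
\<close>

definition expected_error ::
  "'w measure \<Rightarrow> nat \<Rightarrow> (real^'d \<Rightarrow> real) \<Rightarrow> ('w \<Rightarrow> nat \<Rightarrow> real^'d \<Rightarrow> real) \<Rightarrow> ennreal" where
  "expected_error M n u v =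
     (\<Sum>k<n.
        (\<integral>\<^sup>+\<omega>. ennreal ((H1_norm (\<lambda>x. v \<omega> k x - (laplacian ^^ k) u x))\<^sup>2) \<partial>M) +
        (\<integral>\<^sup>+\<omega>. ennreal ((Hdiv_norm
            (\<lambda>x. gradient (v \<omega> k) x - gradient ((laplacian ^^ k) u) x))\<^sup>2) \<partial>M))"

end

theory Submission
  imports Defs
begin

text \<open>
  The proof combines three estimates. \<^emph>\<open>Stability\<close>: integration by parts and Poincare
  inequalities on the cube, applied to the components \<open>n - 1, \<dots>, 0\<close> in turn, bound the errors by
  the population loss. A Dirichlet residual is only small in \<open>L\<^sup>2\<close> of the boundary, so the normal
  derivative against which it is paired is merely bounded; weighting the two by \<open>\<eta>\<close> and \<open>1 / \<eta>\<close>
  costs half of the rate. \<^emph>\<open>Approximation\<close>: the fourth derivative of the cosine writes cosines as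
  averages of truncated cubics, and Maurey's argument, carried out greedily in the quadratic form of
  the population loss, finds a network of width \<open>m\<close> with loss \<open>O(1 / m)\<close>. \<^emph>\<open>Generalisation\<close>: each
  residual is a combination, with absolutely bounded weights, of functions from one finite-dimensional
  Lipschitz family, so its empirical mean square is controlled by the uniform deviation over pairs
  from this family, which chaining bounds by \<open>O(1 / sqrt N)\<close> independently of the width.
\<close>

section \<open>The unit cube\<close>

text \<open>The derivatives in the statement see a function only on the closed cube, and
  \<open>f\<close> and \<open>g\<close> are tied to \<open>u\<close> only in the open cube and off
  the edges. The proof therefore works with extensions to the whole space (for \<open>u\<close>, its
  cosine series) and discards a null set of samples. The smoothness actually consumed is
  \<open>2 * n + 2\<close>: the \<open>n - 1\<close> Laplacians of the last component cost
  \<open>2 * n - 2\<close> powers of the frequency and the representation by truncated cubics four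
  more; the same power makes the jets of the \<open>n\<close>-th Laplacian summable. All estimates
  are homogeneous in the Barron norm \<open>B\<close>: the weights of a residual sum to at most
  \<open>10 * B\<close> and the data are divided by \<open>6 * B\<close>, so deviations of the loss
  scale with the square of \<open>B\<close>. The minimiser may depend on the sample in a
  nonmeasurable way; a bound uniform over all networks, with one measurable majorant, is applied to
  it and to a competitor fixed before sampling. For Dirichlet data the loss is of order x^2 + y^2
  with x = m^(-1/2) and y = N^(-1/4), up to the factor B^2; taking \<open>\<eta>\<close> = (x + y) /
  2 balances \<open>\<eta>\<close> against loss / \<open>\<eta>\<close>.\<close>

abbreviation cube_measure :: "(real^'d) measure" where
  "cube_measure \<equiv> uniform_measure lborel cube"

definition upd :: "'d \<Rightarrow> real \<Rightarrow> real^'d \<Rightarrow> real^'d" where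
  "upd i t x = (\<chi> j. if j = i then t else x $ j)"

lemma upd_nth [simp]: "upd i t x $ j = (if j = i then t else x $ j)"
  by (simp add: upd_def)

lemma One_vec_nth [simp]: "(One :: real^'d) $ i = 1"
proof -
  have "(One :: real^'d) $ i = One \<bullet> axis i (1::real)" by (simp add: inner_axis)
  also have "\<dots> = 1" by (simp add: axis_in_Basis_iff)
  finally show ?thesis .
qed

lemma mem_cube: "x \<in> cube \<longleftrightarrow> (\<forall>i. 0 \<le> x $ i \<and> x $ i \<le> 1)"
  by (simp add: cube_def mem_box_cart del: sum_component)

lemma interior_cube: "interior cube = box 0 (One :: real^'d)"
  by (simp add: cube_def interior_cbox)

lemma mem_interior_cube: "x \<in> interior cube \<longleftrightarrow> (\<forall>i. 0 < x $ i \<and> x $ i < 1)"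
  by (simp add: interior_cube mem_box_cart del: sum_component)

lemma frontier_cube: "frontier cube = cube - interior cube"
  by (simp add: cube_def frontier_def)

lemma cube_borel [measurable, simp]: "cube \<in> sets borel"
  by (simp add: cube_def)

lemma emeasure_cube [simp]: "emeasure lborel (cube :: (real^'d) set) = 1"
  by (simp add: cube_def)

lemma measure_cube [simp]: "measure lborel (cube :: (real^'d) set) = 1"
  by (simp add: measure_def)

lemma prob_space_cube: "prob_space (cube_measure :: (real^'d) measure)"
  by (rule prob_space_uniform_measure) simp_all

lemma sets_cube_measure [measurable_cong]: "sets (cube_measure :: (real^'d) measure) = sets borel"
  by simp

lemma cube_measure_eq_density:
  "(cube_measure :: (real^'d) measure) = density lborel (indicator cube)"
  by (simp add: uniform_measure_def divide_ennreal_def)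

lemma AE_cube: "AE x in (cube_measure :: (real^'d) measure). x \<in> cube"
  by (rule AE_uniform_measureI) auto

lemma AE_interior_cube: "AE x in (cube_measure :: (real^'d) measure). x \<in> interior cube"
proof (rule AE_uniform_measureI)
  have "AE x in lborel. x \<notin> cbox 0 (One::real^'d) - box 0 One"
    by (rule AE_not_in) (rule null_sets_cbox_Diff_box)
  then show "AE x in lborel. (x::real^'d) \<in> cube \<longrightarrow> x \<in> interior cube"
    by (rule AE_mp) (auto simp: cube_def)
qed simp

lemma integral_cube:
  fixes f :: "real^'d \<Rightarrow> real"
  assumes "f \<in> borel_measurable borel"
  shows "(LINT x:cube|lborel. f x) = (\<integral>x. f x \<partial>cube_measure)"
proof -
  have "density lborel (indicator cube :: real^'d \<Rightarrow> ennreal) = density lborel (\<lambda>x. ennreal (indicator cube x))"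
    by (rule density_cong) (auto simp: ennreal_indicator)
  then have "(\<integral>x. f x \<partial>cube_measure) = (\<integral>x. indicator cube x *\<^sub>R f x \<partial>lborel)"
    unfolding cube_measure_eq_density using assms
    by (simp add: integral_density)
  then show ?thesis by (simp add: set_lebesgue_integral_def)
qed

lemma measurable_upd [measurable]:
  "(\<lambda>(t, x). upd i t x) \<in> borel_measurable (borel \<Otimes>\<^sub>M borel)"
  "upd i t \<in> borel_measurable borel"
proof -
  have eq: "upd i t x = x + (t - x $ i) *\<^sub>R axis i 1" for t x
    by (auto simp: vec_eq_iff axis_def)
  have [measurable]: "(\<lambda>x::real^'a. x $ i) \<in> borel_measurable borel"
    by (rule borel_measurable_continuous_onI) (intro continuous_intros)
  show "(\<lambda>(t, x). upd i t x) \<in> borel_measurable (borel \<Otimes>\<^sub>M borel)" "upd i t \<in> borel_measurable borel"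
    unfolding eq by measurable
qed

text \<open>Fubini along one coordinate: \<open>lborel\<close> is the image of a product measure
  indexed by \<open>Basis\<close>, and the factor belonging to \<open>axis i 1\<close> is split
  off.\<close>

lemma nn_integral_lborel_coordinate:
  fixes f :: "real^'d \<Rightarrow> ennreal" and i :: 'd
  assumes f [measurable]: "f \<in> borel_measurable borel"
  defines "P \<equiv> \<Pi>\<^sub>M b\<in>Basis - {axis i 1 :: real^'d}. (lborel :: real measure)"
  shows "(\<integral>\<^sup>+x. f x \<partial>lborel) = (\<integral>\<^sup>+g. (\<integral>\<^sup>+t. f (upd i t (\<Sum>b\<in>Basis - {axis i 1}. g b *\<^sub>R b)) \<partial>lborel) \<partial>P)"
proof -
  interpret product_sigma_finite "\<lambda>b::real^'d. lborel :: real measure"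
    by standard
  let ?b = "axis i 1 :: real^'d"
  have b: "?b \<in> Basis" by (simp add: axis_in_Basis_iff)
  then have B: "Basis = insert ?b (Basis - {?b})" by auto
  have "(\<integral>\<^sup>+x. f x \<partial>lborel) = (\<integral>\<^sup>+g. f (\<Sum>b\<in>Basis. g b *\<^sub>R b) \<partial>(\<Pi>\<^sub>M b\<in>Basis. lborel))"
    by (subst lborel_eq) (simp add: nn_integral_distr)
  also have "\<dots> = (\<integral>\<^sup>+g. (\<integral>\<^sup>+t. f (\<Sum>b\<in>Basis. (g(?b := t)) b *\<^sub>R b) \<partial>lborel) \<partial>P)"
    unfolding P_def
    by (subst (1) B, subst product_nn_integral_insert) (auto simp flip: B)
  also have "\<dots> = (\<integral>\<^sup>+g. (\<integral>\<^sup>+t. f (upd i t (\<Sum>b\<in>Basis - {?b}. g b *\<^sub>R b)) \<partial>lborel) \<partial>P)"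
  proof (intro nn_integral_cong)
    fix g t
    \<comment> \<open>The sum over the other basis vectors has \<open>i\<close>-th coordinate 0, so
      adding \<open>t\<close> times the missing vector is the same as
      \<open>upd i t\<close>.\<close>
    have z: "(\<Sum>b\<in>Basis - {?b}. g b *\<^sub>R b) $ i = 0"
      by (auto simp: sum_component Basis_vec_def axis_eq_axis intro!: sum.neutral) (auto simp: axis_def split: if_splits)
    have "(\<Sum>b\<in>Basis. (g(?b := t)) b *\<^sub>R b) = t *\<^sub>R ?b + (\<Sum>b\<in>Basis - {?b}. (g(?b := t)) b *\<^sub>R b)"
      using b by (subst sum.remove[of _ ?b]) auto
    also have "(\<Sum>b\<in>Basis - {?b}. (g(?b := t)) b *\<^sub>R b) = (\<Sum>b\<in>Basis - {?b}. g b *\<^sub>R b)"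
      by (intro sum.cong) auto
    also have "t *\<^sub>R ?b + \<dots> = upd i t (\<Sum>b\<in>Basis - {?b}. g b *\<^sub>R b)"
      using z by (auto simp: vec_eq_iff axis_def simp del: sum_component)
    finally show "f (\<Sum>b\<in>Basis. (g(?b := t)) b *\<^sub>R b) = f (upd i t (\<Sum>b\<in>Basis - {?b}. g b *\<^sub>R b))" by simp
  qed
  finally show ?thesis .
qed

text \<open>Replacing one coordinate by an independent uniform one preserves the uniform
  distribution. This removes the need for cubes of lower dimension: a face integral becomes an
  integral over the full cube of a function of \<open>upd i s x\<close>, in which the
  \<open>i\<close>-th coordinate of \<open>x\<close> is idle.\<close>

lemma nn_integral_cube_resample:
  fixes f :: "real^'d \<Rightarrow> ennreal"
  assumes f [measurable]: "f \<in> borel_measurable borel"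
  shows "(\<integral>\<^sup>+x. f x \<partial>cube_measure)
       = (\<integral>\<^sup>+x. (\<integral>\<^sup>+t. f (upd i t x) * indicator {0..1} t \<partial>lborel) \<partial>cube_measure)"
proof -
  define c where "c = (\<lambda>g::real^'d \<Rightarrow> real. \<Sum>b\<in>Basis - {axis i 1}. g b *\<^sub>R b)"
  let ?P = "\<Pi>\<^sub>M b\<in>Basis - {axis i 1 :: real^'d}. (lborel :: real measure)"
  \<comment> \<open>The cylinder over the cube in direction \<open>i\<close>: membership in it does
    not depend on the \<open>i\<close>-th coordinate, so its indicator can leave the inner
    integral.\<close>
  define Q where "Q = {x::real^'d. \<forall>j. j \<noteq> i \<longrightarrow> 0 \<le> x $ j \<and> x $ j \<le> 1}"
  have ind: "indicator cube (upd i t x) = (indicator Q x * indicator {0..1} t :: ennreal)" for t x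
    by (auto simp: Q_def mem_cube indicator_def)
  have [measurable]: "(\<lambda>t. upd i t x) \<in> borel_measurable borel" for x
    using measurable_compose[OF _ measurable_upd(1), of "\<lambda>t. (t, x)" borel i] by simp
  have upd2: "upd i t (upd i s x) = upd i t x" for t s x by (simp add: vec_eq_iff)
  have mI: "(\<lambda>x. \<integral>\<^sup>+t. f (upd i t x) * indicator {0..1} t \<partial>lborel) \<in> borel_measurable borel"
  proof -
    have "(\<lambda>p. f (upd i (snd p) (fst p)) * indicator {0..1} (snd p)) \<in> borel_measurable (borel \<Otimes>\<^sub>M lborel)"
      using measurable_compose[OF _ measurable_upd(1), of "\<lambda>p. (snd p, fst p)" "borel \<Otimes>\<^sub>M borel" i]
      by measurable
    then show ?thesis by measurable
  qed
  have 1: "(\<integral>\<^sup>+x. f x \<partial>cube_measure) = (\<integral>\<^sup>+x. f x * indicator cube x \<partial>lborel)"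
    unfolding cube_measure_eq_density by (subst nn_integral_density) (auto simp: mult.commute)
  also have "\<dots> = (\<integral>\<^sup>+g. (\<integral>\<^sup>+t. f (upd i t (c g)) * indicator cube (upd i t (c g)) \<partial>lborel) \<partial>?P)"
    unfolding c_def by (rule nn_integral_lborel_coordinate) simp
  also have "\<dots> = (\<integral>\<^sup>+g. indicator Q (c g) * (\<integral>\<^sup>+t. f (upd i t (c g)) * indicator {0..1} t \<partial>lborel) \<partial>?P)"
    unfolding ind by (intro nn_integral_cong, subst nn_integral_cmult[symmetric]) (auto intro!: nn_integral_cong simp: mult_ac)
  also have "\<dots> = (\<integral>\<^sup>+g. (\<integral>\<^sup>+s. (\<integral>\<^sup>+t. f (upd i t (upd i s (c g))) * indicator {0..1} t \<partial>lborel)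
        * indicator cube (upd i s (c g)) \<partial>lborel) \<partial>?P)"
  proof (intro nn_integral_cong)
    fix g
    let ?I = "\<integral>\<^sup>+t. f (upd i t (c g)) * indicator {0..1} t \<partial>lborel"
    have "(\<integral>\<^sup>+s. ?I * (indicator Q (c g) * indicator {0..1} (s::real)) \<partial>lborel) = (?I * indicator Q (c g)) * (\<integral>\<^sup>+s. indicator {0..1::real} s \<partial>lborel)"
      by (subst nn_integral_cmult[symmetric]) (auto simp: mult.assoc)
    then show "indicator Q (c g) * ?I = (\<integral>\<^sup>+s. (\<integral>\<^sup>+t. f (upd i t (upd i s (c g))) * indicator {0..1} t \<partial>lborel)
        * indicator cube (upd i s (c g)) \<partial>lborel)"
      by (simp add: upd2 ind mult.commute)
  qed
  also have "\<dots> = (\<integral>\<^sup>+x. (\<integral>\<^sup>+t. f (upd i t x) * indicator {0..1} t \<partial>lborel) * indicator cube x \<partial>lborel)"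
    unfolding c_def by (rule nn_integral_lborel_coordinate[symmetric]) (use mI in measurable)
  also have "\<dots> = (\<integral>\<^sup>+x. (\<integral>\<^sup>+t. f (upd i t x) * indicator {0..1} t \<partial>lborel) \<partial>cube_measure)"
    unfolding cube_measure_eq_density using mI by (subst nn_integral_density) (auto simp: mult.commute)
  finally show ?thesis .
qed

lemma AE_cubeI:
  assumes "\<And>x. x \<in> cube \<Longrightarrow> P x"
  shows "AE x in (cube_measure :: (real^'d) measure). P x"
  using AE_cube by (rule AE_mp) (auto simp: assms)

lemma upd_upd [simp]: "upd i t (upd i s x) = upd i t x"
  by (simp add: vec_eq_iff)

lemma upd_same [simp]: "upd i (x $ i) x = x"
  by (simp add: vec_eq_iff)

lemma upd_eq_add: "upd i t x = x + (t - x $ i) *\<^sub>R axis i 1"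
  by (auto simp: vec_eq_iff axis_def)

lemma upd_in_cube: "x \<in> cube \<Longrightarrow> 0 \<le> t \<Longrightarrow> t \<le> 1 \<Longrightarrow> upd i t x \<in> cube"
  by (simp add: mem_cube)

lemma continuous_upd [continuous_intros]:
  "continuous_on S f \<Longrightarrow> continuous_on S g \<Longrightarrow> continuous_on S (\<lambda>x. upd i (f x) (g x))"
  unfolding upd_eq_add by (intro continuous_intros)

lemma compact_cube: "compact (cube :: (real^'d) set)"
  by (simp add: cube_def)

lemma bounded_on_cube:
  fixes f :: "real^'d \<Rightarrow> real"
  assumes "continuous_on cube f"
  obtains K where "K > 0" "\<And>x. x \<in> cube \<Longrightarrow> \<bar>f x\<bar> \<le> K"
  using compact_imp_bounded[OF compact_continuous_image[OF assms compact_cube]]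
  by (auto simp: bounded_pos)

lemma integrable_cube_bounded:
  fixes f :: "real^'d \<Rightarrow> real"
  assumes "f \<in> borel_measurable borel" "\<And>x. x \<in> cube \<Longrightarrow> \<bar>f x\<bar> \<le> K"
  shows "integrable cube_measure f"
proof -
  interpret prob_space "cube_measure :: (real^'d) measure" by (rule prob_space_cube)
  show ?thesis
    by (rule integrable_const_bound[where B = K])
       (use assms in \<open>auto intro!: AE_cubeI simp: measurable_cong_sets[OF sets_cube_measure]\<close>)
qed

lemma integrable_cube_continuous:
  fixes f :: "real^'d \<Rightarrow> real"
  assumes "continuous_on UNIV f"
  shows "integrable cube_measure f"
proof -
  obtain K where "\<And>x. x \<in> cube \<Longrightarrow> \<bar>f x\<bar> \<le> K"
    using bounded_on_cube[OF continuous_on_subset[OF assms]] by auto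
  then show ?thesis
    by (intro integrable_cube_bounded[where K = K]) (use assms in \<open>auto intro: borel_measurable_continuous_onI\<close>)
qed

lemma integral_cube_mono:
  fixes f g :: "real^'d \<Rightarrow> real"
  assumes "continuous_on UNIV f" "continuous_on UNIV g" "\<And>x. x \<in> cube \<Longrightarrow> f x \<le> g x"
  shows "(\<integral>x. f x \<partial>cube_measure) \<le> (\<integral>x. g x \<partial>cube_measure)"
  using assms by (intro integral_mono_AE integrable_cube_continuous AE_cubeI)

text \<open>The fundamental theorem of calculus on each line in direction \<open>i\<close>, averaged
  over the lines by \<open>nn_integral_cube_resample\<close>. Every integration by parts below is an
  instance with a suitable \<psi>.\<close>

lemma integral_cube_partial:
  fixes \<psi> d :: "real^'d \<Rightarrow> real"
  assumes \<psi>: "continuous_on UNIV \<psi>" and d: "continuous_on UNIV d"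
    and der: "\<And>x t. ((\<lambda>t. \<psi> (upd i t x)) has_real_derivative d (upd i t x)) (at t)"
  shows "(\<integral>x. d x \<partial>cube_measure) = (\<integral>x. \<psi> (upd i 1 x) - \<psi> (upd i 0 x) \<partial>cube_measure)"
proof -
  interpret prob_space "cube_measure :: (real^'d) measure" by (rule prob_space_cube)
  \<comment> \<open>Nonnegative integrals are used for Fubini and the fundamental theorem, so
    \<open>d\<close> is shifted by a bound \<open>K\<close>; the shift cancels at the end.\<close>
  obtain K where K: "\<And>x. x \<in> cube \<Longrightarrow> \<bar>d x\<bar> \<le> K"
    using bounded_on_cube[OF continuous_on_subset[OF d]] by auto
  have Kd: "0 \<le> d x + K" if "x \<in> cube" for x
    using K[OF that] by linarith
  have cpsi: "continuous_on UNIV (\<lambda>x. \<psi> (upd i t x))" for t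
    by (intro continuous_on_compose2[OF \<psi>] continuous_intros) auto
  have md [measurable]: "d \<in> borel_measurable borel"
    using d by (rule borel_measurable_continuous_onI)
  have inner: "(\<integral>\<^sup>+t. ennreal (d (upd i t x) + K) * indicator {0..1} t \<partial>lborel)
      = ennreal (\<psi> (upd i 1 x) - \<psi> (upd i 0 x) + K) \<and> 0 \<le> \<psi> (upd i 1 x) - \<psi> (upd i 0 x) + K"
    if x: "x \<in> cube" for x
  proof -
    have [measurable]: "(\<lambda>t. d (upd i t x)) \<in> borel_measurable borel"
      by (intro borel_measurable_continuous_onI continuous_on_compose2[OF d] continuous_intros) auto
    have nn: "0 \<le> d (upd i t x) + K" if "0 \<le> t" "t \<le> 1" for t
      using K[OF upd_in_cube[OF x that, of i]] by linarith
    have D: "((\<lambda>t. \<psi> (upd i t x) + K * t) has_real_derivative d (upd i t x) + K) (at t)" for t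
      by (auto intro!: derivative_eq_intros der)
    have "(\<integral>\<^sup>+t. ennreal (d (upd i t x) + K) * indicator {0..1} t \<partial>lborel)
        = ennreal ((\<psi> (upd i 1 x) + K * 1) - (\<psi> (upd i 0 x) + K * 0))"
      by (rule nn_integral_FTC_Icc[where F = "\<lambda>t. \<psi> (upd i t x) + K * t"])
        (simp_all add: D nn has_field_derivative_at_within)
    moreover have "\<psi> (upd i 0 x) + K * 0 \<le> \<psi> (upd i 1 x) + K * 1"
      by (rule DERIV_nonneg_imp_nondecreasing[where f = "\<lambda>t. \<psi> (upd i t x) + K * t"])
        (simp, intro exI conjI, rule D, simp add: nn)
    ultimately show ?thesis by (simp add: algebra_simps)
  qed
  have cdiff: "continuous_on UNIV (\<lambda>x. \<psi> (upd i 1 x) - \<psi> (upd i 0 x))"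
    by (intro continuous_intros cpsi)
  have i1: "integrable cube_measure (\<lambda>x. d x + K)"
    by (intro integrable_cube_continuous continuous_intros d)
  have i2: "integrable cube_measure (\<lambda>x. \<psi> (upd i 1 x) - \<psi> (upd i 0 x) + K)"
    by (intro integrable_cube_continuous continuous_on_add cdiff continuous_on_const)
  have n1: "AE x in cube_measure. 0 \<le> d x + K"
    by (rule AE_cubeI) (rule Kd)
  have n2: "AE x in cube_measure. 0 \<le> \<psi> (upd i 1 x) - \<psi> (upd i 0 x) + K"
    by (rule AE_cubeI) (use inner in blast)
  have "ennreal (\<integral>x. d x + K \<partial>cube_measure) = (\<integral>\<^sup>+x. ennreal (d x + K) \<partial>cube_measure)"
    by (rule nn_integral_eq_integral[symmetric, OF i1 n1])
  also have "\<dots> = (\<integral>\<^sup>+x. (\<integral>\<^sup>+t. ennreal (d (upd i t x) + K) * indicator {0..1} t \<partial>lborel) \<partial>cube_measure)"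
    by (rule nn_integral_cube_resample) simp
  also have "\<dots> = (\<integral>\<^sup>+x. ennreal (\<psi> (upd i 1 x) - \<psi> (upd i 0 x) + K) \<partial>cube_measure)"
    by (intro nn_integral_cong_AE AE_cubeI) (use inner in blast)
  also have "\<dots> = ennreal (\<integral>x. \<psi> (upd i 1 x) - \<psi> (upd i 0 x) + K \<partial>cube_measure)"
    by (rule nn_integral_eq_integral[OF i2 n2])
  finally have "(\<integral>x. d x + K \<partial>cube_measure) = (\<integral>x. \<psi> (upd i 1 x) - \<psi> (upd i 0 x) + K \<partial>cube_measure)"
    using integral_nonneg_AE[OF n1] integral_nonneg_AE[OF n2] by (subst (asm) ennreal_inj)
  moreover have "(\<integral>x. d x + K \<partial>cube_measure) = (\<integral>x. d x \<partial>cube_measure) + K"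
    by (subst Bochner_Integration.integral_add) (simp_all add: prob_space integrable_cube_continuous[OF d])
  moreover have "(\<integral>x. \<psi> (upd i 1 x) - \<psi> (upd i 0 x) + K \<partial>cube_measure)
      = (\<integral>x. \<psi> (upd i 1 x) - \<psi> (upd i 0 x) \<partial>cube_measure) + K"
    by (subst Bochner_Integration.integral_add[OF integrable_cube_continuous[OF cdiff]])
      (simp_all add: prob_space)
  ultimately show ?thesis by simp
qed

section \<open>Integrals over faces, and jets of twice differentiable functions\<close>

definition face_integral :: "('d \<Rightarrow> real \<Rightarrow> real^'d \<Rightarrow> real) \<Rightarrow> real" where
  "face_integral F = (\<Sum>i\<in>UNIV. \<Sum>s\<in>{0,1}. \<integral>x. F i s (upd i s x) \<partial>cube_measure)"

text \<open>A jet consists of the value, the gradient and the pure second derivatives of a function.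
  Carrying them along avoids derivatives at the boundary, which are one-sided.\<close>

type_synonym 'd jet = "real \<times> (real^'d) \<times> (real^'d)"

abbreviation val :: "'d::finite jet \<Rightarrow> real" where "val j \<equiv> fst j"
abbreviation grd :: "'d::finite jet \<Rightarrow> real^'d" where "grd j \<equiv> fst (snd j)"
abbreviation hes :: "'d::finite jet \<Rightarrow> real^'d" where "hes j \<equiv> snd (snd j)"

definition lap :: "'d::finite jet \<Rightarrow> real" where
  "lap j = (\<Sum>i\<in>UNIV. hes j $ i)"

text \<open>Mixed second derivatives are left out because only the Laplacian enters: the
  \<open>i\<close>-th gradient component has to be differentiable in direction \<open>i\<close>
  alone. Everything is required on the whole space, so one-sided derivatives never appear in
  calculations with jets.\<close>

definition C2_jet :: "(real^'d \<Rightarrow> 'd jet) \<Rightarrow> bool" where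
  "C2_jet J \<longleftrightarrow> continuous_on UNIV J \<and>
     (\<forall>x. ((\<lambda>y. val (J y)) has_derivative (\<lambda>h. grd (J x) \<bullet> h)) (at x)) \<and>
     (\<forall>i x. ((\<lambda>t. grd (J (upd i t x)) $ i) has_real_derivative hes (J x) $ i) (at (x $ i)))"

lemma upd_has_derivative: "((\<lambda>t. upd i t x) has_vector_derivative axis i 1) (at t within S)"
  unfolding upd_eq_add by (auto intro!: derivative_eq_intros)

lemma C2_continuous:
  assumes "C2_jet J"
  shows "continuous_on S J" "continuous_on S (\<lambda>x. val (J x))" "continuous_on S (\<lambda>x. grd (J x))"
    "continuous_on S (\<lambda>x. hes (J x))" "continuous_on S (\<lambda>x. lap (J x))"
proof -
  show *: "continuous_on S J" using assms continuous_on_subset unfolding C2_jet_def by blast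
  show "continuous_on S (\<lambda>x. val (J x))" "continuous_on S (\<lambda>x. grd (J x))"
    "continuous_on S (\<lambda>x. hes (J x))" "continuous_on S (\<lambda>x. lap (J x))"
    unfolding lap_def by (intro continuous_intros *)+
qed

lemma C2_val_coord:
  assumes "C2_jet J"
  shows "((\<lambda>t. val (J (upd i t x))) has_real_derivative grd (J (upd i t x)) $ i) (at t)"
proof -
  have "((\<lambda>y. val (J y)) has_derivative (\<lambda>h. grd (J (upd i t x)) \<bullet> h)) (at (upd i t x))"
    using assms by (auto simp: C2_jet_def)
  then have "((\<lambda>t. val (J (upd i t x))) has_derivative (\<lambda>h. grd (J (upd i t x)) \<bullet> (h *\<^sub>R axis i 1))) (at t)"
    using upd_has_derivative[of i x t UNIV] has_derivative_compose[of "\<lambda>t. upd i t x"]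
    unfolding has_vector_derivative_def by fastforce
  then show ?thesis
    by (simp add: has_field_derivative_def inner_axis mult.commute[of _ "grd _ $ _"] mult_commute_abs)
qed

lemma C2_grd_coord:
  assumes "C2_jet J"
  shows "((\<lambda>t. grd (J (upd i t x)) $ i) has_real_derivative hes (J (upd i t x)) $ i) (at t)"
proof -
  have "((\<lambda>s. grd (J (upd i s (upd i t x))) $ i) has_real_derivative hes (J (upd i t x)) $ i) (at (upd i t x $ i))"
    using assms unfolding C2_jet_def by blast
  then show ?thesis by simp
qed

lemma C2_jetI:
  assumes "continuous_on UNIV J"
    and "\<And>x. ((\<lambda>y. val (J y)) has_derivative (\<lambda>h. grd (J x) \<bullet> h)) (at x)"
    and "\<And>i x. ((\<lambda>t. grd (J (upd i t x)) $ i) has_real_derivative hes (J x) $ i) (at (x $ i))"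
  shows "C2_jet J"
  using assms by (simp add: C2_jet_def)

lemma C2_jetD:
  assumes "C2_jet J"
  shows "continuous_on UNIV J"
    and "((\<lambda>y. val (J y)) has_derivative (\<lambda>h. grd (J x) \<bullet> h)) (at x)"
    and "((\<lambda>t. grd (J (upd i t x)) $ i) has_real_derivative hes (J x) $ i) (at (x $ i))"
  using assms by (simp_all add: C2_jet_def)

lemma C2_add:
  assumes "C2_jet J" "C2_jet K"
  shows "C2_jet (\<lambda>x. J x + K x)"
proof (rule C2_jetI)
  show "continuous_on UNIV (\<lambda>x. J x + K x)"
    by (intro continuous_intros C2_jetD(1) assms)
  show "((\<lambda>y. val (J y + K y)) has_derivative (\<lambda>h. grd (J x + K x) \<bullet> h)) (at x)" for x
    using has_derivative_add[OF C2_jetD(2)[OF assms(1)] C2_jetD(2)[OF assms(2)], of x]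
    by (simp add: inner_add_left)
  show "((\<lambda>t. grd (J (upd i t x) + K (upd i t x)) $ i) has_real_derivative hes (J x + K x) $ i) (at (x $ i))" for i x
    using DERIV_add[OF C2_jetD(3)[OF assms(1)] C2_jetD(3)[OF assms(2)], of i x] by simp
qed

lemma C2_scaleR:
  assumes "C2_jet J"
  shows "C2_jet (\<lambda>x. c *\<^sub>R J x)"
proof (rule C2_jetI)
  show "continuous_on UNIV (\<lambda>x. c *\<^sub>R J x)"
    by (intro continuous_intros C2_jetD(1) assms)
  show "((\<lambda>y. val (c *\<^sub>R J y)) has_derivative (\<lambda>h. grd (c *\<^sub>R J x) \<bullet> h)) (at x)" for x
    using has_derivative_mult_right[OF C2_jetD(2)[OF assms], of c x] by simp
  show "((\<lambda>t. grd (c *\<^sub>R J (upd i t x)) $ i) has_real_derivative hes (c *\<^sub>R J x) $ i) (at (x $ i))" for i x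
    using DERIV_cmult[OF C2_jetD(3)[OF assms, where i = i and x = x], of c] by simp
qed

lemma C2_const: "C2_jet (\<lambda>x. (c, 0, 0))"
  by (rule C2_jetI) (simp_all add: has_derivative_const)

lemma C2_diff:
  assumes "C2_jet J" "C2_jet K"
  shows "C2_jet (\<lambda>x. J x - K x)"
  using C2_add[OF assms(1) C2_scaleR[OF assms(2), of "-1"]] by simp

lemma C2_sum:
  assumes "\<And>i. i \<in> I \<Longrightarrow> C2_jet (J i)"
  shows "C2_jet (\<lambda>x. \<Sum>i\<in>I. J i x)"
  using assms
proof (induction I rule: infinite_finite_induct)
  case (insert i I)
  then show ?case using C2_add[of "J i" "\<lambda>x. \<Sum>i\<in>I. J i x"] by simp
qed (use C2_const[of 0] in \<open>simp_all add: zero_prod_def\<close>)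

definition ridge_jet :: "(real \<Rightarrow> real) \<Rightarrow> (real \<Rightarrow> real) \<Rightarrow> (real \<Rightarrow> real) \<Rightarrow> real^'d \<Rightarrow> real \<Rightarrow> real^'d \<Rightarrow> 'd jet" where
  "ridge_jet g g' g'' w b x =
     (g (w \<bullet> x + b), g' (w \<bullet> x + b) *\<^sub>R w, \<chi> i. g'' (w \<bullet> x + b) * (w $ i)\<^sup>2)"

lemma C2_ridge:
  assumes g: "\<And>z. (g has_real_derivative g' z) (at z)"
    and g': "\<And>z. (g' has_real_derivative g'' z) (at z)"
    and g'': "continuous_on UNIV g''"
  shows "C2_jet (ridge_jet g g' g'' w b)"
proof (rule C2_jetI)
  have cg: "continuous_on UNIV g" "continuous_on UNIV g'"
    using g g' DERIV_continuous_on has_field_derivative_at_within by blast+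
  show "continuous_on UNIV (ridge_jet g g' g'' w b)"
    unfolding ridge_jet_def by (intro continuous_intros continuous_on_compose2[OF cg(1)] continuous_on_compose2[OF cg(2)]
        continuous_on_compose2[OF g'']) auto
next
  fix x
  have "((\<lambda>y. g (w \<bullet> y + b)) has_derivative (\<lambda>h. g' (w \<bullet> x + b) * (w \<bullet> h))) (at x)"
    by (rule has_derivative_compose[of "\<lambda>y. w \<bullet> y + b" _ x UNIV g, simplified])
       (auto intro!: derivative_eq_intros g[unfolded has_field_derivative_def])
  then show "((\<lambda>y. val (ridge_jet g g' g'' w b y)) has_derivative (\<lambda>h. grd (ridge_jet g g' g'' w b x) \<bullet> h)) (at x)"
    by (simp add: ridge_jet_def)
next
  fix i x
  have l: "w \<bullet> upd i t x + b = (w \<bullet> x + b - w $ i * x $ i) + w $ i * t" for t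
    unfolding upd_eq_add by (simp add: inner_add_right inner_axis algebra_simps)
  have "((\<lambda>t. g' (w \<bullet> upd i t x + b)) has_real_derivative g'' (w \<bullet> x + b) * w $ i) (at (x $ i))"
    unfolding l
    by (rule DERIV_chain2[where f = g' and g = "\<lambda>t. w \<bullet> x + b - w $ i * x $ i + w $ i * t"])
       (auto intro!: derivative_eq_intros g')
  from DERIV_cmult_right[OF this, of "w $ i"]
  show "((\<lambda>t. grd (ridge_jet g g' g'' w b (upd i t x)) $ i) has_real_derivative hes (ridge_jet g g' g'' w b x) $ i) (at (x $ i))"
    by (simp add: ridge_jet_def power2_eq_square mult.assoc)
qed

section \<open>Derivatives within the cube\<close>

text \<open>Even at a face the admissible increments form a nondegenerate interval, so the
  derivative within the cube is unique. It therefore agrees with the two-sided derivative of any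
  \<open>w\<close> that coincides with \<open>v\<close> on the cube.\<close>

lemma partial_deriv_cube:
  assumes x: "x \<in> cube" and eq: "\<And>y. y \<in> cube \<Longrightarrow> v y = w y"
    and der: "((\<lambda>t. w (upd i t x)) has_real_derivative d) (at (x $ i))"
  shows "partial_deriv i v x = d"
proof -
  let ?S = "{t. x + t *\<^sub>R axis i 1 \<in> cube}"
  have S: "?S = {- (x $ i)..1 - x $ i}"
  proof (intro set_eqI iffI)
    fix t assume "t \<in> ?S"
    then have "0 \<le> (x + t *\<^sub>R axis i 1) $ i \<and> (x + t *\<^sub>R axis i 1) $ i \<le> 1" unfolding mem_cube by blast
    then show "t \<in> {- (x $ i)..1 - x $ i}" by (simp add: axis_def)
  next
    fix t assume "t \<in> {- (x $ i)..1 - x $ i}"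
    then show "t \<in> ?S" using x by (auto simp: mem_cube axis_def)
  qed
  have *: "upd i (x $ i + t) x = x + t *\<^sub>R axis i 1" for t
    by (simp add: upd_eq_add)
  have "((\<lambda>t. w (upd i (x $ i + t) x)) has_real_derivative d) (at 0)"
    using der DERIV_shift[of "\<lambda>t. w (upd i t x)" d 0 "x $ i"] by (simp add: add.commute)
  then have "((\<lambda>t. w (x + t *\<^sub>R axis i 1)) has_vector_derivative d) (at 0 within ?S)"
    unfolding * has_real_derivative_iff_has_vector_derivative by (rule has_vector_derivative_at_within)
  then have "((\<lambda>t. v (x + t *\<^sub>R axis i 1)) has_vector_derivative d) (at 0 within ?S)"
    by (rule has_vector_derivative_transform[rotated 2]) (use x eq in auto)
  moreover have "0 \<in> {- (x $ i)..1 - x $ i}" using x by (auto simp: mem_cube)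
  ultimately show ?thesis
    unfolding partial_deriv_def S
    by (intro vector_derivative_within_cbox[of "- (x $ i)" "1 - x $ i", simplified]) auto
qed

lemma
  assumes J: "C2_jet J" and eq: "\<And>y. y \<in> cube \<Longrightarrow> v y = val (J y)" and x: "x \<in> cube"
  shows gradient_C2: "gradient v x = grd (J x)"
    and laplacian_C2: "laplacian v x = lap (J x)"
proof -
  \<comment> \<open>Needed at every point of the cube, since the Laplacian differentiates this
    gradient along segments of the cube.\<close>
  have g: "gradient v y = grd (J y)" if "y \<in> cube" for y
  proof -
    have "((\<lambda>t. val (J (upd i t y))) has_real_derivative grd (J y) $ i) (at (y $ i))" for i
      using C2_val_coord[OF J, of i y "y $ i"] by simp
    then show ?thesis
      using that by (auto simp: gradient_def vec_eq_iff intro!: partial_deriv_cube[where w = "\<lambda>y. val (J y)"] eq)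
  qed
  then show "gradient v x = grd (J x)" using x .
  show "laplacian v x = lap (J x)"
    unfolding laplacian_def divergence_def lap_def
    using J x g by (intro sum.cong refl partial_deriv_cube[where w = "\<lambda>y. grd (J y) $ i" for i])
       (auto simp: C2_jet_def)
qed

section \<open>Integration by parts and trace inequalities\<close>

text \<open>In each coordinate, \<open>integral_cube_partial\<close> is applied to the value times
  the \<open>i\<close>-th gradient component; \<open>2 * s - 1\<close> is the sign of the outer
  normal on the face where that coordinate is \<open>s\<close>.\<close>

lemma green_cube:
  assumes J: "C2_jet J"
  shows "(\<integral>x. grd (J x) \<bullet> grd (J x) + val (J x) * lap (J x) \<partial>cube_measure)
       = face_integral (\<lambda>i s y. val (J y) * ((2 * s - 1) * grd (J y) $ i))"
proof -
  note c = C2_continuous[OF J, of UNIV]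
  have cu: "continuous_on UNIV (\<lambda>x. val (J (upd i s x)) * grd (J (upd i s x)) $ i)" for i s
    by (intro continuous_intros continuous_on_compose2[OF c(2)] continuous_on_compose2[OF c(3)]) auto
  have 1: "(\<integral>x. (grd (J x) $ i)\<^sup>2 + val (J x) * hes (J x) $ i \<partial>cube_measure)
     = (\<Sum>s\<in>{0,1}. \<integral>x. val (J (upd i s x)) * ((2 * s - 1) * grd (J (upd i s x)) $ i) \<partial>cube_measure)" for i
  proof -
    have "(\<integral>x. (grd (J x) $ i)\<^sup>2 + val (J x) * hes (J x) $ i \<partial>cube_measure)
       = (\<integral>x. val (J (upd i 1 x)) * grd (J (upd i 1 x)) $ i - val (J (upd i 0 x)) * grd (J (upd i 0 x)) $ i \<partial>cube_measure)"
      by (rule integral_cube_partial)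
        (auto intro!: continuous_intros c derivative_eq_intros C2_val_coord[OF J] C2_grd_coord[OF J] simp: power2_eq_square)
    then show ?thesis
      using integrable_cube_continuous[OF cu, of i 0] integrable_cube_continuous[OF cu, of i 1] by simp
  qed
  have "(\<integral>x. grd (J x) \<bullet> grd (J x) + val (J x) * lap (J x) \<partial>cube_measure)
      = (\<integral>x. (\<Sum>i\<in>UNIV. (grd (J x) $ i)\<^sup>2 + val (J x) * hes (J x) $ i) \<partial>cube_measure)"
    by (simp add: lap_def inner_vec_def sum.distrib sum_distrib_left power2_eq_square)
  also have "\<dots> = (\<Sum>i\<in>UNIV. \<integral>x. (grd (J x) $ i)\<^sup>2 + val (J x) * hes (J x) $ i \<partial>cube_measure)"
    by (intro Bochner_Integration.integral_sum integrable_cube_continuous continuous_intros c)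
  finally show ?thesis by (simp add: 1 face_integral_def)
qed

text \<open>Integrate the \<open>i\<close>-th derivative of the squared value times the weight
  \<open>x $ i - 1\<close>. The weight vanishes on the face at 1 and is -1 on the face at 0, so a
  single trace remains; the cross term is absorbed by completing a square.\<close>

lemma friedrichs_coordinate:
  assumes J: "C2_jet J"
  shows "(\<integral>x. (val (J x))\<^sup>2 \<partial>cube_measure)
      \<le> 2 * (\<integral>x. (val (J (upd i 0 x)))\<^sup>2 \<partial>cube_measure) + 4 * (\<integral>x. grd (J x) \<bullet> grd (J x) \<partial>cube_measure)"
proof -
  note c = C2_continuous[OF J, of UNIV]
  have cu: "continuous_on UNIV (\<lambda>x. (val (J (upd i s x)))\<^sup>2)" for i s
    by (intro continuous_intros continuous_on_compose2[OF c(2)]) auto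
  have cd: "continuous_on UNIV (\<lambda>x. (val (J x))\<^sup>2 + (x $ i - 1) * (2 * val (J x) * grd (J x) $ i))"
    by (intro continuous_intros c)
  have "(\<integral>x. (val (J x))\<^sup>2 + (x $ i - 1) * (2 * val (J x) * grd (J x) $ i) \<partial>cube_measure)
      = (\<integral>x. (upd i 1 x $ i - 1) * (val (J (upd i 1 x)))\<^sup>2 - (upd i 0 x $ i - 1) * (val (J (upd i 0 x)))\<^sup>2 \<partial>cube_measure)"
    by (rule integral_cube_partial[where \<psi> = "\<lambda>x. (x $ i - 1) * (val (J x))\<^sup>2"])
      (auto intro!: continuous_intros c derivative_eq_intros C2_val_coord[OF J] simp: algebra_simps)
  also have "\<dots> = (\<integral>x. (val (J (upd i 0 x)))\<^sup>2 \<partial>cube_measure)" by simp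
  finally have eq: "(\<integral>x. (val (J x))\<^sup>2 + (x $ i - 1) * (2 * val (J x) * grd (J x) $ i) \<partial>cube_measure)
      = (\<integral>x. (val (J (upd i 0 x)))\<^sup>2 \<partial>cube_measure)" .
  have "(\<integral>x. (val (J x))\<^sup>2 / 2 \<partial>cube_measure)
     \<le> (\<integral>x. ((val (J x))\<^sup>2 + (x $ i - 1) * (2 * val (J x) * grd (J x) $ i)) + 2 * (grd (J x) \<bullet> grd (J x)) \<partial>cube_measure)"
  proof (rule integral_cube_mono)
    fix x :: "real^'a" assume x: "x \<in> cube"
    let ?v = "val (J x)" and ?g = "grd (J x) $ i" and ?t = "x $ i - 1"
    have "?g\<^sup>2 \<le> grd (J x) \<bullet> grd (J x)"
      unfolding inner_vec_def power2_eq_square inner_real_def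
      by (rule member_le_sum[where f = "\<lambda>i. grd (J x) $ i * grd (J x) $ i"]) auto
    moreover have "?t\<^sup>2 * ?g\<^sup>2 \<le> ?g\<^sup>2"
      using x by (intro mult_left_le_one_le) (auto simp: mem_cube power2_eq_square intro!: abs_square_le_1[unfolded power2_eq_square, THEN iffD2] )
    moreover have "0 \<le> (?v / 2 + ?t * ?g)\<^sup>2" by simp
    ultimately show "?v\<^sup>2 / 2 \<le> (?v\<^sup>2 + ?t * (2 * ?v * ?g)) + 2 * (grd (J x) \<bullet> grd (J x))"
      by (simp add: power2_eq_square algebra_simps)
  next
    show "continuous_on UNIV (\<lambda>x. (val (J x))\<^sup>2 / 2)"
      by (intro continuous_intros c) simp
  qed (intro continuous_intros c)
  also have "\<dots> = (\<integral>x. (val (J (upd i 0 x)))\<^sup>2 \<partial>cube_measure) + 2 * (\<integral>x. grd (J x) \<bullet> grd (J x) \<partial>cube_measure)"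
    by (subst Bochner_Integration.integral_add)
       (auto simp: eq intro!: integrable_cube_continuous cd continuous_intros c)
  finally show ?thesis by simp
qed

text \<open>The same integration with a weight that vanishes on the opposite face, read in the other
  direction: now the trace is the quantity to be bounded.\<close>

lemma trace_coordinate:
  assumes J: "C2_jet J" and s: "s \<in> {0, 1}"
  shows "(\<integral>x. (val (J (upd i s x)))\<^sup>2 \<partial>cube_measure)
      \<le> 2 * (\<integral>x. (val (J x))\<^sup>2 \<partial>cube_measure) + (\<integral>x. grd (J x) \<bullet> grd (J x) \<partial>cube_measure)"
proof -
  note c = C2_continuous[OF J, of UNIV]
  define p where "p = (\<lambda>x::real^'a. x $ i - (1 - s))"
  have cu: "continuous_on UNIV (\<lambda>x. (val (J (upd i s x)))\<^sup>2)" for i s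
    by (intro continuous_intros continuous_on_compose2[OF c(2)]) auto
  have cd: "continuous_on UNIV (\<lambda>x. (val (J x))\<^sup>2 + p x * (2 * val (J x) * grd (J x) $ i))"
    unfolding p_def by (intro continuous_intros c)
  have "(\<integral>x. (val (J x))\<^sup>2 + p x * (2 * val (J x) * grd (J x) $ i) \<partial>cube_measure)
      = (\<integral>x. p (upd i 1 x) * (val (J (upd i 1 x)))\<^sup>2 - p (upd i 0 x) * (val (J (upd i 0 x)))\<^sup>2 \<partial>cube_measure)"
    unfolding p_def by (rule integral_cube_partial[where \<psi> = "\<lambda>x. (x $ i - (1 - s)) * (val (J x))\<^sup>2"])
      (auto intro!: continuous_intros c derivative_eq_intros C2_val_coord[OF J] simp: algebra_simps)
  also have "\<dots> = (\<integral>x. (val (J (upd i s x)))\<^sup>2 \<partial>cube_measure)"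
    using s by (auto simp: p_def)
  finally have eq: "(\<integral>x. (val (J (upd i s x)))\<^sup>2 \<partial>cube_measure)
      = (\<integral>x. (val (J x))\<^sup>2 + p x * (2 * val (J x) * grd (J x) $ i) \<partial>cube_measure)" by simp
  also have "\<dots> \<le> (\<integral>x. 2 * (val (J x))\<^sup>2 + grd (J x) \<bullet> grd (J x) \<partial>cube_measure)"
  proof (rule integral_cube_mono)
    fix x :: "real^'a" assume x: "x \<in> cube"
    let ?v = "val (J x)" and ?g = "grd (J x) $ i" and ?t = "p x"
    have "?g\<^sup>2 \<le> grd (J x) \<bullet> grd (J x)"
      unfolding inner_vec_def power2_eq_square inner_real_def
      by (rule member_le_sum[where f = "\<lambda>i. grd (J x) $ i * grd (J x) $ i"]) auto
    moreover have "?t\<^sup>2 * ?g\<^sup>2 \<le> ?g\<^sup>2"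
      using x s by (intro mult_left_le_one_le) (auto simp: p_def mem_cube power2_eq_square intro!: abs_square_le_1[unfolded power2_eq_square, THEN iffD2] )
    moreover have "0 \<le> (?v - ?t * ?g)\<^sup>2" by simp
    ultimately show "?v\<^sup>2 + ?t * (2 * ?v * ?g) \<le> 2 * ?v\<^sup>2 + grd (J x) \<bullet> grd (J x)"
      by (simp add: power2_eq_square algebra_simps)
  qed (rule cd, intro continuous_intros c)
  also have "\<dots> = 2 * (\<integral>x. (val (J x))\<^sup>2 \<partial>cube_measure) + (\<integral>x. grd (J x) \<bullet> grd (J x) \<partial>cube_measure)"
    by (subst Bochner_Integration.integral_add)
       (auto intro!: integrable_cube_continuous continuous_intros c)
  finally show ?thesis .
qed

section \<open>The uniform distribution on the boundary\<close>

abbreviation boundary_measure :: "(real^'d) measure" where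
  "boundary_measure \<equiv> uniform_measure surface_measure (frontier cube)"

lemma sets_surface_measure [simp, measurable_cong]: "sets surface_measure = sets borel"
  by (simp add: surface_measure_def)

lemma space_surface_measure [simp]: "space surface_measure = UNIV"
  by (simp add: surface_measure_def)

lemma nn_integral_surface:
  fixes f :: "real^'d \<Rightarrow> ennreal"
  assumes f [measurable]: "f \<in> borel_measurable borel"
  shows "(\<integral>\<^sup>+x. f x \<partial>surface_measure) = (\<Sum>i\<in>UNIV. \<Sum>s\<in>{0,1}. \<integral>\<^sup>+x. f (upd i s x) \<partial>cube_measure)"
proof -
  let ?C = "count_space (UNIV \<times> {0,1}) :: ('d \<times> real) measure"
  let ?R = "restrict_space lborel cube :: (real^'d) measure"
  interpret C: sigma_finite_measure ?C by (rule sigma_finite_measure_count_space_finite) simp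
  \<comment> \<open>The index of the face ranges over a finite set, so joint measurability reduces
    to measurability of \<open>upd i s\<close> for each fixed face.\<close>
  have m: "(\<lambda>(x, i, s). upd i s x) \<in> ?R \<Otimes>\<^sub>M ?C \<rightarrow>\<^sub>M borel"
  proof -
    have "(\<lambda>p. upd (fst (snd p)) (snd (snd p)) (fst p)) \<in> ?R \<Otimes>\<^sub>M ?C \<rightarrow>\<^sub>M borel"
    proof (rule measurable_compose_countable'[where f = "\<lambda>q p. upd (fst q) (snd q) (fst p)" and g = snd and I = "UNIV \<times> {0,1}"])
      fix q :: "'d \<times> real"
      have "fst \<in> ?R \<Otimes>\<^sub>M ?C \<rightarrow>\<^sub>M borel"
        by (rule measurable_compose[OF measurable_fst]) (simp add: measurable_restrict_space1)
      then show "(\<lambda>p. upd (fst q) (snd q) (fst p)) \<in> ?R \<Otimes>\<^sub>M ?C \<rightarrow>\<^sub>M borel"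
        by (rule measurable_compose[OF _ measurable_upd(2)])
    qed (auto intro: countable_finite)
    then show ?thesis by (simp add: case_prod_beta)
  qed
  have "(\<integral>\<^sup>+x. f x \<partial>surface_measure) = (\<integral>\<^sup>+p. f (case p of (x, i, s) \<Rightarrow> upd i s x) \<partial>(?R \<Otimes>\<^sub>M ?C))"
    using m unfolding surface_measure_def upd_def by (subst nn_integral_distr) (auto simp: case_prod_beta)
  also have "\<dots> = (\<integral>\<^sup>+x. \<integral>\<^sup>+q. f (upd (fst q) (snd q) x) \<partial>?C \<partial>?R)"
    using measurable_compose[OF m f] by (subst C.nn_integral_fst[symmetric]) (auto simp: case_prod_beta)
  also have "\<dots> = (\<integral>\<^sup>+x. (\<Sum>q\<in>UNIV \<times> {0,1}. f (upd (fst q) (snd q) x)) \<partial>?R)"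
    by (simp add: nn_integral_count_space_finite)
  also have "\<dots> = (\<integral>\<^sup>+x. (\<Sum>q\<in>UNIV \<times> {0,1}. f (upd (fst q) (snd q) x)) \<partial>cube_measure)"
  proof -
    have [measurable]: "(\<lambda>x. \<Sum>q\<in>UNIV \<times> {0,1}. f (upd (fst q) (snd q) x)) \<in> borel_measurable borel"
      by (intro borel_measurable_sum) (rule measurable_compose[OF measurable_upd(2) f])
    show ?thesis
      unfolding cube_measure_eq_density
      by (subst nn_integral_density, simp, simp, subst nn_integral_restrict_space) (auto simp: mult.commute)
  qed
  also have "\<dots> = (\<Sum>q\<in>UNIV \<times> {0,1}. \<integral>\<^sup>+x. f (upd (fst q) (snd q) x) \<partial>cube_measure)"
    by (intro nn_integral_sum) (simp add: measurable_compose[OF measurable_upd(2) f])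
  finally show ?thesis unfolding sum.cartesian_product by (simp add: case_prod_beta del: sum.insert)
qed

lemma upd_in_frontier: "x \<in> cube \<Longrightarrow> s \<in> {0,1} \<Longrightarrow> upd i s x \<in> frontier cube"
  by (auto simp: frontier_cube mem_cube mem_interior_cube intro!: exI[of _ i])

lemma upd_regular:
  assumes "x \<in> interior cube" "s \<in> {0, 1}"
  shows "upd i s x \<in> regular_boundary" "outer_normal (upd i s x) = (2 * s - 1) *\<^sub>R axis i 1"
proof -
  have ne: "x $ j \<noteq> 0" "x $ j \<noteq> 1" for j using assms(1) by (simp_all add: mem_interior_cube less_le)
  have "x \<in> cube" using assms(1) interior_subset by blast
  then show "upd i s x \<in> regular_boundary"
    using assms(2) ne by (auto simp: regular_boundary_def intro!: upd_in_frontier)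
  show "outer_normal (upd i s x) = (2 * s - 1) *\<^sub>R axis i 1"
    using assms(2) ne by (auto simp: outer_normal_def vec_eq_iff axis_def)
qed

lemma frontier_cube_borel [measurable, simp]: "frontier (cube :: (real^'d) set) \<in> sets borel"
  by (simp add: borel_closed)

lemma emeasure_frontier: "emeasure surface_measure (frontier cube :: (real^'d) set) = ennreal (2 * real CARD('d))"
proof -
  interpret prob_space "cube_measure :: (real^'d) measure" by (rule prob_space_cube)
  have "emeasure surface_measure (frontier cube :: (real^'d) set) = (\<integral>\<^sup>+x. indicator (frontier cube :: (real^'d) set) x \<partial>surface_measure)"
    by simp
  also have "\<dots> = (\<Sum>i\<in>(UNIV::'d set). \<Sum>s\<in>{0,1}. \<integral>\<^sup>+x. indicator (frontier cube :: (real^'d) set) (upd i s x) \<partial>cube_measure)"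
    by (rule nn_integral_surface) simp
  also have "\<dots> = (\<Sum>i\<in>(UNIV::'d set). \<Sum>s\<in>{0,1::real}. \<integral>\<^sup>+x. 1 \<partial>(cube_measure :: (real^'d) measure))"
    by (intro sum.cong refl nn_integral_cong_AE AE_cubeI) (simp add: upd_in_frontier)
  also have "\<dots> = ennreal (2 * real CARD('d))"
    by (simp add: emeasure_space_1 ennreal_of_nat_eq_real_of_nat mult.commute flip: ennreal_mult ennreal_numeral)
  finally show ?thesis .
qed

lemma measure_frontier: "measure surface_measure (frontier cube :: (real^'d) set) = 2 * real CARD('d)"
  by (simp add: measure_def emeasure_frontier)

lemma prob_space_boundary: "prob_space (boundary_measure :: (real^'d) measure)"
  by (rule prob_space_uniform_measure) (simp_all add: emeasure_frontier)

text \<open>The exceptional set consists of points where no coordinate, or more than one, lies in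
  {0, 1}. Its preimage under each face map \<open>upd i s\<close> misses the open cube and is
  therefore null.\<close>

lemma AE_boundary: "AE x in (boundary_measure :: (real^'d) measure). x \<in> regular_boundary"
proof (rule AE_uniform_measureI)
  define Z where "Z = {x::real^'d. \<not> (\<exists>!i. x $ i = 0 \<or> x $ i = 1)}"
  have [measurable]: "(\<lambda>x::real^'d. x $ i) \<in> borel_measurable borel" for i
    by (rule borel_measurable_continuous_onI) (intro continuous_intros)
  have [measurable]: "Z \<in> sets borel"
    unfolding Z_def Ex1_def by measurable
  have "emeasure surface_measure Z = (\<integral>\<^sup>+x. indicator Z x \<partial>surface_measure)"
    by simp
  also have "\<dots> = (\<Sum>i\<in>UNIV. \<Sum>s\<in>{0,1}. \<integral>\<^sup>+x. indicator Z (upd i s x) \<partial>cube_measure)"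
    by (rule nn_integral_surface) simp
  also have "\<dots> = (\<Sum>i\<in>(UNIV::'d set). \<Sum>s\<in>{0,1::real}. \<integral>\<^sup>+x. 0 \<partial>(cube_measure :: (real^'d) measure))"
  proof (intro sum.cong refl nn_integral_cong_AE)
    fix i and s :: real assume s: "s \<in> {0,1}"
    have "upd i s x \<notin> Z" if "x \<in> interior cube" for x
      using upd_regular(1)[OF that s] unfolding regular_boundary_def Z_def by blast
    then show "AE x in cube_measure. indicator Z (upd i s x) = (0::ennreal)"
      using AE_interior_cube by (rule_tac AE_mp[OF AE_interior_cube]) auto
  qed
  finally have "Z \<in> null_sets surface_measure" by (simp add: null_sets_def)
  then have "AE x in surface_measure. x \<notin> Z" by (rule AE_not_in)
  then show "AE x in (surface_measure :: (real^'d) measure). x \<in> frontier cube \<longrightarrow> x \<in> regular_boundary"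
    by (rule AE_mp) (auto simp: regular_boundary_def Z_def)
qed simp

lemma regular_boundary_subset: "x \<in> regular_boundary \<Longrightarrow> x \<in> cube"
  by (simp add: regular_boundary_def frontier_cube)

lemma AE_boundaryI:
  assumes "\<And>x. x \<in> regular_boundary \<Longrightarrow> P x"
  shows "AE x in (boundary_measure :: (real^'d) measure). P x"
  using AE_boundary by (rule AE_mp) (auto simp: assms)

text \<open>The divisor \<open>2 * real CARD('d)\<close> is the surface area of the cube. As in
  \<open>integral_cube_partial\<close>, adding the bound \<open>K\<close> allows a passage through
  nonnegative integrals, where \<open>nn_integral_surface\<close> applies.\<close>

lemma integral_boundary:
  fixes f :: "real^'d \<Rightarrow> real"
  assumes f [measurable]: "f \<in> borel_measurable borel" and K: "\<And>x. x \<in> cube \<Longrightarrow> \<bar>f x\<bar> \<le> K"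
  shows "(\<integral>x. f x \<partial>boundary_measure) = face_integral (\<lambda>i s. f) / (2 * real CARD('d))"
proof -
  interpret C: prob_space "cube_measure :: (real^'d) measure" by (rule prob_space_cube)
  interpret B: prob_space "boundary_measure :: (real^'d) measure" by (rule prob_space_boundary)
  let ?d = "2 * real CARD('d)"
  have d: "?d > 0" by simp
  have Kd: "0 \<le> f x + K" if "x \<in> cube" for x using K[OF that] by linarith
  have fu [measurable]: "(\<lambda>x. f (upd i s x)) \<in> borel_measurable borel" for i s
    by (rule measurable_compose[OF measurable_upd(2) f])
  have c01: "upd i s x \<in> cube" if "s \<in> {0,1}" "x \<in> cube" for i s and x :: "real^'d"
    using that by (auto intro: upd_in_cube)
  have iB: "integrable boundary_measure f"
  proof (rule B.integrable_const_bound[where B = K])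
    show "AE x in boundary_measure. norm (f x) \<le> K"
      by (rule AE_boundaryI) (simp add: regular_boundary_subset K)
  qed simp
  have iC: "integrable cube_measure (\<lambda>x. f (upd i s x))" if "s \<in> {0,1}" for i s
    by (rule integrable_cube_bounded[where K = K]) (use K c01[OF that] in simp_all)
  have AEc: "AE x in cube_measure. 0 \<le> f (upd i s x) + K" if "s \<in> {0,1}" for i s
    by (rule AE_cubeI) (use Kd c01[OF that] in blast)
  have AEb: "AE x in boundary_measure. 0 \<le> f x + K"
    by (rule AE_boundaryI) (simp add: regular_boundary_subset Kd)
  have eqc: "(\<integral>\<^sup>+x. ennreal (f (upd i s x) + K) \<partial>cube_measure) = ennreal ((\<integral>x. f (upd i s x) \<partial>cube_measure) + K)
      \<and> 0 \<le> (\<integral>x. f (upd i s x) \<partial>cube_measure) + K"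
    if "s \<in> {0,1}" for i s
  proof -
    have "(\<integral>\<^sup>+x. ennreal (f (upd i s x) + K) \<partial>cube_measure) = ennreal (\<integral>x. f (upd i s x) + K \<partial>cube_measure)"
      by (rule nn_integral_eq_integral[OF Bochner_Integration.integrable_add[OF iC[OF that] C.integrable_const] AEc[OF that]])
    moreover have "(\<integral>x. f (upd i s x) + K \<partial>cube_measure) = (\<integral>x. f (upd i s x) \<partial>cube_measure) + K"
      by (subst Bochner_Integration.integral_add) (simp_all add: iC[OF that] C.prob_space)
    ultimately show ?thesis using integral_nonneg_AE[OF AEc[OF that], of i] by simp
  qed
  have "ennreal ((\<integral>x. f x \<partial>boundary_measure) + K) = ennreal (\<integral>x. f x + K \<partial>boundary_measure)"
    by (subst Bochner_Integration.integral_add) (simp_all add: iB B.prob_space[simplified])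
  also have "\<dots> = (\<integral>\<^sup>+x. ennreal (f x + K) \<partial>boundary_measure)"
    by (rule nn_integral_eq_integral[symmetric, OF Bochner_Integration.integrable_add[OF iB B.integrable_const] AEb])
  also have "\<dots> = (\<integral>\<^sup>+x. ennreal (f x + K) * indicator (frontier cube) x \<partial>surface_measure) / ennreal ?d"
    by (subst nn_integral_uniform_measure) (simp_all add: emeasure_frontier)
  also have "(\<integral>\<^sup>+x. ennreal (f x + K) * indicator (frontier cube) x \<partial>surface_measure)
      = (\<Sum>i\<in>UNIV. \<Sum>s\<in>{0,1}. \<integral>\<^sup>+x. ennreal (f (upd i s x) + K) * indicator (frontier cube) (upd i s x) \<partial>cube_measure)"
    by (rule nn_integral_surface) simp
  also have "\<dots> = (\<Sum>i\<in>UNIV. \<Sum>s\<in>{0,1}. \<integral>\<^sup>+x. ennreal (f (upd i s x) + K) \<partial>cube_measure)"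
    by (intro sum.cong refl nn_integral_cong_AE AE_cubeI) (simp add: upd_in_frontier)
  also have "\<dots> = (\<Sum>i\<in>UNIV. \<Sum>s\<in>{0,1}. ennreal ((\<integral>x. f (upd i s x) \<partial>cube_measure) + K))"
    by (intro sum.cong refl) (simp add: eqc)
  also have "\<dots> = ennreal (\<Sum>i\<in>UNIV. \<Sum>s\<in>{0,1}. (\<integral>x. f (upd i s x) \<partial>cube_measure) + K)"
  proof -
    have "(\<Sum>s\<in>{0,1}. ennreal ((\<integral>x. f (upd i s x) \<partial>cube_measure) + K))
        = ennreal (\<Sum>s\<in>{0,1}. (\<integral>x. f (upd i s x) \<partial>cube_measure) + K)" for i
      by (rule sum_ennreal) (use eqc in blast)
    moreover have "0 \<le> (\<Sum>s\<in>{0,1}. (\<integral>x. f (upd i s x) \<partial>cube_measure) + K)" for i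
      by (rule sum_nonneg) (use eqc in blast)
    ultimately show ?thesis by (simp only: sum_ennreal)
  qed
  also have "(\<Sum>i\<in>UNIV. \<Sum>s\<in>{0,1}. (\<integral>x. f (upd i s x) \<partial>cube_measure) + K) = face_integral (\<lambda>i s. f) + ?d * K"
    by (simp add: face_integral_def sum.distrib algebra_simps)
  also have "ennreal (face_integral (\<lambda>i s. f) + ?d * K) / ennreal ?d = ennreal ((face_integral (\<lambda>i s. f) + ?d * K) / ?d)"
  proof (rule divide_ennreal)
    have "0 \<le> (\<Sum>i\<in>UNIV. \<Sum>s\<in>{0,1}. (\<integral>x. f (upd i s x) \<partial>cube_measure) + K)"
      using eqc by (intro sum_nonneg) auto
    then show "0 \<le> face_integral (\<lambda>i s. f) + ?d * K"
      by (simp add: face_integral_def sum.distrib algebra_simps)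
  qed simp
  finally have "ennreal ((\<integral>x. f x \<partial>boundary_measure) + K) = ennreal ((face_integral (\<lambda>i s. f) + ?d * K) / ?d)" .
  moreover have "0 \<le> (\<integral>x. f x \<partial>boundary_measure) + K"
    using integral_nonneg_AE[OF AEb] by (subst (asm) Bochner_Integration.integral_add) (simp_all add: iB B.prob_space[simplified])
  moreover have "0 \<le> (face_integral (\<lambda>i s. f) + ?d * K) / ?d"
  proof -
    have "0 \<le> (\<Sum>i\<in>UNIV. \<Sum>s\<in>{0,1}. (\<integral>x. f (upd i s x) \<partial>cube_measure) + K)"
      using eqc by (intro sum_nonneg) auto
    then show ?thesis
      by (simp add: face_integral_def sum.distrib algebra_simps)
  qed
  ultimately have "(\<integral>x. f x \<partial>boundary_measure) + K = (face_integral (\<lambda>i s. f) + ?d * K) / ?d"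
    by simp
  then show ?thesis using d by (simp add: add_divide_distrib)
qed

section \<open>The Poincare inequality\<close>

text \<open>For fixed \<open>y\<close> the map of \<open>x\<close> to the point of the segment is
  affine with Jacobian (1 - t)^d, which is at least 2^(-d) for \<open>t\<close> up to 1/2, and by
  convexity its image stays in the cube.\<close>

lemma nn_integral_segment_le:
  fixes F :: "real^'d \<Rightarrow> ennreal"
  assumes F [measurable]: "F \<in> borel_measurable borel" and y: "y \<in> cube" and t: "0 \<le> t" "t \<le> 1/2"
  shows "(\<integral>\<^sup>+x. F (t *\<^sub>R y + (1 - t) *\<^sub>R x) \<partial>cube_measure) \<le> 2 ^ CARD('d) * (\<integral>\<^sup>+x. F x \<partial>cube_measure)"
proof -
  let ?T = "\<lambda>x::real^'d. t *\<^sub>R y + (1 - t) *\<^sub>R x"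
  have [measurable]: "?T \<in> borel_measurable borel"
    by (intro borel_measurable_continuous_onI continuous_intros)
  have T: "?T x \<in> cube" if "x \<in> cube" for x
    using y that t by (auto simp: mem_cube intro!: convex_bound_le add_nonneg_nonneg)
  have half: "ennreal (1/2) ^ CARD('d) \<le> ennreal (\<bar>1 - t\<bar> ^ DIM(real^'d))"
  proof -
    have "(1/2) ^ CARD('d) \<le> \<bar>1 - t\<bar> ^ CARD('d)" using t by (intro power_mono) auto
    then show ?thesis by (subst ennreal_power) (auto intro: ennreal_leI)
  qed
  have "(\<integral>\<^sup>+x. F x * indicator cube x \<partial>lborel) = ennreal (\<bar>1 - t\<bar> ^ DIM(real^'d)) * (\<integral>\<^sup>+x. F (?T x) * indicator cube (?T x) \<partial>lborel)"
    using t by (subst lborel_affine[of "1 - t" "t *\<^sub>R y"])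
      (auto simp: nn_integral_density nn_integral_distr nn_integral_cmult)
  also have "\<dots> \<ge> ennreal (1/2) ^ CARD('d) * (\<integral>\<^sup>+x. F (?T x) * indicator cube x \<partial>lborel)"
    using half T by (intro mult_mono nn_integral_mono) (auto simp: indicator_def)
  finally have "2 ^ CARD('d) * (ennreal (1/2) ^ CARD('d) * (\<integral>\<^sup>+x. F (?T x) * indicator cube x \<partial>lborel))
      \<le> 2 ^ CARD('d) * (\<integral>\<^sup>+x. F x * indicator cube x \<partial>lborel)"
    by (rule mult_left_mono) simp
  moreover have "2 ^ CARD('d) * ennreal (1/2) ^ CARD('d) = 1"
  proof -
    have "ennreal 2 * ennreal (1/2) = ennreal (2 * (1/2))"
      by (rule ennreal_mult[symmetric]) auto
    also have "2 * (1/2) = (1::real)" by simp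
    finally have "2 * ennreal (1/2) = 1"
      by (simp only: ennreal_numeral ennreal_1)
    then show ?thesis by (simp flip: power_mult_distrib)
  qed
  ultimately have "(\<integral>\<^sup>+x. F (?T x) * indicator cube x \<partial>lborel) \<le> 2 ^ CARD('d) * (\<integral>\<^sup>+x. F x * indicator cube x \<partial>lborel)"
    by (simp flip: mult.assoc)
  then show ?thesis
    unfolding cube_measure_eq_density by (simp add: nn_integral_density mult.commute)
qed

text \<open>Cauchy-Schwarz for the derivative along the segment from \<open>x\<close> to
  \<open>y\<close>; the factor \<open>CARD('d)\<close> bounds the squared length of the
  segment.\<close>

lemma sq_diff_le_segment:
  assumes J: "C2_jet J" and x: "x \<in> cube" and y: "(y::real^'d) \<in> cube"
  shows "ennreal ((val (J x) - val (J y))\<^sup>2)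
      \<le> (\<integral>\<^sup>+t. ennreal (real CARD('d) * (grd (J (t *\<^sub>R y + (1 - t) *\<^sub>R x)) \<bullet> grd (J (t *\<^sub>R y + (1 - t) *\<^sub>R x)))) * indicator {0..1} t \<partial>lborel)"
proof -
  let ?p = "\<lambda>t. t *\<^sub>R y + (1 - t) *\<^sub>R x"
  define \<phi> where "\<phi> t = val (J (?p t))" for t
  define \<phi>' where "\<phi>' t = grd (J (?p t)) \<bullet> (y - x)" for t
  have d\<phi>: "(\<phi> has_real_derivative \<phi>' t) (at t)" for t
  proof -
    have "(?p has_derivative (\<lambda>h. h *\<^sub>R (y - x))) (at t)"
      by (auto intro!: derivative_eq_intros simp: algebra_simps)
    from has_derivative_compose[OF this C2_jetD(2)[OF J]]
    show ?thesis
      unfolding \<phi>_def \<phi>'_def has_field_derivative_def by (simp add: mult_commute_abs)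
  qed
  have c\<phi>': "continuous_on S \<phi>'" for S
    unfolding \<phi>'_def
    by (intro continuous_intros continuous_on_compose2[OF C2_continuous(3)[OF J, of UNIV]]) auto
  \<comment> \<open>The antiderivative is taken on a larger interval so that its derivative is
    two-sided at the endpoints of [0, 1] as well.\<close>
  obtain \<Phi> where \<Phi>: "\<And>t. t \<in> {-1..2} \<Longrightarrow> (\<Phi> has_vector_derivative (\<phi>' t)\<^sup>2) (at t within {-1..2})"
    using antiderivative_continuous[of "-1" 2 "\<lambda>t. (\<phi>' t)\<^sup>2"] continuous_on_power[OF c\<phi>'] by metis
  have d\<Phi>: "(\<Phi> has_real_derivative (\<phi>' t)\<^sup>2) (at t)" if "0 \<le> t" "t \<le> 1" for t
    using \<Phi>[of t] that at_within_interior[of t "{-1..2}"]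
    by (simp add: has_real_derivative_iff_has_vector_derivative)
  let ?c = "\<phi> 1 - \<phi> 0"
  \<comment> \<open>Cauchy-Schwarz in monotone form: the derivative of this function is the square
    of \<open>\<phi>' t - ?c\<close>, and comparing its end values leaves \<open>?c\<close> squared
    on the left.\<close>
  have "\<Phi> 0 - 2 * ?c * \<phi> 0 + ?c\<^sup>2 * 0 \<le> \<Phi> 1 - 2 * ?c * \<phi> 1 + ?c\<^sup>2 * 1"
  proof (rule DERIV_nonneg_imp_nondecreasing[where f = "\<lambda>t. \<Phi> t - 2 * ?c * \<phi> t + ?c\<^sup>2 * t"])
    fix t :: real assume t: "0 \<le> t" "t \<le> 1"
    have "((\<lambda>t. \<Phi> t - 2 * ?c * \<phi> t + ?c\<^sup>2 * t) has_real_derivative (\<phi>' t)\<^sup>2 - 2 * ?c * \<phi>' t + ?c\<^sup>2) (at t)"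
      by (auto intro!: derivative_eq_intros d\<Phi>[OF t] d\<phi>)
    moreover have "(\<phi>' t)\<^sup>2 - 2 * ?c * \<phi>' t + ?c\<^sup>2 = (\<phi>' t - ?c)\<^sup>2"
      by (simp add: power2_eq_square algebra_simps)
    ultimately show "\<exists>z. ((\<lambda>t. \<Phi> t - 2 * ?c * \<phi> t + ?c\<^sup>2 * t) has_real_derivative z) (at t) \<and> 0 \<le> z"
      by (metis zero_le_power2)
  qed simp
  then have "?c\<^sup>2 \<le> \<Phi> 1 - \<Phi> 0"
    by (simp add: power2_eq_square algebra_simps)
  then have "ennreal ((val (J x) - val (J y))\<^sup>2) \<le> ennreal (\<Phi> 1 - \<Phi> 0)"
    by (intro ennreal_leI) (simp add: \<phi>_def power2_commute)
  also have "\<dots> = (\<integral>\<^sup>+t. ennreal ((\<phi>' t)\<^sup>2) * indicator {0..1} t \<partial>lborel)"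
  proof (rule nn_integral_FTC_Icc[symmetric])
    show "(\<lambda>t. (\<phi>' t)\<^sup>2) \<in> borel_measurable borel"
      by (intro borel_measurable_continuous_onI continuous_on_power c\<phi>')
  qed (simp_all add: d\<Phi> has_field_derivative_at_within)
  also have "\<dots> \<le> (\<integral>\<^sup>+t. ennreal (real CARD('d) * (grd (J (?p t)) \<bullet> grd (J (?p t)))) * indicator {0..1} t \<partial>lborel)"
  proof (intro nn_integral_mono mult_right_mono ennreal_leI)
    fix t
    have "(\<phi>' t)\<^sup>2 \<le> (grd (J (?p t)) \<bullet> grd (J (?p t))) * ((y - x) \<bullet> (y - x))"
      unfolding \<phi>'_def by (rule Cauchy_Schwarz_ineq)
    also have "\<dots> \<le> (grd (J (?p t)) \<bullet> grd (J (?p t))) * (\<Sum>i\<in>(UNIV::'d set). 1)"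
    proof (rule mult_left_mono)
     show "(y - x) \<bullet> (y - x) \<le> (\<Sum>i\<in>(UNIV::'d set). 1)"
      unfolding inner_vec_def
    proof (rule sum_mono)
      fix i
      have "0 \<le> x $ i" "x $ i \<le> 1" "0 \<le> y $ i" "y $ i \<le> 1" using x y by (auto simp: mem_cube)
      then have "\<bar>(y - x) $ i\<bar> \<le> 1" by auto
      then show "(y - x) $ i \<bullet> (y - x) $ i \<le> 1"
        using abs_square_le_1[of "(y - x) $ i"] by (simp add: power2_eq_square)
     qed
    qed simp
    finally show "(\<phi>' t)\<^sup>2 \<le> real CARD('d) * (grd (J (?p t)) \<bullet> grd (J (?p t)))"
      by (simp add: mult.commute)
  qed simp
  finally show ?thesis .
qed

text \<open>The variance is half the double integral of squared differences, and each difference is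
  bounded along a segment. At parameter \<open>t\<close> the substitution is made in whichever of
  the two end points has weight at least 1/2; that costs the factor
  \<open>2 ^ CARD('d)\<close>.\<close>

lemma poincare_cube:
  fixes J :: "real^'d \<Rightarrow> 'd jet"
  assumes J: "C2_jet J"
  shows "(\<integral>x. (val (J x))\<^sup>2 \<partial>cube_measure) \<le> (\<integral>x. val (J x) \<partial>cube_measure)\<^sup>2
    + real CARD('d) * 2 ^ CARD('d) * (\<integral>x. grd (J x) \<bullet> grd (J x) \<partial>cube_measure)"
proof -
  interpret prob_space "cube_measure :: (real^'d) measure" by (rule prob_space_cube)
  interpret P: pair_sigma_finite "cube_measure :: (real^'d) measure" "cube_measure :: (real^'d) measure"
    by standard
  interpret Q: pair_sigma_finite "cube_measure :: (real^'d) measure" "lborel :: real measure"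
    by standard
  note c = C2_continuous[OF J, of UNIV]
  define F where "F x = ennreal (real CARD('d) * (grd (J x) \<bullet> grd (J x)))" for x
  let ?p = "\<lambda>x y t. t *\<^sub>R y + (1 - t) *\<^sub>R (x::real^'d)"
  have [measurable]: "F \<in> borel_measurable borel"
    unfolding F_def by (intro measurable_compose[OF _ measurable_ennreal] borel_measurable_continuous_onI continuous_intros c)
  have [measurable]: "(\<lambda>x. val (J x)) \<in> borel_measurable borel"
    by (intro borel_measurable_continuous_onI c)
  have seg: "(\<integral>\<^sup>+x. \<integral>\<^sup>+y. F (?p x y t) \<partial>cube_measure \<partial>cube_measure) \<le> 2 ^ CARD('d) * (\<integral>\<^sup>+x. F x \<partial>cube_measure)"
    if t: "0 \<le> t" "t \<le> 1" for t
  proof (cases "t \<le> 1/2")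
    case True
    have "(\<integral>\<^sup>+x. \<integral>\<^sup>+y. F (?p x y t) \<partial>cube_measure \<partial>cube_measure)
        = (\<integral>\<^sup>+y. \<integral>\<^sup>+x. F (?p x y t) \<partial>cube_measure \<partial>cube_measure)"
      by (rule P.Fubini') simp
    also have "\<dots> \<le> (\<integral>\<^sup>+y. 2 ^ CARD('d) * (\<integral>\<^sup>+x. F x \<partial>cube_measure) \<partial>(cube_measure :: (real^'d) measure))"
      by (intro nn_integral_mono_AE AE_cubeI nn_integral_segment_le) (use t True in auto)
    finally show ?thesis by (simp add: emeasure_space_1[simplified])
  next
    case False
    have "(\<integral>\<^sup>+x. \<integral>\<^sup>+y. F (?p x y t) \<partial>cube_measure \<partial>cube_measure)
        \<le> (\<integral>\<^sup>+x. 2 ^ CARD('d) * (\<integral>\<^sup>+y. F y \<partial>cube_measure) \<partial>(cube_measure :: (real^'d) measure))"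
    proof (intro nn_integral_mono_AE AE_cubeI)
      fix x :: "real^'d" assume "x \<in> cube"
      from nn_integral_segment_le[of F x "1 - t"] this
      show "(\<integral>\<^sup>+y. F (?p x y t) \<partial>cube_measure) \<le> 2 ^ CARD('d) * (\<integral>\<^sup>+y. F y \<partial>cube_measure)"
        using t False by (simp add: add.commute)
    qed
    then show ?thesis by (simp add: emeasure_space_1[simplified])
  qed
  let ?V = "\<integral>x. (val (J x))\<^sup>2 \<partial>cube_measure" and ?m = "\<integral>x. val (J x) \<partial>cube_measure"
  let ?G = "\<integral>x. grd (J x) \<bullet> grd (J x) \<partial>cube_measure"
  have i1: "integrable cube_measure (\<lambda>x. val (J x))" and i2: "integrable cube_measure (\<lambda>x. (val (J x))\<^sup>2)"
    and i3: "integrable cube_measure (\<lambda>x. grd (J x) \<bullet> grd (J x))"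
    by (intro integrable_cube_continuous continuous_intros c)+
  have inner: "(\<integral>\<^sup>+y. ennreal ((val (J x) - val (J y))\<^sup>2) \<partial>cube_measure) = ennreal ((val (J x))\<^sup>2 - 2 * val (J x) * ?m + ?V)
     \<and> 0 \<le> (val (J x))\<^sup>2 - 2 * val (J x) * ?m + ?V" for x
  proof -
    have "(\<integral>\<^sup>+y. ennreal ((val (J x) - val (J y))\<^sup>2) \<partial>cube_measure) = ennreal (\<integral>y. (val (J x) - val (J y))\<^sup>2 \<partial>cube_measure)"
      by (intro nn_integral_eq_integral integrable_cube_continuous continuous_intros c) simp
    moreover have "(\<integral>y. (val (J x) - val (J y))\<^sup>2 \<partial>cube_measure) = (\<integral>y. ((val (J x))\<^sup>2 - 2 * val (J x) * val (J y)) + (val (J y))\<^sup>2 \<partial>cube_measure)"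
      by (simp add: power2_eq_square algebra_simps)
    moreover have "\<dots> = (val (J x))\<^sup>2 - 2 * val (J x) * ?m + ?V"
      using i1 i2 by (simp add: prob_space[simplified])
    moreover have "0 \<le> (\<integral>y. (val (J x) - val (J y))\<^sup>2 \<partial>cube_measure)" by simp
    ultimately show ?thesis by simp
  qed
  have "ennreal (2 * ?V - 2 * ?m\<^sup>2) = ennreal (\<integral>x. (val (J x))\<^sup>2 - 2 * val (J x) * ?m + ?V \<partial>cube_measure)"
  proof -
    have "(\<integral>x. (val (J x))\<^sup>2 - 2 * val (J x) * ?m + ?V \<partial>cube_measure) = 2 * ?V - 2 * ?m\<^sup>2"
      using i1 i2 by (simp add: prob_space[simplified] power2_eq_square)
    then show ?thesis by simp
  qed
  also have "\<dots> = (\<integral>\<^sup>+x. ennreal ((val (J x))\<^sup>2 - 2 * val (J x) * ?m + ?V) \<partial>cube_measure)"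
    using inner by (intro nn_integral_eq_integral[symmetric] integrable_cube_continuous continuous_intros c) auto
  also have "\<dots> = (\<integral>\<^sup>+x. \<integral>\<^sup>+y. ennreal ((val (J x) - val (J y))\<^sup>2) \<partial>cube_measure \<partial>cube_measure)"
    using inner by simp
  also have "\<dots> \<le> (\<integral>\<^sup>+x. \<integral>\<^sup>+y. \<integral>\<^sup>+t. F (?p x y t) * indicator {0..1} t \<partial>lborel \<partial>cube_measure \<partial>cube_measure)"
    unfolding F_def by (intro nn_integral_mono_AE AE_cubeI sq_diff_le_segment J)
  also have "\<dots> = (\<integral>\<^sup>+x. \<integral>\<^sup>+t. \<integral>\<^sup>+y. F (?p x y t) * indicator {0..1} t \<partial>cube_measure \<partial>lborel \<partial>cube_measure)"
    by (intro nn_integral_cong Q.Fubini'[symmetric]) simp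
  also have "\<dots> = (\<integral>\<^sup>+t. \<integral>\<^sup>+x. \<integral>\<^sup>+y. F (?p x y t) * indicator {0..1} t \<partial>cube_measure \<partial>cube_measure \<partial>lborel)"
    by (rule Q.Fubini'[symmetric]) simp
  also have "\<dots> \<le> (\<integral>\<^sup>+t. 2 ^ CARD('d) * (\<integral>\<^sup>+x. F x \<partial>cube_measure) * indicator {0..1} t \<partial>(lborel :: real measure))"
    using seg by (intro nn_integral_mono) (auto simp: indicator_def)
  also have "\<dots> = 2 ^ CARD('d) * (\<integral>\<^sup>+x. F x \<partial>cube_measure)"
    by (subst nn_integral_cmult) auto
  also have "(\<integral>\<^sup>+x. F x \<partial>cube_measure) = ennreal (real CARD('d) * ?G)"
    unfolding F_def using i3 by (subst nn_integral_eq_integral) auto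
  also have "2 ^ CARD('d) * ennreal (real CARD('d) * ?G) = ennreal (2 ^ CARD('d) * (real CARD('d) * ?G))"
    by (simp add: ennreal_mult' flip: ennreal_numeral ennreal_power)
  finally have "2 * ?V - 2 * ?m\<^sup>2 \<le> 2 ^ CARD('d) * (real CARD('d) * ?G)"
    by (subst (asm) ennreal_le_iff) (auto intro!: mult_nonneg_nonneg)
  moreover have "0 \<le> 2 ^ CARD('d) * (real CARD('d) * ?G)"
    by (intro mult_nonneg_nonneg) auto
  moreover have "real CARD('d) * 2 ^ CARD('d) * ?G = 2 ^ CARD('d) * (real CARD('d) * ?G)"
    by (simp add: mult_ac)
  ultimately show ?thesis by linarith
qed

section \<open>Energy estimates for the three boundary conditions\<close>

lemma face_integral_mono:
  fixes F G :: "'d::finite \<Rightarrow> real \<Rightarrow> real^'d \<Rightarrow> real"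
  assumes "\<And>i s. continuous_on UNIV (F i s)" "\<And>i s. continuous_on UNIV (G i s)"
    and "\<And>i s y. s \<in> {0,1} \<Longrightarrow> y \<in> cube \<Longrightarrow> F i s y \<le> G i s y"
  shows "face_integral F \<le> face_integral G"
  unfolding face_integral_def
proof (intro sum_mono integral_cube_mono)
  fix i and s :: real and x :: "real^'d" assume "s \<in> {0,1}" "x \<in> cube"
  then show "F i s (upd i s x) \<le> G i s (upd i s x)" by (intro assms upd_in_cube) auto
qed (intro continuous_on_compose2[OF assms(1)] continuous_on_compose2[OF assms(2)] continuous_intros, auto)+

lemma integrable_face:
  assumes "continuous_on UNIV f"
  shows "integrable cube_measure (\<lambda>x::real^'d. f (upd i s x) :: real)"
  by (intro integrable_cube_continuous continuous_on_compose2[OF assms] continuous_intros) auto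

lemma face_integral_add:
  fixes F G :: "'d::finite \<Rightarrow> real \<Rightarrow> real^'d \<Rightarrow> real"
  assumes "\<And>i s. continuous_on UNIV (F i s)" "\<And>i s. continuous_on UNIV (G i s)"
  shows "face_integral (\<lambda>i s y. F i s y + G i s y) = face_integral F + face_integral G"
  unfolding face_integral_def sum.distrib[symmetric]
  by (intro sum.cong refl Bochner_Integration.integral_add integrable_face assms)

lemma face_integral_cmult:
  "face_integral (\<lambda>i s y. c * F i s y) = c * face_integral F"
  by (simp add: face_integral_def sum_distrib_left distrib_left)

lemma face_integral_const:
  "face_integral (\<lambda>(i::'d::finite) s y. c) = 2 * real CARD('d) * c"
proof -
  interpret prob_space "cube_measure :: (real^'d) measure" by (rule prob_space_cube)
  show ?thesis by (simp add: face_integral_def prob_space[simplified])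
qed

lemma face_integral_nonneg:
  assumes "\<And>i s y. 0 \<le> F i s y"
  shows "0 \<le> face_integral F"
  unfolding face_integral_def using assms by (intro sum_nonneg integral_nonneg_AE) auto

text \<open>On the face where the \<open>i\<close>-th coordinate is \<open>s \<in> {0, 1}\<close>, the outer normal derivative is
  \<open>(2 * s - 1)\<close> times the \<open>i\<close>-th partial derivative.\<close>

fun bc_jet :: "bc \<Rightarrow> 'd \<Rightarrow> real \<Rightarrow> 'd::finite jet \<Rightarrow> real" where
  "bc_jet Dirichlet i s j = val j"
| "bc_jet Neumann i s j = (2 * s - 1) * grd j $ i"
| "bc_jet Robin i s j = val j + (2 * s - 1) * grd j $ i"

definition val_sq where "val_sq J = (\<integral>x. (val (J x))\<^sup>2 \<partial>cube_measure)"
definition grd_sq where "grd_sq J = (\<integral>x. grd (J x) \<bullet> grd (J x) \<partial>cube_measure)"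
definition lap_sq where "lap_sq J = (\<integral>x. (lap (J x))\<^sup>2 \<partial>cube_measure)"
definition bc_sq where "bc_sq \<alpha> J = face_integral (\<lambda>i s y. (bc_jet \<alpha> i s (J y))\<^sup>2)"

lemma sq_nonneg: "0 \<le> val_sq J" "0 \<le> grd_sq J" "0 \<le> lap_sq J" "0 \<le> bc_sq \<alpha> J"
  by (simp_all add: val_sq_def grd_sq_def lap_sq_def bc_sq_def face_integral_nonneg)

lemma continuous_bc_jet [continuous_intros]:
  assumes "C2_jet J"
  shows "continuous_on UNIV (\<lambda>y. bc_jet \<alpha> i s (J y))"
  by (cases \<alpha>) (auto intro!: continuous_intros C2_continuous[OF assms])

text \<open>Green's identity with the interior pairing split by Young's inequality. The weight
  \<open>\<epsilon>\<close> stays free: the value term is absorbed later by Friedrichs or Poincare,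
  whose constants differ.\<close>

lemma energy_identity:
  assumes J: "C2_jet J" and \<epsilon>: "\<epsilon> > 0"
  shows "grd_sq J \<le> face_integral (\<lambda>i s y. val (J y) * bc_jet Neumann i s (J y)) + \<epsilon> * val_sq J + lap_sq J / (4 * \<epsilon>)"
proof -
  note c = C2_continuous[OF J, of UNIV]
  have i: "integrable cube_measure (\<lambda>x. grd (J x) \<bullet> grd (J x))" "integrable cube_measure (\<lambda>x. (val (J x))\<^sup>2)"
     "integrable cube_measure (\<lambda>x. (lap (J x))\<^sup>2)" "integrable cube_measure (\<lambda>x. val (J x) * lap (J x))"
    by (intro integrable_cube_continuous continuous_intros c)+
  have "(\<integral>x. - (val (J x) * lap (J x)) \<partial>cube_measure) \<le> (\<integral>x. \<epsilon> * (val (J x))\<^sup>2 + inverse (4 * \<epsilon>) * (lap (J x))\<^sup>2 \<partial>cube_measure)"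
  proof (rule integral_cube_mono)
    fix x
    have "0 \<le> (2 * \<epsilon> * val (J x) + lap (J x))\<^sup>2" by simp
    then have "4 * \<epsilon> * (- (val (J x) * lap (J x))) \<le> 4 * \<epsilon> * (\<epsilon> * (val (J x))\<^sup>2) + (lap (J x))\<^sup>2"
      by (simp add: power2_eq_square algebra_simps)
    also have "\<dots> = 4 * \<epsilon> * (\<epsilon> * (val (J x))\<^sup>2 + inverse (4 * \<epsilon>) * (lap (J x))\<^sup>2)"
      using \<epsilon> by (simp add: distrib_left)
    finally have "4 * \<epsilon> * (- (val (J x) * lap (J x))) \<le> 4 * \<epsilon> * (\<epsilon> * (val (J x))\<^sup>2 + inverse (4 * \<epsilon>) * (lap (J x))\<^sup>2)" .
    then show "- (val (J x) * lap (J x)) \<le> \<epsilon> * (val (J x))\<^sup>2 + inverse (4 * \<epsilon>) * (lap (J x))\<^sup>2"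
      using \<epsilon> by (subst (asm) mult_le_cancel_left_pos) auto
  qed (intro continuous_intros c)+
  moreover have "(\<integral>x. \<epsilon> * (val (J x))\<^sup>2 + inverse (4 * \<epsilon>) * (lap (J x))\<^sup>2 \<partial>cube_measure) = \<epsilon> * val_sq J + inverse (4 * \<epsilon>) * lap_sq J"
    unfolding val_sq_def lap_sq_def by (subst Bochner_Integration.integral_add) (simp_all add: i)
  moreover have "inverse (4 * \<epsilon>) * lap_sq J = lap_sq J / (4 * \<epsilon>)"
    by (simp only: divide_inverse mult.commute)
  ultimately have "- (\<integral>x. val (J x) * lap (J x) \<partial>cube_measure) \<le> \<epsilon> * val_sq J + lap_sq J / (4 * \<epsilon>)"
    by simp
  moreover have "grd_sq J + (\<integral>x. val (J x) * lap (J x) \<partial>cube_measure) = face_integral (\<lambda>i s y. val (J y) * bc_jet Neumann i s (J y))"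
    using green_cube[OF J] unfolding grd_sq_def bc_jet.simps by (subst (asm) Bochner_Integration.integral_add[OF i(1,4)])
  ultimately show ?thesis by linarith
qed

lemma friedrichs:
  assumes J: "C2_jet J"
  shows "val_sq J \<le> 2 * bc_sq Dirichlet J + 4 * grd_sq J"
proof -
  fix i0 :: 'a
  have "(\<integral>x. (val (J (upd i0 0 x)))\<^sup>2 \<partial>cube_measure) \<le> (\<Sum>s\<in>{0,1}. \<integral>x. (val (J (upd i0 s x)))\<^sup>2 \<partial>cube_measure)"
    by simp
  also have "\<dots> \<le> bc_sq Dirichlet J"
    unfolding bc_sq_def face_integral_def bc_jet.simps
    by (rule member_le_sum[where f = "\<lambda>i. \<Sum>s\<in>{0,1}. \<integral>x. (val (J (upd i s x)))\<^sup>2 \<partial>cube_measure"]) (auto intro!: sum_nonneg)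
  finally show ?thesis
    using friedrichs_coordinate[OF J, of i0] by (simp add: val_sq_def grd_sq_def)
qed

lemma trace_inequality:
  fixes J :: "real^'d \<Rightarrow> 'd jet"
  assumes J: "C2_jet J"
  shows "bc_sq Dirichlet J \<le> 2 * real CARD('d) * (2 * val_sq J + grd_sq J)"
proof -
  have "bc_sq Dirichlet J \<le> (\<Sum>i\<in>(UNIV::'d set). \<Sum>s\<in>{0,1::real}. 2 * val_sq J + grd_sq J)"
    unfolding bc_sq_def face_integral_def bc_jet.simps val_sq_def grd_sq_def
    by (intro sum_mono trace_coordinate J)
  then show ?thesis by (simp add: algebra_simps)
qed

lemma face_integral_bc:
  fixes J :: "real^'d \<Rightarrow> 'd jet"
  assumes J: "C2_jet J"
  shows "face_integral (\<lambda>i s y. a * (bc_jet \<alpha> i s (J y))\<^sup>2 + b * (bc_jet \<beta> i s (J y))\<^sup>2) = a * bc_sq \<alpha> J + b * bc_sq \<beta> J"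
    and "face_integral (\<lambda>i s y. c + b * (bc_jet \<beta> i s (J y))\<^sup>2) = 2 * real CARD('d) * c + b * bc_sq \<beta> J"
proof -
  have c: "continuous_on UNIV (\<lambda>y. a * (bc_jet \<alpha> i s (J y))\<^sup>2)" for a \<alpha> i s
    by (intro continuous_intros J)
  show "face_integral (\<lambda>i s y. a * (bc_jet \<alpha> i s (J y))\<^sup>2 + b * (bc_jet \<beta> i s (J y))\<^sup>2) = a * bc_sq \<alpha> J + b * bc_sq \<beta> J"
    unfolding bc_sq_def face_integral_add[OF c c] face_integral_cmult by simp
  show "face_integral (\<lambda>i s y. c + b * (bc_jet \<beta> i s (J y))\<^sup>2) = 2 * real CARD('d) * c + b * bc_sq \<beta> J"
    unfolding bc_sq_def face_integral_add[OF continuous_on_const c] face_integral_cmult face_integral_const by simp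
qed

text \<open>The arithmetic of \<open>robin_step\<close>. With weight 1/16, inserting the bound for
  \<open>v\<close> returns only \<open>g / 4 + s / 8\<close>: three quarters of \<open>g\<close>
  survive, and the negative multiple of \<open>s\<close> outweighs the positive one.\<close>

lemma absorb_robin:
  fixes v g s r l :: real
  assumes "v \<le> 2 * s + 4 * g" "0 \<le> v" "0 \<le> g" "0 \<le> l" "0 \<le> r" "0 \<le> s"
    and "g \<le> (-1/2) * s + (1/2) * r + (1/16) * v + 4 * l"
  shows "v + 2 * g + l \<le> 100 * (r + l)"
proof -
  have 0: "16 * g + 8 * s \<le> 8 * r + v + 64 * l" using assms(7) by simp
  then have 1: "12 * g + 6 * s \<le> 8 * r + 64 * l" using assms(1) by linarith
  have "3 * v \<le> 8 * r + 64 * l" using 1 assms(1) by linarith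
  moreover have "12 * g \<le> 8 * r + 64 * l" using 1 assms by linarith
  ultimately have "6 * v + 12 * g + 6 * l \<le> 24 * r + 198 * l" by linarith
  then show ?thesis using assms by simp
qed
lemma absorb_dirichlet:
  fixes v g s r l :: real
  assumes "v \<le> 2 * s + 4 * g" "0 \<le> l" "0 \<le> r" "s \<le> r" "0 \<le> a"
    and "g \<le> a + r / 2 + (1/16) * v + 4 * l"
  shows "v + 2 * g + l \<le> 100 * (a + r + l)"
proof -
  have 0: "16 * g \<le> 16 * a + 8 * r + v + 64 * l" using assms(6) by simp
  have 2: "v \<le> 2 * r + 4 * g" using assms(1,4) by linarith
  have 1: "12 * g \<le> 16 * a + 10 * r + 64 * l" using 0 2 by linarith
  have "2 * v + 4 * g + 2 * l \<le> 4 * r + 12 * g + 2 * l" using 2 by linarith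
  also have "\<dots> \<le> 16 * a + 14 * r + 66 * l" using 1 by linarith
  finally show ?thesis using assms(2,3,5) by simp
qed

text \<open>With \<open>r = v + g\<close> on the boundary, \<open>v * g\<close> is at most half of
  r^2 minus half of v^2. The negative trace term pays for the boundary term of Friedrichs'
  inequality, so no loss of rate occurs.\<close>

lemma robin_step:
  assumes J: "C2_jet J"
  shows "val_sq J + 2 * grd_sq J + lap_sq J \<le> 100 * (bc_sq Robin J + lap_sq J)"
proof -
  have "face_integral (\<lambda>i s y. val (J y) * bc_jet Neumann i s (J y))
     \<le> face_integral (\<lambda>i s y. (-1/2) * (bc_jet Dirichlet i s (J y))\<^sup>2 + (1/2) * (bc_jet Robin i s (J y))\<^sup>2)"
  proof (rule face_integral_mono)
    fix i s y
    show "val (J y) * bc_jet Neumann i s (J y) \<le> (-1/2) * (bc_jet Dirichlet i s (J y))\<^sup>2 + (1/2) * (bc_jet Robin i s (J y))\<^sup>2"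
      using zero_le_power2[of "bc_jet Neumann i s (J y)"] by (simp add: power2_eq_square algebra_simps)
  qed (intro continuous_intros C2_continuous[OF J] J)+
  also have "\<dots> = (-1/2) * bc_sq Dirichlet J + (1/2) * bc_sq Robin J"
    by (rule face_integral_bc(1)[OF J])
  finally have e: "grd_sq J \<le> (-1/2) * bc_sq Dirichlet J + (1/2) * bc_sq Robin J + (1/16) * val_sq J + 4 * lap_sq J"
    using energy_identity[OF J, of "1/16"] by simp
  show ?thesis
    by (rule absorb_robin[OF friedrichs[OF J] _ _ _ _ _ e]) (simp_all add: sq_nonneg)
qed

lemma dirichlet_step:
  fixes J :: "real^'d \<Rightarrow> 'd jet"
  assumes J: "C2_jet J" and \<eta>: "0 < \<eta>" "\<eta> \<le> 1"
    and b: "\<And>x. x \<in> cube \<Longrightarrow> norm (grd (J x)) \<le> b"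
  shows "val_sq J + 2 * grd_sq J + lap_sq J \<le> 100 * (real CARD('d) * b\<^sup>2 * \<eta> + bc_sq Dirichlet J / \<eta> + lap_sq J)"
proof -
  have "face_integral (\<lambda>i s y. val (J y) * bc_jet Neumann i s (J y))
     \<le> face_integral (\<lambda>i s y. (\<eta> / 2) * b\<^sup>2 + (1 / (2 * \<eta>)) * (bc_jet Dirichlet i s (J y))\<^sup>2)"
  proof (rule face_integral_mono)
    fix i s and y :: "real^'d" assume s: "s \<in> {0,1::real}" and y: "y \<in> cube"
    let ?v = "val (J y)" and ?g = "bc_jet Neumann i s (J y)"
    have "\<bar>?g\<bar> = \<bar>grd (J y) $ i\<bar>" using s by auto
    also have "\<dots> \<le> b" using component_le_norm_cart[of "grd (J y)" i] b[OF y] by simp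
    finally have g: "?g\<^sup>2 \<le> b\<^sup>2" by (simp add: abs_le_square_iff[symmetric])
    have "0 \<le> (\<eta> * ?g - ?v)\<^sup>2" by simp
    then have "2 * \<eta> * (?v * ?g) \<le> \<eta>\<^sup>2 * ?g\<^sup>2 + ?v\<^sup>2"
      by (simp add: power2_eq_square algebra_simps)
    also have "\<dots> \<le> \<eta>\<^sup>2 * b\<^sup>2 + ?v\<^sup>2" using g by (simp add: mult_left_mono)
    also have "\<dots> = 2 * \<eta> * ((\<eta> / 2) * b\<^sup>2 + (1 / (2 * \<eta>)) * ?v\<^sup>2)"
      using \<eta> by (simp add: power2_eq_square field_simps)
    finally show "?v * ?g \<le> (\<eta> / 2) * b\<^sup>2 + (1 / (2 * \<eta>)) * (bc_jet Dirichlet i s (J y))\<^sup>2"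
      using \<eta> by (subst (asm) mult_le_cancel_left_pos) auto
  qed (intro continuous_intros C2_continuous[OF J] J)+
  also have "\<dots> = real CARD('d) * b\<^sup>2 * \<eta> + bc_sq Dirichlet J / (2 * \<eta>)"
    using face_integral_bc(2)[OF J, of "(\<eta> / 2) * b\<^sup>2" "1 / (2 * \<eta>)" Dirichlet] by simp
  finally have 1: "grd_sq J \<le> real CARD('d) * b\<^sup>2 * \<eta> + bc_sq Dirichlet J / (2 * \<eta>) + (1/16) * val_sq J + 4 * lap_sq J"
    using energy_identity[OF J, of "1/16"] by simp
  \<comment> \<open>Since \<open>\<eta>\<close> is at most 1, the weighted trace term also dominates
    the unweighted one that Friedrichs' inequality brings in.\<close>
  have 2: "bc_sq Dirichlet J \<le> bc_sq Dirichlet J / \<eta>"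
    using \<eta> sq_nonneg(4)[of Dirichlet J] by (simp add: le_divide_eq mult_left_le)
  have "0 \<le> real CARD('d) * b\<^sup>2 * \<eta>" using \<eta> by simp
  with 1 2 \<eta> sq_nonneg(3)[of J] sq_nonneg(4)[of Dirichlet J] show ?thesis
    by (intro absorb_dirichlet[OF friedrichs[OF J]]) (simp_all add: divide_nonneg_pos)
qed

lemma absorb_neumann:
  fixes v g l N m d P :: real
  assumes "d \<ge> 1" "P \<ge> 1" "0 \<le> m" "0 \<le> N" "0 \<le> l" "0 \<le> g"
    and v: "v \<le> m + P * g" and g: "g \<le> 4 * m + 4 * (d * (2 * P + 1)) * N + 2 * P * l"
  shows "v + 2 * g + l \<le> (100 * d * (2 * P + 1)\<^sup>2) * (m + N + l)"
proof -
  define Q where "Q = 2 * P + 1"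
  define K where "K = d * Q"
  define X where "X = m + N + l"
  have Q: "1 \<le> Q" "2 * P \<le> Q" "P + 2 \<le> 3 * Q" using assms(2) by (simp_all add: Q_def)
  have QK: "Q \<le> K" using mult_right_mono[of 1 d Q] assms(1) Q by (simp add: K_def)
  then have K: "1 \<le> K" using Q by linarith
  have X: "0 \<le> X" "m \<le> X" "N \<le> X" "l \<le> X" using assms by (simp_all add: X_def)
  have "4 * m \<le> 4 * (K * X)" using mult_mono[of 1 K m X] K X assms(3) by simp
  moreover have "4 * K * N \<le> 4 * (K * X)" using mult_left_mono[of N X K] K X by simp
  moreover have "2 * P * l \<le> K * X" using Q QK K X assms(5) by (intro mult_mono) auto
  ultimately have gK: "g \<le> 9 * (K * X)" using g unfolding Q_def[symmetric] K_def[symmetric] by linarith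
  have a: "v + 2 * g + l \<le> X + (P + 2) * g" using v assms(4) by (simp add: X_def algebra_simps)
  have b: "(P + 2) * g \<le> (3 * Q) * (9 * (K * X))" using gK Q assms(2,6) by (intro mult_mono) auto
  have c: "X \<le> Q * (K * X)"
  proof -
    have "1 * X \<le> (Q * K) * X" using mult_mono[of 1 Q 1 K] Q K X by (intro mult_right_mono) auto
    then show ?thesis by simp
  qed
  have "Q * (K * X) + (3 * Q) * (9 * (K * X)) = 28 * (d * Q\<^sup>2 * X)"
    by (simp add: K_def power2_eq_square)
  with a b c have "v + 2 * g + l \<le> 28 * (d * Q\<^sup>2 * X)" by linarith
  also have "\<dots> \<le> 100 * (d * Q\<^sup>2 * X)" using X(1) assms(1) by (intro mult_right_mono) auto
  finally show ?thesis by (simp add: X_def Q_def mult.assoc)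
qed

text \<open>Neumann data leave the trace uncontrolled, so the mean and Poincare's inequality replace
  Friedrichs'. The trace produced by Young's inequality goes back to value and gradient through
  \<open>trace_inequality\<close>.\<close>

lemma neumann_step:
  fixes J :: "real^'d \<Rightarrow> 'd jet"
  assumes J: "C2_jet J"
  defines "d \<equiv> real CARD('d)"
  defines "P \<equiv> d * 2 ^ CARD('d)"
  shows "val_sq J + 2 * grd_sq J + lap_sq J
    \<le> (100 * d * (2 * P + 1)\<^sup>2) * ((\<integral>x. val (J x) \<partial>cube_measure)\<^sup>2 + bc_sq Neumann J + lap_sq J)"
proof -
  have d1: "d \<ge> 1" unfolding d_def by (simp add: Suc_leI)
  have P1: "P \<ge> 1" unfolding P_def using mult_mono[of 1 d 1 "2 ^ CARD('d)"] d1 by simp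
  define m2 where "m2 = (\<integral>x. val (J x) \<partial>cube_measure)\<^sup>2"
  \<comment> \<open>Chosen so that the trace term, after the trace and Poincare inequalities,
    returns exactly a quarter of \<open>grd_sq J\<close>. The weight \<open>1 / (4 * P)\<close> in
    the energy estimate returns another quarter, so half of the gradient term survives.\<close>
  define \<delta> where "\<delta> = 1 / (8 * d * (2 * P + 1))"
  have \<delta>: "\<delta> > 0" using d1 P1 by (simp add: \<delta>_def)
  have m2: "m2 \<ge> 0" by (simp add: m2_def)
  have poin: "val_sq J \<le> m2 + P * grd_sq J"
    using poincare_cube[OF J] by (simp add: val_sq_def m2_def P_def d_def grd_sq_def)
  have "face_integral (\<lambda>i s y. val (J y) * bc_jet Neumann i s (J y))
     \<le> face_integral (\<lambda>i s y. \<delta> * (bc_jet Dirichlet i s (J y))\<^sup>2 + (1 / (4 * \<delta>)) * (bc_jet Neumann i s (J y))\<^sup>2)"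
  proof (rule face_integral_mono)
    fix i s and y :: "real^'d"
    let ?v = "val (J y)" and ?g = "bc_jet Neumann i s (J y)"
    have "0 \<le> (2 * \<delta> * ?v - ?g)\<^sup>2" by simp
    then have "4 * \<delta> * (?v * ?g) \<le> 4 * \<delta> * (\<delta> * ?v\<^sup>2) + ?g\<^sup>2"
      by (simp add: power2_eq_square algebra_simps)
    also have "\<dots> = 4 * \<delta> * (\<delta> * ?v\<^sup>2 + (1 / (4 * \<delta>)) * ?g\<^sup>2)"
      using \<delta> by (simp add: distrib_left)
    finally have "4 * \<delta> * (?v * ?g) \<le> 4 * \<delta> * (\<delta> * ?v\<^sup>2 + (1 / (4 * \<delta>)) * ?g\<^sup>2)" .
    then show "?v * ?g \<le> \<delta> * (bc_jet Dirichlet i s (J y))\<^sup>2 + (1 / (4 * \<delta>)) * ?g\<^sup>2"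
      using \<delta> by (subst (asm) mult_le_cancel_left_pos) auto
  qed (intro continuous_intros C2_continuous[OF J] J)+
  also have "\<dots> = \<delta> * bc_sq Dirichlet J + bc_sq Neumann J / (4 * \<delta>)"
    using face_integral_bc(1)[OF J, of \<delta> Dirichlet "1 / (4 * \<delta>)" Neumann] by simp
  finally have 1: "grd_sq J \<le> \<delta> * bc_sq Dirichlet J + bc_sq Neumann J / (4 * \<delta>) + (1 / (4 * P)) * val_sq J + P * lap_sq J"
    using energy_identity[OF J, of "1 / (4 * P)"] P1 by (simp add: mult.commute)
  have "\<delta> * bc_sq Dirichlet J \<le> \<delta> * (2 * d * (2 * m2 + (2 * P + 1) * grd_sq J))"
  proof (intro mult_left_mono)
    have "2 * val_sq J + grd_sq J \<le> 2 * m2 + (2 * P + 1) * grd_sq J"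
      using poin by (simp add: algebra_simps)
    then have "2 * d * (2 * val_sq J + grd_sq J) \<le> 2 * d * (2 * m2 + (2 * P + 1) * grd_sq J)"
      using d1 by (intro mult_left_mono) auto
    then show "bc_sq Dirichlet J \<le> 2 * d * (2 * m2 + (2 * P + 1) * grd_sq J)"
      using trace_inequality[OF J] unfolding d_def by linarith
  qed (use \<delta> in simp)
  also have "\<dots> = (1 / (2 * (2 * P + 1))) * m2 + grd_sq J / 4"
  proof -
    have "1 / (8 * d * Q) * (2 * d * (2 * m + Q * G)) = (1 / (2 * Q)) * m + G / 4" if "d > 0" "Q > 0" for d Q m G :: real
      using that by (simp add: field_simps)
    then show ?thesis unfolding \<delta>_def by this (use d1 P1 in simp_all)
  qed
  also have "\<dots> \<le> m2 + grd_sq J / 4"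
    using mult_right_mono[of "1 / (2 * (2 * P + 1))" 1 m2] P1 m2 by simp
  finally have 2: "\<delta> * bc_sq Dirichlet J \<le> m2 + grd_sq J / 4" .
  have "(1 / (4 * P)) * val_sq J \<le> (1 / (4 * P)) * (m2 + P * grd_sq J)"
    using poin P1 by (intro mult_left_mono) auto
  also have "\<dots> = (1 / (4 * P)) * m2 + grd_sq J / 4" using P1 by (simp add: field_simps)
  also have "\<dots> \<le> m2 + grd_sq J / 4" using mult_right_mono[of "1 / (4 * P)" 1 m2] P1 m2 by simp
  finally have 3: "(1 / (4 * P)) * val_sq J \<le> m2 + grd_sq J / 4" .
  have 4: "bc_sq Neumann J / (4 * \<delta>) = 2 * d * (2 * P + 1) * bc_sq Neumann J"
    unfolding \<delta>_def using d1 P1 by (simp add: field_simps)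
  let ?Q = "2 * P + 1" let ?K = "d * ?Q"
  have G: "grd_sq J \<le> 4 * m2 + 4 * ?K * bc_sq Neumann J + 2 * P * lap_sq J"
  proof -
    have "grd_sq J \<le> 4 * m2 + 2 * (bc_sq Neumann J / (4 * \<delta>)) + 2 * (P * lap_sq J)"
      using 1 2 3 by linarith
    then show ?thesis unfolding 4 by (simp only: mult.assoc)
  qed
  show ?thesis
    unfolding m2_def[symmetric]
    by (rule absorb_neumann[OF d1 P1 m2 _ _ _ poin G]) (rule sq_nonneg)+
qed

section \<open>Stability of the first-order system\<close>

text \<open>When \<open>e\<close> is a network minus the exact jets, this is the \<open>k\<close>-th
  component of the residual of the first-order system: the exact jets solve the coupled equations,
  so the data need not appear.\<close>

definition residual :: "nat \<Rightarrow> (nat \<Rightarrow> real^'d \<Rightarrow> 'd jet) \<Rightarrow> nat \<Rightarrow> real^'d \<Rightarrow> real" where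
  "residual n e k x = lap (e k x) - (if Suc k < n then val (e (Suc k) x) else 0)"

definition residual_sq :: "nat \<Rightarrow> (nat \<Rightarrow> real^'d \<Rightarrow> 'd jet) \<Rightarrow> nat \<Rightarrow> real" where
  "residual_sq n e k = (\<integral>x. (residual n e k x)\<^sup>2 \<partial>cube_measure)"

definition jet_loss :: "bc \<Rightarrow> nat \<Rightarrow> (nat \<Rightarrow> real^'d \<Rightarrow> 'd jet) \<Rightarrow> real" where
  "jet_loss \<alpha> n e = (\<Sum>k<n. residual_sq n e k) + (\<Sum>k<n. bc_sq \<alpha> (e k)) +
     (if \<alpha> = Neumann then (\<integral>x. val (e 0 x) \<partial>cube_measure)\<^sup>2 else 0)"

text \<open>The gradient counts twice because it occurs both in the \<open>H1\<close> norm of the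
  error and in the \<open>H(div)\<close> norm of its gradient.\<close>

definition jet_error :: "(nat \<Rightarrow> real^'d \<Rightarrow> 'd jet) \<Rightarrow> nat \<Rightarrow> real" where
  "jet_error e k = val_sq (e k) + 2 * grd_sq (e k) + lap_sq (e k)"

lemma jet_error_nonneg: "0 \<le> jet_error e k"
  by (simp add: jet_error_def sq_nonneg)

lemma residual_sq_nonneg: "0 \<le> residual_sq n e k"
  by (simp add: residual_sq_def)

lemma residual_bc_le_loss:
  assumes "k < n"
  shows "residual_sq n e k + bc_sq \<alpha> (e k) \<le> jet_loss \<alpha> n e"
proof -
  have "residual_sq n e k \<le> (\<Sum>k<n. residual_sq n e k)" "bc_sq \<alpha> (e k) \<le> (\<Sum>k<n. bc_sq \<alpha> (e k))"
    using assms by (intro member_le_sum; simp add: residual_sq_nonneg sq_nonneg)+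
  moreover have "0 \<le> (\<Sum>k<n. residual_sq n e k)" "0 \<le> (\<Sum>k<n. bc_sq \<alpha> (e k))"
    by (intro sum_nonneg residual_sq_nonneg sq_nonneg)+
  moreover have "0 \<le> (if \<alpha> = Neumann then (\<integral>x. val (e 0 x) \<partial>cube_measure)\<^sup>2 else 0)" by simp
  ultimately show ?thesis
    unfolding jet_loss_def by linarith+
qed

lemma jet_loss_nonneg: "0 \<le> jet_loss \<alpha> n e"
  unfolding jet_loss_def by (intro add_nonneg_nonneg sum_nonneg residual_sq_nonneg sq_nonneg) auto

lemma lap_sq_le:
  assumes "\<And>k. k < n \<Longrightarrow> C2_jet (e k)" "k < n"
  shows "lap_sq (e k) \<le> 2 * residual_sq n e k + (if Suc k < n then 2 * jet_error e (Suc k) else 0)"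
proof (cases "Suc k < n")
  case True
  note c = C2_continuous[OF assms(1)[OF assms(2)], of UNIV] C2_continuous[OF assms(1)[OF True], of UNIV]
  have "lap_sq (e k) \<le> (\<integral>x. 2 * (residual n e k x)\<^sup>2 + 2 * (val (e (Suc k) x))\<^sup>2 \<partial>cube_measure)"
    unfolding lap_sq_def
  proof (rule integral_cube_mono)
    fix x
    have "0 \<le> (lap (e k x) - 2 * val (e (Suc k) x))\<^sup>2" by simp
    then show "(lap (e k x))\<^sup>2 \<le> 2 * (residual n e k x)\<^sup>2 + 2 * (val (e (Suc k) x))\<^sup>2"
      using True by (simp add: residual_def power2_eq_square algebra_simps)
  qed (unfold residual_def, use True in \<open>auto intro!: continuous_intros c\<close>)
  also have "\<dots> = 2 * residual_sq n e k + 2 * val_sq (e (Suc k))"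
    unfolding residual_sq_def val_sq_def
    by (subst Bochner_Integration.integral_add)
       (use True in \<open>auto simp: residual_def intro!: integrable_cube_continuous continuous_intros c\<close>)
  also have "val_sq (e (Suc k)) \<le> jet_error e (Suc k)"
    by (simp add: jet_error_def sq_nonneg)
  finally show ?thesis using True by simp
next
  case False
  then have "lap_sq (e k) = residual_sq n e k"
    by (simp add: lap_sq_def residual_sq_def residual_def)
  then show ?thesis using False residual_sq_nonneg[of n e k] by simp
qed

text \<open>The equations are solved for \<open>k = n - 1\<close> first; each step feeds the error of component
  \<open>k + 1\<close> into the right-hand side of the equation for component \<open>k\<close>.\<close>

lemma backward_recursion:
  fixes K X :: real and E :: "nat \<Rightarrow> real"
  assumes K: "K \<ge> 1" and X: "X \<ge> 0" and nn: "\<And>k. E k \<ge> 0"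
    and step: "\<And>k. k < n \<Longrightarrow> E k \<le> K * (X + (if Suc k < n then E (Suc k) else 0))"
  shows "(\<Sum>k<n. E k) \<le> real n * (real n * K ^ n) * X"
proof -
  \<comment> \<open>The induction counts components from the last one: \<open>j = 0\<close> is
    component \<open>n - 1\<close>, whose equation has no successor term.\<close>
  have *: "j < n \<Longrightarrow> E (n - Suc j) \<le> real (Suc j) * K ^ Suc j * X" for j
  proof (induction j)
    case 0
    then show ?case using step[of "n - 1"] by simp
  next
    case (Suc j)
    have eq: "Suc (n - Suc (Suc j)) = n - Suc j" using Suc.prems by simp
    have "E (n - Suc (Suc j)) \<le> K * (X + E (n - Suc j))"
      using step[of "n - Suc (Suc j)"] Suc.prems unfolding eq by simp
    also have "\<dots> \<le> K * (X + real (Suc j) * K ^ Suc j * X)"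
      using Suc K by (intro mult_left_mono add_left_mono) auto
    also have "\<dots> = K * X + real (Suc j) * K ^ Suc (Suc j) * X"
      by (simp add: algebra_simps)
    also have "K * X \<le> K ^ Suc (Suc j) * X"
      using power_increasing[of 1 "Suc (Suc j)" K] K X by (intro mult_right_mono) auto
    finally show ?case by (simp add: algebra_simps)
  qed
  have "E k \<le> real n * K ^ n * X" if "k < n" for k
  proof -
    have "E k \<le> real (n - k) * K ^ (n - k) * X"
      using *[of "n - Suc k"] that by (simp add: Suc_diff_Suc)
    also have "\<dots> \<le> real n * K ^ n * X"
      using K X by (intro mult_right_mono mult_mono power_increasing) auto
    finally show ?thesis .
  qed
  then have "(\<Sum>k<n. E k) \<le> (\<Sum>k<n. real n * K ^ n * X)" by (intro sum_mono) auto
  then show ?thesis by simp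
qed

lemma stability_Robin:
  assumes e: "\<And>k. k < n \<Longrightarrow> C2_jet (e k)"
  shows "(\<Sum>k<n. jet_error e k) \<le> real n * (real n * 400 ^ n) * jet_loss Robin n e"
proof (rule backward_recursion)
  fix k assume k: "k < n"
  have "jet_error e k \<le> 100 * (bc_sq Robin (e k) + lap_sq (e k))"
    unfolding jet_error_def by (rule robin_step[OF e[OF k]])
  \<comment> \<open>The Laplacian is at most the root of twice the residual energy plus twice the
    next error; after the factor 100 everything stays below 400.\<close>
  then show "jet_error e k \<le> 400 * (jet_loss Robin n e + (if Suc k < n then jet_error e (Suc k) else 0))"
    using lap_sq_le[of n e, OF e k] residual_bc_le_loss[OF k, of e Robin]
      residual_sq_nonneg[of n e k] sq_nonneg(4)[of Robin "e k"] jet_error_nonneg[of e "Suc k"] by (simp split: if_splits)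
qed (simp_all add: jet_loss_nonneg jet_error_nonneg)

lemma stability_Dirichlet:
  fixes e :: "nat \<Rightarrow> real^'d \<Rightarrow> 'd jet"
  assumes e: "\<And>k. k < n \<Longrightarrow> C2_jet (e k)" and \<eta>: "0 < \<eta>" "\<eta> \<le> 1"
    and b: "\<And>k x. k < n \<Longrightarrow> x \<in> cube \<Longrightarrow> norm (grd (e k x)) \<le> b"
  shows "(\<Sum>k<n. jet_error e k) \<le> real n * (real n * 400 ^ n) * (real CARD('d) * b\<^sup>2 * \<eta> + jet_loss Dirichlet n e / \<eta>)"
proof (rule backward_recursion)
  fix k assume k: "k < n"
  have "jet_error e k \<le> 100 * (real CARD('d) * b\<^sup>2 * \<eta> + bc_sq Dirichlet (e k) / \<eta> + lap_sq (e k))"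
    unfolding jet_error_def by (rule dirichlet_step[OF e[OF k] \<eta> b[OF k]])
  moreover have "residual_sq n e k + bc_sq Dirichlet (e k) / \<eta> \<le> jet_loss Dirichlet n e / \<eta>"
  proof -
    have "residual_sq n e k \<le> residual_sq n e k / \<eta>"
      using \<eta> residual_sq_nonneg[of n e k] by (simp add: le_divide_eq mult_left_le)
    moreover have "residual_sq n e k / \<eta> + bc_sq Dirichlet (e k) / \<eta> \<le> jet_loss Dirichlet n e / \<eta>"
      using residual_bc_le_loss[OF k, of e Dirichlet] \<eta> by (simp add: add_divide_distrib[symmetric] divide_right_mono)
    ultimately show ?thesis by linarith
  qed
  moreover have "0 \<le> real CARD('d) * b\<^sup>2 * \<eta>" "0 \<le> bc_sq Dirichlet (e k) / \<eta>" using \<eta> by (simp_all add: sq_nonneg)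
  ultimately show "jet_error e k \<le> 400 * ((real CARD('d) * b\<^sup>2 * \<eta> + jet_loss Dirichlet n e / \<eta>) + (if Suc k < n then jet_error e (Suc k) else 0))"
    using lap_sq_le[of n e, OF e k] residual_sq_nonneg[of n e k] jet_error_nonneg[of e "Suc k"] by (simp split: if_splits)
qed (use \<eta> in \<open>simp_all add: jet_loss_nonneg jet_error_nonneg add_nonneg_nonneg divide_nonneg_pos\<close>)

section \<open>Mean values and the Neumann problem\<close>

lemma divergence_theorem_cube:
  fixes J :: "real^'d \<Rightarrow> 'd jet"
  assumes J: "C2_jet J"
  shows "(\<integral>x. lap (J x) \<partial>cube_measure) = face_integral (\<lambda>i s y. bc_jet Neumann i s (J y))"
proof -
  note c = C2_continuous[OF J, of UNIV]
  have "(\<integral>x. hes (J x) $ i \<partial>cube_measure) = (\<Sum>s\<in>{0,1}. \<integral>x. (2 * s - 1) * grd (J (upd i s x)) $ i \<partial>cube_measure)" for i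
  proof -
    have cu: "continuous_on UNIV (\<lambda>x. grd (J (upd i s x)) $ i)" for s
      by (intro continuous_intros continuous_on_compose2[OF c(3)]) auto
    have "(\<integral>x. hes (J x) $ i \<partial>cube_measure) = (\<integral>x. grd (J (upd i 1 x)) $ i - grd (J (upd i 0 x)) $ i \<partial>cube_measure)"
      by (rule integral_cube_partial) (auto intro!: continuous_intros c C2_grd_coord[OF J])
    also have "\<dots> = (\<integral>x. grd (J (upd i 1 x)) $ i \<partial>cube_measure) - (\<integral>x. grd (J (upd i 0 x)) $ i \<partial>cube_measure)"
      by (rule Bochner_Integration.integral_diff) (intro integrable_cube_continuous cu)+
    finally show ?thesis by simp
  qed
  moreover have "(\<integral>x. lap (J x) \<partial>cube_measure) = (\<Sum>i\<in>UNIV. \<integral>x. hes (J x) $ i \<partial>cube_measure)"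
    unfolding lap_def by (intro Bochner_Integration.integral_sum integrable_cube_continuous continuous_intros c)
  ultimately show ?thesis by (simp add: face_integral_def)
qed

lemma cube_integral_square_le:
  fixes f :: "real^'d \<Rightarrow> real"
  assumes "continuous_on UNIV f"
  shows "(\<integral>x. f x \<partial>cube_measure)\<^sup>2 \<le> (\<integral>x. (f x)\<^sup>2 \<partial>cube_measure)"
proof -
  interpret prob_space "cube_measure :: (real^'d) measure" by (rule prob_space_cube)
  let ?m = "\<integral>x. f x \<partial>cube_measure"
  have i: "integrable cube_measure f" "integrable cube_measure (\<lambda>x. (f x)\<^sup>2)"
    by (intro integrable_cube_continuous continuous_intros assms)+
  have "0 \<le> (\<integral>x. (f x - ?m)\<^sup>2 \<partial>cube_measure)" by simp
  also have "\<dots> = (\<integral>x. (f x)\<^sup>2 - 2 * ?m * f x + ?m\<^sup>2 \<partial>cube_measure)"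
    by (simp add: power2_eq_square algebra_simps)
  also have "\<dots> = (\<integral>x. (f x)\<^sup>2 \<partial>cube_measure) - ?m\<^sup>2"
    using i by (simp add: prob_space[simplified] power2_eq_square)
  finally show ?thesis by simp
qed

lemma face_integral_square_le:
  fixes F :: "'d::finite \<Rightarrow> real \<Rightarrow> real^'d \<Rightarrow> real"
  assumes "\<And>i s. continuous_on UNIV (F i s)"
  shows "(face_integral F)\<^sup>2 \<le> 2 * real CARD('d) * face_integral (\<lambda>i s y. (F i s y)\<^sup>2)"
proof -
  let ?a = "\<lambda>p. \<integral>x. F (fst p) (snd p) (upd (fst p) (snd p) x) \<partial>cube_measure"
  have "(face_integral F)\<^sup>2 = (\<Sum>p\<in>UNIV \<times> {0,1}. ?a p)\<^sup>2"
    unfolding face_integral_def sum.cartesian_product by (simp add: case_prod_beta)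
  also have "\<dots> \<le> real (card (UNIV \<times> {0, 1::real} :: ('d \<times> real) set)) * (\<Sum>p\<in>UNIV \<times> {0,1}. (?a p)\<^sup>2)"
    using sum_squared_le_sum_of_squares[of ?a "UNIV \<times> {0,1}"] by (simp add: mult.commute)
  also have "\<dots> \<le> 2 * real CARD('d) * (\<Sum>p\<in>UNIV \<times> {0,1}. \<integral>x. (F (fst p) (snd p) (upd (fst p) (snd p) x))\<^sup>2 \<partial>cube_measure)"
  proof (intro mult_mono sum_mono cube_integral_square_le)
    show "continuous_on UNIV (\<lambda>x. F (fst p) (snd p) (upd (fst p) (snd p) x))" for p
      by (intro continuous_on_compose2[OF assms] continuous_intros) auto
  qed (auto simp: card_cartesian_product intro!: sum_nonneg)
  also have "\<dots> = 2 * real CARD('d) * face_integral (\<lambda>i s y. (F i s y)\<^sup>2)"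
    unfolding face_integral_def sum.cartesian_product by (simp add: case_prod_beta)
  finally show ?thesis .
qed

text \<open>Only the mean of component 0 is penalised. For \<open>k = l + 1\<close> the value of
  component \<open>k\<close> is the Laplacian of component \<open>l\<close> minus a residual, and by
  the divergence theorem the mean of that Laplacian is a boundary flux, which the Neumann loss
  controls.\<close>

lemma mean_sq_le:
  fixes e :: "nat \<Rightarrow> real^'d \<Rightarrow> 'd jet"
  assumes e: "\<And>k. k < n \<Longrightarrow> C2_jet (e k)" and k: "k < n"
  shows "(\<integral>x. val (e k x) \<partial>cube_measure)\<^sup>2 \<le> 4 * real CARD('d) * jet_loss Neumann n e"
proof (cases k)
  case 0
  have d: "1 \<le> 4 * real CARD('d)" using zero_less_card_finite[where 'a='d] by linarith
  have "(\<integral>x. val (e 0 x) \<partial>cube_measure)\<^sup>2 \<le> jet_loss Neumann n e"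
    by (simp add: jet_loss_def sum_nonneg residual_sq_nonneg sq_nonneg)
  also have "\<dots> \<le> 4 * real CARD('d) * jet_loss Neumann n e"
    using mult_right_mono[OF d jet_loss_nonneg[of Neumann n e]] by simp
  finally show ?thesis using 0 by simp
next
  case (Suc l)
  then have l: "l < n" "Suc l < n" using k by auto
  note c = C2_continuous[OF e[OF l(1)], of UNIV] C2_continuous[OF e[OF l(2)], of UNIV]
  have cr: "continuous_on UNIV (residual n e l)"
    using l unfolding residual_def by (auto intro!: continuous_intros c)
  let ?F = "face_integral (\<lambda>i s y. bc_jet Neumann i s (e l y))" and ?r = "\<integral>x. residual n e l x \<partial>cube_measure"
  have "(\<integral>x. val (e k x) \<partial>cube_measure) = (\<integral>x. lap (e l x) - residual n e l x \<partial>cube_measure)"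
    using l Suc by (simp add: residual_def)
  also have "\<dots> = ?F - ?r"
    unfolding divergence_theorem_cube[OF e[OF l(1)], symmetric]
    by (intro Bochner_Integration.integral_diff integrable_cube_continuous c cr)
  finally have "(\<integral>x. val (e k x) \<partial>cube_measure)\<^sup>2 = (?F - ?r)\<^sup>2" by simp
  also have "\<dots> \<le> 2 * ?F\<^sup>2 + 2 * ?r\<^sup>2"
    using zero_le_power2[of "?F + ?r"] by (simp add: power2_eq_square algebra_simps)
  also have "?F\<^sup>2 \<le> 2 * real CARD('d) * bc_sq Neumann (e l)"
    unfolding bc_sq_def by (intro face_integral_square_le continuous_intros e l)
  also have "?r\<^sup>2 \<le> residual_sq n e l"
    unfolding residual_sq_def by (rule cube_integral_square_le[OF cr])
  also have "2 * residual_sq n e l \<le> 4 * real CARD('d) * residual_sq n e l"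
    using zero_less_card_finite[where 'a='d] residual_sq_nonneg[of n e l] by (intro mult_right_mono) linarith+
  finally have "(\<integral>x. val (e k x) \<partial>cube_measure)\<^sup>2 \<le> 4 * real CARD('d) * (residual_sq n e l + bc_sq Neumann (e l))"
    by (simp add: algebra_simps)
  also have "\<dots> \<le> 4 * real CARD('d) * jet_loss Neumann n e"
    using residual_bc_le_loss[OF l(1), of e Neumann] by (intro mult_left_mono) auto
  finally show ?thesis .
qed

text \<open>The constant of \<open>neumann_step\<close>, times \<open>6 * real d\<close> for the
  means and Laplacians that are fed into it.\<close>

definition neumann_const :: "nat \<Rightarrow> real" where
  "neumann_const d = 600 * real d * (2 * (real d * 2 ^ d) + 1)\<^sup>2 * real d"

lemma stability_Neumann:
  fixes e :: "nat \<Rightarrow> real^'d \<Rightarrow> 'd jet"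
  assumes e: "\<And>k. k < n \<Longrightarrow> C2_jet (e k)"
  shows "(\<Sum>k<n. jet_error e k) \<le> real n * (real n * neumann_const CARD('d) ^ n) * jet_loss Neumann n e"
proof (rule backward_recursion)
  let ?d = "real CARD('d)" and ?L = "jet_loss Neumann n e"
  let ?Q = "(2 * (?d * 2 ^ CARD('d)) + 1)\<^sup>2"
  have d1: "1 \<le> ?d" using zero_less_card_finite[where 'a='d] by linarith
  have Q1: "1 \<le> ?Q" using d1 by (intro one_le_power) auto
  have L: "0 \<le> ?L" by (rule jet_loss_nonneg)
  fix k assume k: "k < n"
  let ?N = "if Suc k < n then jet_error e (Suc k) else 0"
  have N: "0 \<le> ?N" by (simp add: jet_error_nonneg)
  have 1: "jet_error e k \<le> (100 * ?d * ?Q) * ((\<integral>x. val (e k x) \<partial>cube_measure)\<^sup>2 + bc_sq Neumann (e k) + lap_sq (e k))"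
    unfolding jet_error_def by (rule neumann_step[OF e[OF k]])
  have "(\<integral>x. val (e k x) \<partial>cube_measure)\<^sup>2 + bc_sq Neumann (e k) + lap_sq (e k) \<le> 4 * ?d * ?L + 2 * ?L + 2 * ?N"
    using mean_sq_le[of n e, OF e k] lap_sq_le[of n e, OF e k] residual_bc_le_loss[OF k, of e Neumann] sq_nonneg(4)[of Neumann "e k"] by auto
  also have "\<dots> \<le> 6 * ?d * (?L + ?N)"
  proof -
    have "4 * d * L + 2 * L + 2 * N \<le> 6 * d * (L + N)" if "1 \<le> d" "0 \<le> L" "0 \<le> N" for d L N :: real
      using mult_right_mono[OF that(1,2)] mult_right_mono[OF that(1,3)] that by (simp add: algebra_simps)
    then show ?thesis using d1 L N by this
  qed
  finally have "(100 * ?d * ?Q) * ((\<integral>x. val (e k x) \<partial>cube_measure)\<^sup>2 + bc_sq Neumann (e k) + lap_sq (e k))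
      \<le> (100 * ?d * ?Q) * (6 * ?d * (?L + ?N))"
    using d1 by (intro mult_left_mono) auto
  also have "\<dots> = neumann_const CARD('d) * (?L + ?N)"
    by (simp add: neumann_const_def)
  finally show "jet_error e k \<le> neumann_const CARD('d) * (?L + ?N)"
    using 1 by linarith
next
  have d1: "1 \<le> real CARD('d)" using zero_less_card_finite[where 'a='d] by linarith
  have "1 * 1 * 1 * 1 \<le> neumann_const CARD('d)"
    unfolding neumann_const_def using d1 by (intro mult_mono one_le_power) auto
  then show "1 \<le> neumann_const CARD('d)" by simp
qed (simp_all add: jet_loss_nonneg jet_error_nonneg)

section \<open>Termwise differentiation of series of jets\<close>

lemma summable_jet_uniform:
  fixes J :: "nat \<Rightarrow> 'a \<Rightarrow> 'b::banach"
  assumes M: "\<And>n x. norm (J n x) \<le> M n" and "summable M"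
  shows "uniform_limit UNIV (\<lambda>n x. \<Sum>i<n. J i x) (\<lambda>x. \<Sum>i. J i x) sequentially"
    and "summable (\<lambda>n. J n x)" "summable (\<lambda>n. norm (J n x))" "norm (\<Sum>i. J i x) \<le> suminf M"
proof -
  show "uniform_limit UNIV (\<lambda>n x. \<Sum>i<n. J i x) (\<lambda>x. \<Sum>i. J i x) sequentially"
    by (rule Weierstrass_m_test[where M = M]) (use assms in auto)
  show *: "summable (\<lambda>n. norm (J n x))"
    by (rule summable_comparison_test'[OF assms(2), of 0]) (use M in auto)
  then show "summable (\<lambda>n. J n x)" by (rule summable_norm_cancel)
  show "norm (\<Sum>i. J i x) \<le> suminf M"
    using summable_norm[OF *] suminf_le[OF _ * assms(2)] M by (meson order_trans)
qed

lemma norm_component_jet: "norm (grd j) \<le> norm (j :: 'd::finite jet)" "norm (hes j) \<le> norm j" "\<bar>val j\<bar> \<le> norm j"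
  using norm_fst_le[of "fst (snd j)" "snd (snd j)"] norm_snd_le[of "snd (snd j)" "fst (snd j)"]
    norm_snd_le[of "snd j" "fst j"] norm_fst_le[of "fst j" "snd j"]
  by simp_all

text \<open>A summable majorant of the whole jet gives uniform convergence of value, gradient and
  second derivatives together. Values are then differentiated termwise in space, and gradient
  components termwise along coordinate lines.\<close>

lemma C2_suminf:
  fixes J :: "nat \<Rightarrow> real^'d \<Rightarrow> 'd jet"
  assumes C2: "\<And>n. C2_jet (J n)" and M: "\<And>n x. norm (J n x) \<le> M n" and sM: "summable M"
  shows "C2_jet (\<lambda>x. \<Sum>n. J n x)"
proof -
  note u = summable_jet_uniform[OF M sM]
  let ?S = "\<lambda>x. \<Sum>n. J n x"
  have blg: "bounded_linear (\<lambda>j::'d jet. grd j)" "bounded_linear (\<lambda>j::'d jet. val j)"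
    by (intro bounded_linear_intros)+
  have bli: "bounded_linear (\<lambda>j::'d jet. grd j $ i)" "bounded_linear (\<lambda>j::'d jet. hes j $ i)" for i
    by (intro bounded_linear_compose[OF bounded_linear_vec_nth] bounded_linear_intros)+
  have lim: "\<forall>\<^sub>F n in sequentially. \<forall>x. norm ((\<Sum>i<n. J i x) - ?S x) < e" if "e > 0" for e
    using uniform_limitD[OF u(1) that] by (simp add: dist_norm)
  show ?thesis
  proof (rule C2_jetI)
    have "continuous_on UNIV (\<lambda>x. \<Sum>i<n. J i x)" for n
      by (rule continuous_on_sum) (rule C2_continuous(1)[OF C2])
    then show "continuous_on UNIV ?S"
      by (intro uniform_limit_theorem[OF _ u(1)]) simp_all
  next
    fix x
    have "\<exists>g. \<forall>x\<in>UNIV. (\<lambda>n. val (J n x)) sums g x \<and> (g has_derivative (\<lambda>h. grd (?S x) \<bullet> h)) (at x within UNIV)"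
    proof (rule has_derivative_series[where x = 0])
      fix e :: real assume "e > 0"
      from lim[OF this] show "\<forall>\<^sub>F n in sequentially. \<forall>x\<in>UNIV. \<forall>h. norm ((\<Sum>i<n. grd (J i x) \<bullet> h) - grd (?S x) \<bullet> h) \<le> e * norm h"
      proof eventually_elim
        case (elim n)
        show ?case
        proof (intro ballI allI)
          fix x h
          have "(\<Sum>i<n. grd (J i x) \<bullet> h) - grd (?S x) \<bullet> h = grd ((\<Sum>i<n. J i x) - ?S x) \<bullet> h"
            by (simp add: inner_diff_left inner_sum_left fst_sum snd_sum)
          also have "norm \<dots> \<le> norm (grd ((\<Sum>i<n. J i x) - ?S x)) * norm h"
            by (simp add: Cauchy_Schwarz_ineq2)
          also have "\<dots> \<le> norm ((\<Sum>i<n. J i x) - ?S x) * norm h"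
            by (intro mult_right_mono norm_component_jet) auto
          also have "\<dots> \<le> e * norm h" using elim by (intro mult_right_mono) (auto intro: less_imp_le)
          finally show "norm ((\<Sum>i<n. grd (J i x) \<bullet> h) - grd (?S x) \<bullet> h) \<le> e * norm h" .
        qed
      qed
    qed (use C2_jetD(2)[OF C2] summable_sums[OF bounded_linear.summable[OF blg(2) u(2)]] in auto)
    then obtain g where g: "\<And>x. (\<lambda>n. val (J n x)) sums g x" "\<And>x. (g has_derivative (\<lambda>h. grd (?S x) \<bullet> h)) (at x)"
      by auto
    have "g = (\<lambda>x. val (?S x))"
    proof
      fix y
      have "val (?S y) = (\<Sum>n. val (J n y))" by (rule bounded_linear.suminf[OF blg(2) u(2)])
      then show "g y = val (?S y)" using g(1)[of y] by (simp add: sums_iff)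
    qed
    then show "((\<lambda>y. val (?S y)) has_derivative (\<lambda>h. grd (?S x) \<bullet> h)) (at x)" using g(2) by simp
  next
    fix i x
    have "\<exists>g. \<forall>t\<in>UNIV. (\<lambda>n. grd (J n (upd i t x)) $ i) sums g t \<and> (g has_field_derivative hes (?S (upd i t x)) $ i) (at t within UNIV)"
    proof (rule has_field_derivative_series[where ?x0.0 = 0])
      show "uniform_limit UNIV (\<lambda>n t. \<Sum>j<n. hes (J j (upd i t x)) $ i) (\<lambda>t. hes (?S (upd i t x)) $ i) sequentially"
      proof (rule uniform_limitI)
        fix e :: real assume "e > 0"
        from lim[OF this] show "\<forall>\<^sub>F n in sequentially. \<forall>t\<in>UNIV. dist (\<Sum>j<n. hes (J j (upd i t x)) $ i) (hes (?S (upd i t x)) $ i) < e"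
        proof eventually_elim
          case (elim n)
          show ?case
          proof
            fix t
            let ?y = "upd i t x"
            have "dist (\<Sum>j<n. hes (J j ?y) $ i) (hes (?S ?y) $ i) = \<bar>hes ((\<Sum>j<n. J j ?y) - ?S ?y) $ i\<bar>"
              by (simp add: dist_norm fst_sum snd_sum)
            also have "\<dots> \<le> norm (hes ((\<Sum>j<n. J j ?y) - ?S ?y))" by (rule component_le_norm_cart)
            also have "\<dots> \<le> norm ((\<Sum>j<n. J j ?y) - ?S ?y)"
              by (rule norm_component_jet)
            finally show "dist (\<Sum>j<n. hes (J j ?y) $ i) (hes (?S ?y) $ i) < e" using elim[rule_format, of ?y] by linarith
          qed
        qed
      qed
    qed (use C2_grd_coord[OF C2] bounded_linear.summable[OF bli(1) u(2)] in auto)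
    then obtain g where g: "\<And>t. (\<lambda>n. grd (J n (upd i t x)) $ i) sums g t"
      "\<And>t. (g has_field_derivative hes (?S (upd i t x)) $ i) (at t)" by auto
    have "g = (\<lambda>t. grd (?S (upd i t x)) $ i)"
    proof
      fix t
      have "grd (?S (upd i t x)) $ i = (\<Sum>n. grd (J n (upd i t x)) $ i)" by (rule bounded_linear.suminf[OF bli(1) u(2)])
      then show "g t = grd (?S (upd i t x)) $ i" using g(1)[of t] by (simp add: sums_iff)
    qed
    then show "((\<lambda>t. grd (?S (upd i t x)) $ i) has_real_derivative hes (?S x) $ i) (at (x $ i))"
      using g(2)[of "x $ i"] by simp
  qed
qed

section \<open>The cosine basis\<close>

text \<open>The Barron weight is a function of this quantity alone, see
  \<open>barron_weight_eq\<close>; it dominates the norm of every signed frequency and the root of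
  the Laplace eigenvalue \<open>freq_sq\<close>.\<close>

definition freq_sum :: "nat^'d \<Rightarrow> real" where
  "freq_sum k = pi * (\<Sum>i\<in>UNIV. real (k $ i))"

text \<open>\<open>A\<close> is the set of coordinates whose sign is flipped. Averaging plane
  cosines over all sign choices gives the product of cosines, which is how a basis function becomes
  a combination of ridge functions.\<close>

definition freq :: "'d::finite set \<Rightarrow> nat^'d \<Rightarrow> real^'d" where
  "freq A k = (\<chi> i. (if i \<in> A then - 1 else 1) * (pi * real (k $ i)))"

definition cos_jet :: "nat^'d \<Rightarrow> real^'d \<Rightarrow> 'd jet" where
  "cos_jet k x = (1 / 2 ^ CARD('d)) *\<^sub>R (\<Sum>A\<in>UNIV. ridge_jet cos (\<lambda>z. - sin z) (\<lambda>z. - cos z) (freq A k) 0 x)"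

text \<open>The phase \<open>t\<close> is there for the induction: a new index contributes
  \<open>cos (t + a j) + cos (t - a j)\<close>, which factors into twice
  \<open>cos t * cos (a j)\<close>.\<close>

lemma sum_cos_signs:
  assumes "finite S"
  shows "(\<Sum>A\<in>Pow S. cos (t + (\<Sum>i\<in>S. (if i \<in> A then - 1 else 1) * a i))) = 2 ^ card S * cos t * (\<Prod>i\<in>S. cos (a i :: real))"
  using assms
proof (induction S arbitrary: t)
  case (insert j S)
  let ?s = "\<lambda>A i. (if i \<in> A then - 1 else 1 :: real)"
  have "(\<Sum>A\<in>Pow (insert j S). cos (t + (\<Sum>i\<in>insert j S. ?s A i * a i)))
     = (\<Sum>A\<in>Pow S. cos (t + (\<Sum>i\<in>insert j S. ?s A i * a i))) + (\<Sum>A\<in>insert j ` Pow S. cos (t + (\<Sum>i\<in>insert j S. ?s A i * a i)))"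
    unfolding Pow_insert using insert.hyps by (intro sum.union_disjoint) auto
  also have "(\<Sum>A\<in>insert j ` Pow S. cos (t + (\<Sum>i\<in>insert j S. ?s A i * a i)))
     = (\<Sum>A\<in>Pow S. cos (t + (\<Sum>i\<in>insert j S. ?s (insert j A) i * a i)))"
    using insert.hyps by (subst sum.reindex) (auto simp: inj_on_def)
  also have "\<dots> = (\<Sum>A\<in>Pow S. cos ((t - a j) + (\<Sum>i\<in>S. ?s A i * a i)))"
  proof (intro sum.cong refl)
    fix A assume "A \<in> Pow S"
    have "(\<Sum>i\<in>S. ?s (insert j A) i * a i) = (\<Sum>i\<in>S. ?s A i * a i)"
      using insert.hyps by (intro sum.cong) auto
    then show "cos (t + (\<Sum>i\<in>insert j S. ?s (insert j A) i * a i)) = cos ((t - a j) + (\<Sum>i\<in>S. ?s A i * a i))"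
      using insert.hyps by (simp add: algebra_simps)
  qed
  also have "(\<Sum>A\<in>Pow S. cos (t + (\<Sum>i\<in>insert j S. ?s A i * a i))) = (\<Sum>A\<in>Pow S. cos ((t + a j) + (\<Sum>i\<in>S. ?s A i * a i)))"
  proof (intro sum.cong refl)
    fix A assume "A \<in> Pow S"
    then have "j \<notin> A" using insert.hyps by auto
    then show "cos (t + (\<Sum>i\<in>insert j S. ?s A i * a i)) = cos ((t + a j) + (\<Sum>i\<in>S. ?s A i * a i))"
      using insert.hyps by (simp add: algebra_simps)
  qed
  also have "\<dots> + (\<Sum>A\<in>Pow S. cos ((t - a j) + (\<Sum>i\<in>S. ?s A i * a i)))
      = 2 ^ card S * (cos (t + a j) + cos (t - a j)) * (\<Prod>i\<in>S. cos (a i))"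
    unfolding insert.IH by (simp add: algebra_simps)
  also have "cos (t + a j) + cos (t - a j) = 2 * cos t * cos (a j)"
    by (simp add: cos_add cos_diff)
  finally show ?case using insert.hyps by (simp add: mult_ac)
qed simp

lemma avg_cos_freq: "(1 / 2 ^ CARD('d)) * (\<Sum>A\<in>UNIV. cos (freq A k \<bullet> x)) = cos_basis k (x :: real^'d)"
proof -
  have "(\<Sum>A\<in>UNIV. cos (freq A k \<bullet> x)) = (\<Sum>A\<in>Pow (UNIV :: 'd set). cos (0 + (\<Sum>i\<in>UNIV. (if i \<in> A then - 1 else 1) * (pi * real (k $ i) * x $ i))))"
    by (simp add: inner_vec_def freq_def mult.assoc)
  also have "\<dots> = 2 ^ CARD('d) * cos_basis k x"
    by (subst sum_cos_signs) (simp_all add: cos_basis_def)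
  finally show ?thesis by simp
qed

lemma C2_cos_jet: "C2_jet (cos_jet k)"
proof -
  have "C2_jet (ridge_jet cos (\<lambda>z. - sin z) (\<lambda>z. - cos z) w 0)" for w :: "real^'a"
    by (rule C2_ridge) (auto intro!: derivative_eq_intros continuous_intros)
  then show ?thesis
    unfolding cos_jet_def by (intro C2_scaleR C2_sum)
qed

lemma val_cos_jet: "val (cos_jet k x) = cos_basis k x"
  unfolding avg_cos_freq[symmetric] by (simp add: cos_jet_def fst_sum ridge_jet_def)

definition freq_sq :: "nat^'d \<Rightarrow> real" where
  "freq_sq k = (\<Sum>i\<in>UNIV. (pi * real (k $ i))\<^sup>2)"

lemma lap_cos_jet: "lap (cos_jet k x) = - freq_sq k * cos_basis k x"
proof -
  have "hes (cos_jet k x) $ i = - (pi * real (k $ i))\<^sup>2 * cos_basis k x" for i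
  proof -
    have "hes (cos_jet k x) $ i = (1 / 2 ^ CARD('a)) * (\<Sum>A\<in>UNIV. - cos (freq A k \<bullet> x) * (freq A k $ i)\<^sup>2)"
      by (simp add: cos_jet_def snd_sum ridge_jet_def)
    also have "(\<lambda>A. - cos (freq A k \<bullet> x) * (freq A k $ i)\<^sup>2) = (\<lambda>A. - (pi * real (k $ i))\<^sup>2 * cos (freq A k \<bullet> x))"
      by (auto simp: freq_def fun_eq_iff power_mult_distrib)
    finally show ?thesis
      unfolding avg_cos_freq[symmetric] by (simp add: sum_negf sum_distrib_left)
  qed
  then show ?thesis by (simp add: lap_def freq_sq_def sum_negf sum_distrib_right)
qed

lemma freq_sum_nonneg: "0 \<le> freq_sum k"
  by (simp add: freq_sum_def sum_nonneg)

lemma sum_sq_le_sq_sum: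
  fixes f :: "'a \<Rightarrow> real"
  assumes "finite S" "\<And>i. i \<in> S \<Longrightarrow> 0 \<le> f i"
  shows "(\<Sum>i\<in>S. (f i)\<^sup>2) \<le> (\<Sum>i\<in>S. f i)\<^sup>2"
  using assms
proof (induction S)
  case (insert j S)
  have "0 \<le> f j * (\<Sum>i\<in>S. f i)" using insert.prems by (intro mult_nonneg_nonneg sum_nonneg) auto
  then show ?case using insert by (simp add: power2_eq_square algebra_simps)
qed simp

lemma freq_sq_bounds: "0 \<le> freq_sq k" "freq_sq k \<le> (freq_sum k)\<^sup>2"
  unfolding freq_sq_def freq_sum_def sum_distrib_left
  by (intro sum_nonneg sum_sq_le_sq_sum; simp)+

lemma norm_freq: "norm (freq A k) \<le> freq_sum k"
proof -
  have "norm (freq A k) \<le> (\<Sum>i\<in>UNIV. \<bar>freq A k $ i\<bar>)" by (rule norm_le_l1_cart)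
  also have "\<dots> = freq_sum k" unfolding freq_def freq_sum_def sum_distrib_left
    by (intro sum.cong) (auto simp: abs_mult)
  finally show ?thesis .
qed

lemma norm_jet_le: "norm (j :: 'd::finite jet) \<le> \<bar>val j\<bar> + norm (grd j) + norm (hes j)"
proof -
  have "norm j \<le> norm (val j) + norm (snd j)"
    using norm_Pair_le[of "fst j" "snd j"] by simp
  moreover have "norm (snd j) \<le> norm (grd j) + norm (hes j)"
    using norm_Pair_le[of "grd j" "hes j"] by simp
  ultimately show ?thesis by simp
qed

lemma norm_ridge_jet:
  fixes w :: "real^'d"
  shows "norm (ridge_jet g g' g'' w b x) \<le> \<bar>g (w \<bullet> x + b)\<bar> + \<bar>g' (w \<bullet> x + b)\<bar> * norm w + \<bar>g'' (w \<bullet> x + b)\<bar> * (norm w)\<^sup>2"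
proof -
  have "norm (\<chi> i. g'' (w \<bullet> x + b) * (w $ i)\<^sup>2) \<le> (\<Sum>i\<in>UNIV. \<bar>g'' (w \<bullet> x + b) * (w $ i)\<^sup>2\<bar>)"
    using norm_le_l1_cart[of "\<chi> i. g'' (w \<bullet> x + b) * (w $ i)\<^sup>2"] by simp
  also have "\<dots> = \<bar>g'' (w \<bullet> x + b)\<bar> * (norm w)\<^sup>2"
    by (simp add: abs_mult sum_distrib_left norm_eq_sqrt_inner inner_vec_def power2_eq_square sum_nonneg)
  finally show ?thesis
    using norm_jet_le[of "ridge_jet g g' g'' w b x"] by (simp add: ridge_jet_def)
qed

lemma norm_cos_jet: "norm (cos_jet k (x :: real^'d)) \<le> 1 + freq_sum k + (freq_sum k)\<^sup>2"
proof -
  let ?B = "1 + freq_sum k + (freq_sum k)\<^sup>2"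
  have "norm (ridge_jet cos (\<lambda>z. - sin z) (\<lambda>z. - cos z) (freq A k) 0 x) \<le> ?B" for A
  proof -
    have "norm (ridge_jet cos (\<lambda>z. - sin z) (\<lambda>z. - cos z) (freq A k) 0 x) \<le> 1 + 1 * norm (freq A k) + 1 * (norm (freq A k))\<^sup>2"
      by (rule order_trans[OF norm_ridge_jet]) (intro add_mono mult_right_mono; simp)
    also have "\<dots> \<le> 1 + 1 * freq_sum k + 1 * (freq_sum k)\<^sup>2"
      by (intro add_mono mult_left_mono power_mono norm_freq) auto
    finally show ?thesis by simp
  qed
  then have "norm (\<Sum>A\<in>UNIV. ridge_jet cos (\<lambda>z. - sin z) (\<lambda>z. - cos z) (freq A k) 0 x) \<le> of_nat (card (UNIV :: 'd set set)) * ?B"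
    by (rule sum_norm_bound)
  then have "norm (cos_jet k x) \<le> (1 / 2 ^ CARD('d)) * (2 ^ CARD('d) * ?B)"
    unfolding cos_jet_def norm_scaleR by (simp add: card_UNIV_set divide_le_eq mult.commute)
  then show ?thesis by simp
qed

section \<open>Absolutely convergent cosine series\<close>

text \<open>The differentiation theorems for series are stated over the natural numbers, whereas the
  Barron norm is an unordered sum; absolute summability makes any enumeration admissible.\<close>

definition enum_freq :: "nat \<Rightarrow> nat^'d" where
  "enum_freq = from_nat_into UNIV"

lemma bij_enum_freq: "bij_betw (enum_freq :: nat \<Rightarrow> nat^'d) UNIV UNIV"
proof -
  have "inj (\<lambda>n::nat. (\<chi> i. n) :: nat^'d)" by (auto simp: inj_def vec_eq_iff)
  then have "infinite (UNIV :: (nat^'d) set)"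
    using finite_subset[OF subset_UNIV] range_inj_infinite by blast
  then show ?thesis unfolding enum_freq_def by (intro bij_betw_from_nat_into) auto
qed

lemma summable_enum_freq:
  fixes f :: "nat^'d \<Rightarrow> real"
  assumes "f summable_on UNIV" "\<And>k. 0 \<le> f k"
  shows "summable (\<lambda>n. f (enum_freq n))" "(\<Sum>n. f (enum_freq n)) = (\<Sum>\<^sub>\<infinity>k. f k)"
proof -
  have *: "(\<lambda>n. f (enum_freq n)) summable_on UNIV"
    using assms(1) summable_on_reindex_bij_betw[OF bij_enum_freq, of f] by simp
  then show "summable (\<lambda>n. f (enum_freq n))" by (rule summable_on_imp_summable)
  have "(\<lambda>n. f (enum_freq n)) sums infsum (\<lambda>n. f (enum_freq n)) UNIV"
    using has_sum_imp_sums has_sum_infsum[OF *] by blast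
  then show "(\<Sum>n. f (enum_freq n)) = (\<Sum>\<^sub>\<infinity>k. f k)"
    unfolding infsum_reindex_bij_betw[OF bij_enum_freq, of f, symmetric] by (simp add: sums_iff)
qed

definition jet_weight :: "nat^'d \<Rightarrow> real" where
  "jet_weight k = 1 + freq_sum k + (freq_sum k)\<^sup>2"

definition cos_series :: "(nat^'d \<Rightarrow> real) \<Rightarrow> real^'d \<Rightarrow> 'd jet" where
  "cos_series c x = (\<Sum>n. c (enum_freq n) *\<^sub>R cos_jet (enum_freq n) x)"

lemma jet_weight_ge_1: "1 \<le> jet_weight k"
  by (simp add: jet_weight_def freq_sum_nonneg)

lemma cos_basis_le_1: "\<bar>cos_basis k x\<bar> \<le> 1"
  unfolding cos_basis_def abs_prod by (intro prod_le_1) auto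

lemma
  fixes c :: "nat^'d \<Rightarrow> real"
  assumes c: "(\<lambda>k. jet_weight k * \<bar>c k\<bar>) summable_on UNIV"
  shows C2_cos_series: "C2_jet (cos_series c)"
    and norm_cos_series: "norm (cos_series c x) \<le> (\<Sum>\<^sub>\<infinity>k. jet_weight k * \<bar>c k\<bar>)"
    and val_cos_series: "(\<lambda>n. c (enum_freq n) * cos_basis (enum_freq n) x) sums val (cos_series c x)"
    and lap_cos_series: "(\<lambda>n. (- freq_sq (enum_freq n :: nat^'d) * c (enum_freq n)) * cos_basis (enum_freq n) x) sums lap (cos_series c x)"
    and summable_cos_coeff: "summable (\<lambda>n. \<bar>c (enum_freq n)\<bar>)"
proof -
  let ?M = "\<lambda>n. jet_weight (enum_freq n :: nat^'d) * \<bar>c (enum_freq n)\<bar>"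
  have w: "0 \<le> jet_weight k * \<bar>c k\<bar>" for k using jet_weight_ge_1[of k] by simp
  have M: "norm (c (enum_freq n) *\<^sub>R cos_jet (enum_freq n) x) \<le> ?M n" for n and x :: "real^'d"
    using mult_right_mono[OF norm_cos_jet[of "enum_freq n" x], of "\<bar>c (enum_freq n)\<bar>"]
    by (simp add: jet_weight_def mult.commute)
  note sM = summable_enum_freq[OF c w]
  note u = summable_jet_uniform[where M = ?M and J = "\<lambda>n x. c (enum_freq n) *\<^sub>R cos_jet (enum_freq n) x", OF M sM(1)]
  show "C2_jet (cos_series c)"
    unfolding cos_series_def[abs_def] by (rule C2_suminf[OF C2_scaleR[OF C2_cos_jet] M sM(1)])
  show "norm (cos_series c x) \<le> (\<Sum>\<^sub>\<infinity>k. jet_weight k * \<bar>c k\<bar>)"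
    using u(4)[of x] sM(2) by (simp add: cos_series_def)
  have s: "(\<lambda>n. c (enum_freq n) *\<^sub>R cos_jet (enum_freq n) x) sums cos_series c x"
    unfolding cos_series_def using u(2) by (rule summable_sums)
  have "bounded_linear (\<lambda>j::'d jet. val j)" by (intro bounded_linear_intros)
  from bounded_linear.sums[OF this s]
  show "(\<lambda>n. c (enum_freq n) * cos_basis (enum_freq n) x) sums val (cos_series c x)"
    by (simp add: val_cos_jet)
  have "bounded_linear (\<lambda>j::'d jet. lap j)"
    unfolding lap_def by (intro bounded_linear_sum bounded_linear_compose[OF bounded_linear_vec_nth] bounded_linear_intros)
  from bounded_linear.sums[OF this s]
  show "(\<lambda>n. (- freq_sq (enum_freq n :: nat^'d) * c (enum_freq n)) * cos_basis (enum_freq n) x) sums lap (cos_series c x)"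
    by (simp add: lap_cos_jet lap_def[of "_ *\<^sub>R _"] flip: sum_distrib_left lap_def) (simp add: mult_ac)
  show "summable (\<lambda>n. \<bar>c (enum_freq n)\<bar>)"
    by (rule summable_comparison_test'[OF sM(1), of 0])
       (use mult_right_mono[OF jet_weight_ge_1, of "\<bar>c _\<bar>"] in auto)
qed

section \<open>Coefficients of the iterated Laplacians\<close>

definition lap_coeff :: "(nat^'d \<Rightarrow> real) \<Rightarrow> nat \<Rightarrow> nat^'d \<Rightarrow> real" where
  "lap_coeff c j k = (- freq_sq k) ^ j * c k"

lemma barron_weight_eq: "barron_weight s k = 1 + freq_sum k ^ s"
  by (simp add: barron_weight_def freq_sum_def power_mult_distrib)

lemma power_le_one_plus:
  fixes y :: real
  assumes "0 \<le> y" "q \<le> s"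
  shows "y ^ q \<le> 1 + y ^ s"
proof (cases "y \<le> 1")
  case True
  then have "y ^ q \<le> 1" using assms by (simp add: power_le_one)
  then show ?thesis using zero_le_power[OF assms(1), of s] by linarith
next
  case False
  then have "y ^ q \<le> y ^ s" using assms(2) by (intro power_increasing) auto
  then show ?thesis by linarith
qed

text \<open>The \<open>j\<close> Laplacians cost \<open>2 * j\<close> powers of the frequency and
  the jet up to two more. Each of the three monomials is below the Barron weight by
  \<open>power_le_one_plus\<close>, whence the factor 3.\<close>

lemma jet_weight_lap_coeff:
  assumes "2 * j + 2 \<le> s"
  shows "jet_weight k * \<bar>lap_coeff c j k\<bar> \<le> 3 * (barron_weight s k * \<bar>c k\<bar>)"
proof -
  let ?y = "freq_sum k"
  have y: "0 \<le> ?y" by (rule freq_sum_nonneg)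
  have "\<bar>lap_coeff c j k\<bar> = freq_sq k ^ j * \<bar>c k\<bar>"
    using freq_sq_bounds(1)[of k] by (simp add: lap_coeff_def abs_mult power_abs)
  also have "\<dots> \<le> ((?y)\<^sup>2) ^ j * \<bar>c k\<bar>"
    by (intro mult_right_mono power_mono freq_sq_bounds) auto
  finally have "jet_weight k * \<bar>lap_coeff c j k\<bar> \<le> (1 + ?y + ?y\<^sup>2) * (?y ^ (2 * j) * \<bar>c k\<bar>)"
    unfolding jet_weight_def using y by (intro mult_left_mono) (auto simp: power_mult)
  also have "\<dots> = (?y ^ (2 * j) + ?y ^ (2 * j + 1) + ?y ^ (2 * j + 2)) * \<bar>c k\<bar>"
    by (simp add: algebra_simps power2_eq_square)
  also have "\<dots> \<le> ((1 + ?y ^ s) + (1 + ?y ^ s) + (1 + ?y ^ s)) * \<bar>c k\<bar>"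
    using assms y by (intro mult_right_mono add_mono power_le_one_plus) auto
  finally show ?thesis by (simp add: barron_weight_eq algebra_simps)
qed

lemma barron_weight_nonneg: "0 \<le> barron_weight s k * \<bar>c k\<bar>"
  by (simp add: barron_weight_eq freq_sum_nonneg)

lemma
  fixes c :: "nat^'d \<Rightarrow> real"
  assumes c: "(\<lambda>k. barron_weight s k * \<bar>c k\<bar>) summable_on UNIV" and j: "2 * j + 2 \<le> s"
  shows summable_lap_coeff: "(\<lambda>k. jet_weight k * \<bar>lap_coeff c j k\<bar>) summable_on UNIV"
    and infsum_lap_coeff: "(\<Sum>\<^sub>\<infinity>k. jet_weight k * \<bar>lap_coeff c j k\<bar>) \<le> 3 * (\<Sum>\<^sub>\<infinity>k. barron_weight s k * \<bar>c k\<bar>)"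
proof -
  have c3: "(\<lambda>k. 3 * (barron_weight s k * \<bar>c k\<bar>)) summable_on UNIV"
    using c by (rule summable_on_cmult_right)
  have nn: "0 \<le> jet_weight k * \<bar>lap_coeff c j k\<bar>" for k using jet_weight_ge_1[of k] by simp
  show *: "(\<lambda>k. jet_weight k * \<bar>lap_coeff c j k\<bar>) summable_on UNIV"
    by (rule summable_on_comparison_test[OF c3]) (use jet_weight_lap_coeff[OF j] nn in auto)
  have "(\<Sum>\<^sub>\<infinity>k. jet_weight k * \<bar>lap_coeff c j k\<bar>) \<le> (\<Sum>\<^sub>\<infinity>k. 3 * (barron_weight s k * \<bar>c k\<bar>))"
    by (rule infsum_mono[OF * c3]) (rule jet_weight_lap_coeff[OF j])
  then show "(\<Sum>\<^sub>\<infinity>k. jet_weight k * \<bar>lap_coeff c j k\<bar>) \<le> 3 * (\<Sum>\<^sub>\<infinity>k. barron_weight s k * \<bar>c k\<bar>)"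
    by (simp add: infsum_cmult_right')
qed

lemma lap_series_step:
  fixes c :: "nat^'d \<Rightarrow> real"
  assumes c: "(\<lambda>k. barron_weight s k * \<bar>c k\<bar>) summable_on UNIV" and j: "2 * Suc j + 2 \<le> s"
  shows "lap (cos_series (lap_coeff c j) x) = val (cos_series (lap_coeff c (Suc j)) x)"
proof -
  have "(\<lambda>n. lap_coeff c (Suc j) (enum_freq n) * cos_basis (enum_freq n) x) sums lap (cos_series (lap_coeff c j) x)"
  proof -
    have "lap_coeff c (Suc j) k = - freq_sq k * lap_coeff c j k" for k by (simp add: lap_coeff_def)
    then show ?thesis using lap_cos_series[OF summable_lap_coeff[OF c], of j x] j by simp
  qed
  moreover have "(\<lambda>n. lap_coeff c (Suc j) (enum_freq n) * cos_basis (enum_freq n) x) sums val (cos_series (lap_coeff c (Suc j)) x)"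
    by (rule val_cos_series[OF summable_lap_coeff[OF c j]])
  ultimately show ?thesis by (rule sums_unique2)
qed

section \<open>Orthogonality and completeness of the cosines on the cube\<close>

lemma cube_continuous_zero:
  fixes f :: "real^'d \<Rightarrow> real"
  assumes f: "continuous_on cube f" and nn: "\<And>x. x \<in> cube \<Longrightarrow> 0 \<le> f x"
    and 0: "(LINT x:cube|lborel. f x) = 0" and x: "x \<in> cube"
  shows "f x = 0"
proof -
  have si: "set_integrable lborel cube f"
    using f unfolding cube_def set_integrable_def by (intro borel_integrable_compact) auto
  have "(f has_integral 0) (cbox 0 One)"
    using set_borel_integral_eq_integral[OF si] 0 unfolding cube_def
    by (simp add: has_integral_integrable_integral)
  then show ?thesis
    using f nn x by (intro has_integral_0_cbox_imp_0[of 0 One f]) (auto simp: cube_def box_eq_empty intro: box_subset_cbox[THEN subsetD])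
qed

text \<open>Finite combinations already form an algebra by the product-to-sum formula, so the
  Stone-Weierstrass theorem applies to them.\<close>

definition cos_poly :: "(real^'d \<Rightarrow> real) set" where
  "cos_poly = {f. \<exists>F a. finite F \<and> f = (\<lambda>x. \<Sum>k\<in>F. a k * cos_basis k x)}"

lemma cos_poly_basis: "(\<lambda>x. a * cos_basis k x) \<in> cos_poly"
  unfolding cos_poly_def by (auto intro!: exI[of _ "{k}"] exI[of _ "\<lambda>_. a"])

lemma cos_poly_add:
  assumes "f \<in> cos_poly" "g \<in> cos_poly"
  shows "(\<lambda>x. f x + g x) \<in> cos_poly"
proof -
  obtain F a G b where F: "finite F" "f = (\<lambda>x. \<Sum>k\<in>F. a k * cos_basis k x)"
    and G: "finite G" "g = (\<lambda>x. \<Sum>k\<in>G. b k * cos_basis k x)"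
    using assms unfolding cos_poly_def by blast
  let ?a = "\<lambda>k. (if k \<in> F then a k else 0) + (if k \<in> G then b k else 0)"
  have "f x + g x = (\<Sum>k\<in>F \<union> G. ?a k * cos_basis k x)" for x
    using F G by (simp add: distrib_right sum.distrib if_distrib[of "\<lambda>z. z * _"] sum.If_cases Int_absorb1 Int_absorb2 cong: if_cong)
  then show ?thesis unfolding cos_poly_def using F(1) G(1) by (auto intro!: exI[of _ "F \<union> G"] exI[of _ ?a])
qed

lemma cos_poly_sum:
  assumes "finite I" "\<And>i. i \<in> I \<Longrightarrow> f i \<in> cos_poly"
  shows "(\<lambda>x. \<Sum>i\<in>I. f i x) \<in> cos_poly"
  using assms
proof (induction I)
  case empty
  show ?case using cos_poly_basis[of 0 0] by simp
next
  case (insert i I)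
  then show ?case using cos_poly_add[of "f i" "\<lambda>x. \<Sum>i\<in>I. f i x"] by simp
qed

lemma cos_poly_cmult:
  assumes "f \<in> cos_poly"
  shows "(\<lambda>x. c * f x) \<in> cos_poly"
proof -
  obtain F a where "finite F" "f = (\<lambda>x. \<Sum>k\<in>F. a k * cos_basis k x)"
    using assms unfolding cos_poly_def by blast
  then show ?thesis
    unfolding cos_poly_def by (auto simp: sum_distrib_left mult.assoc intro!: exI[of _ F] exI[of _ "\<lambda>k. c * a k"])
qed

text \<open>The product-to-sum formula holds in each coordinate; expanding the product over
  coordinates gives a sum over the sets of coordinates in which the sum frequency is taken.\<close>

lemma cos_basis_mult: "(\<lambda>x::real^'d. cos_basis k x * cos_basis l x) \<in> cos_poly"
proof -
  \<comment> \<open>Outside \<open>A\<close> the frequency is the absolute difference, written by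
    cases because subtraction of natural numbers truncates; the cosine is even, so the sign is
    immaterial.\<close>
  define r where "r A = (\<chi> i. if i \<in> A then k $ i + l $ i else (if k $ i \<le> l $ i then l $ i - k $ i else k $ i - l $ i))" for A :: "'d set"
  have "cos_basis k x * cos_basis l x = (\<Sum>A\<in>Pow UNIV. (1 / 2) ^ CARD('d) * cos_basis (r A) x)" for x :: "real^'d"
  proof -
    let ?p = "\<lambda>i. (1/2) * cos (pi * real (k $ i + l $ i) * x $ i)"
    let ?q = "\<lambda>i. (1/2) * cos (pi * (real (k $ i) - real (l $ i)) * x $ i)"
    have "cos_basis k x * cos_basis l x = (\<Prod>i\<in>UNIV. ?p i + ?q i)"
      unfolding cos_basis_def prod.distrib[symmetric]
      by (intro prod.cong refl) (simp add: cos_times_cos algebra_simps)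
    also have "\<dots> = (\<Sum>A\<in>Pow UNIV. (\<Prod>i\<in>A. ?p i) * (\<Prod>i\<in>UNIV - A. ?q i))"
      by (rule prod_add) simp
    also have "\<dots> = (\<Sum>A\<in>Pow UNIV. (1 / 2) ^ CARD('d) * cos_basis (r A) x)"
    proof (intro sum.cong refl)
      fix A :: "'d set"
      have c: "cos (pi * real (r A $ i) * x $ i) = (if i \<in> A then cos (pi * real (k $ i + l $ i) * x $ i) else cos (pi * (real (k $ i) - real (l $ i)) * x $ i))" for i
      proof -
        have "pi * (real (l $ i) - real (k $ i)) * x $ i = - (pi * (real (k $ i) - real (l $ i)) * x $ i)"
          by (simp add: algebra_simps)
        then have "cos (pi * (real (l $ i) - real (k $ i)) * x $ i) = cos (pi * (real (k $ i) - real (l $ i)) * x $ i)"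
          by (simp only: cos_minus)
        then show ?thesis by (auto simp: r_def of_nat_diff)
      qed
      have "(1 / 2) ^ CARD('d) * cos_basis (r A) x = (\<Prod>i\<in>UNIV. (1/2) * cos (pi * real (r A $ i) * x $ i))"
        by (simp add: cos_basis_def prod_dividef power_one_over)
      also have "\<dots> = (\<Prod>i\<in>A. (1/2) * cos (pi * real (r A $ i) * x $ i)) * (\<Prod>i\<in>UNIV - A. (1/2) * cos (pi * real (r A $ i) * x $ i))"
        by (subst prod.subset_diff[of A UNIV]) (simp_all add: mult.commute)
      also have "\<dots> = (\<Prod>i\<in>A. ?p i) * (\<Prod>i\<in>UNIV - A. ?q i)"
        unfolding c by (intro arg_cong2[of _ _ _ _ times] prod.cong) auto
      finally show "(\<Prod>i\<in>A. ?p i) * (\<Prod>i\<in>UNIV - A. ?q i) = (1 / 2) ^ CARD('d) * cos_basis (r A) x" by simp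
    qed
    finally show ?thesis .
  qed
  then show ?thesis by (simp only:) (intro cos_poly_sum cos_poly_basis, simp)
qed

lemma cos_poly_mult:
  assumes "f \<in> cos_poly" "g \<in> cos_poly"
  shows "(\<lambda>x. f x * g x) \<in> cos_poly"
proof -
  obtain F a G b where F: "finite F" "f = (\<lambda>x. \<Sum>k\<in>F. a k * cos_basis k x)"
    and G: "finite G" "g = (\<lambda>x. \<Sum>k\<in>G. b k * cos_basis k x)"
    using assms unfolding cos_poly_def by blast
  have "f x * g x = (\<Sum>k\<in>F. \<Sum>l\<in>G. (a k * b l) * (cos_basis k x * cos_basis l x))" for x
    unfolding F(2) G(2) sum_product by (simp add: mult_ac)
  then show ?thesis
    by (simp only:) (intro cos_poly_sum F(1) G(1) cos_poly_cmult cos_basis_mult)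
qed

lemma continuous_cos_basis: "continuous_on S (cos_basis k)"
  using C2_continuous(2)[OF C2_cos_jet[of k], of S] by (simp add: val_cos_jet)

text \<open>Points are separated because the cosine is injective on the half period [0, pi], to
  which the coordinates of the cube are scaled. This is why cosines without sines are complete on
  the cube.\<close>

lemma function_ring_cos_poly: "function_ring_on (cos_poly :: (real^'d \<Rightarrow> real) set) cube"
proof
  show "continuous_on cube f" if "f \<in> cos_poly" for f :: "real^'d \<Rightarrow> real"
    using that unfolding cos_poly_def by (auto intro!: continuous_intros continuous_cos_basis)
  show "(\<lambda>x. c) \<in> cos_poly" for c
    using cos_poly_basis[of c 0] by (simp add: cos_basis_def)
  fix x y :: "real^'d" assume xy: "x \<in> cube" "y \<in> cube" "x \<noteq> y"
  then obtain i where i: "x $ i \<noteq> y $ i" by (auto simp: vec_eq_iff)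
  define k where "k = ((\<chi> j. if j = i then 1 else 0) :: nat^'d)"
  have cb: "cos_basis k z = cos (pi * z $ i)" for z :: "real^'d"
    unfolding cos_basis_def
    by (subst prod.remove[of UNIV i]) (auto simp: k_def intro!: prod.neutral)
  have "0 \<le> pi * z $ i \<and> pi * z $ i \<le> pi" if "z \<in> cube" for z :: "real^'d"
    using that by (auto simp: mem_cube intro: mult_left_le)
  then have "cos (pi * x $ i) \<noteq> cos (pi * y $ i)"
    using xy i cos_inj_pi[of "pi * x $ i" "pi * y $ i"] by auto
  then show "\<exists>f\<in>cos_poly. f x \<noteq> f y"
    using cos_poly_basis[of 1 k] by (intro bexI[of _ "\<lambda>z. 1 * cos_basis k z"]) (simp_all add: cb)
qed (auto simp: compact_cube intro: cos_poly_add cos_poly_mult)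

lemma set_integrable_cube:
  assumes "continuous_on cube f"
  shows "set_integrable lborel cube (f :: real^'d \<Rightarrow> real)"
  using assms unfolding set_integrable_def by (intro borel_integrable_compact compact_cube) auto

text \<open>If \<open>p\<close> is a uniform approximation of \<open>w\<close> in the algebra, then
  the integral of \<open>w * w\<close> equals that of \<open>w * (w - p)\<close>, which is
  arbitrarily small.\<close>

lemma cube_orthogonal_zero:
  fixes w :: "real^'d \<Rightarrow> real"
  assumes w: "continuous_on cube w" and orth: "\<And>k. (LINT x:cube|lborel. w x * cos_basis k x) = 0"
    and x: "x \<in> cube"
  shows "w x = 0"
proof -
  interpret function_ring_on "cos_poly :: (real^'d \<Rightarrow> real) set" cube by (rule function_ring_cos_poly)
  have orth_poly: "(LINT x:cube|lborel. w x * f x) = 0" if f: "f \<in> cos_poly" for f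
  proof -
    obtain F a where F: "finite F" "f = (\<lambda>x. \<Sum>k\<in>F. a k * cos_basis k x)"
      using f unfolding cos_poly_def by blast
    have "(LINT x:cube|lborel. w x * f x) = (LINT x:cube|lborel. (\<Sum>k\<in>F. a k * (w x * cos_basis k x)))"
      unfolding F(2) by (simp add: sum_distrib_left mult_ac)
    also have "\<dots> = (\<Sum>k\<in>F. LINT x:cube|lborel. a k * (w x * cos_basis k x))"
    proof -
      have "set_integrable lborel cube (\<lambda>x. a k * (w x * cos_basis k x))" for k
        by (intro set_integrable_cube continuous_intros w continuous_cos_basis)
      then show ?thesis
        unfolding set_lebesgue_integral_def set_integrable_def scaleR_sum_right
        by (intro Bochner_Integration.integral_sum) auto
    qed
    also have "\<dots> = 0" by (simp add: orth)
    finally show ?thesis .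
  qed
  obtain K where K: "K > 0" "\<And>x. x \<in> cube \<Longrightarrow> \<bar>w x\<bar> \<le> K"
    using bounded_on_cube[OF w] by blast
  have le: "(LINT x:cube|lborel. w x * w x) \<le> e" if e: "e > 0" for e
  proof -
    obtain p where p: "p \<in> cos_poly" "\<And>x. x \<in> cube \<Longrightarrow> \<bar>w x - p x\<bar> < e / K"
      using Stone_Weierstrass_basic[OF w, of "e / K"] e K by auto
    note cp = continuous[OF p(1)]
    have "(LINT x:cube|lborel. w x * w x) = (LINT x:cube|lborel. w x * p x) + (LINT x:cube|lborel. w x * (w x - p x))"
      by (subst set_integral_add(2)[symmetric]) (auto intro!: set_integrable_cube continuous_intros w cp simp: algebra_simps)
    also have "\<dots> = (LINT x:cube|lborel. w x * (w x - p x))" using orth_poly[OF p(1)] by simp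
    also have "\<dots> \<le> (LINT x:(cube :: (real^'d) set)|lborel. e)"
      unfolding set_lebesgue_integral_def
    proof (rule integral_mono)
      show "integrable lborel (\<lambda>x. indicator cube x *\<^sub>R (w x * (w x - p x)))" "integrable lborel (\<lambda>x::real^'d. indicator cube x *\<^sub>R e)"
        unfolding set_integrable_def[symmetric] by (intro set_integrable_cube continuous_intros w cp)+
      fix x :: "real^'d"
      show "indicator cube x *\<^sub>R (w x * (w x - p x)) \<le> indicator cube x *\<^sub>R e"
      proof (cases "x \<in> cube")
        case True
        have "\<bar>w x * (w x - p x)\<bar> \<le> K * (e / K)"
          unfolding abs_mult using K p(2)[OF True] True e by (intro mult_mono) (auto intro: less_imp_le)
        then show ?thesis using K(1) True by simp
      qed simp
    qed
    also have "\<dots> = e" by (simp add: set_lebesgue_integral_def)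
    finally show ?thesis .
  qed
  have "(LINT x:cube|lborel. w x * w x) \<le> 0"
  proof (rule field_le_epsilon)
    fix e :: real assume "0 < e"
    then show "(LINT x:cube|lborel. w x * w x) \<le> 0 + e" using le[of e] by simp
  qed
  moreover have "0 \<le> (LINT x:cube|lborel. w x * w x)"
    unfolding set_lebesgue_integral_def by (intro integral_nonneg_AE) auto
  ultimately have "w x * w x = 0"
    by (intro cube_continuous_zero[of "\<lambda>x. w x * w x"] continuous_intros w x) auto
  then show ?thesis by simp
qed

lemma LINT_cube_measure:
  assumes "continuous_on UNIV (f :: real^'d \<Rightarrow> real)"
  shows "(LINT x:cube|lborel. f x) = (\<integral>x. f x \<partial>cube_measure)"
  by (rule integral_cube) (rule borel_measurable_continuous_onI[OF assms])

text \<open>One integrates in a coordinate where the frequencies differ: the remaining factor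
  \<open>R\<close> does not depend on it, and the antiderivative is a combination of sines that
  vanish at 0 and 1.\<close>

lemma cos_basis_orthogonal:
  fixes k l :: "nat^'d"
  assumes "k \<noteq> l"
  shows "(\<integral>x. cos_basis k x * cos_basis l x \<partial>cube_measure) = 0"
proof -
  obtain i where i: "k $ i \<noteq> l $ i" using assms by (auto simp: vec_eq_iff)
  define R where "R x = (\<Prod>j\<in>UNIV - {i}. cos (pi * real (k $ j) * x $ j) * cos (pi * real (l $ j) * x $ j))" for x :: "real^'d"
  define a b where "a = pi * (real (k $ i) + real (l $ i))" and "b = pi * (real (k $ i) - real (l $ i))"
  have ab: "a \<noteq> 0" "b \<noteq> 0" using i by (auto simp: a_def b_def)
  have sin0: "sin a = 0" "sin b = 0"
    unfolding a_def b_def using sin_npi_int[of "int (k $ i) + int (l $ i)"] sin_npi_int[of "int (k $ i) - int (l $ i)"]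
    by (simp_all add: mult.commute)
  have eq: "cos_basis k x * cos_basis l x = R x * ((cos (a * x $ i) + cos (b * x $ i)) / 2)" for x
  proof -
    have "cos_basis k x * cos_basis l x = (cos (pi * real (k $ i) * x $ i) * cos (pi * real (l $ i) * x $ i)) * R x"
      unfolding cos_basis_def prod.distrib[symmetric] R_def by (subst prod.remove[of UNIV i]) auto
    then show ?thesis by (simp add: cos_times_cos a_def b_def algebra_simps)
  qed
  have Ru: "R (upd i t x) = R x" for t x
    unfolding R_def by (intro prod.cong) auto
  have cR: "continuous_on UNIV R" unfolding R_def by (intro continuous_intros)
  have "(\<integral>x. R x * ((cos (a * x $ i) + cos (b * x $ i)) / 2) \<partial>cube_measure)
     = (\<integral>x. R (upd i 1 x) * ((sin (a * upd i 1 x $ i) / a + sin (b * upd i 1 x $ i) / b) / 2)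
           - R (upd i 0 x) * ((sin (a * upd i 0 x $ i) / a + sin (b * upd i 0 x $ i) / b) / 2) \<partial>cube_measure)"
    by (rule integral_cube_partial[where \<psi> = "\<lambda>x. R x * ((sin (a * x $ i) / a + sin (b * x $ i) / b) / 2)"])
      (use ab in \<open>auto intro!: continuous_intros cR derivative_eq_intros simp: Ru\<close>)
  then show ?thesis by (simp add: eq sin0)
qed

lemma cos_basis_norm_pos: "(\<integral>x. (cos_basis k x)\<^sup>2 \<partial>cube_measure) \<noteq> (0::real)"
proof
  assume *: "(\<integral>x. (cos_basis k x)\<^sup>2 \<partial>cube_measure) = 0"
  have "(cos_basis k 0)\<^sup>2 = (0::real)"
    by (rule cube_continuous_zero[where f = "\<lambda>x. (cos_basis k x)\<^sup>2"])
      (auto simp: mem_cube * LINT_cube_measure[OF continuous_on_power[OF continuous_cos_basis]]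
        intro!: continuous_intros continuous_cos_basis)
  then show False by (simp add: cos_basis_def)
qed

lemma integral_cos_series:
  fixes c :: "nat^'d \<Rightarrow> real"
  assumes c: "(\<lambda>k. jet_weight k * \<bar>c k\<bar>) summable_on UNIV"
  shows "(\<integral>x. val (cos_series c x) * cos_basis k x \<partial>cube_measure) = c k * (\<integral>x. (cos_basis k x)\<^sup>2 \<partial>cube_measure)"
proof -
  interpret prob_space "cube_measure :: (real^'d) measure" by (rule prob_space_cube)
  obtain m where m: "enum_freq m = k"
    using bij_enum_freq[where 'd='d] unfolding bij_betw_def by (metis UNIV_I imageE)
  let ?f = "\<lambda>n x. c (enum_freq n) * cos_basis (enum_freq n) x * cos_basis k x"
  have cf: "continuous_on UNIV (?f n)" for n by (intro continuous_intros continuous_cos_basis)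
  have s: "(\<lambda>n. ?f n x) sums (val (cos_series c x) * cos_basis k x)" for x
    using sums_mult2[OF val_cos_series[OF c, of x], of "cos_basis k x"] by (simp add: mult.assoc)
  have bd: "norm (?f n x) \<le> \<bar>c (enum_freq n)\<bar>" for n x
    using mult_mono[OF mult_left_mono[OF cos_basis_le_1[of "enum_freq n" x], of "\<bar>c (enum_freq n)\<bar>"] cos_basis_le_1[of k x]] by (simp add: abs_mult)
  have "(\<integral>x. val (cos_series c x) * cos_basis k x \<partial>cube_measure) = (\<integral>x. (\<Sum>n. ?f n x) \<partial>cube_measure)"
    using s by (simp add: sums_iff)
  also have "\<dots> = (\<Sum>n. \<integral>x. ?f n x \<partial>cube_measure)"
  proof (rule integral_suminf)
    show "integrable cube_measure (?f n)" for n by (rule integrable_cube_continuous[OF cf])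
    show "AE x in cube_measure. summable (\<lambda>n. norm (?f n x))"
      by (intro AE_I2 summable_comparison_test'[OF summable_cos_coeff[OF c], of 0]) (use bd in auto)
    show "summable (\<lambda>n. \<integral>x. norm (?f n x) \<partial>cube_measure)"
    proof (rule summable_comparison_test'[OF summable_cos_coeff[OF c], of 0])
      fix n
      have "(\<integral>x. norm (?f n x) \<partial>cube_measure) \<le> (\<integral>x. \<bar>c (enum_freq n)\<bar> \<partial>(cube_measure :: (real^'d) measure))"
        by (intro integral_mono_AE integrable_norm integrable_cube_continuous[OF cf]) (use bd in auto)
      then show "norm (\<integral>x. norm (?f n x) \<partial>cube_measure) \<le> \<bar>c (enum_freq n)\<bar>"
        by (simp add: prob_space[simplified])
    qed
  qed
  also have "\<dots> = (\<Sum>n\<in>{m}. \<integral>x. ?f n x \<partial>cube_measure)"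
  proof (rule suminf_finite)
    fix n assume "n \<notin> {m}"
    then have "(enum_freq n :: nat^'d) \<noteq> k"
      using m bij_enum_freq[where 'd='d] unfolding bij_betw_def inj_on_def by auto
    then show "(\<integral>x. ?f n x \<partial>cube_measure) = 0"
      using cos_basis_orthogonal[of "enum_freq n" k] by (simp add: mult.assoc)
  qed simp
  also have "\<dots> = c k * (\<integral>x. (cos_basis k x)\<^sup>2 \<partial>cube_measure)"
    by (simp add: m mult.assoc power2_eq_square)
  finally show ?thesis .
qed

text \<open>Coefficients determine a function only almost everywhere. Continuity of \<open>u\<close>
  selects the representative: the difference from the series is continuous and orthogonal to the
  whole basis, hence zero at every point of the cube.\<close>

lemma barron_eq_cos_series:
  fixes u :: "real^'d \<Rightarrow> real"
  assumes u: "u \<in> barron_space s" "2 \<le> s" "continuous_on cube u" and x: "x \<in> cube"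
  shows "u x = val (cos_series (cos_coeff u) x)"
proof -
  let ?c = "cos_coeff u"
  have c0: "lap_coeff ?c 0 = ?c" by (simp add: lap_coeff_def fun_eq_iff)
  have c: "(\<lambda>k. jet_weight k * \<bar>?c k\<bar>) summable_on UNIV"
    using summable_lap_coeff[of s ?c 0] u by (simp add: barron_space_def c0)
  have cS: "continuous_on S (\<lambda>x. val (cos_series ?c x))" for S
    by (rule C2_continuous(2)[OF C2_cos_series[OF c]])
  have "u x - val (cos_series ?c x) = 0"
  proof (rule cube_orthogonal_zero[where w = "\<lambda>x. u x - val (cos_series ?c x)"])
    fix k
    have "(LINT x:cube|lborel. (u x - val (cos_series ?c x)) * cos_basis k x)
        = (LINT x:cube|lborel. u x * cos_basis k x) - (LINT x:cube|lborel. val (cos_series ?c x) * cos_basis k x)"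
      unfolding left_diff_distrib
      by (intro set_integral_diff set_integrable_cube continuous_intros u cS continuous_cos_basis)
    also have "(LINT x:cube|lborel. val (cos_series ?c x) * cos_basis k x) = ?c k * (LINT x:cube|lborel. (cos_basis k x)\<^sup>2)"
      by (simp add: LINT_cube_measure integral_cos_series[OF c] continuous_intros cS continuous_cos_basis)
    also have "\<dots> = (LINT x:cube|lborel. u x * cos_basis k x)"
      using cos_basis_norm_pos[of k] by (simp add: cos_coeff_def LINT_cube_measure continuous_intros continuous_cos_basis)
    finally show "(LINT x:cube|lborel. (u x - val (cos_series ?c x)) * cos_basis k x) = 0" by simp
  qed (intro continuous_intros u cS, rule x)
  then show ?thesis by simp
qed

text \<open>The series is defined on the whole space and thus provides the extension of the
  \<open>j\<close>-th iterated Laplacian of \<open>u\<close> that \<open>partial_deriv_cube\<close>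
  asks for.\<close>

definition barron_jet :: "(real^'d \<Rightarrow> real) \<Rightarrow> nat \<Rightarrow> real^'d \<Rightarrow> 'd jet" where
  "barron_jet u j = cos_series (lap_coeff (cos_coeff u) j)"

lemma
  fixes u :: "real^'d \<Rightarrow> real"
  assumes u: "u \<in> barron_space s" and j: "2 * j + 2 \<le> s"
  shows C2_barron_jet: "C2_jet (barron_jet u j)"
    and norm_barron_jet: "norm (barron_jet u j x) \<le> 3 * barron_norm s u"
proof -
  have c: "(\<lambda>k. barron_weight s k * \<bar>cos_coeff u k\<bar>) summable_on UNIV"
    using u by (simp add: barron_space_def)
  note sl = summable_lap_coeff[OF c j]
  show "C2_jet (barron_jet u j)" unfolding barron_jet_def by (rule C2_cos_series[OF sl])
  show "norm (barron_jet u j x) \<le> 3 * barron_norm s u"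
    using order_trans[OF norm_cos_series[OF sl] infsum_lap_coeff[OF c j]]
    unfolding barron_jet_def barron_norm_def .
qed

lemma lap_barron_jet:
  assumes "u \<in> barron_space s" "2 * Suc j + 2 \<le> s"
  shows "lap (barron_jet u j x) = val (barron_jet u (Suc j) x)"
  unfolding barron_jet_def using assms by (intro lap_series_step[of s]) (auto simp: barron_space_def)

lemma iterated_laplacian_barron:
  fixes u :: "real^'d \<Rightarrow> real"
  assumes u: "u \<in> barron_space s" "continuous_on cube u"
  shows "2 * j + 2 \<le> s \<Longrightarrow> x \<in> cube \<Longrightarrow> (laplacian ^^ j) u x = val (barron_jet u j x)"
proof (induction j arbitrary: x)
  case 0
  have "lap_coeff (cos_coeff u) 0 = cos_coeff u" by (simp add: lap_coeff_def fun_eq_iff)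
  then show ?case using barron_eq_cos_series[OF u(1) _ u(2)] 0 by (simp add: barron_jet_def)
next
  case (Suc j)
  have "laplacian ((laplacian ^^ j) u) x = lap (barron_jet u j x)"
    by (rule laplacian_C2[OF C2_barron_jet[OF u(1)]]) (use Suc in auto)
  then show ?case using lap_barron_jet[OF u(1) Suc.prems(1)] by simp
qed

section \<open>Uniform deviations of parametrised empirical means\<close>

lemma prod_mono_ennreal:
  fixes f g :: "'a \<Rightarrow> ennreal"
  assumes "\<And>i. i \<in> A \<Longrightarrow> f i \<le> g i"
  shows "prod f A \<le> prod g A"
  using assms by (induction A rule: infinite_finite_induct) (auto intro!: mult_mono)

text \<open>Hoeffding's lemma at the scale \<open>1 / (c * sqrt N)\<close> bounds each factor by
  \<open>exp (1 / (2 * N))\<close>. The product of \<open>N\<close> factors is then at most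
  \<open>exp (1 / 2)\<close>, a bound free of \<open>N\<close> and \<open>c\<close>.\<close>

lemma (in prob_space) exp_moment_centered_sum:
  fixes X :: "nat \<Rightarrow> 'a \<Rightarrow> 'b::topological_space" and g :: "'b \<Rightarrow> real"
  assumes X: "indep_vars (\<lambda>_. borel) X {..<N}" and law: "\<And>j. j < N \<Longrightarrow> distr M borel (X j) = \<mu>"
    and g [measurable]: "g \<in> borel_measurable borel" and c: "c > 0" "\<And>x. \<bar>g x\<bar> \<le> c" and N: "N \<ge> 1"
  shows "(\<integral>\<^sup>+\<omega>. ennreal (exp ((\<Sum>j<N. g (X j \<omega>) - (\<integral>x. g x \<partial>\<mu>)) / (c * sqrt N))) \<partial>M) \<le> 2"
proof -
  let ?l = "1 / (c * sqrt N)" and ?m = "\<integral>x. g x \<partial>\<mu>"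
  have l: "?l > 0" using c N by simp
  have rv [measurable]: "X j \<in> M \<rightarrow>\<^sub>M borel" if "j < N" for j
    using X that by (auto simp: indep_vars_def)
  have one: "(\<integral>\<^sup>+\<omega>. ennreal (exp (?l * (g (X j \<omega>) - ?m))) \<partial>M) \<le> ennreal (exp (1 / (2 * real N)))" if j: "j < N" for j
  proof -
    note rv[OF j, measurable]
    interpret interval_bounded_random_variable M "\<lambda>\<omega>. g (X j \<omega>)" "-c" c
      by unfold_locales (use c(2) in \<open>auto simp: abs_le_iff minus_le_iff\<close>)
    have "expectation (\<lambda>\<omega>. g (X j \<omega>)) = ?m"
      unfolding law[OF j, symmetric] by (subst integral_distr) auto
    then have "(\<integral>\<^sup>+\<omega>. ennreal (exp (?l * (g (X j \<omega>) - ?m))) \<partial>M) \<le> ennreal (exp (?l\<^sup>2 * (c - (-c))\<^sup>2 / 8))"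
      using Hoeffdings_lemma_nn_integral[OF l] by simp
    also have "?l\<^sup>2 * (c - (-c))\<^sup>2 / 8 = 1 / (2 * real N)"
      using c N by (simp add: power_divide power_mult_distrib field_simps)
    finally show ?thesis .
  qed
  have "(\<integral>\<^sup>+\<omega>. ennreal (exp ((\<Sum>j<N. g (X j \<omega>) - ?m) / (c * sqrt N))) \<partial>M)
      = (\<integral>\<^sup>+\<omega>. (\<Prod>j<N. ennreal (exp (?l * (g (X j \<omega>) - ?m)))) \<partial>M)"
    by (intro nn_integral_cong) (simp add: prod_ennreal exp_sum sum_distrib_left sum_divide_distrib flip: exp_sum)
  also have "\<dots> = (\<Prod>j<N. \<integral>\<^sup>+\<omega>. ennreal (exp (?l * (g (X j \<omega>) - ?m))) \<partial>M)"
  proof (rule indep_vars_nn_integral)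
    show "indep_vars (\<lambda>_. borel) (\<lambda>j \<omega>. ennreal (exp (?l * (g (X j \<omega>) - ?m)))) {..<N}"
      by (rule indep_vars_compose2[OF X, of "\<lambda>_ x. ennreal (exp (?l * (g x - ?m)))"]) simp
  qed auto
  also have "\<dots> \<le> (\<Prod>j<N. ennreal (exp (1 / (2 * real N))))"
    by (intro prod_mono_ennreal) (use one in auto)
  also have "\<dots> = ennreal (exp (1 / 2))"
    using N by (simp add: ennreal_power flip: exp_of_nat_mult)
  also have "\<dots> \<le> ennreal 2"
  proof (rule ennreal_leI)
    have "exp (1/2 :: real) \<le> 1 + 1/2 + (1/2)\<^sup>2" by (rule exp_bound) auto
    then show "exp (1/2 :: real) \<le> 2" by (simp add: power2_eq_square)
  qed
  finally show ?thesis by simp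
qed

lemma (in prob_space) exp_abs_moment_centered_sum:
  fixes X :: "nat \<Rightarrow> 'a \<Rightarrow> 'b::topological_space" and g :: "'b \<Rightarrow> real"
  assumes X: "indep_vars (\<lambda>_. borel) X {..<N}" and law: "\<And>j. j < N \<Longrightarrow> distr M borel (X j) = \<mu>"
    and g [measurable]: "g \<in> borel_measurable borel" and c: "c > 0" "\<And>x. \<bar>g x\<bar> \<le> c" and N: "N \<ge> 1"
  shows "(\<integral>\<^sup>+\<omega>. ennreal (exp (\<bar>\<Sum>j<N. g (X j \<omega>) - (\<integral>x. g x \<partial>\<mu>)\<bar> / (c * sqrt N))) \<partial>M) \<le> 4"
proof -
  have rv [measurable]: "X j \<in> M \<rightarrow>\<^sub>M borel" if "j < N" for j
    using X that by (auto simp: indep_vars_def)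
  let ?S = "\<lambda>\<omega>. (\<Sum>j<N. g (X j \<omega>) - (\<integral>x. g x \<partial>\<mu>)) / (c * sqrt N)"
  have S [measurable]: "?S \<in> borel_measurable M"
    by (intro borel_measurable_divide borel_measurable_sum borel_measurable_diff measurable_compose[OF rv g]) auto
  have neg: "(\<Sum>j<N. - g (X j \<omega>) - (\<integral>x. - g x \<partial>\<mu>)) / (c * sqrt N) = - ?S \<omega>" for \<omega>
    by (simp add: sum_subtractf sum_negf diff_divide_distrib)
  have "(\<integral>\<^sup>+\<omega>. ennreal (exp (\<bar>\<Sum>j<N. g (X j \<omega>) - (\<integral>x. g x \<partial>\<mu>)\<bar> / (c * sqrt N))) \<partial>M)
      \<le> (\<integral>\<^sup>+\<omega>. ennreal (exp (?S \<omega>)) + ennreal (exp (- ?S \<omega>)) \<partial>M)"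
  proof (intro nn_integral_mono)
    fix \<omega>
    have "\<bar>\<Sum>j<N. g (X j \<omega>) - (\<integral>x. g x \<partial>\<mu>)\<bar> / (c * sqrt N) = \<bar>?S \<omega>\<bar>"
      using c N by (simp only: abs_divide) (simp add: abs_mult)
    moreover have "exp \<bar>z\<bar> \<le> exp z + exp (- z)" for z :: real
      by (cases "z \<ge> 0") auto
    ultimately have "exp (\<bar>\<Sum>j<N. g (X j \<omega>) - (\<integral>x. g x \<partial>\<mu>)\<bar> / (c * sqrt N)) \<le> exp (?S \<omega>) + exp (- ?S \<omega>)"
      by metis
    from ennreal_leI[OF this] show "ennreal (exp (\<bar>\<Sum>j<N. g (X j \<omega>) - (\<integral>x. g x \<partial>\<mu>)\<bar> / (c * sqrt N)))
        \<le> ennreal (exp (?S \<omega>)) + ennreal (exp (- ?S \<omega>))"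
      by (subst (asm) ennreal_plus) auto
  qed
  also have "\<dots> = (\<integral>\<^sup>+\<omega>. ennreal (exp (?S \<omega>)) \<partial>M) + (\<integral>\<^sup>+\<omega>. ennreal (exp (- ?S \<omega>)) \<partial>M)"
    by (rule nn_integral_add) measurable
  also have "\<dots> \<le> 2 + 2"
    using exp_moment_centered_sum[OF X law g c N] exp_moment_centered_sum[OF X law _ c(1) _ N, of "\<lambda>x. - g x"] c(2)
    unfolding neg by (intro add_mono) auto
  finally show ?thesis by simp
qed

definition rnd :: "nat \<Rightarrow> 'a::euclidean_space \<Rightarrow> 'a" where
  "rnd l \<theta> = (\<Sum>b\<in>Basis. (real_of_int \<lfloor>2 ^ l * (\<theta> \<bullet> b)\<rfloor> / 2 ^ l) *\<^sub>R b)"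

lemma rnd_inner: "b \<in> Basis \<Longrightarrow> rnd l \<theta> \<bullet> b = real_of_int \<lfloor>2 ^ l * (\<theta> \<bullet> b)\<rfloor> / 2 ^ l"
  unfolding rnd_def by simp

lemma rnd_bounds:
  assumes "b \<in> Basis"
  shows "rnd l \<theta> \<bullet> b \<le> \<theta> \<bullet> b" "\<theta> \<bullet> b \<le> rnd l \<theta> \<bullet> b + (1/2) ^ l"
proof -
  have "real_of_int \<lfloor>2 ^ l * (\<theta> \<bullet> b)\<rfloor> \<le> 2 ^ l * (\<theta> \<bullet> b)" "2 ^ l * (\<theta> \<bullet> b) \<le> real_of_int \<lfloor>2 ^ l * (\<theta> \<bullet> b)\<rfloor> + 1"
    by linarith+
  then show "rnd l \<theta> \<bullet> b \<le> \<theta> \<bullet> b" "\<theta> \<bullet> b \<le> rnd l \<theta> \<bullet> b + (1/2) ^ l"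
    unfolding rnd_inner[OF assms] by (simp_all add: field_simps power_one_over)
qed

lemma rnd_floor_bounds:
  fixes x :: real
  assumes "-1 \<le> x" "x \<le> 1"
  shows "- (2 ^ l) \<le> \<lfloor>2 ^ l * x\<rfloor>" "\<lfloor>2 ^ l * x\<rfloor> \<le> 2 ^ l"
proof -
  have "2 ^ l * (-1) \<le> 2 ^ l * x" using assms by (intro mult_left_mono) auto
  then show "- (2 ^ l) \<le> \<lfloor>2 ^ l * x\<rfloor>" by (simp add: le_floor_iff)
  have "2 ^ l * x \<le> 2 ^ l * 1" using assms by (intro mult_left_mono) auto
  then have "\<lfloor>2 ^ l * x\<rfloor> \<le> \<lfloor>(2 ^ l :: real)\<rfloor>" by (intro floor_mono) simp
  then show "\<lfloor>2 ^ l * x\<rfloor> \<le> 2 ^ l" by simp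
qed

lemma rnd_in_box:
  assumes "\<theta> \<in> cbox (- One) One"
  shows "rnd l \<theta> \<in> cbox (- One) One"
  unfolding mem_box
proof
  fix b :: 'a assume b: "b \<in> Basis"
  have x: "- 1 \<le> \<theta> \<bullet> b" "\<theta> \<bullet> b \<le> 1" using assms b by (auto simp: mem_box)
  have "real_of_int (- (2 ^ l)) \<le> real_of_int \<lfloor>2 ^ l * (\<theta> \<bullet> b)\<rfloor>" "real_of_int \<lfloor>2 ^ l * (\<theta> \<bullet> b)\<rfloor> \<le> real_of_int (2 ^ l)"
    using rnd_floor_bounds[OF x, of l] by (simp_all only: of_int_le_iff)
  then show "- One \<bullet> b \<le> rnd l \<theta> \<bullet> b \<and> rnd l \<theta> \<bullet> b \<le> One \<bullet> b"
    using b by (simp add: rnd_inner field_simps)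
qed

text \<open>Roundings are nested, so the point at level \<open>l\<close> is a function of the point
  at level \<open>Suc l\<close>. The increments of the chain are therefore indexed by one grid
  instead of by pairs of grid points.\<close>

lemma rnd_rnd: "rnd l (rnd (Suc l) \<theta>) = rnd l \<theta>"
proof -
  have "\<lfloor>2 ^ l * (rnd (Suc l) \<theta> \<bullet> b)\<rfloor> = \<lfloor>2 ^ l * (\<theta> \<bullet> b)\<rfloor>" if b: "b \<in> Basis" for b
  proof -
    let ?y = "2 ^ l * (\<theta> \<bullet> b)"
    have a: "2 ^ l * (rnd (Suc l) \<theta> \<bullet> b) = real_of_int \<lfloor>2 * ?y\<rfloor> / 2"
      by (simp add: rnd_inner[OF b] mult.assoc)
    have "\<lfloor>real_of_int \<lfloor>2 * ?y\<rfloor> / 2\<rfloor> = \<lfloor>?y\<rfloor>"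
    proof (rule floor_unique)
      have "2 * \<lfloor>?y\<rfloor> \<le> \<lfloor>2 * ?y\<rfloor>" by (simp add: le_floor_iff)
      then show "real_of_int \<lfloor>?y\<rfloor> \<le> real_of_int \<lfloor>2 * ?y\<rfloor> / 2" by linarith
      show "real_of_int \<lfloor>2 * ?y\<rfloor> / 2 < real_of_int \<lfloor>?y\<rfloor> + 1" by linarith
    qed
    then show ?thesis by (simp only: a)
  qed
  then show ?thesis unfolding rnd_def[of l] by simp
qed

lemma norm_rnd: "norm (\<theta> - rnd l \<theta>) \<le> real DIM('a) * (1/2) ^ l" for \<theta> :: "'a::euclidean_space"
proof -
  have "norm (\<theta> - rnd l \<theta>) \<le> (\<Sum>b\<in>Basis. \<bar>(\<theta> - rnd l \<theta>) \<bullet> b\<bar>)" by (rule norm_le_l1)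
  also have "\<dots> \<le> (\<Sum>b\<in>(Basis :: 'a set). (1/2) ^ l)"
    using rnd_bounds[where l = l and \<theta> = \<theta>] by (intro sum_mono) (auto simp: inner_diff_left abs_le_iff algebra_simps)
  finally show ?thesis by simp
qed

definition rnd_grid :: "nat \<Rightarrow> 'a::euclidean_space set" where
  "rnd_grid l = rnd l ` cbox (- One) One"

lemma rnd_grid:
  shows finite_rnd_grid: "finite (rnd_grid l :: 'a::euclidean_space set)"
    and card_rnd_grid: "real (card (rnd_grid l :: 'a set)) \<le> exp (real DIM('a) * (real l + 2))"
proof -
  let ?P = "(Basis :: 'a set) \<rightarrow>\<^sub>E {- (2 ^ l)..(2 ^ l :: int)}"
  let ?f = "\<lambda>f. \<Sum>b\<in>(Basis :: 'a set). (real_of_int (f b) / 2 ^ l) *\<^sub>R b"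
  have sub: "rnd_grid l \<subseteq> ?f ` ?P"
  proof
    fix p :: 'a assume "p \<in> rnd_grid l"
    then obtain \<theta> where \<theta>: "\<theta> \<in> cbox (- One) One" "p = rnd l \<theta>" by (auto simp: rnd_grid_def)
    have "(\<lambda>b\<in>Basis. \<lfloor>2 ^ l * (\<theta> \<bullet> b)\<rfloor>) \<in> ?P"
      using \<theta>(1) by (auto simp: mem_box intro!: rnd_floor_bounds)
    moreover have "p = ?f (\<lambda>b\<in>Basis. \<lfloor>2 ^ l * (\<theta> \<bullet> b)\<rfloor>)"
      unfolding \<theta>(2) rnd_def by (intro sum.cong) auto
    ultimately show "p \<in> ?f ` ?P" by blast
  qed
  have fP: "finite ?P" by (intro finite_PiE) auto
  show "finite (rnd_grid l :: 'a set)" using sub fP finite_surj by blast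
  have "card (rnd_grid l :: 'a set) \<le> card ?P" using sub fP by (rule surj_card_le[rotated])
  also have "card ?P = (card {- (2 ^ l)..(2 ^ l :: int)}) ^ DIM('a)" by (simp add: card_PiE)
  finally have "real (card (rnd_grid l :: 'a set)) \<le> real (card {- (2 ^ l)..(2 ^ l :: int)}) ^ DIM('a)"
    by (metis of_nat_le_iff of_nat_power)
  also have "\<dots> \<le> exp (real l + 2) ^ DIM('a)"
  proof (rule power_mono)
    have e2: "2 \<le> exp (1 :: real)" using exp_ge_add_one_self[of 1] by simp
    have "real (card {- (2 ^ l)..(2 ^ l :: int)}) = 2 * 2 ^ l + 1" by simp
    also have "\<dots> \<le> (2 :: real) ^ (l + 2)"
    proof -
      have "1 \<le> (2 :: real) ^ l" by simp
      moreover have "(2 :: real) ^ (l + 2) = 4 * 2 ^ l" by (simp add: power_add)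
      ultimately show ?thesis by linarith
    qed
    also have "\<dots> \<le> exp 1 ^ (l + 2)" using e2 by (intro power_mono) auto
    also have "\<dots> = exp (real l + 2)"
      using exp_of_nat_mult[of "l + 2" "1 :: real"] by (simp only: of_nat_add of_nat_numeral mult_1_right)
    finally show "real (card {- (2 ^ l)..(2 ^ l :: int)}) \<le> exp (real l + 2)" .
  qed simp
  also have "\<dots> = exp (real DIM('a) * (real l + 2))" by (simp flip: exp_of_nat_mult)
  finally show "real (card (rnd_grid l :: 'a set)) \<le> exp (real DIM('a) * (real l + 2))" .
qed

lemma le_exp_tilt:
  fixes y \<sigma> s :: real
  assumes "\<sigma> > 0"
  shows "\<bar>y\<bar> \<le> \<sigma> * (s + exp (- s) * exp (\<bar>y\<bar> / \<sigma>))"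
proof -
  have "\<bar>y\<bar> / \<sigma> - s \<le> exp (\<bar>y\<bar> / \<sigma> - s)" using exp_ge_add_one_self[of "\<bar>y\<bar> / \<sigma> - s"] by linarith
  also have "\<dots> = exp (- s) * exp (\<bar>y\<bar> / \<sigma>)" by (simp add: exp_diff exp_minus field_simps)
  finally show ?thesis using assms by (simp add: field_simps)
qed

text \<open>The maximum of finitely many centered sums over a grid is bounded through
  \<open>t \<le> s + exp (t - s)\<close>, with \<open>s\<close> the logarithm of the number of grid points.\<close>

lemma (in prob_space) grid_maximum:
  fixes X :: "nat \<Rightarrow> 'a \<Rightarrow> 'b::topological_space" and g :: "'c \<Rightarrow> 'b \<Rightarrow> real"
  assumes X: "indep_vars (\<lambda>_. borel) X {..<N}" and law: "\<And>j. j < N \<Longrightarrow> distr M borel (X j) = \<mu>"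
    and g: "\<And>p. p \<in> P \<Longrightarrow> g p \<in> borel_measurable borel" and c: "c > 0" "\<And>p x. p \<in> P \<Longrightarrow> \<bar>g p x\<bar> \<le> c" and N: "N \<ge> 1"
    and P: "finite P" "real (card P) \<le> exp s" and s: "s \<ge> 0"
  shows "\<exists>T. T \<in> borel_measurable M \<and> (\<integral>\<^sup>+\<omega>. ennreal (T \<omega>) \<partial>M) \<le> ennreal (c * sqrt N * (s + 4)) \<and> (\<forall>\<omega>. 0 \<le> T \<omega>) \<and>
    (\<forall>p\<in>P. \<forall>\<omega>. \<bar>\<Sum>j<N. g p (X j \<omega>) - (\<integral>x. g p x \<partial>\<mu>)\<bar> \<le> T \<omega>)"
proof (intro exI conjI allI ballI)
  let ?\<sigma> = "c * sqrt N"
  let ?S = "\<lambda>p \<omega>. \<Sum>j<N. g p (X j \<omega>) - (\<integral>x. g p x \<partial>\<mu>)"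
  \<comment> \<open>The sum over \<open>P\<close> majorises each of its terms, so a single
    measurable \<open>T\<close> bounds all centered sums at once.\<close>
  let ?T = "\<lambda>\<omega>. ?\<sigma> * (s + exp (- s) * (\<Sum>p\<in>P. exp (\<bar>?S p \<omega>\<bar> / ?\<sigma>)))"
  have \<sigma>: "?\<sigma> > 0" using c N by simp
  have rv [measurable]: "X j \<in> M \<rightarrow>\<^sub>M borel" if "j < N" for j
    using X that by (auto simp: indep_vars_def)
  have mS: "?S p \<in> borel_measurable M" if "p \<in> P" for p
    by (intro borel_measurable_sum borel_measurable_diff measurable_compose[OF rv g[OF that]]) auto
  have mE: "(\<lambda>\<omega>. exp (\<bar>?S p \<omega>\<bar> / ?\<sigma>)) \<in> borel_measurable M" if "p \<in> P" for p
    using mS[OF that] by measurable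
  have m1: "(\<lambda>\<omega>. \<Sum>p\<in>P. exp (\<bar>?S p \<omega>\<bar> / ?\<sigma>)) \<in> borel_measurable M"
    by (rule borel_measurable_sum[OF mE])
  then show "?T \<in> borel_measurable M" by measurable
  show "0 \<le> ?T \<omega>" for \<omega>
    using c(1) s by (intro mult_nonneg_nonneg add_nonneg_nonneg sum_nonneg) auto
  show "\<bar>?S p \<omega>\<bar> \<le> ?T \<omega>" if "p \<in> P" for p \<omega>
  proof -
    have "\<bar>?S p \<omega>\<bar> \<le> ?\<sigma> * (s + exp (- s) * exp (\<bar>?S p \<omega>\<bar> / ?\<sigma>))" by (rule le_exp_tilt[OF \<sigma>])
    also have "\<dots> \<le> ?T \<omega>"
      using \<sigma> that P by (intro mult_left_mono add_left_mono member_le_sum) auto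
    finally show ?thesis .
  qed
  have "(\<integral>\<^sup>+\<omega>. ennreal (?T \<omega>) \<partial>M) = (\<integral>\<^sup>+\<omega>. ennreal (?\<sigma> * s) + ennreal (?\<sigma> * exp (- s)) * (\<Sum>p\<in>P. ennreal (exp (\<bar>?S p \<omega>\<bar> / ?\<sigma>))) \<partial>M)"
  proof (intro nn_integral_cong)
    fix \<omega>
    have "?T \<omega> = ?\<sigma> * s + (?\<sigma> * exp (- s)) * (\<Sum>p\<in>P. exp (\<bar>?S p \<omega>\<bar> / ?\<sigma>))" by (simp add: algebra_simps)
    also have "ennreal \<dots> = ennreal (?\<sigma> * s) + ennreal ((?\<sigma> * exp (- s)) * (\<Sum>p\<in>P. exp (\<bar>?S p \<omega>\<bar> / ?\<sigma>)))"
      using c(1) s by (intro ennreal_plus) (auto intro!: mult_nonneg_nonneg sum_nonneg)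
    also have "ennreal ((?\<sigma> * exp (- s)) * (\<Sum>p\<in>P. exp (\<bar>?S p \<omega>\<bar> / ?\<sigma>))) = ennreal (?\<sigma> * exp (- s)) * (\<Sum>p\<in>P. ennreal (exp (\<bar>?S p \<omega>\<bar> / ?\<sigma>)))"
      using \<sigma> by (subst ennreal_mult) (auto simp: sum_nonneg sum_ennreal)
    finally show "ennreal (?T \<omega>) = ennreal (?\<sigma> * s) + ennreal (?\<sigma> * exp (- s)) * (\<Sum>p\<in>P. ennreal (exp (\<bar>?S p \<omega>\<bar> / ?\<sigma>)))" .
  qed
  also have "\<dots> = ennreal (?\<sigma> * s) + ennreal (?\<sigma> * exp (- s)) * (\<Sum>p\<in>P. \<integral>\<^sup>+\<omega>. ennreal (exp (\<bar>?S p \<omega>\<bar> / ?\<sigma>)) \<partial>M)"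
  proof -
    define E where "E p \<omega> = ennreal (exp (\<bar>?S p \<omega>\<bar> / ?\<sigma>))" for p \<omega>
    have E: "E p \<in> borel_measurable M" if "p \<in> P" for p
      unfolding E_def by (rule measurable_compose[OF mE[OF that] measurable_ennreal])
    have E': "(\<lambda>\<omega>. \<Sum>p\<in>P. E p \<omega>) \<in> borel_measurable M"
      by (rule borel_measurable_sum[OF E])
    have "(\<integral>\<^sup>+\<omega>. a + b * (\<Sum>p\<in>P. E p \<omega>) \<partial>M) = a + b * (\<Sum>p\<in>P. \<integral>\<^sup>+\<omega>. E p \<omega> \<partial>M)" for a b
      using E' E by (simp add: nn_integral_add nn_integral_cmult nn_integral_sum emeasure_space_1)
    then show ?thesis unfolding E_def by this
  qed
  also have "\<dots> \<le> ennreal (?\<sigma> * s) + ennreal (?\<sigma> * exp (- s)) * (\<Sum>p\<in>P. ennreal 4)"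
    using exp_abs_moment_centered_sum[OF X law g c(1) c(2) N]
    by (intro add_left_mono mult_left_mono sum_mono) auto
  also have "\<dots> = ennreal (?\<sigma> * s + ?\<sigma> * exp (- s) * (real (card P) * 4))"
  proof -
    have "(\<Sum>p\<in>P. ennreal 4) = ennreal (\<Sum>p\<in>P. 4)" by (rule sum_ennreal) simp
    then have "(\<Sum>p\<in>P. ennreal 4) = ennreal (real (card P) * 4)" by simp
    then show ?thesis
      using \<sigma> s by (simp only: ennreal_mult[symmetric] ennreal_plus[symmetric] mult_nonneg_nonneg exp_ge_zero less_imp_le of_nat_0_le_iff zero_le_numeral)
  qed
  also have "\<dots> \<le> ennreal (?\<sigma> * (s + 4))"
  proof (rule ennreal_leI)
    \<comment> \<open>The factor \<open>exp (- s)\<close> cancels the number of grid points; the 4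
      that remains is the bound of \<open>exp_abs_moment_centered_sum\<close>.\<close>
    have "exp (- s) * real (card P) \<le> exp (- s) * exp s" using P by (intro mult_left_mono) auto
    then have "?\<sigma> * (exp (- s) * real (card P)) \<le> ?\<sigma> * 1" using \<sigma> by (intro mult_left_mono) (auto simp: exp_minus)
    then show "?\<sigma> * s + ?\<sigma> * exp (- s) * (real (card P) * 4) \<le> ?\<sigma> * (s + 4)" by (simp add: algebra_simps)
  qed
  finally show "(\<integral>\<^sup>+\<omega>. ennreal (?T \<omega>) \<partial>M) \<le> ennreal (?\<sigma> * (s + 4))" .
qed

text \<open>The first bracket is the contribution of the coarsest grid, the second that of all
  increments, summed in \<open>chain_sum\<close>.\<close>

definition chain_const :: "nat \<Rightarrow> real" where
  "chain_const D = (2 * real D + 4) + real D * (9 * real D + 12)"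

text \<open>By Bernoulli's inequality the linear growth is below a multiple of (4/3)^l, which leaves
  a geometric series with ratio 2/3 and sum 3.\<close>

lemma chain_sum:
  fixes D :: real
  assumes "D \<ge> 0"
  shows "summable (\<lambda>l. (1/2) ^ l * (D * (real l + 3) + 4))"
    and "(\<Sum>l. (1/2) ^ l * (D * (real l + 3) + 4)) \<le> 9 * D + 12"
proof -
  have le: "(1/2) ^ l * (D * (real l + 3) + 4) \<le> (3 * D + 4) * (2/3) ^ l" for l
  proof -
    have b: "1 + real l * (1/3) \<le> (1 + 1/3 :: real) ^ l" by (rule Bernoulli_inequality) simp
    have "1 * 1 \<le> (1 + 1/3 :: real) ^ l" by (simp add: one_le_power)
    then have "D * (real l + 3) + 4 \<le> D * (3 * (4/3) ^ l) + 4 * (4/3) ^ l"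
      using assms b by (intro add_mono mult_left_mono) auto
    then have "(1/2) ^ l * (D * (real l + 3) + 4) \<le> (1/2) ^ l * ((3 * D + 4) * (4/3) ^ l)"
      by (intro mult_left_mono) (auto simp: algebra_simps)
    also have "\<dots> = (3 * D + 4) * ((1/2) ^ l * (4/3) ^ l)" by simp
    also have "(1/2) ^ l * (4/3) ^ l = (2/3 :: real) ^ l" by (simp flip: power_mult_distrib)
    finally show ?thesis .
  qed
  have s: "summable (\<lambda>l. (3 * D + 4) * (2/3) ^ l)" by (intro summable_mult summable_geometric) simp
  show *: "summable (\<lambda>l. (1/2) ^ l * (D * (real l + 3) + 4))"
    by (rule summable_comparison_test'[OF s, of 0]) (use le assms in auto)
  have "(\<Sum>l. (1/2) ^ l * (D * (real l + 3) + 4)) \<le> (\<Sum>l. (3 * D + 4) * (2/3) ^ l)"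
    by (rule suminf_le[OF le * s])
  also have "\<dots> = (3 * D + 4) * 3" by (subst suminf_mult) (auto simp: suminf_geometric intro: summable_geometric)
  finally show "(\<Sum>l. (1/2) ^ l * (D * (real l + 3) + 4)) \<le> 9 * D + 12" by simp
qed

text \<open>Chaining: successive dyadic roundings of the parameter give increments of geometrically
  decreasing size, which outweighs the growth of the grids.\<close>

lemma (in prob_space) uniform_deviation:
  fixes X :: "nat \<Rightarrow> 'a \<Rightarrow> 'b::topological_space" and h :: "'c::euclidean_space \<Rightarrow> 'b \<Rightarrow> real"
  assumes X: "indep_vars (\<lambda>_. borel) X {..<N}" and law: "\<And>j. j < N \<Longrightarrow> distr M borel (X j) = \<mu>" and N: "N \<ge> 1"
    and h: "\<And>\<theta>. \<theta> \<in> cbox (- One) One \<Longrightarrow> h \<theta> \<in> borel_measurable borel"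
    and K: "K > 0" "\<And>\<theta> x. \<theta> \<in> cbox (- One) One \<Longrightarrow> \<bar>h \<theta> x\<bar> \<le> K"
    and L: "\<And>\<theta> \<theta>' x. \<theta> \<in> cbox (- One) One \<Longrightarrow> \<theta>' \<in> cbox (- One) One \<Longrightarrow> \<bar>h \<theta> x - h \<theta>' x\<bar> \<le> K * norm (\<theta> - \<theta>')"
  obtains G where "G \<in> borel_measurable M" "(\<integral>\<^sup>+\<omega>. G \<omega> \<partial>M) \<le> ennreal (chain_const DIM('c) * K / sqrt N)"
    "\<And>\<theta> \<omega>. \<theta> \<in> cbox (- One) One \<Longrightarrow> ennreal \<bar>(\<Sum>j<N. h \<theta> (X j \<omega>)) / real N - (\<integral>x. h \<theta> x \<partial>\<mu>)\<bar> \<le> G \<omega>"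
proof -
  let ?D = "real DIM('c)" and ?C = "cbox (- One) One :: 'c set"
  have D: "?D \<ge> 1" using DIM_positive[where 'a='c] by linarith
  interpret \<mu>: prob_space \<mu>
    using X law[of 0] N prob_space_distr[of "X 0" borel] by (auto simp: indep_vars_def)
  have sets\<mu>: "sets \<mu> = sets borel" using law[of 0] N by auto
  have grid: "p \<in> ?C" if "p \<in> rnd_grid l" for p l
    using that rnd_in_box by (auto simp: rnd_grid_def)
  let ?S = "\<lambda>g \<omega>. \<Sum>j<N. g (X j \<omega>) - (\<integral>x. g x \<partial>\<mu>)"
  \<comment> \<open>Parameters for the increments from level \<open>l\<close> to level
    \<open>Suc l\<close>: the Lipschitz constant times the rounding error bounds their size, and
    \<open>?s l\<close> bounds the logarithm of the number of grid points at level
    \<open>Suc l\<close>.\<close>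
  let ?c = "\<lambda>l. K * (?D * (1/2) ^ l)"
  let ?s = "\<lambda>l. ?D * (real l + 3)"
  let ?g = "\<lambda>l p x. h p x - h (rnd l p) x"
  have "\<exists>T. T \<in> borel_measurable M \<and> (\<integral>\<^sup>+\<omega>. ennreal (T \<omega>) \<partial>M) \<le> ennreal (K * sqrt N * (2 * ?D + 4)) \<and> (\<forall>\<omega>. 0 \<le> T \<omega>)
      \<and> (\<forall>p\<in>rnd_grid 0. \<forall>\<omega>. \<bar>?S (h p) \<omega>\<bar> \<le> T \<omega>)"
  proof -
    have "real (card (rnd_grid 0 :: 'c set)) \<le> exp (2 * ?D)"
      using card_rnd_grid[of 0, where 'a='c] by (simp add: mult.commute)
    then show ?thesis
      by (intro grid_maximum X law h grid K N finite_rnd_grid) (use D in auto)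
  qed
  then obtain T0 where T0: "T0 \<in> borel_measurable M" "(\<integral>\<^sup>+\<omega>. ennreal (T0 \<omega>) \<partial>M) \<le> ennreal (K * sqrt N * (2 * ?D + 4))"
    "\<And>\<omega>. 0 \<le> T0 \<omega>" "\<And>p \<omega>. p \<in> rnd_grid 0 \<Longrightarrow> \<bar>?S (h p) \<omega>\<bar> \<le> T0 \<omega>" by blast
  have "\<exists>T. T \<in> borel_measurable M \<and> (\<integral>\<^sup>+\<omega>. ennreal (T \<omega>) \<partial>M) \<le> ennreal (?c l * sqrt N * (?s l + 4)) \<and> (\<forall>\<omega>. 0 \<le> T \<omega>)
      \<and> (\<forall>p\<in>rnd_grid (Suc l). \<forall>\<omega>. \<bar>?S (?g l p) \<omega>\<bar> \<le> T \<omega>)" for l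
  proof -
    have card: "real (card (rnd_grid (Suc l) :: 'c set)) \<le> exp (?s l)"
      using card_rnd_grid[of "Suc l", where 'a='c] by (simp add: algebra_simps)
    have m: "?g l p \<in> borel_measurable borel" if "p \<in> rnd_grid (Suc l)" for p
      using h[OF grid[OF that]] h[OF rnd_in_box[OF grid[OF that]]] by (intro borel_measurable_diff)
    have b: "\<bar>?g l p x\<bar> \<le> ?c l" if "p \<in> rnd_grid (Suc l)" for p x
      by (rule order_trans[OF L[OF grid[OF that] rnd_in_box[OF grid[OF that]]] mult_left_mono[OF norm_rnd]]) (use K in simp)
    have c: "?c l > 0" using D K by simp
    have s: "?s l \<ge> 0" using D by simp
    show ?thesis
      by (rule grid_maximum[OF X]) (fact law m c b N finite_rnd_grid card s)+
  qed
  note level = this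
  obtain T where T: "\<And>l. T l \<in> borel_measurable M" "\<And>l. (\<integral>\<^sup>+\<omega>. ennreal (T l \<omega>) \<partial>M) \<le> ennreal (?c l * sqrt N * (?s l + 4))"
    "\<And>l \<omega>. 0 \<le> T l \<omega>" "\<And>l p \<omega>. p \<in> rnd_grid (Suc l) \<Longrightarrow> \<bar>?S (?g l p) \<omega>\<bar> \<le> T l \<omega>"
  proof -
    from level have "\<exists>T. \<forall>l. T l \<in> borel_measurable M \<and> (\<integral>\<^sup>+\<omega>. ennreal (T l \<omega>) \<partial>M) \<le> ennreal (?c l * sqrt N * (?s l + 4)) \<and> (\<forall>\<omega>. 0 \<le> T l \<omega>)
      \<and> (\<forall>p\<in>rnd_grid (Suc l). \<forall>\<omega>. \<bar>?S (?g l p) \<omega>\<bar> \<le> T l \<omega>)"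
      by (intro choice allI)
    then show ?thesis using that by blast
  qed
  \<comment> \<open>\<open>G\<close> takes extended values because the series of level bounds may
    diverge at individual outcomes; only its integral is known to be finite.\<close>
  define G where "G \<omega> = ennreal (1 / N) * (ennreal (T0 \<omega>) + (\<Sum>l. ennreal (T l \<omega>)))" for \<omega>
  have mT0: "(\<lambda>\<omega>. ennreal (T0 \<omega>)) \<in> borel_measurable M" and mT: "\<And>l. (\<lambda>\<omega>. ennreal (T l \<omega>)) \<in> borel_measurable M"
    using T0(1) T(1) by measurable
  have mTs: "(\<lambda>\<omega>. \<Sum>l. ennreal (T l \<omega>)) \<in> borel_measurable M"
    using mT by measurable
  have "G \<in> borel_measurable M" unfolding G_def using mT0 mTs by measurable
  moreover have "(\<integral>\<^sup>+\<omega>. G \<omega> \<partial>M) \<le> ennreal (chain_const DIM('c) * K / sqrt N)"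
  proof -
    have "(\<integral>\<^sup>+\<omega>. G \<omega> \<partial>M) = ennreal (1 / N) * ((\<integral>\<^sup>+\<omega>. ennreal (T0 \<omega>) \<partial>M) + (\<Sum>l. \<integral>\<^sup>+\<omega>. ennreal (T l \<omega>) \<partial>M))"
      unfolding G_def using mT0 mTs mT
      by (subst nn_integral_cmult, measurable, subst nn_integral_add, measurable, subst nn_integral_suminf, measurable)
    also have "\<dots> \<le> ennreal (1 / N) * (ennreal (K * sqrt N * (2 * ?D + 4)) + (\<Sum>l. ennreal (?c l * sqrt N * (?s l + 4))))"
      using T0(2) T(2) by (intro mult_left_mono add_mono suminf_le) auto
    also have "(\<Sum>l. ennreal (?c l * sqrt N * (?s l + 4))) = ennreal (\<Sum>l. ?c l * sqrt N * (?s l + 4))"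
    proof (rule suminf_ennreal2)
      show "0 \<le> ?c l * sqrt N * (?s l + 4)" for l using K D by simp
      show "summable (\<lambda>l. ?c l * sqrt N * (?s l + 4))"
        using summable_mult[OF chain_sum(1)[of ?D], of "K * ?D * sqrt N"] D by (simp add: mult_ac)
    qed
    also have "(\<Sum>l. ?c l * sqrt N * (?s l + 4)) = K * ?D * sqrt N * (\<Sum>l. (1/2) ^ l * (?D * (real l + 3) + 4))"
      using suminf_mult[OF chain_sum(1)[of ?D], of "K * ?D * sqrt N"] D by (simp add: mult_ac)
    also have "ennreal (1 / N) * (ennreal (K * sqrt N * (2 * ?D + 4)) + ennreal (K * ?D * sqrt N * (\<Sum>l. (1/2) ^ l * (?D * (real l + 3) + 4))))
       \<le> ennreal (1 / N) * (ennreal (K * sqrt N * (2 * ?D + 4)) + ennreal (K * ?D * sqrt N * (9 * ?D + 12)))"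
      using K D chain_sum(2)[of ?D] by (intro mult_left_mono add_left_mono ennreal_leI) auto
    also have "\<dots> = ennreal (1 / N * (K * sqrt N * (2 * ?D + 4) + K * ?D * sqrt N * (9 * ?D + 12)))"
      using K D by (subst ennreal_plus[symmetric], simp, simp, subst ennreal_mult[symmetric]) auto
    also have "1 / N * (K * sqrt N * (2 * ?D + 4) + K * ?D * sqrt N * (9 * ?D + 12)) = chain_const DIM('c) * K * (sqrt N / N)"
      by (simp add: chain_const_def algebra_simps add_divide_distrib)
    also have "sqrt N / N = 1 / sqrt N"
    proof -
      have "sqrt N / N = sqrt N / (sqrt N * sqrt N)" by simp
      also have "\<dots> = 1 / sqrt N" using N by (subst divide_divide_eq_left[symmetric]) simp
      finally show ?thesis .
    qed
    finally show ?thesis by simp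
  qed
  moreover have "ennreal \<bar>(\<Sum>j<N. h \<theta> (X j \<omega>)) / real N - (\<integral>x. h \<theta> x \<partial>\<mu>)\<bar> \<le> G \<omega>" if \<theta>: "\<theta> \<in> ?C" for \<theta> \<omega>
  proof -
    have int: "integrable \<mu> (h p)" if "p \<in> ?C" for p
      by (rule \<mu>.integrable_const_bound[where B = K])
        (use K(2)[OF that] h[OF that] in \<open>auto simp: measurable_cong_sets[OF sets\<mu> refl]\<close>)
    have diff: "?S (\<lambda>x. h p x - h q x) \<omega> = ?S (h p) \<omega> - ?S (h q) \<omega>" if "p \<in> ?C" "q \<in> ?C" for p q
      using int[OF that(1)] int[OF that(2)] by (simp add: sum_subtractf) (simp add: right_diff_distrib)
    have finite_level: "\<bar>?S (h (rnd l \<theta>)) \<omega>\<bar> \<le> T0 \<omega> + (\<Sum>i<l. T i \<omega>)" for l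
    proof (induction l)
      case 0
      then show ?case using T0(4)[of "rnd 0 \<theta>" \<omega>] \<theta> by (auto simp: rnd_grid_def)
    next
      case (Suc l)
      have "\<bar>?S (?g l (rnd (Suc l) \<theta>)) \<omega>\<bar> \<le> T l \<omega>"
        using \<theta> by (intro T(4)) (auto simp: rnd_grid_def)
      then have "\<bar>?S (h (rnd (Suc l) \<theta>)) \<omega> - ?S (h (rnd l \<theta>)) \<omega>\<bar> \<le> T l \<omega>"
        using diff[OF rnd_in_box[OF \<theta>, of "Suc l"] rnd_in_box[OF \<theta>, of l]] by (simp only: rnd_rnd)
      moreover have "\<bar>a\<bar> \<le> t0 + (t + t')" if "\<bar>a - b\<bar> \<le> t'" "\<bar>b\<bar> \<le> t0 + t" for a b t0 t t' :: real
        using that by linarith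
      ultimately show ?case using Suc unfolding sum.lessThan_Suc by blast
    qed
    \<comment> \<open>Breaking off the chain at level \<open>l\<close> costs at most
      \<open>2 * ?c l\<close> per sample, which tends to 0; so the grid bounds extend to all
      parameters.\<close>
    have lim: "\<bar>?S (h \<theta>) \<omega>\<bar> \<le> \<bar>?S (h (rnd l \<theta>)) \<omega>\<bar> + 2 * N * ?c l" for l
    proof -
      have Lx: "\<bar>h \<theta> x - h (rnd l \<theta>) x\<bar> \<le> ?c l" for x
        by (rule order_trans[OF L[OF \<theta> rnd_in_box[OF \<theta>]] mult_left_mono[OF norm_rnd]]) (use K in simp)
      have "\<bar>\<integral>x. h \<theta> x - h (rnd l \<theta>) x \<partial>\<mu>\<bar> \<le> (\<integral>x. \<bar>h \<theta> x - h (rnd l \<theta>) x\<bar> \<partial>\<mu>)"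
        by (rule integral_abs_bound)
      also have "\<dots> \<le> (\<integral>x. ?c l \<partial>\<mu>)"
        using Lx int[OF \<theta>] int[OF rnd_in_box[OF \<theta>]] by (intro integral_mono) auto
      finally have Li: "\<bar>\<integral>x. h \<theta> x - h (rnd l \<theta>) x \<partial>\<mu>\<bar> \<le> ?c l" by (simp add: \<mu>.prob_space)
      have "\<bar>?S (\<lambda>x. h \<theta> x - h (rnd l \<theta>) x) \<omega>\<bar> \<le> (\<Sum>j<N. 2 * ?c l)"
      proof (rule order_trans[OF sum_abs], rule sum_mono)
        fix j
        show "\<bar>(h \<theta> (X j \<omega>) - h (rnd l \<theta>) (X j \<omega>)) - (\<integral>x. h \<theta> x - h (rnd l \<theta>) x \<partial>\<mu>)\<bar> \<le> 2 * ?c l"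
          using abs_triangle_ineq4[of "h \<theta> (X j \<omega>) - h (rnd l \<theta>) (X j \<omega>)" "\<integral>x. h \<theta> x - h (rnd l \<theta>) x \<partial>\<mu>"] Lx[of "X j \<omega>"] Li
          by linarith
      qed
      moreover have "(\<Sum>j<N. 2 * ?c l) = 2 * N * ?c l" by simp
      moreover have "\<bar>a\<bar> \<le> \<bar>b\<bar> + t" if "\<bar>a - b\<bar> \<le> t" for a b t :: real using that by linarith
      ultimately show ?thesis unfolding diff[OF \<theta> rnd_in_box[OF \<theta>]] by metis
    qed
    have "ennreal \<bar>?S (h \<theta>) \<omega>\<bar> \<le> ennreal (T0 \<omega>) + (\<Sum>l. ennreal (T l \<omega>)) + ennreal e" if e: "e > 0" for e
    proof -
      have "(\<lambda>l. 2 * N * ?c l) \<longlonglongrightarrow> 2 * N * (K * (?D * 0))"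
        by (intro tendsto_intros LIMSEQ_power_zero) auto
      then have "\<forall>\<^sub>F l in sequentially. 2 * N * ?c l < e" using e by (intro order_tendstoD) auto
      then obtain l where l: "2 * N * ?c l < e" unfolding eventually_sequentially by blast
      have "ennreal \<bar>?S (h \<theta>) \<omega>\<bar> \<le> ennreal (T0 \<omega> + (\<Sum>i<l. T i \<omega>) + e)"
        using lim[of l] finite_level[of l] l by (intro ennreal_leI) linarith
      also have "\<dots> = ennreal (T0 \<omega>) + (\<Sum>i<l. ennreal (T i \<omega>)) + ennreal e"
        using T0(3) T(3) e by (simp add: sum_nonneg sum_ennreal)
      also have "\<dots> \<le> ennreal (T0 \<omega>) + (\<Sum>l. ennreal (T l \<omega>)) + ennreal e"
        by (intro add_mono order_refl sum_le_suminf) auto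
      finally show ?thesis .
    qed
    then have "ennreal \<bar>?S (h \<theta>) \<omega>\<bar> \<le> ennreal (T0 \<omega>) + (\<Sum>l. ennreal (T l \<omega>))"
      by (rule ennreal_le_epsilon[rotated])
    then have "ennreal (1 / N) * ennreal \<bar>?S (h \<theta>) \<omega>\<bar> \<le> G \<omega>"
      unfolding G_def by (rule mult_left_mono) simp
    moreover have "(\<Sum>j<N. h \<theta> (X j \<omega>)) / real N - (\<integral>x. h \<theta> x \<partial>\<mu>) = 1 / N * ?S (h \<theta>) \<omega>"
      using N by (simp add: sum_subtractf field_simps)
    moreover have "ennreal \<bar>1 / N * s\<bar> = ennreal (1 / N) * ennreal \<bar>s\<bar>" for s :: real
      by (simp add: abs_mult ennreal_mult[symmetric])
    ultimately show ?thesis by (simp only:)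
  qed
  ultimately show ?thesis using that by blast
qed

section \<open>Networks\<close>

lemma ReCU_pos_part: "ReCU z = (max 0 z) ^ 3"
  by (simp add: ReCU_def max_def)

text \<open>Away from 0 the function is locally a power or zero. At 0 the difference quotient is
  bounded by a positive power of the increment, because the exponent is at least 2.\<close>

lemma DERIV_pos_part_power:
  fixes z :: real
  shows "((\<lambda>z. (max 0 z) ^ Suc (Suc n)) has_real_derivative real (Suc (Suc n)) * (max 0 z) ^ Suc n) (at z)"
proof -
  consider "z > 0" | "z < 0" | "z = 0" by linarith
  then show ?thesis
  proof cases
    case 1
    have "((\<lambda>z. z ^ Suc (Suc n)) has_real_derivative real (Suc (Suc n)) * z ^ Suc n) (at z)"
      by (rule DERIV_cong[OF DERIV_pow]) simp
    then have "((\<lambda>z. (max 0 z) ^ Suc (Suc n)) has_real_derivative real (Suc (Suc n)) * z ^ Suc n) (at z)"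
      by (rule has_field_derivative_transform_within_open[where S = "{0<..}"]) (use 1 in auto)
    then show ?thesis using 1 by simp
  next
    case 2
    have "((\<lambda>z. 0) has_real_derivative 0) (at z)" by simp
    then have "((\<lambda>z. (max 0 z) ^ Suc (Suc n)) has_real_derivative 0) (at z)"
      by (rule has_field_derivative_transform_within_open[where S = "{..<0}"]) (use 2 in auto)
    then show ?thesis using 2 by simp
  next
    case 3
    have "((\<lambda>h. (max 0 (0 + h)) ^ Suc (Suc n) / h) \<longlongrightarrow> 0) (at (0 :: real))"
    proof (rule Lim_null_comparison)
      show "\<forall>\<^sub>F h in at (0 :: real). norm ((max 0 (0 + h)) ^ Suc (Suc n) / h) \<le> \<bar>h\<bar> ^ Suc n"
        by (rule always_eventually) (auto simp: max_def abs_mult power_abs field_simps intro!: mult_nonpos_nonneg)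
      show "((\<lambda>h. \<bar>h\<bar> ^ Suc n) \<longlongrightarrow> 0) (at (0 :: real))"
        by (rule tendsto_eq_intros tendsto_ident_at refl | simp)+
    qed
    then show ?thesis using 3 unfolding DERIV_def by simp
  qed
qed

lemma DERIV_ReCU: "(ReCU has_real_derivative 3 * (max 0 z)\<^sup>2) (at z)"
  using DERIV_pos_part_power[of 1 z] by (simp add: ReCU_pos_part[abs_def] numeral_3_eq_3 numeral_2_eq_2)

lemma DERIV_ReCU': "((\<lambda>z. 3 * (max 0 z)\<^sup>2) has_real_derivative 6 * max 0 z) (at z)"
  using DERIV_cmult[OF DERIV_pos_part_power[of 0 z], of 3] by (simp add: numeral_2_eq_2)

definition act_jet :: "real^'d \<Rightarrow> real \<Rightarrow> real^'d \<Rightarrow> 'd jet" where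
  "act_jet = ridge_jet ReCU (\<lambda>z. 3 * (max 0 z)\<^sup>2) (\<lambda>z. 6 * max 0 z)"

lemma C2_act_jet: "C2_jet (act_jet w b)"
  unfolding act_jet_def
  by (intro C2_ridge DERIV_ReCU DERIV_ReCU' continuous_intros)

lemma norm_cube_le:
  assumes "x \<in> cube"
  shows "norm (x :: real^'d) \<le> real CARD('d)"
proof -
  have "norm x \<le> (\<Sum>i\<in>UNIV. \<bar>x $ i\<bar>)" by (rule norm_le_l1_cart)
  also have "\<dots> \<le> (\<Sum>i\<in>(UNIV :: 'd set). 1)" using assms by (intro sum_mono) (simp add: mem_cube)
  finally show ?thesis by simp
qed

text \<open>On the cube the norm of \<open>x\<close> is at most \<open>d\<close>, so the argument of
  the activation is at most \<open>d + 1\<close>; the summands bound the activation and its first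
  two derivatives there.\<close>

definition act_bound :: "nat \<Rightarrow> real" where
  "act_bound d = (real d + 1) ^ 3 + 3 * (real d + 1)\<^sup>2 + 6 * (real d + 1)"

lemma act_bound_pos: "0 < act_bound d"
  unfolding act_bound_def by (intro add_nonneg_pos) auto

lemma norm_act_jet:
  fixes w :: "real^'d"
  assumes "norm w \<le> 1" "\<bar>b\<bar> \<le> 1" "x \<in> cube"
  shows "norm (act_jet w b x) \<le> act_bound CARD('d)"
proof -
  let ?z = "w \<bullet> x + b" and ?d = "real CARD('d) + 1"
  have "\<bar>w \<bullet> x\<bar> \<le> norm w * norm x" by (rule Cauchy_Schwarz_ineq2)
  also have "\<dots> \<le> 1 * real CARD('d)" using assms norm_cube_le by (intro mult_mono) auto
  finally have z: "0 \<le> max 0 ?z" "max 0 ?z \<le> ?d" using assms(2) by auto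
  have "norm (act_jet w b x) \<le> \<bar>ReCU ?z\<bar> + \<bar>3 * (max 0 ?z)\<^sup>2\<bar> * norm w + \<bar>6 * max 0 ?z\<bar> * (norm w)\<^sup>2"
    unfolding act_jet_def by (rule norm_ridge_jet)
  also have "\<dots> \<le> \<bar>ReCU ?z\<bar> + \<bar>3 * (max 0 ?z)\<^sup>2\<bar> * 1 + \<bar>6 * max 0 ?z\<bar> * 1"
    using assms(1) by (intro add_mono mult_left_mono power_le_one) auto
  also have "\<dots> = (max 0 ?z) ^ 3 + 3 * (max 0 ?z)\<^sup>2 + 6 * max 0 ?z"
    using z by (simp add: ReCU_pos_part abs_mult)
  also have "\<dots> \<le> act_bound CARD('d)"
    unfolding act_bound_def using z by (intro add_mono mult_left_mono power_mono) auto
  finally show ?thesis .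
qed

definition net_jet :: "(nat \<Rightarrow> real) \<Rightarrow> (nat \<Rightarrow> nat \<Rightarrow> real) \<Rightarrow> (nat \<Rightarrow> real^'d) \<Rightarrow> (nat \<Rightarrow> real) \<Rightarrow> nat \<Rightarrow> nat \<Rightarrow> real^'d \<Rightarrow> 'd jet" where
  "net_jet c a W b m k x = (c k, 0, 0) + (\<Sum>i<m. a i k *\<^sub>R act_jet (W i) (b i) x)"

lemma C2_net_jet: "C2_jet (net_jet c a W b m k)"
  unfolding net_jet_def[abs_def] by (intro C2_add C2_const C2_sum C2_scaleR C2_act_jet)

lemma val_net_jet: "val (net_jet c a W b m k x) = c k + (\<Sum>i<m. a i k * ReCU (W i \<bullet> x + b i))"
  by (simp add: net_jet_def fst_sum act_jet_def ridge_jet_def)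

text \<open>The constraints of \<open>ReCU_nets\<close> on the parameters alone, so that one can
  change width and budget while keeping track of the same parameters.\<close>

definition net_params :: "nat \<Rightarrow> nat \<Rightarrow> real \<Rightarrow> (nat \<Rightarrow> real) \<Rightarrow> (nat \<Rightarrow> nat \<Rightarrow> real) \<Rightarrow> (nat \<Rightarrow> real^'d) \<Rightarrow> (nat \<Rightarrow> real) \<Rightarrow> bool" where
  "net_params n m B c a W b \<longleftrightarrow> L2_set c {..<n} \<le> 2 * B \<and> (\<forall>i<m. norm (W i) \<le> 1 \<and> \<bar>b i\<bar> \<le> 1) \<and>
     (\<Sum>i<m. L2_set (a i) {..<n}) \<le> 4 * B"

lemma ReCU_nets_iff:
  "v \<in> ReCU_nets n m B \<longleftrightarrow> (\<exists>c a W b. net_params n m B c a W b \<and> (\<forall>k<n. \<forall>x. v k x = val (net_jet c a W b m k x)))"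
  by (auto simp: ReCU_nets_def net_params_def val_net_jet)

lemma abs_le_L2_set: "k < n \<Longrightarrow> \<bar>a k\<bar> \<le> L2_set a {..<n}" for k n :: nat
  unfolding L2_set_def using member_le_sum[of k "{..<n}" "\<lambda>i. (a i)\<^sup>2"] by (intro real_le_rsqrt) simp

lemma norm_net_jet:
  fixes W :: "nat \<Rightarrow> real^'d"
  assumes p: "net_params n m B c a W b" and k: "k < n" and x: "x \<in> cube"
  shows "norm (net_jet c a W b m k x) \<le> (2 + 4 * act_bound CARD('d)) * B"
proof -
  have "norm (net_jet c a W b m k x) \<le> norm (c k, 0 :: real^'d, 0 :: real^'d) + (\<Sum>i<m. norm (a i k *\<^sub>R act_jet (W i) (b i) x))"
    unfolding net_jet_def by (intro norm_triangle_mono norm_sum order_refl)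
  also have "\<dots> \<le> 2 * B + (\<Sum>i<m. L2_set (a i) {..<n} * act_bound CARD('d))"
  proof (intro add_mono sum_mono)
    show "norm (c k, 0 :: real^'d, 0 :: real^'d) \<le> 2 * B"
      using abs_le_L2_set[OF k, of c] p by (simp add: net_params_def norm_Pair)
    fix i assume "i \<in> {..<m}"
    then show "norm (a i k *\<^sub>R act_jet (W i) (b i) x) \<le> L2_set (a i) {..<n} * act_bound CARD('d)"
      using p unfolding norm_scaleR
      by (intro mult_mono abs_le_L2_set k norm_act_jet x) (auto simp: net_params_def L2_set_nonneg)
  qed
  also have "(\<Sum>i<m. L2_set (a i) {..<n} * act_bound CARD('d)) = (\<Sum>i<m. L2_set (a i) {..<n}) * act_bound CARD('d)"
    by (simp add: sum_distrib_right)
  also have "\<dots> \<le> (4 * B) * act_bound CARD('d)"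
    using p act_bound_pos[of "CARD('d)"] by (intro mult_right_mono) (auto simp: net_params_def)
  finally show ?thesis by (simp add: algebra_simps)
qed

section \<open>Approximation of Barron functions by networks\<close>

text \<open>The width \<open>M\<close> is unrestricted here: only the norm budget \<open>B\<close>
  is tracked, and the approximation is uniform for whole jets. The width is brought down afterwards
  by \<open>width_reduction\<close>, which keeps the budget.\<close>

definition approximable :: "nat \<Rightarrow> real \<Rightarrow> (nat \<Rightarrow> real^'d \<Rightarrow> 'd jet) \<Rightarrow> bool" where
  "approximable n B J \<longleftrightarrow> (\<forall>\<epsilon>>0. \<exists>M c a W b. net_params n M B c a W b \<and>
     (\<forall>k<n. \<forall>x\<in>cube. norm (J k x - net_jet c a W b M k x) \<le> \<epsilon>))"

lemma approximable_mono:
  assumes "approximable n B J" "B \<le> B'"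
  shows "approximable n B' J"
  unfolding approximable_def
proof (intro allI impI)
  fix \<epsilon> :: real assume "\<epsilon> > 0"
  then obtain M c a and W :: "nat \<Rightarrow> real^'a" and b where p: "net_params n M B c a W b" "\<forall>k<n. \<forall>x\<in>cube. norm (J k x - net_jet c a W b M k x) \<le> \<epsilon>"
    using assms(1) unfolding approximable_def by blast
  have "net_params n M B' c a W b" using p(1) assms(2) by (auto simp: net_params_def)
  with p(2) show "\<exists>M c a W b. net_params n M B' c a W b \<and> (\<forall>k<n. \<forall>x\<in>cube. norm (J k x - net_jet c a W b M k x) \<le> \<epsilon>)" by blast
qed

lemma approximable_limit:
  assumes "\<And>\<epsilon>. \<epsilon> > 0 \<Longrightarrow> \<exists>J'. approximable n B J' \<and> (\<forall>k<n. \<forall>x\<in>cube. norm (J k x - J' k x) \<le> \<epsilon>)"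
  shows "approximable n B J"
  unfolding approximable_def
proof (intro allI impI)
  fix \<epsilon> :: real assume \<epsilon>: "\<epsilon> > 0"
  then obtain J' where J': "approximable n B J'" "\<forall>k<n. \<forall>x\<in>cube. norm (J k x - J' k x) \<le> \<epsilon> / 2"
    using assms[of "\<epsilon> / 2"] by auto
  then obtain M c a and W :: "nat \<Rightarrow> real^'a" and b where p: "net_params n M B c a W b" "\<forall>k<n. \<forall>x\<in>cube. norm (J' k x - net_jet c a W b M k x) \<le> \<epsilon> / 2"
    using \<epsilon> unfolding approximable_def by (metis half_gt_zero)
  have "norm (J k x - net_jet c a W b M k x) \<le> \<epsilon>" if "k < n" "x \<in> cube" for k x
    using norm_diff_triangle_le[of "J k x" "J' k x" "\<epsilon> / 2" "net_jet c a W b M k x" "\<epsilon> / 2"] J'(2) p(2) that by simp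
  with p(1) show "\<exists>M c a W b. net_params n M B c a W b \<and> (\<forall>k<n. \<forall>x\<in>cube. norm (J k x - net_jet c a W b M k x) \<le> \<epsilon>)" by blast
qed

lemma approximable_cong:
  assumes "approximable n B J'" "\<And>k x. k < n \<Longrightarrow> x \<in> cube \<Longrightarrow> J k x = J' k x"
  shows "approximable n B J"
  using assms by (intro approximable_limit) (auto intro!: exI[of _ J'])

lemma approximable_add:
  fixes J J' :: "nat \<Rightarrow> real^'d \<Rightarrow> 'd jet"
  assumes "approximable n B J" "approximable n B' J'"
  shows "approximable n (B + B') (\<lambda>k x. J k x + J' k x)"
  unfolding approximable_def
proof (intro allI impI)
  fix \<epsilon> :: real assume \<epsilon>: "\<epsilon> > 0"
  obtain M c a and W :: "nat \<Rightarrow> real^'d" and b where p: "net_params n M B c a W b" "\<forall>k<n. \<forall>x\<in>cube. norm (J k x - net_jet c a W b M k x) \<le> \<epsilon> / 2"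
    using assms(1) \<epsilon> unfolding approximable_def by (metis half_gt_zero)
  obtain M' c' a' and W' :: "nat \<Rightarrow> real^'d" and b' where p': "net_params n M' B' c' a' W' b'" "\<forall>k<n. \<forall>x\<in>cube. norm (J' k x - net_jet c' a' W' b' M' k x) \<le> \<epsilon> / 2"
    using assms(2) \<epsilon> unfolding approximable_def by (metis half_gt_zero)
  \<comment> \<open>The two networks are placed side by side, so their budgets add.\<close>
  define A where "A i = (if i < M then a i else a' (i - M))" for i
  define V where "V i = (if i < M then W i else W' (i - M))" for i
  define \<beta> where "\<beta> i = (if i < M then b i else b' (i - M))" for i
  have split: "(\<Sum>i<M + M'. f i) = (\<Sum>i<M. f i) + (\<Sum>i<M'. f (M + i))" for f :: "nat \<Rightarrow> 'x::comm_monoid_add"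
    by (induction M') (simp_all add: add.assoc)
  have net: "net_jet (\<lambda>k. c k + c' k) A V \<beta> (M + M') k x = net_jet c a W b M k x + net_jet c' a' W' b' M' k x" for k x
    unfolding net_jet_def split by (simp add: A_def V_def \<beta>_def)
  have "net_params n (M + M') (B + B') (\<lambda>k. c k + c' k) A V \<beta>"
    unfolding net_params_def
  proof (intro conjI allI impI)
    show "L2_set (\<lambda>k. c k + c' k) {..<n} \<le> 2 * (B + B')"
      using L2_set_triangle_ineq[of c c' "{..<n}"] p(1) p'(1) by (simp add: net_params_def)
    show "(\<Sum>i<M + M'. L2_set (A i) {..<n}) \<le> 4 * (B + B')"
      unfolding split using p(1) p'(1) by (simp add: net_params_def A_def)
    fix i assume i: "i < M + M'"
    then have "\<not> i < M \<Longrightarrow> i - M < M'" by linarith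
    then show "norm (V i) \<le> 1" "\<bar>\<beta> i\<bar> \<le> 1"
      using p(1) p'(1) by (auto simp: net_params_def V_def \<beta>_def)
  qed
  moreover have "norm ((J k x + J' k x) - net_jet (\<lambda>k. c k + c' k) A V \<beta> (M + M') k x) \<le> \<epsilon>" if "k < n" "x \<in> cube" for k x
  proof -
    have "(J k x + J' k x) - net_jet (\<lambda>k. c k + c' k) A V \<beta> (M + M') k x
        = (J k x - net_jet c a W b M k x) + (J' k x - net_jet c' a' W' b' M' k x)"
      unfolding net by simp
    moreover have "norm ((J k x - net_jet c a W b M k x) + (J' k x - net_jet c' a' W' b' M' k x)) \<le> \<epsilon> / 2 + \<epsilon> / 2"
      using p(2) p'(2) that by (intro norm_triangle_mono) auto
    ultimately show ?thesis by (simp only: field_sum_of_halves)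
  qed
  ultimately show "\<exists>M c a W b. net_params n M (B + B') c a W b \<and> (\<forall>k<n. \<forall>x\<in>cube. norm (J k x + J' k x - net_jet c a W b M k x) \<le> \<epsilon>)"
    by blast
qed

lemma approximable_const:
  assumes "L2_set q {..<n} \<le> 2 * B" "B \<ge> 0"
  shows "approximable n B (\<lambda>k x. q k *\<^sub>R (1, 0, 0))"
  unfolding approximable_def
proof (intro allI impI exI conjI)
  show "net_params n 0 B q (\<lambda>_ _. 0) (\<lambda>_. 0) (\<lambda>_. 0)" using assms by (simp add: net_params_def)
qed (simp add: net_jet_def)

lemma approximable_act:
  fixes w :: "real^'d"
  assumes "L2_set q {..<n} \<le> 4 * B" "B \<ge> 0" "norm w \<le> 1" "\<bar>b\<bar> \<le> 1"
  shows "approximable n B (\<lambda>k x. q k *\<^sub>R act_jet w b x)"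
  unfolding approximable_def
proof (intro allI impI exI conjI)
  show "net_params n 1 B (\<lambda>_. 0) (\<lambda>_. q) (\<lambda>_. w) (\<lambda>_. b)" using assms by (simp add: net_params_def L2_set_def)
qed (simp add: net_jet_def zero_prod_def)

lemma approximable_sum:
  assumes "finite I" "\<And>i. i \<in> I \<Longrightarrow> approximable n (B i) (J i)"
  shows "approximable n (\<Sum>i\<in>I. B i) (\<lambda>k x. \<Sum>i\<in>I. J i k x)"
  using assms
proof (induction I)
  case empty
  show ?case using approximable_const[of "\<lambda>_. 0" n 0] by (simp add: L2_set_def zero_prod_def)
next
  case (insert i I)
  then show ?case using approximable_add[of n "B i" "J i"] by simp
qed

section \<open>Cosines as averages of truncated cubics\<close>

lemma riemann_sum_error:
  fixes F :: "real \<Rightarrow> real"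
  assumes I: "(F has_integral I) {0..1}" and L: "L \<ge> 1"
    and lip: "\<And>s t. s \<in> {0..1} \<Longrightarrow> t \<in> {0..1} \<Longrightarrow> \<bar>F s - F t\<bar> \<le> K * \<bar>s - t\<bar>" and K: "K \<ge> 0"
  shows "\<bar>I - (\<Sum>l<L. F (real l / real L) / real L)\<bar> \<le> K / real L"
proof -
  let ?h = "1 / real L"
  have step: "m \<le> L \<Longrightarrow> \<bar>integral {0..real m / real L} F - (\<Sum>l<m. F (real l / real L) / real L)\<bar> \<le> real m * (K * ?h * ?h)" for m
  proof (induction m)
    case (Suc m)
    let ?a = "real m / real L" and ?b = "real (Suc m) / real L"
    have ab: "0 \<le> ?a" "?a \<le> ?b" "?b \<le> 1" using Suc.prems L by (simp_all add: divide_right_mono)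
    have len: "?b - ?a = ?h" by (simp add: diff_divide_distrib[symmetric])
    have int: "F integrable_on {0..?b}" "F integrable_on {?a..?b}"
      using integrable_on_subinterval[OF has_integral_integrable[OF I], of 0 ?b]
        integrable_on_subinterval[OF has_integral_integrable[OF I], of ?a ?b] ab
      by (simp_all only: box_real atLeastatMost_subset_iff) auto
    have eq: "integral {0..?b} F = integral {0..?a} F + integral {?a..?b} F"
      using Henstock_Kurzweil_Integration.integral_combine[OF ab(1,2) int(1)] by simp
    have "((\<lambda>t. F t - F ?a) has_integral (integral {?a..?b} F - F ?a * ?h)) {?a..?b}"
      using has_integral_diff[OF integrable_integral[OF int(2)] has_integral_const_real[of "F ?a" ?a ?b]] ab len by (simp add: mult.commute)
    then have "norm (integral {?a..?b} F - F ?a * ?h) \<le> (K * ?h) * measure lborel {?a..?b}"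
    proof (rule has_integral_bound_real[rotated 2])
      show "0 \<le> K * ?h" using K by simp
      fix t assume t: "t \<in> {?a..?b} - {}"
      have "\<bar>F t - F ?a\<bar> \<le> K * \<bar>t - ?a\<bar>" using t ab order_trans[OF ab(1), of t] by (intro lip) auto
      also have "\<dots> \<le> K * ?h" using t len K by (intro mult_left_mono) auto
      finally show "norm (F t - F ?a) \<le> K * ?h" by simp
    qed simp
    then have "\<bar>integral {?a..?b} F - F ?a / real L\<bar> \<le> K * ?h * ?h"
      using ab len by simp
    moreover have "\<bar>integral {0..?a} F - (\<Sum>l<m. F (real l / real L) / real L)\<bar> \<le> real m * (K * ?h * ?h)"
      using Suc by simp
    moreover have "real (Suc m) * (K * ?h * ?h) = real m * (K * ?h * ?h) + K * ?h * ?h"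
      by (simp only: of_nat_Suc distrib_right mult_1)
    ultimately show ?case unfolding eq sum.lessThan_Suc by linarith
  qed simp
  have "\<bar>integral {0..1} F - (\<Sum>l<L. F (real l / real L) / real L)\<bar> \<le> real L * (K * ?h * ?h)"
    using step[of L] L by simp
  then show ?thesis using I L by (simp add: integral_unique)
qed

text \<open>The fourth derivative of \<open>z \<mapsto> cos (y z)\<close> is the density of its representation by truncated cubics.\<close>

lemma cos_hinge_integral:
  fixes y z :: real
  assumes y: "y > 0" and z: "0 \<le> z" "z \<le> 1"
  shows "((\<lambda>b. y ^ 4 * cos (y * b) * max 0 (z - b)) has_integral y\<^sup>2 * (1 - cos (y * z))) {0..1}"
proof -
  let ?\<Phi> = "\<lambda>b. y ^ 4 * ((z - b) * sin (y * b) / y - cos (y * b) / y\<^sup>2)"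
  have d: "(?\<Phi> has_real_derivative y ^ 4 * cos (y * b) * (z - b)) (at b within {0..z})" for b
    using y by (auto intro!: derivative_eq_intros simp: field_simps power2_eq_square)
  have "((\<lambda>b. y ^ 4 * cos (y * b) * (z - b)) has_integral (?\<Phi> z - ?\<Phi> 0)) {0..z}"
    using z d by (intro fundamental_theorem_of_calculus) (auto simp: has_real_derivative_iff_has_vector_derivative)
  moreover have "?\<Phi> z - ?\<Phi> 0 = y\<^sup>2 * (1 - cos (y * z))"
    using y by (simp add: field_simps power2_eq_square power4_eq_xxxx)
  ultimately have 1: "((\<lambda>b. y ^ 4 * cos (y * b) * max 0 (z - b)) has_integral y\<^sup>2 * (1 - cos (y * z))) {0..z}"
    by (subst has_integral_cong[where g = "\<lambda>b. y ^ 4 * cos (y * b) * (z - b)"]) auto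
  have 2: "((\<lambda>b. y ^ 4 * cos (y * b) * max 0 (z - b)) has_integral 0) {z..1}"
    by (rule has_integral_is_0) auto
  show ?thesis using has_integral_combine[OF z 1 2] by simp
qed

lemma cos_hinge_lipschitz:
  fixes y z s t :: real
  assumes y: "y > 0" and z: "0 \<le> z" "z \<le> 1" and st: "s \<in> {0..1}" "t \<in> {0..1}"
  shows "\<bar>y ^ 4 * cos (y * s) * max 0 (z - s) - y ^ 4 * cos (y * t) * max 0 (z - t)\<bar> \<le> (y ^ 4 * (y + 1)) * \<bar>s - t\<bar>"
proof -
  have c: "\<bar>cos (y * s) - cos (y * t)\<bar> \<le> y * \<bar>s - t\<bar>"
  proof -
    have "norm (cos (y * s) - cos (y * t)) \<le> 1 * norm (y * s - y * t)"
      by (rule field_differentiable_bound[where S = UNIV and f' = "\<lambda>x. - sin x"])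
        (auto intro!: derivative_eq_intros)
    also have "norm (y * s - y * t) = y * \<bar>s - t\<bar>" using y by (simp add: right_diff_distrib[symmetric] abs_mult)
    finally show ?thesis by simp
  qed
  have "\<bar>cos (y * s) * max 0 (z - s) - cos (y * t) * max 0 (z - t)\<bar>
     = \<bar>(cos (y * s) - cos (y * t)) * max 0 (z - s) + cos (y * t) * (max 0 (z - s) - max 0 (z - t))\<bar>"
    by (simp add: algebra_simps)
  also have "\<dots> \<le> \<bar>cos (y * s) - cos (y * t)\<bar> * \<bar>max 0 (z - s)\<bar> + \<bar>cos (y * t)\<bar> * \<bar>max 0 (z - s) - max 0 (z - t)\<bar>"
    by (rule order_trans[OF abs_triangle_ineq]) (simp add: abs_mult)
  also have "\<dots> \<le> (y * \<bar>s - t\<bar>) * 1 + 1 * \<bar>s - t\<bar>"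
    using c st z by (intro add_mono mult_mono) (auto simp: abs_cos_le_one)
  finally have "y ^ 4 * \<bar>cos (y * s) * max 0 (z - s) - cos (y * t) * max 0 (z - t)\<bar> \<le> y ^ 4 * ((y + 1) * \<bar>s - t\<bar>)"
    by (intro mult_left_mono) (simp_all add: algebra_simps)
  moreover have "\<bar>y ^ 4 * cos (y * s) * max 0 (z - s) - y ^ 4 * cos (y * t) * max 0 (z - t)\<bar> = y ^ 4 * \<bar>cos (y * s) * max 0 (z - s) - cos (y * t) * max 0 (z - t)\<bar>"
    using y by (simp add: mult.assoc right_diff_distrib[symmetric] abs_mult)
  ultimately show ?thesis by (simp add: mult.assoc)
qed

text \<open>The remainder of \<open>cos (y * z)\<close> after its quadratic Taylor polynomial at 0,
  cut off for negative \<open>z\<close>. Value and first two derivatives vanish at 0, so the cut is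
  twice continuously differentiable, with derivatives \<open>cosT1\<close> and
  \<open>cosT2\<close>.\<close>

definition cosT :: "real \<Rightarrow> real \<Rightarrow> real" where
  "cosT y z = (if z \<ge> 0 then cos (y * z) - 1 + y\<^sup>2 * z\<^sup>2 / 2 else 0)"
definition cosT1 :: "real \<Rightarrow> real \<Rightarrow> real" where
  "cosT1 y z = (if z \<ge> 0 then y\<^sup>2 * z - y * sin (y * z) else 0)"
definition cosT2 :: "real \<Rightarrow> real \<Rightarrow> real" where
  "cosT2 y z = (if z \<ge> 0 then y\<^sup>2 * (1 - cos (y * z)) else 0)"

lemma zero_at_0_bound:
  fixes f :: "real \<Rightarrow> real"
  assumes "\<And>z. (f has_real_derivative f' z) (at z)" "\<And>z. 0 \<le> z \<Longrightarrow> z \<le> 1 \<Longrightarrow> \<bar>f' z\<bar> \<le> \<delta>" "f 0 = 0" "0 \<le> z" "z \<le> 1"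
  shows "\<bar>f z\<bar> \<le> \<delta>"
proof -
  have "norm (f z - f 0) \<le> \<delta> * norm (z - 0)"
    by (rule field_differentiable_bound[where S = "{0..1}" and f' = f'])
      (use assms in \<open>auto intro: has_field_derivative_at_within\<close>)
  moreover have "0 \<le> \<delta>" using assms(2)[of 0] by simp
  ultimately show ?thesis using assms(3-5) mult_left_mono[of z 1 \<delta>] by simp
qed

text \<open>The Riemann sum is compared with the integral only for the second derivative. The errors
  of the first derivative and of the value vanish at 0 and are recovered by integrating over an
  interval of length at most 1. For negative \<open>z\<close> both sides vanish.\<close>

lemma cosT_riemann:
  fixes y z :: real and L :: nat
  assumes y: "y > 0" and z: "\<bar>z\<bar> \<le> 1" and L: "L \<ge> 1"
  defines "\<delta> \<equiv> (y ^ 4 * (y + 1)) / real L"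
    and "\<alpha> \<equiv> \<lambda>l. (y ^ 4 * cos (y * (real l / real L)) / real L) / 6"
  shows "\<bar>cosT y z - (\<Sum>l<L. \<alpha> l * ReCU (z - real l / real L))\<bar> \<le> \<delta>"
    and "\<bar>cosT1 y z - (\<Sum>l<L. \<alpha> l * (3 * (max 0 (z - real l / real L))\<^sup>2))\<bar> \<le> \<delta>"
    and "\<bar>cosT2 y z - (\<Sum>l<L. \<alpha> l * (6 * max 0 (z - real l / real L)))\<bar> \<le> \<delta>"
proof -
  have \<delta>: "\<delta> \<ge> 0" using y L by (simp add: \<delta>_def)
  let ?b = "\<lambda>l. real l / real L"
  define E where "E z = cos (y * z) - 1 + y\<^sup>2 * z\<^sup>2 / 2 - (\<Sum>l<L. \<alpha> l * ReCU (z - ?b l))" for z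
  define E1 where "E1 z = y\<^sup>2 * z - y * sin (y * z) - (\<Sum>l<L. \<alpha> l * (3 * (max 0 (z - ?b l))\<^sup>2))" for z
  define E2 where "E2 z = y\<^sup>2 * (1 - cos (y * z)) - (\<Sum>l<L. \<alpha> l * (6 * max 0 (z - ?b l)))" for z
  have dr: "((\<lambda>z. ReCU (z - b)) has_real_derivative 3 * (max 0 (z - b))\<^sup>2) (at z)" for b z
    using DERIV_shift[of ReCU _ z "- b"] DERIV_ReCU[of "z - b"] by simp
  have dr': "((\<lambda>z. 3 * (max 0 (z - b))\<^sup>2) has_real_derivative 6 * max 0 (z - b)) (at z)" for b z
    using DERIV_shift[of "\<lambda>z. 3 * (max 0 z)\<^sup>2" _ z "- b"] DERIV_ReCU'[of "z - b"] by simp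
  have dE: "(E has_real_derivative E1 z) (at z)" for z
    unfolding E_def E1_def
  proof (rule DERIV_diff)
    show "((\<lambda>z. cos (y * z) - 1 + y\<^sup>2 * z\<^sup>2 / 2) has_real_derivative y\<^sup>2 * z - y * sin (y * z)) (at z)"
      by (auto intro!: derivative_eq_intros simp: power2_eq_square algebra_simps)
  qed (intro DERIV_sum DERIV_cmult dr)
  have dE1: "(E1 has_real_derivative E2 z) (at z)" for z
    unfolding E1_def E2_def
  proof (rule DERIV_diff)
    show "((\<lambda>z. y\<^sup>2 * z - y * sin (y * z)) has_real_derivative y\<^sup>2 * (1 - cos (y * z))) (at z)"
      by (auto intro!: derivative_eq_intros simp: power2_eq_square algebra_simps)
  qed (intro DERIV_sum DERIV_cmult dr')
  have E2: "\<bar>E2 z\<bar> \<le> \<delta>" if "0 \<le> z" "z \<le> 1" for z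
  proof -
    have "\<bar>y\<^sup>2 * (1 - cos (y * z)) - (\<Sum>l<L. y ^ 4 * cos (y * ?b l) * max 0 (z - ?b l) / real L)\<bar> \<le> (y ^ 4 * (y + 1)) / real L"
      by (rule riemann_sum_error[OF cos_hinge_integral[OF y that] L cos_hinge_lipschitz[OF y that]]) (use y in auto)
    moreover have "(\<Sum>l<L. y ^ 4 * cos (y * ?b l) * max 0 (z - ?b l) / real L) = (\<Sum>l<L. \<alpha> l * (6 * max 0 (z - ?b l)))"
      unfolding \<alpha>_def by (intro sum.cong) auto
    ultimately show ?thesis unfolding E2_def \<delta>_def by simp
  qed
  \<comment> \<open>All nodes are nonnegative, so every truncated cubic and its derivatives vanish
    at 0, as the remainder does.\<close>
  have z0: "max 0 (- ?b l) = 0" "ReCU (- ?b l) = 0" for l by (simp_all add: ReCU_pos_part max_absorb1)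
  have E1: "\<bar>E1 z\<bar> \<le> \<delta>" if "0 \<le> z" "z \<le> 1" for z
    by (rule zero_at_0_bound[OF dE1 E2 _ that]) (simp_all add: E1_def z0)
  have E: "\<bar>E z\<bar> \<le> \<delta>" if "0 \<le> z" "z \<le> 1" for z
    by (rule zero_at_0_bound[OF dE E1 _ that]) (simp_all add: E_def z0)
  have neg: "max 0 (z - ?b l) = 0" if "z < 0" for l
    using that by (simp add: max_def) (smt (verit) divide_nonneg_nonneg of_nat_0_le_iff)
  show "\<bar>cosT y z - (\<Sum>l<L. \<alpha> l * ReCU (z - ?b l))\<bar> \<le> \<delta>"
    "\<bar>cosT1 y z - (\<Sum>l<L. \<alpha> l * (3 * (max 0 (z - ?b l))\<^sup>2))\<bar> \<le> \<delta>"
    "\<bar>cosT2 y z - (\<Sum>l<L. \<alpha> l * (6 * max 0 (z - ?b l)))\<bar> \<le> \<delta>"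
    using E[of z] E1[of z] E2[of z] z neg \<delta>
    by (auto simp: cosT_def cosT1_def cosT2_def E_def E1_def E2_def ReCU_pos_part)
qed

text \<open>The coefficients of the Riemann sum have total mass at most \<open>y ^ 4 / 6\<close>;
  the outer weights may sum to four times the budget, which gives 24. One scalar ridge function
  serves all \<open>n\<close> components through the vector \<open>q\<close>.\<close>

lemma approximable_cosT:
  fixes w :: "real^'d"
  assumes y: "y > 0" and w: "norm w \<le> 1" "\<And>x. x \<in> cube \<Longrightarrow> \<bar>w \<bullet> x\<bar> \<le> 1"
  shows "approximable n (L2_set q {..<n} * y ^ 4 / 24) (\<lambda>k x. q k *\<^sub>R ridge_jet (cosT y) (cosT1 y) (cosT2 y) w 0 x)"
proof (rule approximable_limit)
  fix \<epsilon> :: real assume \<epsilon>: "\<epsilon> > 0"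
  let ?q = "L2_set q {..<n}"
  have q: "?q \<ge> 0" by (rule L2_set_nonneg)
  \<comment> \<open>Three times, because value, gradient and second derivatives each contribute one
    Riemann error.\<close>
  define K where "K = 3 * ?q * (y ^ 4 * (y + 1))"
  have K: "K \<ge> 0" using q y by (simp add: K_def)
  obtain L :: nat where L0: "real L > K / \<epsilon>" using reals_Archimedean2 by blast
  have L: "L \<ge> 1" using L0 K \<epsilon> by (cases L) (auto simp: divide_nonneg_pos leD)
  define \<alpha> where "\<alpha> l = (y ^ 4 * cos (y * (real l / real L)) / real L) / 6" for l
  let ?\<delta> = "(y ^ 4 * (y + 1)) / real L"
  define J where "J k x = (\<Sum>l<L. (\<alpha> l * q k) *\<^sub>R act_jet w (- (real l / real L)) x)" for k and x :: "real^'d"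
  have "approximable n (\<Sum>l<L. \<bar>\<alpha> l\<bar> * ?q / 4) J"
    unfolding J_def[abs_def]
  proof (rule approximable_sum)
    fix l assume l: "l \<in> {..<L}"
    show "approximable n (\<bar>\<alpha> l\<bar> * ?q / 4) (\<lambda>k x. (\<alpha> l * q k) *\<^sub>R act_jet w (- (real l / real L)) x)"
    proof (rule approximable_act)
      have "L2_set (\<lambda>k. \<alpha> l * q k) {..<n} = \<bar>\<alpha> l\<bar> * ?q"
        by (simp add: L2_set_def power_mult_distrib sum_distrib_left[symmetric] real_sqrt_mult)
      then show "L2_set (\<lambda>k. \<alpha> l * q k) {..<n} \<le> 4 * (\<bar>\<alpha> l\<bar> * ?q / 4)" by simp
    qed (use w l q in auto)
  qed simp
  moreover have "(\<Sum>l<L. \<bar>\<alpha> l\<bar> * ?q / 4) \<le> ?q * y ^ 4 / 24"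
  proof -
    have "(\<Sum>l<L. \<bar>\<alpha> l\<bar> * ?q / 4) \<le> (\<Sum>l<L. (y ^ 4 / real L / 6) * ?q / 4)"
    proof (intro sum_mono divide_right_mono mult_right_mono)
      fix l
      have "y ^ 4 * \<bar>cos (y * (real l / real L))\<bar> \<le> y ^ 4 * 1" using y by (intro mult_left_mono) auto
      then show "\<bar>\<alpha> l\<bar> \<le> y ^ 4 / real L / 6"
        unfolding \<alpha>_def using y by (simp add: abs_mult divide_right_mono)
    qed (use q in auto)
    also have "\<dots> = ?q * y ^ 4 / 24" using L by simp
    finally show ?thesis .
  qed
  ultimately have "approximable n (?q * y ^ 4 / 24) J" by (rule approximable_mono)
  moreover have "norm (q k *\<^sub>R ridge_jet (cosT y) (cosT1 y) (cosT2 y) w 0 x - J k x) \<le> \<epsilon>" if k: "k < n" and x: "x \<in> cube" for k x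
  proof -
    let ?z = "w \<bullet> x"
    have z: "\<bar>?z\<bar> \<le> 1" by (rule w(2)[OF x])
    define e where "e z = cosT y z - (\<Sum>l<L. \<alpha> l * ReCU (z - real l / real L))" for z
    define e1 where "e1 z = cosT1 y z - (\<Sum>l<L. \<alpha> l * (3 * (max 0 (z - real l / real L))\<^sup>2))" for z
    define e2 where "e2 z = cosT2 y z - (\<Sum>l<L. \<alpha> l * (6 * max 0 (z - real l / real L)))" for z
    have "q k *\<^sub>R ridge_jet (cosT y) (cosT1 y) (cosT2 y) w 0 x - J k x = q k *\<^sub>R ridge_jet e e1 e2 w 0 x"
      unfolding J_def act_jet_def ridge_jet_def e_def e1_def e2_def
      by (auto simp: prod_eq_iff fst_sum snd_sum vec_eq_iff algebra_simps sum_distrib_left sum_distrib_right scaleR_sum_left)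
    also have "norm \<dots> \<le> ?q * (?\<delta> + ?\<delta> + ?\<delta>)"
      unfolding norm_scaleR
    proof (rule mult_mono)
      show "\<bar>q k\<bar> \<le> ?q" by (rule abs_le_L2_set[OF k])
      have "norm (ridge_jet e e1 e2 w 0 x) \<le> \<bar>e ?z\<bar> + \<bar>e1 ?z\<bar> * norm w + \<bar>e2 ?z\<bar> * (norm w)\<^sup>2"
        using norm_ridge_jet[of e e1 e2 w 0 x] by simp
      also have "\<dots> \<le> ?\<delta> + ?\<delta> * 1 + ?\<delta> * 1"
        using cosT_riemann[OF y z L] w(1) y L unfolding e_def e1_def e2_def \<alpha>_def
        by (intro add_mono mult_mono power_le_one) auto
      finally show "norm (ridge_jet e e1 e2 w 0 x) \<le> ?\<delta> + ?\<delta> + ?\<delta>" by simp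
    qed (use q in auto)
    also have "\<dots> = K / real L" by (simp add: K_def)
    also have "\<dots> \<le> \<epsilon>" using L0 L \<epsilon> by (simp add: field_simps)
    finally show ?thesis .
  qed
  ultimately show "\<exists>J'. approximable n (?q * y ^ 4 / 24) J' \<and> (\<forall>k<n. \<forall>x\<in>cube. norm (q k *\<^sub>R ridge_jet (cosT y) (cosT1 y) (cosT2 y) w 0 x - J' k x) \<le> \<epsilon>)"
    by blast
qed

lemma L2_set_cmult: "L2_set (\<lambda>k. a * q k) S = \<bar>a\<bar> * L2_set q S"
  by (simp add: L2_set_def power_mult_distrib sum_distrib_left[symmetric] real_sqrt_mult)

text \<open>The two one-sided remainders together restore the cosine up to its quadratic Taylor
  polynomial. That polynomial is expressed through (1 + z)^3 + (1 - z)^3 = 2 + 6 z^2, and for |z| at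
  most 1 both cubes are values of the activation with bias 1.\<close>

lemma cos_ridge_decomposition:
  fixes w :: "real^'d"
  assumes "\<bar>w \<bullet> x\<bar> \<le> 1"
  shows "ridge_jet cos (\<lambda>z. - sin z) (\<lambda>z. - cos z) (y *\<^sub>R w) 0 x
    = (1 + y\<^sup>2 / 6) *\<^sub>R (1, 0, 0) + (- y\<^sup>2 / 12) *\<^sub>R act_jet w 1 x + (- y\<^sup>2 / 12) *\<^sub>R act_jet (- w) 1 x
      + ridge_jet (cosT y) (cosT1 y) (cosT2 y) w 0 x + ridge_jet (cosT y) (cosT1 y) (cosT2 y) (- w) 0 x"
proof -
  define z where "z = w \<bullet> x"
  have m: "max 0 (z + 1) = z + 1" "max 0 (- z + 1) = 1 - z" "max 0 (1 - z) = 1 - z" using assms by (auto simp: z_def)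
  have v: "cos (y * z) = (1 + y\<^sup>2 / 6) + (- y\<^sup>2 / 12) * ReCU (z + 1) + (- y\<^sup>2 / 12) * ReCU (1 - z) + cosT y z + cosT y (- z)"
    unfolding ReCU_pos_part m cosT_def by (auto simp: power3_eq_cube power2_eq_square field_simps)
  have g: "- sin (y * z) * y = (- y\<^sup>2 / 12) * (3 * (z + 1)\<^sup>2) - (- y\<^sup>2 / 12) * (3 * (1 - z)\<^sup>2) + cosT1 y z - cosT1 y (- z)"
    unfolding cosT1_def by (auto simp: power2_eq_square algebra_simps)
  have h: "- cos (y * z) * y\<^sup>2 = (- y\<^sup>2 / 12) * (6 * (z + 1)) + (- y\<^sup>2 / 12) * (6 * (1 - z)) + cosT2 y z + cosT2 y (- z)"
    unfolding cosT2_def by (auto simp: power2_eq_square algebra_simps)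
  have "(- sin (y * z) * y) *\<^sub>R w = (- y\<^sup>2 / 12) *\<^sub>R ((3 * (z + 1)\<^sup>2) *\<^sub>R w) + (- y\<^sup>2 / 12) *\<^sub>R ((3 * (1 - z)\<^sup>2) *\<^sub>R (- w))
       + cosT1 y z *\<^sub>R w + cosT1 y (- z) *\<^sub>R (- w)"
    unfolding g by (simp add: scaleR_left_distrib scaleR_left_diff_distrib)
  moreover have "- cos (y * z) * (y * w $ i)\<^sup>2 = (- y\<^sup>2 / 12) * ((6 * (z + 1)) * (w $ i)\<^sup>2) + (- y\<^sup>2 / 12) * ((6 * (1 - z)) * (w $ i)\<^sup>2)
       + cosT2 y z * (w $ i)\<^sup>2 + cosT2 y (- z) * (w $ i)\<^sup>2" for i
  proof -
    have "- cos (y * z) * (y * w $ i)\<^sup>2 = (- cos (y * z) * y\<^sup>2) * (w $ i)\<^sup>2" by (simp add: power_mult_distrib)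
    then show ?thesis unfolding h by (simp only: distrib_right mult.assoc)
  qed
  ultimately show ?thesis
    using v unfolding ridge_jet_def act_jet_def z_def[symmetric]
    by (simp add: m z_def[symmetric] inner_minus_left prod_eq_iff vec_eq_iff)
qed

text \<open>The budget is half the constant term plus a quarter of the mass of the atoms, matching
  the bounds \<open>2 * B\<close> and \<open>4 * B\<close> of the network class.\<close>

lemma approximable_cos:
  fixes w :: "real^'d"
  assumes y: "y > 0" and w: "norm w \<le> 1" "\<And>x. x \<in> cube \<Longrightarrow> \<bar>w \<bullet> x\<bar> \<le> 1"
  shows "approximable n (L2_set q {..<n} * (1/2 + y\<^sup>2 / 8 + y ^ 4 / 12))
    (\<lambda>k x. q k *\<^sub>R ridge_jet cos (\<lambda>z. - sin z) (\<lambda>z. - cos z) (y *\<^sub>R w) 0 x)"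
proof -
  let ?q = "L2_set q {..<n}" and ?R = "ridge_jet (cosT y) (cosT1 y) (cosT2 y)"
  have q: "?q \<ge> 0" by (rule L2_set_nonneg)
  have w': "norm (- w) \<le> 1" "\<And>x. x \<in> cube \<Longrightarrow> \<bar>- w \<bullet> x\<bar> \<le> 1" using w by auto
  have "0 \<le> 1 + y\<^sup>2 / 6" by (intro add_nonneg_nonneg) auto
  then have 1: "approximable n (?q * (1 + y\<^sup>2 / 6) / 2) (\<lambda>k x. ((1 + y\<^sup>2 / 6) * q k) *\<^sub>R (1, 0 :: real^'d, 0 :: real^'d))"
  proof (intro approximable_const)
    show "L2_set (\<lambda>k. (1 + y\<^sup>2 / 6) * q k) {..<n} \<le> 2 * (?q * (1 + y\<^sup>2 / 6) / 2)"
      unfolding L2_set_cmult using \<open>0 \<le> 1 + y\<^sup>2 / 6\<close> by (simp only: abs_of_nonneg) simp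
  qed (use q in simp)
  have 2: "approximable n (?q * (y\<^sup>2 / 12) / 4) (\<lambda>k x. ((- y\<^sup>2 / 12) * q k) *\<^sub>R act_jet v 1 x)" if "norm v \<le> 1" for v :: "real^'d"
  proof (rule approximable_act[OF _ _ that])
    show "L2_set (\<lambda>k. (- y\<^sup>2 / 12) * q k) {..<n} \<le> 4 * (?q * (y\<^sup>2 / 12) / 4)"
      unfolding L2_set_cmult by simp
  qed (use q in simp_all)
  note 3 = approximable_cosT[OF y w, of n q] approximable_cosT[OF y w', of n q]
  have "approximable n (?q * (1 + y\<^sup>2 / 6) / 2 + ?q * (y\<^sup>2 / 12) / 4 + ?q * (y\<^sup>2 / 12) / 4 + ?q * y ^ 4 / 24 + ?q * y ^ 4 / 24)
     (\<lambda>k x. ((1 + y\<^sup>2 / 6) * q k) *\<^sub>R (1, 0, 0) + ((- y\<^sup>2 / 12) * q k) *\<^sub>R act_jet w 1 x + ((- y\<^sup>2 / 12) * q k) *\<^sub>R act_jet (- w) 1 x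
       + q k *\<^sub>R ?R w 0 x + q k *\<^sub>R ?R (- w) 0 x)"
    by (intro approximable_add 1 2 3 w w')
  then have "approximable n (?q * (1 + y\<^sup>2 / 6) / 2 + ?q * (y\<^sup>2 / 12) / 4 + ?q * (y\<^sup>2 / 12) / 4 + ?q * y ^ 4 / 24 + ?q * y ^ 4 / 24)
     (\<lambda>k x. q k *\<^sub>R ridge_jet cos (\<lambda>z. - sin z) (\<lambda>z. - cos z) (y *\<^sub>R w) 0 x)"
  proof (rule approximable_cong)
    fix k and x :: "real^'d" assume "x \<in> cube"
    show "q k *\<^sub>R ridge_jet cos (\<lambda>z. - sin z) (\<lambda>z. - cos z) (y *\<^sub>R w) 0 x
        = ((1 + y\<^sup>2 / 6) * q k) *\<^sub>R (1, 0, 0) + ((- y\<^sup>2 / 12) * q k) *\<^sub>R act_jet w 1 x + ((- y\<^sup>2 / 12) * q k) *\<^sub>R act_jet (- w) 1 x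
       + q k *\<^sub>R ?R w 0 x + q k *\<^sub>R ?R (- w) 0 x"
      unfolding cos_ridge_decomposition[OF w(2)[OF \<open>x \<in> cube\<close>]] scaleR_add_right scaleR_scaleR by (simp only: mult.commute)
  qed
  then show ?thesis by (rule approximable_mono) (simp add: field_simps)
qed

lemma geometric_sum_le:
  fixes x :: real
  assumes "x \<ge> 2"
  shows "(\<Sum>j<Suc n. x ^ j) \<le> 2 * x ^ n"
proof (induction n)
  case (Suc n)
  have "(\<Sum>j<Suc (Suc n). x ^ j) \<le> 2 * x ^ n + x ^ Suc n" using Suc by simp
  also have "2 * x ^ n \<le> x ^ Suc n" using assms by (simp add: mult_right_mono)
  finally show ?case by simp
qed simp

text \<open>All \<open>n\<close> components share the ridge functions of one frequency. With
  \<open>y = freq_sum k\<close>, their coefficients have norm at most twice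
  \<open>y ^ (2 * n - 2)\<close> times \<open>\<bar>c k\<bar>\<close> when \<open>y\<close> is
  positive, and a cosine costs at most half of \<open>y ^ 4\<close>, so the budget is within the
  Barron weight with constant exactly 1. Frequency zero is a mere constant and is treated
  apart.\<close>

lemma approximable_frequency:
  fixes c :: "nat^'d \<Rightarrow> real" and k :: "nat^'d"
  assumes n: "n \<ge> 1" and s: "2 * n + 2 \<le> s"
  shows "approximable n (barron_weight s k * \<bar>c k\<bar>) (\<lambda>j x. lap_coeff c j k *\<^sub>R cos_jet k x)"
proof -
  let ?y = "freq_sum k" and ?q = "\<lambda>j. lap_coeff c j k"
  have y0: "?y \<ge> 0" by (rule freq_sum_nonneg)
  have qle: "L2_set ?q {..<n} \<le> \<bar>c k\<bar> * (\<Sum>j<n. (?y\<^sup>2) ^ j)"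
  proof -
    have "L2_set ?q {..<n} \<le> (\<Sum>j<n. \<bar>?q j\<bar>)" by (rule L2_set_le_sum_abs)
    also have "\<dots> \<le> (\<Sum>j<n. \<bar>c k\<bar> * (?y\<^sup>2) ^ j)"
    proof (intro sum_mono)
      fix j
      have "\<bar>?q j\<bar> = freq_sq k ^ j * \<bar>c k\<bar>"
        using freq_sq_bounds(1)[of k] by (simp add: lap_coeff_def abs_mult power_abs)
      also have "\<dots> \<le> (?y\<^sup>2) ^ j * \<bar>c k\<bar>" by (intro mult_right_mono power_mono freq_sq_bounds) auto
      finally show "\<bar>?q j\<bar> \<le> \<bar>c k\<bar> * (?y\<^sup>2) ^ j" by (simp add: mult.commute)
    qed
    finally show ?thesis by (simp add: sum_distrib_left)
  qed
  show ?thesis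
  proof (cases "?y = 0")
    case True
    have f0: "freq A k = 0" for A using norm_freq[of A k] True by simp
    have r: "ridge_jet cos (\<lambda>z. - sin z) (\<lambda>z. - cos z) (0 :: real^'d) 0 x = (1, 0, 0)" for x
      unfolding ridge_jet_def by (simp add: vec_eq_iff)
    have "cos_jet k x = (1, 0, 0)" for x :: "real^'d"
      unfolding cos_jet_def f0 r by (simp add: sum_constant_scaleR card_UNIV_set)
    moreover have "approximable n (barron_weight s k * \<bar>c k\<bar>) (\<lambda>j x. ?q j *\<^sub>R (1, 0 :: real^'d, 0 :: real^'d))"
    proof (rule approximable_const)
      have "(\<Sum>j<n. (0::real) ^ j) = 1"
        using n by (cases n) (simp_all add: sum.lessThan_Suc_shift del: sum.lessThan_Suc)
      then have "L2_set ?q {..<n} \<le> \<bar>c k\<bar>" using qle True by simp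
      moreover have "\<bar>c k\<bar> \<le> 2 * (barron_weight s k * \<bar>c k\<bar>)"
      proof -
        have "1 * \<bar>c k\<bar> \<le> (2 * barron_weight s k) * \<bar>c k\<bar>"
          using y0 by (intro mult_right_mono) (simp_all add: barron_weight_eq)
        then show ?thesis by (simp only: mult.assoc mult_1)
      qed
      ultimately show "L2_set ?q {..<n} \<le> 2 * (barron_weight s k * \<bar>c k\<bar>)" by linarith
    qed (rule barron_weight_nonneg)
    ultimately show ?thesis by simp
  next
    case False
    obtain n' where n': "n = Suc n'" using n by (cases n) auto
    \<comment> \<open>A nonzero frequency has integer entries, so its \<open>freq_sum\<close> is at
      least pi. Hence powers of \<open>?y\<close> squared grow by a factor of at least 9 and lower
      powers are dominated by the top one.\<close>
    have y3: "?y \<ge> 3"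
    proof -
      have "(\<Sum>i\<in>UNIV. k $ i) \<noteq> 0"
      proof
        assume "(\<Sum>i\<in>UNIV. k $ i) = 0"
        then have "k $ i = 0" for i by simp
        then show False using False by (simp add: freq_sum_def)
      qed
      then have "1 \<le> real (\<Sum>i\<in>UNIV. k $ i)" by linarith
      then have "pi * 1 \<le> pi * (\<Sum>i\<in>UNIV. real (k $ i))" by (intro mult_left_mono) auto
      then show ?thesis using pi_gt3 unfolding freq_sum_def by linarith
    qed
    let ?D = "L2_set ?q {..<n} * (1/2 + ?y\<^sup>2 / 8 + ?y ^ 4 / 12)"
    let ?R = "ridge_jet cos (\<lambda>z. - sin z) (\<lambda>z. - cos z) :: real^'d \<Rightarrow> real \<Rightarrow> real^'d \<Rightarrow> 'd jet"
    have "approximable n (\<Sum>A\<in>(UNIV :: 'd set set). ?D / 2 ^ CARD('d)) (\<lambda>j x. \<Sum>A\<in>UNIV. ((1 / 2 ^ CARD('d)) * ?q j) *\<^sub>R ?R (freq A k) 0 x)"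
    proof (rule approximable_sum)
      fix A :: "'d set"
      let ?w = "(1 / ?y) *\<^sub>R freq A k"
      have "approximable n (L2_set (\<lambda>j. (1 / 2 ^ CARD('d)) * ?q j) {..<n} * (1/2 + ?y\<^sup>2 / 8 + ?y ^ 4 / 12))
          (\<lambda>j x. ((1 / 2 ^ CARD('d)) * ?q j) *\<^sub>R ?R (?y *\<^sub>R ?w) 0 x)"
      proof (rule approximable_cos)
        show "?y > 0" using y3 by simp
        show "norm ?w \<le> 1" using norm_freq[of A k] y3 by (simp add: divide_le_eq)
        fix x :: "real^'d" assume x: "x \<in> cube"
        have "\<bar>freq A k \<bullet> x\<bar> \<le> (\<Sum>i\<in>UNIV. \<bar>freq A k $ i * x $ i\<bar>)"
          unfolding inner_vec_def inner_real_def by (rule sum_abs)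
        also have "\<dots> \<le> (\<Sum>i\<in>UNIV. pi * real (k $ i))"
          using x by (intro sum_mono) (auto simp: freq_def abs_mult mem_cube mult_left_le)
        finally have "\<bar>freq A k \<bullet> x\<bar> \<le> ?y" by (simp add: freq_sum_def sum_distrib_left)
        then show "\<bar>?w \<bullet> x\<bar> \<le> 1" using y3 by (simp add: abs_mult divide_le_eq)
      qed
      then show "approximable n (?D / 2 ^ CARD('d)) (\<lambda>j x. ((1 / 2 ^ CARD('d)) * ?q j) *\<^sub>R ?R (freq A k) 0 x)"
        unfolding L2_set_cmult using y3 by simp
    qed simp
    then have "approximable n ?D (\<lambda>j x. ?q j *\<^sub>R cos_jet k x)"
      by (simp add: cos_jet_def card_UNIV_set scaleR_sum_right mult.commute)
    moreover have "?D \<le> barron_weight s k * \<bar>c k\<bar>"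
    proof -
      have y2: "?y\<^sup>2 \<ge> 9" using power_mono[OF y3, of 2] by simp
      have y4: "?y ^ 4 = ?y\<^sup>2 * ?y\<^sup>2" by (simp add: power4_eq_xxxx power2_eq_square)
      have p: "1 + ?y\<^sup>2 / 4 + ?y ^ 4 / 6 \<le> ?y ^ 4"
      proof -
        have "1 + z / 4 + z * z / 6 \<le> z * z" if "9 \<le> z" for z :: real
          using mult_left_mono[OF that, of z] that by linarith
        then show ?thesis unfolding y4 using y2 .
      qed
      have "?D \<le> (\<bar>c k\<bar> * (2 * (?y\<^sup>2) ^ n')) * (1/2 + ?y\<^sup>2 / 8 + ?y ^ 4 / 12)"
      proof (intro mult_right_mono order_trans[OF qle] mult_left_mono)
        show "(\<Sum>j<n. (?y\<^sup>2) ^ j) \<le> 2 * (?y\<^sup>2) ^ n'" unfolding n' using y2 by (intro geometric_sum_le) simp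
      qed (use y0 in auto)
      also have "\<dots> = (\<bar>c k\<bar> * (?y\<^sup>2) ^ n') * (1 + ?y\<^sup>2 / 4 + ?y ^ 4 / 6)"
      proof -
        have "(a * (2 * p)) * (1/2 + z / 8 + w / 12) = (a * p) * (1 + z / 4 + w / 6)" for a p z w :: real
          by (simp add: algebra_simps)
        then show ?thesis .
      qed
      also have "\<dots> \<le> (\<bar>c k\<bar> * (?y\<^sup>2) ^ n') * ?y ^ 4" by (intro mult_left_mono p) auto
      also have "\<dots> = \<bar>c k\<bar> * ?y ^ (2 * n' + 4)" by (simp add: power_add power_mult)
      also have "\<dots> \<le> \<bar>c k\<bar> * (1 + ?y ^ s)"
        using s n' y0 by (intro mult_left_mono power_le_one_plus) auto
      finally show ?thesis by (simp add: barron_weight_eq mult.commute)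
    qed
    ultimately show ?thesis by (rule approximable_mono)
  qed
qed

text \<open>The budgets of the frequencies sum to at most the Barron norm, while the partial sums of
  the jets converge uniformly; one truncation works for all \<open>n\<close> components.\<close>

lemma approximable_barron:
  fixes u :: "real^'d \<Rightarrow> real"
  assumes n: "n \<ge> 1" and s: "2 * n + 2 \<le> s" and u: "u \<in> barron_space s"
  shows "approximable n (barron_norm s u) (barron_jet u)"
proof (rule approximable_limit)
  fix \<epsilon> :: real assume \<epsilon>: "\<epsilon> > 0"
  let ?c = "cos_coeff u" and ?e = "enum_freq :: nat \<Rightarrow> nat^'d"
  have c: "(\<lambda>k. barron_weight s k * \<bar>?c k\<bar>) summable_on UNIV"
    using u by (simp add: barron_space_def)
  have nn: "0 \<le> barron_weight s k * \<bar>?c k\<bar>" for k by (rule barron_weight_nonneg)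
  note sb = summable_enum_freq[OF c nn]
  have "\<forall>\<^sub>F P in sequentially. \<forall>x. norm (barron_jet u j x - (\<Sum>m<P. lap_coeff ?c j (?e m) *\<^sub>R cos_jet (?e m) x)) \<le> \<epsilon>" if j: "j < n" for j
  proof -
    have js: "2 * j + 2 \<le> s" using j s by simp
    let ?M = "\<lambda>m. jet_weight (?e m) * \<bar>lap_coeff ?c j (?e m)\<bar>"
    have M: "norm (lap_coeff ?c j (?e m) *\<^sub>R cos_jet (?e m) x) \<le> ?M m" for m and x :: "real^'d"
      using mult_right_mono[OF norm_cos_jet[of "?e m" x], of "\<bar>lap_coeff ?c j (?e m)\<bar>"]
      by (simp add: jet_weight_def mult.commute)
    have sM: "summable ?M"
    proof (intro summable_enum_freq[OF summable_lap_coeff[OF c js]])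
      show "0 \<le> jet_weight k * \<bar>lap_coeff ?c j k\<bar>" for k using jet_weight_ge_1[of k] by simp
    qed
    have "uniform_limit UNIV (\<lambda>P x. \<Sum>m<P. lap_coeff ?c j (?e m) *\<^sub>R cos_jet (?e m) x) (barron_jet u j) sequentially"
      using summable_jet_uniform(1)[where M = ?M and J = "\<lambda>m x. lap_coeff ?c j (?e m) *\<^sub>R cos_jet (?e m) x", OF M sM]
      unfolding barron_jet_def cos_series_def[abs_def] .
    from uniform_limitD[OF this \<epsilon>] show ?thesis
      by eventually_elim (auto simp: dist_norm norm_minus_commute intro: less_imp_le)
  qed
  then have "\<forall>\<^sub>F P in sequentially. \<forall>j\<in>{..<n}. \<forall>x. norm (barron_jet u j x - (\<Sum>m<P. lap_coeff ?c j (?e m) *\<^sub>R cos_jet (?e m) x)) \<le> \<epsilon>"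
    by (intro eventually_ball_finite) auto
  then obtain P where P: "\<forall>j\<in>{..<n}. \<forall>x. norm (barron_jet u j x - (\<Sum>m<P. lap_coeff ?c j (?e m) *\<^sub>R cos_jet (?e m) x)) \<le> \<epsilon>"
    unfolding eventually_sequentially by blast
  have "approximable n (\<Sum>m<P. barron_weight s (?e m) * \<bar>?c (?e m)\<bar>) (\<lambda>j x. \<Sum>m<P. lap_coeff ?c j (?e m) *\<^sub>R cos_jet (?e m) x)"
    by (intro approximable_sum approximable_frequency n s) simp
  moreover have "(\<Sum>m<P. barron_weight s (?e m) * \<bar>?c (?e m)\<bar>) \<le> barron_norm s u"
    unfolding barron_norm_def sb(2)[symmetric] by (intro sum_le_suminf sb(1)) (auto intro: barron_weight_nonneg)
  ultimately have "approximable n (barron_norm s u) (\<lambda>j x. \<Sum>m<P. lap_coeff ?c j (?e m) *\<^sub>R cos_jet (?e m) x)"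
    by (rule approximable_mono)
  with P show "\<exists>J'. approximable n (barron_norm s u) J' \<and> (\<forall>k<n. \<forall>x\<in>cube. norm (barron_jet u k x - J' k x) \<le> \<epsilon>)"
    by blast
qed

section \<open>Maurey's argument\<close>

text \<open>At each point the average equals the square of \<open>a\<close> plus the variance of the
  \<open>h i\<close>, because the cross term has mean zero. The variance is at most
  \<open>\<kappa>\<close> squared.\<close>

lemma variance_step:
  fixes a :: "real^'d \<Rightarrow> real" and h :: "'i \<Rightarrow> real^'d \<Rightarrow> real"
  assumes I: "finite I" and p: "\<And>i. i \<in> I \<Longrightarrow> 0 \<le> p i" "(\<Sum>i\<in>I. p i) = 1"
    and c: "continuous_on UNIV a" "\<And>i. i \<in> I \<Longrightarrow> continuous_on UNIV (h i)"
    and \<kappa>: "\<And>i x. i \<in> I \<Longrightarrow> x \<in> cube \<Longrightarrow> \<bar>h i x\<bar> \<le> \<kappa>"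
  shows "(\<Sum>i\<in>I. p i * (\<integral>x. (a x + h i x - (\<Sum>j\<in>I. p j * h j x))\<^sup>2 \<partial>cube_measure))
     \<le> (\<integral>x. (a x)\<^sup>2 \<partial>cube_measure) + \<kappa>\<^sup>2"
proof -
  interpret prob_space "cube_measure :: (real^'d) measure" by (rule prob_space_cube)
  let ?m = "\<lambda>x. \<Sum>j\<in>I. p j * h j x"
  have cm: "continuous_on UNIV ?m" by (intro continuous_intros c)
  have "(\<Sum>i\<in>I. p i * (\<integral>x. (a x + h i x - ?m x)\<^sup>2 \<partial>cube_measure)) = (\<integral>x. (\<Sum>i\<in>I. p i * (a x + h i x - ?m x)\<^sup>2) \<partial>cube_measure)"
    by (subst Bochner_Integration.integral_sum) (auto intro!: integrable_cube_continuous continuous_intros c cm)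
  also have "\<dots> \<le> (\<integral>x. (a x)\<^sup>2 + \<kappa>\<^sup>2 \<partial>cube_measure)"
  proof (rule integral_cube_mono)
    fix x :: "real^'d" assume x: "x \<in> cube"
    have sq: "(\<Sum>i\<in>I. p i * (b + h i x)\<^sup>2) = (\<Sum>i\<in>I. p i) * b\<^sup>2 + 2 * b * (\<Sum>i\<in>I. p i * h i x) + (\<Sum>i\<in>I. p i * (h i x)\<^sup>2)" for b
      by (simp add: sum_distrib_left sum_distrib_right sum.distrib[symmetric] power2_eq_square algebra_simps)
    have "(\<Sum>i\<in>I. p i * (a x + h i x - ?m x)\<^sup>2) = (\<Sum>i\<in>I. p i * ((a x - ?m x) + h i x)\<^sup>2)"
      by (simp add: algebra_simps)
    also have "\<dots> = (\<Sum>i\<in>I. p i) * (a x - ?m x)\<^sup>2 + 2 * (a x - ?m x) * (\<Sum>i\<in>I. p i * h i x) + (\<Sum>i\<in>I. p i * (h i x)\<^sup>2)"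
      by (rule sq)
    also have "\<dots> = (a x)\<^sup>2 - (?m x)\<^sup>2 + (\<Sum>i\<in>I. p i * (h i x)\<^sup>2)"
      unfolding p(2) by (simp add: power2_eq_square algebra_simps)
    also have "(\<Sum>i\<in>I. p i * (h i x)\<^sup>2) \<le> (\<Sum>i\<in>I. p i * \<kappa>\<^sup>2)"
      using \<kappa>[OF _ x] p(1) by (intro sum_mono mult_left_mono) (auto simp: abs_le_square_iff[symmetric] intro: order_trans[OF _ abs_ge_self])
    also have "\<dots> = \<kappa>\<^sup>2" using p(2) by (simp flip: sum_distrib_right)
    finally show "(\<Sum>i\<in>I. p i * (a x + h i x - ?m x)\<^sup>2) \<le> (a x)\<^sup>2 + \<kappa>\<^sup>2"
      using zero_le_power2[of "?m x"] by linarith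
  qed (auto intro!: continuous_intros c cm)
  also have "\<dots> = (\<integral>x. (a x)\<^sup>2 \<partial>cube_measure) + \<kappa>\<^sup>2"
    by (subst Bochner_Integration.integral_add) (auto intro!: integrable_cube_continuous continuous_intros c simp: prob_space[simplified])
  finally show ?thesis .
qed

text \<open>The squared Neumann mean of \<open>jet_loss\<close> is replaced by the larger
  \<open>val_sq (e 0)\<close>. The result is, for every boundary condition, an integral of squares
  of pointwise linear expressions, which is the form that \<open>variance_step\<close>
  handles.\<close>

definition jet_energy :: "bc \<Rightarrow> nat \<Rightarrow> (nat \<Rightarrow> real^'d \<Rightarrow> 'd jet) \<Rightarrow> real" where
  "jet_energy \<alpha> n e = (\<Sum>k<n. residual_sq n e k) + (\<Sum>k<n. bc_sq \<alpha> (e k)) + val_sq (e 0)"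

lemma jet_loss_le_energy:
  assumes "C2_jet (e 0)"
  shows "jet_loss \<alpha> n e \<le> jet_energy \<alpha> n e"
  unfolding jet_loss_def jet_energy_def val_sq_def
  using cube_integral_square_le[OF C2_continuous(2)[OF assms]] by (auto simp: sq_nonneg(1)[unfolded val_sq_def])

lemma lap_linear: "lap (j + j') = lap j + lap j'" "lap (j - j') = lap j - lap j'" "lap (r *\<^sub>R j) = r * lap j" "lap (\<Sum>i\<in>I. f i) = (\<Sum>i\<in>I. lap (f i))"
proof -
  show 1: "lap (j + j') = lap j + lap j'" for j j' by (simp add: lap_def sum.distrib)
  show 2: "lap (r *\<^sub>R j) = r * lap j" for r j by (simp add: lap_def sum_distrib_left)
  show "lap (j - j') = lap j - lap j'" by (simp add: lap_def sum_subtractf)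
  have "lap 0 = 0" by (simp add: lap_def)
  then show "lap (\<Sum>i\<in>I. f i) = (\<Sum>i\<in>I. lap (f i))"
    by (induction I rule: infinite_finite_induct) (simp_all add: 1)
qed

lemma bc_jet_linear: "bc_jet \<alpha> i s (j + j') = bc_jet \<alpha> i s j + bc_jet \<alpha> i s j'" "bc_jet \<alpha> i s (j - j') = bc_jet \<alpha> i s j - bc_jet \<alpha> i s j'"
    "bc_jet \<alpha> i s (r *\<^sub>R j) = r * bc_jet \<alpha> i s j" "bc_jet \<alpha> i s (\<Sum>l\<in>I. f l) = (\<Sum>l\<in>I. bc_jet \<alpha> i s (f l))"
proof -
  show 1: "bc_jet \<alpha> i s (j + j') = bc_jet \<alpha> i s j + bc_jet \<alpha> i s j'" for j j' by (cases \<alpha>) (simp_all add: algebra_simps)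
  show "bc_jet \<alpha> i s (j - j') = bc_jet \<alpha> i s j - bc_jet \<alpha> i s j'" by (cases \<alpha>) (simp_all add: algebra_simps)
  show "bc_jet \<alpha> i s (r *\<^sub>R j) = r * bc_jet \<alpha> i s j" by (cases \<alpha>) (simp_all add: algebra_simps)
  have "bc_jet \<alpha> i s 0 = 0" by (cases \<alpha>) simp_all
  then show "bc_jet \<alpha> i s (\<Sum>l\<in>I. f l) = (\<Sum>l\<in>I. bc_jet \<alpha> i s (f l))"
    by (induction I rule: infinite_finite_induct) (simp_all add: 1)
qed

lemma lap_bound: "\<bar>lap (j :: 'd::finite jet)\<bar> \<le> real CARD('d) * norm j"
proof -
  have "\<bar>lap j\<bar> \<le> (\<Sum>i\<in>UNIV. \<bar>hes j $ i\<bar>)" unfolding lap_def by (rule sum_abs)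
  also have "\<dots> \<le> (\<Sum>i\<in>(UNIV :: 'd set). norm j)"
    by (intro sum_mono order_trans[OF component_le_norm_cart norm_component_jet(2)])
  finally show ?thesis by simp
qed

lemma bc_jet_bound:
  assumes "s \<in> {0,1}"
  shows "\<bar>bc_jet \<alpha> i s (j :: 'd::finite jet)\<bar> \<le> 2 * norm j"
proof -
  have v: "\<bar>val j\<bar> \<le> norm j" by (rule norm_component_jet)
  have "\<bar>(2 * s - 1) * grd j $ i\<bar> = \<bar>grd j $ i\<bar>" using assms by auto
  also have "\<dots> \<le> norm j" by (rule order_trans[OF component_le_norm_cart norm_component_jet(1)])
  finally show ?thesis using v by (cases \<alpha>) auto
qed

lemma jet_energy_le:
  fixes e :: "nat \<Rightarrow> real^'d \<Rightarrow> 'd jet"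
  assumes e: "\<And>k. C2_jet (e k)" and \<epsilon>: "\<And>k x. k < n \<Longrightarrow> x \<in> cube \<Longrightarrow> norm (e k x) \<le> \<epsilon>" and n: "n \<ge> 1"
  shows "jet_energy \<alpha> n e \<le> (real n * (real CARD('d) + 1)\<^sup>2 + real n * (2 * real CARD('d)) * 4 + 1) * \<epsilon>\<^sup>2"
proof -
  interpret prob_space "cube_measure :: (real^'d) measure" by (rule prob_space_cube)
  let ?d = "real CARD('d)"
  have bd: "(\<integral>x. (f x)\<^sup>2 \<partial>cube_measure) \<le> (c * \<epsilon>)\<^sup>2" if "continuous_on UNIV f" "\<And>x. x \<in> cube \<Longrightarrow> \<bar>f x\<bar> \<le> c * \<epsilon>" for f :: "real^'d \<Rightarrow> real" and c
  proof -
    have "(\<integral>x. (f x)\<^sup>2 \<partial>cube_measure) \<le> (\<integral>x. (c * \<epsilon>)\<^sup>2 \<partial>(cube_measure :: (real^'d) measure))"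
      using that by (intro integral_cube_mono continuous_intros) (auto simp: abs_le_square_iff[symmetric] intro: order_trans[OF _ abs_ge_self])
    then show ?thesis by (simp add: prob_space[simplified])
  qed
  have "residual_sq n e k \<le> ((?d + 1) * \<epsilon>)\<^sup>2" if k: "k < n" for k
    unfolding residual_sq_def
  proof (rule bd)
    show "continuous_on UNIV (residual n e k)"
      unfolding residual_def by (cases "Suc k < n") (auto intro!: continuous_intros C2_continuous e)
    fix x :: "real^'d" assume x: "x \<in> cube"
    have "\<bar>lap (e k x)\<bar> \<le> ?d * \<epsilon>"
      using lap_bound[of "e k x"] mult_left_mono[OF \<epsilon>[OF k x], of ?d] by linarith
    moreover have "\<bar>if Suc k < n then val (e (Suc k) x) else 0\<bar> \<le> \<epsilon>"
      using \<epsilon>[of "Suc k" x] order_trans[OF norm_ge_zero \<epsilon>[OF k x]] x norm_component_jet(3)[of "e (Suc k) x"] by auto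
    ultimately show "\<bar>residual n e k x\<bar> \<le> (?d + 1) * \<epsilon>"
      unfolding residual_def using abs_triangle_ineq4 by (simp add: distrib_right)
  qed
  then have "(\<Sum>k<n. residual_sq n e k) \<le> (\<Sum>k<n. ((?d + 1) * \<epsilon>)\<^sup>2)" by (intro sum_mono) auto
  then have 1: "(\<Sum>k<n. residual_sq n e k) \<le> real n * (?d + 1)\<^sup>2 * \<epsilon>\<^sup>2" by (simp add: power_mult_distrib mult.assoc)
  have "bc_sq \<alpha> (e k) \<le> 2 * ?d * (2 * \<epsilon>)\<^sup>2" if k: "k < n" for k
  proof -
    have "bc_sq \<alpha> (e k) \<le> face_integral (\<lambda>(i :: 'd) s y. (2 * \<epsilon>)\<^sup>2)"
      unfolding bc_sq_def
    proof (rule face_integral_mono)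
      fix i s and y :: "real^'d" assume s: "s \<in> {0,1::real}" and y: "y \<in> cube"
      have "\<bar>bc_jet \<alpha> i s (e k y)\<bar> \<le> \<bar>2 * \<epsilon>\<bar>"
        using bc_jet_bound[OF s, of \<alpha> i "e k y"] \<epsilon>[OF k y] by linarith
      then show "(bc_jet \<alpha> i s (e k y))\<^sup>2 \<le> (2 * \<epsilon>)\<^sup>2" by (simp only: abs_le_square_iff)
    qed (intro continuous_intros e)+
    then show ?thesis by (simp add: face_integral_const)
  qed
  then have "(\<Sum>k<n. bc_sq \<alpha> (e k)) \<le> (\<Sum>k<n. 2 * ?d * (2 * \<epsilon>)\<^sup>2)" by (intro sum_mono) auto
  then have 2: "(\<Sum>k<n. bc_sq \<alpha> (e k)) \<le> real n * (2 * ?d) * 4 * \<epsilon>\<^sup>2" by (simp add: power_mult_distrib mult_ac)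
  have 3: "val_sq (e 0) \<le> (1 * \<epsilon>)\<^sup>2"
    unfolding val_sq_def
  proof (rule bd)
    show "\<bar>val (e 0 x)\<bar> \<le> 1 * \<epsilon>" if "x \<in> cube" for x
      using order_trans[OF norm_component_jet(3) \<epsilon>[of 0 x]] n that by simp
  qed (rule C2_continuous(2)[OF e])
  show ?thesis using 1 2 3 unfolding jet_energy_def by (simp add: algebra_simps)
qed

text \<open>The energy of jets of norm at most 1: the summands come from the interior residuals,
  from the \<open>2 * d\<close> faces with a boundary expression of size at most 2, and from the
  value term.\<close>

definition energy_const :: "nat \<Rightarrow> nat \<Rightarrow> real" where
  "energy_const n d = real n * (real d + 1)\<^sup>2 + real n * (2 * real d) * 4 + 1"

lemma energy_const_pos: "0 < energy_const n d"
  unfolding energy_const_def by (intro add_nonneg_pos add_nonneg_nonneg mult_nonneg_nonneg) auto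

text \<open>Averaging over the next sampled atom \<open>i\<close> kills the cross term, so some \<open>i\<close> increases the
  energy of the accumulated error by at most the energy bound of a single atom.\<close>

lemma energy_step:
  fixes e :: "nat \<Rightarrow> real^'d \<Rightarrow> 'd jet" and E :: "'i \<Rightarrow> nat \<Rightarrow> real^'d \<Rightarrow> 'd jet"
  assumes I: "finite I" and p: "\<And>i. i \<in> I \<Longrightarrow> 0 \<le> p i" "(\<Sum>i\<in>I. p i) = 1"
    and e: "\<And>k. C2_jet (e k)" and E: "\<And>i k. i \<in> I \<Longrightarrow> C2_jet (E i k)"
    and \<kappa>: "\<And>i k x. i \<in> I \<Longrightarrow> k < n \<Longrightarrow> x \<in> cube \<Longrightarrow> norm (E i k x) \<le> \<kappa>" and n: "n \<ge> 1"
  shows "\<exists>i\<in>I. jet_energy \<alpha> n (\<lambda>k x. e k x + E i k x - (\<Sum>j\<in>I. p j *\<^sub>R E j k x)) \<le> jet_energy \<alpha> n e + energy_const n CARD('d) * \<kappa>\<^sup>2"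
proof -
  let ?d = "real CARD('d)"
  let ?e = "\<lambda>i k x. e k x + E i k x - (\<Sum>j\<in>I. p j *\<^sub>R E j k x)"
  have r: "residual n (?e i) k x = residual n e k x + residual n (E i) k x - (\<Sum>j\<in>I. p j * residual n (E j) k x)" for i k x
    by (simp add: residual_def lap_linear fst_sum sum_subtractf right_diff_distrib)
  have cr: "continuous_on UNIV (residual n f k)" if "\<And>k. C2_jet (f k)" for f and k
    unfolding residual_def by (cases "Suc k < n") (auto intro!: continuous_intros C2_continuous that)
  have nE: "I \<noteq> {}" using p(2) by auto
  have \<kappa>0: "\<kappa> \<ge> 0" using nE \<kappa>[of _ 0 0] n by (auto simp: mem_cube intro: order_trans[OF norm_ge_zero])
  have 1: "(\<Sum>i\<in>I. p i * residual_sq n (?e i) k) \<le> residual_sq n e k + ((?d + 1) * \<kappa>)\<^sup>2" if k: "k < n" for k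
    unfolding residual_sq_def r
  proof (rule variance_step[OF I p cr[OF e] cr[OF E]])
    fix i x assume i: "i \<in> I" and x: "x \<in> (cube :: (real^'d) set)"
    have "\<bar>lap (E i k x)\<bar> \<le> ?d * \<kappa>"
      using lap_bound[of "E i k x"] mult_left_mono[OF \<kappa>[OF i k x], of ?d] by linarith
    moreover have "\<bar>if Suc k < n then val (E i (Suc k) x) else 0\<bar> \<le> \<kappa>"
      using \<kappa>[OF i, of "Suc k" x] \<kappa>0 x norm_component_jet(3)[of "E i (Suc k) x"] by auto
    ultimately show "\<bar>residual n (E i) k x\<bar> \<le> (?d + 1) * \<kappa>"
      unfolding residual_def using abs_triangle_ineq4 by (simp add: distrib_right)
  qed
  have cb: "continuous_on UNIV (\<lambda>x. bc_jet \<alpha> i s (f (upd i s x)))" if "C2_jet f" for f and i :: 'd and s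
    by (intro continuous_on_compose2[OF continuous_bc_jet[OF that]] continuous_intros) auto
  have 2: "(\<Sum>i\<in>I. p i * bc_sq \<alpha> (?e i k)) \<le> bc_sq \<alpha> (e k) + 2 * ?d * (2 * \<kappa>)\<^sup>2" if k: "k < n" for k
  proof -
    have "(\<Sum>i\<in>I. p i * bc_sq \<alpha> (?e i k)) = (\<Sum>a\<in>UNIV. \<Sum>s\<in>{0,1}. \<Sum>i\<in>I. p i * (\<integral>x. (bc_jet \<alpha> a s (?e i k (upd a s x)))\<^sup>2 \<partial>cube_measure))"
      unfolding bc_sq_def face_integral_def sum_distrib_left
      by (subst sum.swap, intro sum.cong refl, subst sum.swap, rule refl)
    also have "\<dots> \<le> (\<Sum>a\<in>(UNIV :: 'd set). \<Sum>s\<in>{0,1}. (\<integral>x. (bc_jet \<alpha> a s (e k (upd a s x)))\<^sup>2 \<partial>cube_measure) + (2 * \<kappa>)\<^sup>2)"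
      unfolding bc_jet_linear
    proof (intro sum_mono variance_step[OF I p cb[OF e] cb[OF E]])
      fix a :: 'd and s :: real and i x assume s: "s \<in> {0,1}" and i: "i \<in> I" and x: "x \<in> (cube :: (real^'d) set)"
      have "upd a s x \<in> cube" using s x by (intro upd_in_cube) auto
      then show "\<bar>bc_jet \<alpha> a s (E i k (upd a s x))\<bar> \<le> 2 * \<kappa>"
        using bc_jet_bound[OF s, of \<alpha> a "E i k (upd a s x)"] \<kappa>[OF i k] by force
    qed
    also have "\<dots> = bc_sq \<alpha> (e k) + 2 * ?d * (2 * \<kappa>)\<^sup>2"
      unfolding bc_sq_def face_integral_def by (simp add: sum.distrib)
    finally show ?thesis .
  qed
  have 3: "(\<Sum>i\<in>I. p i * val_sq (?e i 0)) \<le> val_sq (e 0) + \<kappa>\<^sup>2"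
    unfolding val_sq_def fst_add fst_diff fst_sum fst_scaleR real_scaleR_def
  proof (rule variance_step[OF I p C2_continuous(2)[OF e] C2_continuous(2)[OF E]])
    show "\<bar>val (E i 0 x)\<bar> \<le> \<kappa>" if "i \<in> I" "x \<in> cube" for i x
      using order_trans[OF norm_component_jet(3) \<kappa>[of i 0 x]] n that by simp
  qed
  have "(\<Sum>i\<in>I. p i * jet_energy \<alpha> n (?e i)) = (\<Sum>k<n. \<Sum>i\<in>I. p i * residual_sq n (?e i) k) + (\<Sum>k<n. \<Sum>i\<in>I. p i * bc_sq \<alpha> (?e i k)) + (\<Sum>i\<in>I. p i * val_sq (?e i 0))"
    unfolding jet_energy_def distrib_left sum.distrib sum_distrib_left
    by (subst (1 2) sum.swap[of _ _ I]) (rule refl)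
  also have "\<dots> \<le> (\<Sum>k<n. residual_sq n e k + ((?d + 1) * \<kappa>)\<^sup>2) + (\<Sum>k<n. bc_sq \<alpha> (e k) + 2 * ?d * (2 * \<kappa>)\<^sup>2) + (val_sq (e 0) + \<kappa>\<^sup>2)"
    by (intro add_mono sum_mono 1 2 3) auto
  also have "\<dots> = jet_energy \<alpha> n e + energy_const n CARD('d) * \<kappa>\<^sup>2"
    unfolding power_mult_distrib[of "?d + 1" \<kappa>]
    by (simp add: jet_energy_def energy_const_def sum.distrib power_mult_distrib algebra_simps)
  finally have le: "(\<Sum>i\<in>I. p i * jet_energy \<alpha> n (?e i)) \<le> jet_energy \<alpha> n e + energy_const n CARD('d) * \<kappa>\<^sup>2" .
  show ?thesis
  proof (rule ccontr)
    let ?X = "jet_energy \<alpha> n e + energy_const n CARD('d) * \<kappa>\<^sup>2"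
    assume "\<not> ?thesis"
    then have gt: "?X < jet_energy \<alpha> n (?e i)" if "i \<in> I" for i using that by (auto simp: not_le)
    \<comment> \<open>The strict inequality survives averaging only if some atom has positive
      weight; the weights sum to 1, so there is one.\<close>
    obtain i0 where i0: "i0 \<in> I" "p i0 > 0"
      using p sum_nonpos[of I p] by (metis le_less less_irrefl not_one_le_zero zero_less_one sum.neutral)
    have "(\<Sum>i\<in>I. p i * ?X) < (\<Sum>i\<in>I. p i * jet_energy \<alpha> n (?e i))"
    proof (intro sum_strict_mono_ex1 I ballI)
      show "p i * ?X \<le> p i * jet_energy \<alpha> n (?e i)" if "i \<in> I" for i
        using gt[OF that] p(1)[OF that] by (intro mult_left_mono) auto
      show "\<exists>i\<in>I. p i * ?X < p i * jet_energy \<alpha> n (?e i)"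
        using i0 gt[OF i0(1)] by (intro bexI[of _ i0] mult_strict_left_mono)
    qed
    then show False using le p(2) by (simp flip: sum_distrib_right)
  qed
qed

lemma jet_energy_cong:
  assumes "\<And>k x. k < n \<Longrightarrow> e k x = e' k x" "n \<ge> 1"
  shows "jet_energy \<alpha> n e = jet_energy \<alpha> n e'"
proof -
  have "residual n e k = residual n e' k" if "k < n" for k
    using assms(1) that by (auto simp: residual_def fun_eq_iff)
  then have "residual_sq n e k = residual_sq n e' k" if "k < n" for k using that by (simp add: residual_sq_def)
  moreover have "e k = e' k" if "k < n" for k using assms(1)[OF that] by auto
  ultimately show ?thesis using assms(2) by (simp add: jet_energy_def)
qed

lemma jet_energy_scaleR: "jet_energy \<alpha> n (\<lambda>k x. r *\<^sub>R e k x) = r\<^sup>2 * jet_energy \<alpha> n e"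
proof -
  have "residual n (\<lambda>k x. r *\<^sub>R e k x) k x = r * residual n e k x" for k x
    by (simp add: residual_def lap_linear right_diff_distrib)
  then show ?thesis
    by (simp add: jet_energy_def residual_sq_def bc_sq_def val_sq_def bc_jet_linear power_mult_distrib face_integral_cmult
        sum_distrib_left distrib_left)
qed

lemma integral_sq_add_le:
  fixes f g :: "real^'d \<Rightarrow> real"
  assumes "continuous_on UNIV f" "continuous_on UNIV g"
  shows "(\<integral>x. (f x + g x)\<^sup>2 \<partial>cube_measure) \<le> 2 * (\<integral>x. (f x)\<^sup>2 \<partial>cube_measure) + 2 * (\<integral>x. (g x)\<^sup>2 \<partial>cube_measure)"
proof -
  have "(\<integral>x. (f x + g x)\<^sup>2 \<partial>cube_measure) \<le> (\<integral>x. 2 * (f x)\<^sup>2 + 2 * (g x)\<^sup>2 \<partial>cube_measure)"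
  proof (rule integral_cube_mono)
    fix x
    show "(f x + g x)\<^sup>2 \<le> 2 * (f x)\<^sup>2 + 2 * (g x)\<^sup>2"
      using zero_le_power2[of "f x - g x"] by (simp add: power2_eq_square algebra_simps)
  qed (intro continuous_intros assms)+
  also have "\<dots> = 2 * (\<integral>x. (f x)\<^sup>2 \<partial>cube_measure) + 2 * (\<integral>x. (g x)\<^sup>2 \<partial>cube_measure)"
    by (subst Bochner_Integration.integral_add) (auto intro!: integrable_cube_continuous continuous_intros assms)
  finally show ?thesis .
qed

lemma jet_energy_add_le:
  fixes e e' :: "nat \<Rightarrow> real^'d \<Rightarrow> 'd jet"
  assumes e: "\<And>k. C2_jet (e k)" and e': "\<And>k. C2_jet (e' k)"
  shows "jet_energy \<alpha> n (\<lambda>k x. e k x + e' k x) \<le> 2 * jet_energy \<alpha> n e + 2 * jet_energy \<alpha> n e'"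
proof -
  have r: "residual n (\<lambda>k x. e k x + e' k x) k x = residual n e k x + residual n e' k x" for k x
    by (simp add: residual_def lap_linear)
  have cr: "continuous_on UNIV (residual n f k)" if "\<And>k. C2_jet (f k)" for f and k
    unfolding residual_def by (cases "Suc k < n") (auto intro!: continuous_intros C2_continuous that)
  have 1: "residual_sq n (\<lambda>k x. e k x + e' k x) k \<le> 2 * residual_sq n e k + 2 * residual_sq n e' k" for k
    unfolding residual_sq_def r by (rule integral_sq_add_le[OF cr[OF e] cr[OF e']])
  have cb: "continuous_on UNIV (\<lambda>x. bc_jet \<alpha> i s (f (upd i s x)))" if "C2_jet f" for f and i :: 'd and s
    by (intro continuous_on_compose2[OF continuous_bc_jet[OF that]] continuous_intros) auto
  have 2: "bc_sq \<alpha> (\<lambda>x. e k x + e' k x) \<le> 2 * bc_sq \<alpha> (e k) + 2 * bc_sq \<alpha> (e' k)" for k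
  proof -
    have "bc_sq \<alpha> (\<lambda>x. e k x + e' k x) \<le> (\<Sum>i\<in>UNIV. \<Sum>s\<in>{0,1}. 2 * (\<integral>x. (bc_jet \<alpha> i s (e k (upd i s x)))\<^sup>2 \<partial>cube_measure) + 2 * (\<integral>x. (bc_jet \<alpha> i s (e' k (upd i s x)))\<^sup>2 \<partial>cube_measure))"
      unfolding bc_sq_def face_integral_def bc_jet_linear by (intro sum_mono integral_sq_add_le cb e e')
    then show ?thesis
      unfolding bc_sq_def face_integral_def by (simp only: sum.distrib sum_distrib_left)
  qed
  have 3: "val_sq (\<lambda>x. e 0 x + e' 0 x) \<le> 2 * val_sq (e 0) + 2 * val_sq (e' 0)"
    unfolding val_sq_def fst_add by (rule integral_sq_add_le[OF C2_continuous(2)[OF e] C2_continuous(2)[OF e']])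
  have "(\<Sum>k<n. residual_sq n (\<lambda>k x. e k x + e' k x) k) \<le> (\<Sum>k<n. 2 * residual_sq n e k + 2 * residual_sq n e' k)"
    "(\<Sum>k<n. bc_sq \<alpha> (\<lambda>x. e k x + e' k x)) \<le> (\<Sum>k<n. 2 * bc_sq \<alpha> (e k) + 2 * bc_sq \<alpha> (e' k))"
    by (intro sum_mono 1 2)+
  with 3 show ?thesis unfolding jet_energy_def distrib_left sum.distrib sum_distrib_left[symmetric] by linarith
qed

text \<open>Atoms are chosen one after another, with repetition, and the accumulated sum is compared
  with \<open>m\<close> times the mean. Its energy grows only linearly in \<open>m\<close>, so
  dividing the sum by \<open>m\<close>, which divides the quadratic energy by m^2, leaves the rate 1
  / m.\<close>

lemma maurey:
  fixes E :: "'i \<Rightarrow> nat \<Rightarrow> real^'d \<Rightarrow> 'd jet"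
  assumes I: "finite I" and p: "\<And>i. i \<in> I \<Longrightarrow> 0 \<le> p i" "(\<Sum>i\<in>I. p i) = 1"
    and E: "\<And>i k. i \<in> I \<Longrightarrow> C2_jet (E i k)"
    and \<kappa>: "\<And>i k x. i \<in> I \<Longrightarrow> k < n \<Longrightarrow> x \<in> cube \<Longrightarrow> norm (E i k x) \<le> \<kappa>" and n: "n \<ge> 1"
  shows "\<exists>f. (\<forall>l<m. f l \<in> I) \<and> jet_energy \<alpha> n (\<lambda>k x. (\<Sum>l<m. E (f l) k x) - real m *\<^sub>R (\<Sum>j\<in>I. p j *\<^sub>R E j k x))
    \<le> real m * (energy_const n CARD('d) * \<kappa>\<^sup>2)"
proof (induction m)
  case 0
  show ?case using jet_energy_scaleR[of \<alpha> n 0 "\<lambda>k (x :: real^'d). 0"] by simp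
next
  case (Suc m)
  then obtain f where f: "\<forall>l<m. f l \<in> I" "jet_energy \<alpha> n (\<lambda>k x. (\<Sum>l<m. E (f l) k x) - real m *\<^sub>R (\<Sum>j\<in>I. p j *\<^sub>R E j k x))
    \<le> real m * (energy_const n CARD('d) * \<kappa>\<^sup>2)" by blast
  let ?e = "\<lambda>k x. (\<Sum>l<m. E (f l) k x) - real m *\<^sub>R (\<Sum>j\<in>I. p j *\<^sub>R E j k x)"
  have "C2_jet (?e k)" for k using f(1) by (intro C2_diff C2_sum C2_scaleR E) auto
  from energy_step[where e = ?e and E = E and I = I and p = p and n = n and \<kappa> = \<kappa> and \<alpha> = \<alpha>, OF I p this E \<kappa> n]
  obtain i where i: "i \<in> I" "jet_energy \<alpha> n (\<lambda>k x. ?e k x + E i k x - (\<Sum>j\<in>I. p j *\<^sub>R E j k x)) \<le> jet_energy \<alpha> n ?e + energy_const n CARD('d) * \<kappa>\<^sup>2"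
    by auto
  let ?f = "f(m := i)"
  have "(\<Sum>l<Suc m. E (?f l) k x) - real (Suc m) *\<^sub>R (\<Sum>j\<in>I. p j *\<^sub>R E j k x) = ?e k x + E i k x - (\<Sum>j\<in>I. p j *\<^sub>R E j k x)" for k x
    by (simp add: scaleR_left_distrib)
  then have "jet_energy \<alpha> n (\<lambda>k x. (\<Sum>l<Suc m. E (?f l) k x) - real (Suc m) *\<^sub>R (\<Sum>j\<in>I. p j *\<^sub>R E j k x)) \<le> real (Suc m) * (energy_const n CARD('d) * \<kappa>\<^sup>2)"
    using i(2) f(2) by (simp only:) (simp add: algebra_simps)
  moreover have "\<forall>l<Suc m. ?f l \<in> I" using f(1) i(1) by (auto simp: less_Suc_eq)
  ultimately show ?case by blast
qed

text \<open>An atom is drawn with probability proportional to the norm of its outer weight and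
  rescaled so that the mean is the given network. The constant part \<open>c\<close> is kept and
  cancels in the difference, so the energy is that of the sampled sum alone.\<close>

lemma width_reduction:
  fixes W :: "nat \<Rightarrow> real^'d"
  assumes net: "net_params n M B c a W b" and m: "m \<ge> 1" and n: "n \<ge> 1"
  shows "\<exists>a' W' b'. net_params n m B c a' W' b' \<and>
    jet_energy \<alpha> n (\<lambda>k x. net_jet c a' W' b' m k x - net_jet c a W b M k x) \<le> energy_const n CARD('d) * (4 * B * act_bound CARD('d))\<^sup>2 / real m"
proof -
  let ?L = "\<lambda>i. L2_set (a i) {..<n}"
  define A where "A = (\<Sum>i<M. ?L i)"
  have A0: "A \<ge> 0" unfolding A_def by (intro sum_nonneg L2_set_nonneg)
  have AB: "A \<le> 4 * B" using net by (simp add: net_params_def A_def)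
  have a0: "a i k = 0" if "?L i = 0" "k < n" for i k using abs_le_L2_set[OF that(2), of "a i"] that(1) by simp
  show ?thesis
  \<comment> \<open>With total weight 0 there is no distribution to sample from, but then all outer
    weights vanish and the network equals its constant part.\<close>
  proof (cases "A = 0")
    case True
    then have L0: "?L i = 0" if "i < M" for i
      using that sum_nonneg_eq_0_iff[of "{..<M}" ?L] by (auto simp: A_def L2_set_nonneg)
    have "net_params n m B c (\<lambda>_ _. 0) (\<lambda>_. 0 :: real^'d) (\<lambda>_. 0)"
      using net A0 AB by (auto simp: net_params_def L2_set_def[of "\<lambda>_. 0"])
    moreover have "jet_energy \<alpha> n (\<lambda>k x. net_jet c (\<lambda>_ _. 0) (\<lambda>_. 0) (\<lambda>_. 0) m k x - net_jet c a W b M k x) = jet_energy \<alpha> n (\<lambda>k x. 0 *\<^sub>R net_jet c a W b M k x)"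
      using a0[OF L0] by (intro jet_energy_cong n) (simp add: net_jet_def zero_prod_def[symmetric])
    moreover have "0 \<le> energy_const n CARD('d) * (4 * B * act_bound CARD('d))\<^sup>2 / real m"
      using energy_const_pos[of n "CARD('d)"] by simp
    ultimately show ?thesis
      unfolding jet_energy_scaleR
      by (intro exI[of _ "\<lambda>_ _. 0"] exI[of _ "\<lambda>_. 0"] conjI) (assumption, simp only: power_zero_numeral mult_zero_left)
  next
    case False
    then have A: "A > 0" using A0 by simp
    define p where "p i = ?L i / A" for i
    define E where "E i k x = (A * (a i k / ?L i)) *\<^sub>R act_jet (W i) (b i) x" for i k x
    let ?\<kappa> = "4 * B * act_bound CARD('d)"
    have "\<exists>f. (\<forall>l<m. f l \<in> {..<M}) \<and> jet_energy \<alpha> n (\<lambda>k x. (\<Sum>l<m. E (f l) k x) - real m *\<^sub>R (\<Sum>j\<in>{..<M}. p j *\<^sub>R E j k x))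
      \<le> real m * (energy_const n CARD('d) * ?\<kappa>\<^sup>2)"
    proof (rule maurey[OF finite_lessThan _ _ _ _ n])
      show "0 \<le> p i" for i using A by (simp add: p_def L2_set_nonneg)
      show "(\<Sum>i<M. p i) = 1" using A by (simp add: p_def A_def flip: sum_divide_distrib)
      show "C2_jet (E i k)" for i k unfolding E_def[abs_def] by (intro C2_scaleR C2_act_jet)
      fix i k and x :: "real^'d" assume i: "i \<in> {..<M}" and k: "k < n" and x: "x \<in> cube"
      have "\<bar>a i k / ?L i\<bar> \<le> 1" using abs_le_L2_set[OF k, of "a i"] L2_set_nonneg[of "a i" "{..<n}"]
        by (cases "?L i = 0") (simp_all add: divide_le_eq)
      then have "\<bar>A * (a i k / ?L i)\<bar> \<le> 4 * B" unfolding abs_mult using A AB mult_mono[of "\<bar>A\<bar>" "4 * B" "\<bar>a i k / ?L i\<bar>" 1] by simp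
      moreover have "norm (act_jet (W i) (b i) x) \<le> act_bound CARD('d)"
        using net i by (intro norm_act_jet x) (auto simp: net_params_def)
      ultimately show "norm (E i k x) \<le> ?\<kappa>" unfolding E_def norm_scaleR using A0 AB by (intro mult_mono) auto
    qed
    then obtain f where f: "\<forall>l<m. f l < M" and le: "jet_energy \<alpha> n (\<lambda>k x. (\<Sum>l<m. E (f l) k x) - real m *\<^sub>R (\<Sum>j<M. p j *\<^sub>R E j k x))
      \<le> real m * (energy_const n CARD('d) * ?\<kappa>\<^sup>2)" by auto
    \<comment> \<open>Each of the \<open>m\<close> drawn atoms receives an outer weight of norm at
      most \<open>A / m\<close>, so the budget is respected. If \<open>?L (f l)\<close> is 0,
      division by zero gives 0, which is consistent with \<open>a0\<close>.\<close>
    define a' where "a' l k = (A / real m / ?L (f l)) * a (f l) k" for l k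
    have L': "L2_set (a' l) {..<n} \<le> A / real m" for l
    proof -
      have "L2_set (a' l) {..<n} = \<bar>A / real m / ?L (f l)\<bar> * ?L (f l)" unfolding a'_def[abs_def] by (rule L2_set_cmult)
      then show ?thesis using A m L2_set_nonneg[of "a (f l)" "{..<n}"] by (cases "?L (f l) = 0") (simp_all add: abs_mult)
    qed
    have "net_params n m B c a' (\<lambda>l. W (f l)) (\<lambda>l. b (f l))"
      unfolding net_params_def
    proof (intro conjI)
      have "(\<Sum>l<m. L2_set (a' l) {..<n}) \<le> (\<Sum>l<m. A / real m)" by (intro sum_mono L')
      also have "\<dots> = A" using m by simp
      finally show "(\<Sum>l<m. L2_set (a' l) {..<n}) \<le> 4 * B" using AB by linarith
    qed (use net f in \<open>auto simp: net_params_def\<close>)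
    moreover have "jet_energy \<alpha> n (\<lambda>k x. net_jet c a' (\<lambda>l. W (f l)) (\<lambda>l. b (f l)) m k x - net_jet c a W b M k x)
        = jet_energy \<alpha> n (\<lambda>k x. (1 / real m) *\<^sub>R ((\<Sum>l<m. E (f l) k x) - real m *\<^sub>R (\<Sum>j<M. p j *\<^sub>R E j k x)))"
    proof (rule jet_energy_cong[OF _ n])
      fix k and x :: "real^'d" assume k: "k < n"
      have "p j *\<^sub>R E j k x = a j k *\<^sub>R act_jet (W j) (b j) x" for j
        using A a0[OF _ k, of j] by (cases "?L j = 0") (simp_all add: p_def E_def)
      moreover have "(1 / real m) *\<^sub>R E (f l) k x = a' l k *\<^sub>R act_jet (W (f l)) (b (f l)) x" for l
        by (simp add: E_def a'_def)
      ultimately show "net_jet c a' (\<lambda>l. W (f l)) (\<lambda>l. b (f l)) m k x - net_jet c a W b M k x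
          = (1 / real m) *\<^sub>R ((\<Sum>l<m. E (f l) k x) - real m *\<^sub>R (\<Sum>j<M. p j *\<^sub>R E j k x))"
        using m unfolding net_jet_def scaleR_diff_right scaleR_sum_right[of "1 / real m"] by simp
    qed
    moreover have "\<dots> \<le> energy_const n CARD('d) * ?\<kappa>\<^sup>2 / real m"
    proof -
      have "jet_energy \<alpha> n (\<lambda>k x. (1 / real m) *\<^sub>R ((\<Sum>l<m. E (f l) k x) - real m *\<^sub>R (\<Sum>j<M. p j *\<^sub>R E j k x)))
         \<le> (1 / real m)\<^sup>2 * (real m * (energy_const n CARD('d) * ?\<kappa>\<^sup>2))"
        unfolding jet_energy_scaleR by (intro mult_left_mono le) simp
      also have "\<dots> = energy_const n CARD('d) * ?\<kappa>\<^sup>2 / real m" using m by (simp add: power2_eq_square)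
      finally show ?thesis .
    qed
    ultimately show ?thesis by (intro exI conjI) (assumption, linarith)
  qed
qed

text \<open>The doubling comes from \<open>jet_energy_add_le\<close>; the bracket collects the width
  reduction, with atoms of size \<open>4 * B * act_bound d\<close>, and the preceding approximation
  of size \<open>B\<close>.\<close>

definition approx_const :: "nat \<Rightarrow> nat \<Rightarrow> real" where
  "approx_const n d = 2 * energy_const n d * (16 * (act_bound d)\<^sup>2 + 1)"

lemma good_network:
  fixes u :: "real^'d \<Rightarrow> real"
  assumes n: "n \<ge> 1" and s: "2 * n + 2 \<le> s" and u: "u \<in> barron_space s" and m: "m \<ge> 1"
  shows "\<exists>c a W b. net_params n m (barron_norm s u) c a W b \<and>
    jet_loss \<alpha> n (\<lambda>k x. net_jet c a W b m k x - barron_jet u k x) \<le> approx_const n CARD('d) * (barron_norm s u)\<^sup>2 / real m"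
proof -
  let ?B = "barron_norm s u" and ?K = "energy_const n CARD('d)" and ?act = "act_bound CARD('d)"
  have C2U: "C2_jet (barron_jet u k)" if "k < n" for k using that s by (intro C2_barron_jet[OF u]) auto
  \<comment> \<open>\<open>jet_energy_add_le\<close> wants twice differentiable jets for every
    index, so the family is continued by zero beyond the \<open>n\<close> relevant
    components.\<close>
  define U where "U k = (if k < n then barron_jet u k else (\<lambda>x. (0, 0, 0)))" for k
  have C2U': "C2_jet (U k)" for k using C2U by (auto simp: U_def C2_const)
  have B0: "?B \<ge> 0"
    unfolding barron_norm_def by (rule infsum_nonneg) (rule barron_weight_nonneg)
  have K0: "?K > 0" by (rule energy_const_pos)
  have "\<exists>M c a W b. net_params n M ?B c a W b \<and> jet_energy \<alpha> n (\<lambda>k x. net_jet c a W b M k x - U k x) \<le> ?K * ?B\<^sup>2 / real m"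
  \<comment> \<open>The target accuracy below is a multiple of the Barron norm and must be positive,
    so norm zero is separated; there the exact jets vanish.\<close>
  proof (cases "?B = 0")
    case True
    have "barron_jet u k x = 0" if "k < n" for k x
      using norm_barron_jet[OF u, of k x] that s True by simp
    then have "jet_energy \<alpha> n (\<lambda>k x. net_jet (\<lambda>_. 0) (\<lambda>_ _. 0) (\<lambda>_. 0) (\<lambda>_. 0) 0 k x - U k x) = jet_energy \<alpha> n (\<lambda>k x. 0 *\<^sub>R U k x)"
      by (intro jet_energy_cong n) (simp add: net_jet_def U_def zero_prod_def)
    then have "jet_energy \<alpha> n (\<lambda>k x. net_jet (\<lambda>_. 0) (\<lambda>_ _. 0) (\<lambda>_. 0) (\<lambda>_. 0) 0 k x - U k x) \<le> ?K * ?B\<^sup>2 / real m"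
      unfolding jet_energy_scaleR using True by simp
    moreover have "net_params n 0 ?B (\<lambda>_. 0) (\<lambda>_ _. 0) (\<lambda>_. 0 :: real^'d) (\<lambda>_. 0)"
      using B0 by (simp add: net_params_def L2_set_def)
    ultimately show ?thesis by blast
  next
    case False
    \<comment> \<open>This accuracy makes the energy of the approximation error as small as that of
      the width reduction, of order 1 / m.\<close>
    then have "?B / sqrt (real m) > 0" using B0 m by simp
    then obtain M c a and W :: "nat \<Rightarrow> real^'d" and b where net: "net_params n M ?B c a W b"
      and close: "\<forall>k<n. \<forall>x\<in>cube. norm (barron_jet u k x - net_jet c a W b M k x) \<le> ?B / sqrt (real m)"
      using approximable_barron[OF n s u] unfolding approximable_def by meson
    have "jet_energy \<alpha> n (\<lambda>k x. net_jet c a W b M k x - U k x) \<le> ?K * (?B / sqrt (real m))\<^sup>2"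
      unfolding energy_const_def
      by (rule jet_energy_le[OF C2_diff[OF C2_net_jet C2U'] _ n]) (use close in \<open>auto simp: U_def norm_minus_commute\<close>)
    also have "\<dots> = ?K * ?B\<^sup>2 / real m" using m by (simp add: power_divide)
    finally show ?thesis using net by blast
  qed
  then obtain M c a and W :: "nat \<Rightarrow> real^'d" and b where net: "net_params n M ?B c a W b"
    and e1: "jet_energy \<alpha> n (\<lambda>k x. net_jet c a W b M k x - U k x) \<le> ?K * ?B\<^sup>2 / real m" by blast
  obtain a' and W' :: "nat \<Rightarrow> real^'d" and b' where net': "net_params n m ?B c a' W' b'"
    and e2: "jet_energy \<alpha> n (\<lambda>k x. net_jet c a' W' b' m k x - net_jet c a W b M k x) \<le> ?K * (4 * ?B * ?act)\<^sup>2 / real m"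
    using width_reduction[OF net m n] by blast
  have "jet_loss \<alpha> n (\<lambda>k x. net_jet c a' W' b' m k x - barron_jet u k x) = jet_loss \<alpha> n (\<lambda>k x. net_jet c a' W' b' m k x - U k x)"
  proof -
    have "residual n (\<lambda>k x. net_jet c a' W' b' m k x - barron_jet u k x) k = residual n (\<lambda>k x. net_jet c a' W' b' m k x - U k x) k" if "k < n" for k
      using that by (auto simp: residual_def U_def fun_eq_iff)
    then show ?thesis using n by (simp add: jet_loss_def residual_sq_def U_def)
  qed
  also have "\<dots> \<le> jet_energy \<alpha> n (\<lambda>k x. net_jet c a' W' b' m k x - U k x)"
    by (intro jet_loss_le_energy C2_diff C2_net_jet C2U')
  also have "\<dots> = jet_energy \<alpha> n (\<lambda>k x. (net_jet c a' W' b' m k x - net_jet c a W b M k x) + (net_jet c a W b M k x - U k x))" by simp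
  also have "\<dots> \<le> 2 * jet_energy \<alpha> n (\<lambda>k x. net_jet c a' W' b' m k x - net_jet c a W b M k x) + 2 * jet_energy \<alpha> n (\<lambda>k x. net_jet c a W b M k x - U k x)"
    by (intro jet_energy_add_le C2_diff C2_net_jet C2U')
  also have "\<dots> \<le> 2 * (?K * (4 * ?B * ?act)\<^sup>2 / real m) + 2 * (?K * ?B\<^sup>2 / real m)" using e1 e2 by linarith
  also have "\<dots> = approx_const n CARD('d) * ?B\<^sup>2 / real m"
  proof -
    have "2 * (K * (4 * B * a)\<^sup>2 / t) + 2 * (K * B\<^sup>2 / t) = 2 * K * (16 * a\<^sup>2 + 1) * B\<^sup>2 / t" for K B a t :: real
      by (simp add: power2_eq_square divide_inverse algebra_simps)
    then show ?thesis unfolding approx_const_def by this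
  qed
  finally show ?thesis using net' by blast
qed

section \<open>Uniform deviations of quadratic functionals of networks\<close>

definition param_box :: "'a::euclidean_space set" where
  "param_box = cbox (- One) One"

lemma mem_param_box: "\<theta> \<in> param_box \<longleftrightarrow> (\<forall>b\<in>Basis. \<bar>\<theta> \<bullet> b\<bar> \<le> 1)"
  by (auto simp: param_box_def mem_box abs_le_iff minus_le_iff)

lemma param_box_Pair: "(\<theta>, \<theta>') \<in> param_box \<longleftrightarrow> \<theta> \<in> param_box \<and> \<theta>' \<in> param_box"
  unfolding mem_param_box Basis_prod_def ball_Un by simp

lemma param_box_real: "(r :: real) \<in> param_box \<longleftrightarrow> \<bar>r\<bar> \<le> 1"
  by (auto simp: mem_param_box)

lemma param_box_vec: "norm (w :: real^'d) \<le> 1 \<Longrightarrow> w \<in> param_box"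
  unfolding mem_param_box using Basis_le_norm order_trans by blast

text \<open>One constant bounds both size and Lipschitz modulus, the form in which
  \<open>uniform_deviation\<close> takes it. Regularity is asked in the parameter only; in the point
  \<open>p\<close> boundedness is enough.\<close>

definition bounded_lipschitz :: "'b set \<Rightarrow> ('a::euclidean_space \<Rightarrow> 'b \<Rightarrow> real) \<Rightarrow> bool" where
  "bounded_lipschitz S h \<longleftrightarrow> (\<exists>K>0. \<forall>\<theta>\<in>param_box. \<forall>\<theta>'\<in>param_box. \<forall>p\<in>S. \<bar>h \<theta> p\<bar> \<le> K \<and> \<bar>h \<theta> p - h \<theta>' p\<bar> \<le> K * norm (\<theta> - \<theta>'))"

lemma bounded_lipschitzI:
  assumes "\<And>\<theta> p. \<theta> \<in> param_box \<Longrightarrow> p \<in> S \<Longrightarrow> \<bar>h \<theta> p\<bar> \<le> K"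
    and "\<And>\<theta> \<theta>' p. \<theta> \<in> param_box \<Longrightarrow> \<theta>' \<in> param_box \<Longrightarrow> p \<in> S \<Longrightarrow> \<bar>h \<theta> p - h \<theta>' p\<bar> \<le> L * norm (\<theta> - \<theta>')"
  shows "bounded_lipschitz S h"
  unfolding bounded_lipschitz_def
proof (intro exI conjI ballI)
  let ?K = "1 + \<bar>K\<bar> + \<bar>L\<bar>"
  show "0 < ?K" by simp
  fix \<theta> \<theta>' :: 'a and p assume *: "\<theta> \<in> param_box" "\<theta>' \<in> param_box" "p \<in> S"
  show "\<bar>h \<theta> p\<bar> \<le> ?K" using assms(1)[OF *(1,3)] by linarith
  have "L * norm (\<theta> - \<theta>') \<le> ?K * norm (\<theta> - \<theta>')" by (intro mult_right_mono) auto
  then show "\<bar>h \<theta> p - h \<theta>' p\<bar> \<le> ?K * norm (\<theta> - \<theta>')" using assms(2)[OF *] by linarith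
qed

lemma bl_point:
  assumes "\<And>p. p \<in> S \<Longrightarrow> \<bar>f p\<bar> \<le> K"
  shows "bounded_lipschitz S (\<lambda>\<theta> p. f p)"
  by (rule bounded_lipschitzI[where K = K and L = 0]) (use assms in auto)

lemma bl_linear:
  fixes L :: "'a::euclidean_space \<Rightarrow> real"
  assumes "bounded_linear L"
  shows "bounded_lipschitz S (\<lambda>\<theta> p. L \<theta>)"
proof -
  obtain K where K: "\<And>x. norm (L x) \<le> norm x * K" using bounded_linear.bounded[OF assms] by blast
  have "compact (param_box :: 'a set)" by (simp add: param_box_def)
  then obtain R where R: "\<And>\<theta> :: 'a. \<theta> \<in> param_box \<Longrightarrow> norm \<theta> \<le> R"
    using compact_imp_bounded bounded_iff by metis
  show ?thesis
  proof (rule bounded_lipschitzI[where K = "R * \<bar>K\<bar>" and L = K])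
    fix \<theta> \<theta>' :: 'a and p :: 'b assume *: "\<theta> \<in> param_box"
    have "norm (L \<theta>) \<le> norm \<theta> * \<bar>K\<bar>" by (rule order_trans[OF K mult_left_mono]) auto
    also have "\<dots> \<le> R * \<bar>K\<bar>" by (rule mult_right_mono[OF R[OF *]]) auto
    finally show "\<bar>L \<theta>\<bar> \<le> R * \<bar>K\<bar>" by simp
    show "\<bar>L \<theta> - L \<theta>'\<bar> \<le> K * norm (\<theta> - \<theta>')"
      using K[of "\<theta> - \<theta>'"] by (simp add: linear_diff[OF bounded_linear.linear[OF assms]] mult.commute)
  qed
qed

lemma bl_add:
  assumes "bounded_lipschitz S f" "bounded_lipschitz S g"
  shows "bounded_lipschitz S (\<lambda>\<theta> p. f \<theta> p + g \<theta> p)"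
proof -
  obtain K where K0: "K > 0" and K: "\<And>\<theta> p. \<theta> \<in> param_box \<Longrightarrow> p \<in> S \<Longrightarrow> \<bar>f \<theta> p\<bar> \<le> K"
    "\<And>\<theta> \<theta>' p. \<theta> \<in> param_box \<Longrightarrow> \<theta>' \<in> param_box \<Longrightarrow> p \<in> S \<Longrightarrow> \<bar>f \<theta> p - f \<theta>' p\<bar> \<le> K * norm (\<theta> - \<theta>')"
    using assms(1) unfolding bounded_lipschitz_def by blast
  obtain L where L0: "L > 0" and L: "\<And>\<theta> p. \<theta> \<in> param_box \<Longrightarrow> p \<in> S \<Longrightarrow> \<bar>g \<theta> p\<bar> \<le> L"
    "\<And>\<theta> \<theta>' p. \<theta> \<in> param_box \<Longrightarrow> \<theta>' \<in> param_box \<Longrightarrow> p \<in> S \<Longrightarrow> \<bar>g \<theta> p - g \<theta>' p\<bar> \<le> L * norm (\<theta> - \<theta>')"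
    using assms(2) unfolding bounded_lipschitz_def by blast
  show ?thesis
  proof (rule bounded_lipschitzI[where K = "K + L" and L = "K + L"])
    fix \<theta> \<theta>' :: 'b and p assume *: "\<theta> \<in> param_box" "p \<in> S"
    show "\<bar>f \<theta> p + g \<theta> p\<bar> \<le> K + L" using K(1)[OF *] L(1)[OF *] by linarith
    assume **: "\<theta>' \<in> param_box"
    show "\<bar>f \<theta> p + g \<theta> p - (f \<theta>' p + g \<theta>' p)\<bar> \<le> (K + L) * norm (\<theta> - \<theta>')"
      unfolding distrib_right using K(2)[OF *(1) ** *(2)] L(2)[OF *(1) ** *(2)] by linarith
  qed
qed

lemma bl_mult:
  assumes "bounded_lipschitz S f" "bounded_lipschitz S g"
  shows "bounded_lipschitz S (\<lambda>\<theta> p. f \<theta> p * g \<theta> p)"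
proof -
  obtain K where K0: "K > 0" and K: "\<And>\<theta> p. \<theta> \<in> param_box \<Longrightarrow> p \<in> S \<Longrightarrow> \<bar>f \<theta> p\<bar> \<le> K"
    "\<And>\<theta> \<theta>' p. \<theta> \<in> param_box \<Longrightarrow> \<theta>' \<in> param_box \<Longrightarrow> p \<in> S \<Longrightarrow> \<bar>f \<theta> p - f \<theta>' p\<bar> \<le> K * norm (\<theta> - \<theta>')"
    using assms(1) unfolding bounded_lipschitz_def by blast
  obtain L where L0: "L > 0" and L: "\<And>\<theta> p. \<theta> \<in> param_box \<Longrightarrow> p \<in> S \<Longrightarrow> \<bar>g \<theta> p\<bar> \<le> L"
    "\<And>\<theta> \<theta>' p. \<theta> \<in> param_box \<Longrightarrow> \<theta>' \<in> param_box \<Longrightarrow> p \<in> S \<Longrightarrow> \<bar>g \<theta> p - g \<theta>' p\<bar> \<le> L * norm (\<theta> - \<theta>')"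
    using assms(2) unfolding bounded_lipschitz_def by blast
  note pos = K0 L0
  show ?thesis
  proof (rule bounded_lipschitzI[where K = "K * L" and L = "K * L + K * L"])
    fix \<theta> \<theta>' :: 'b and p assume *: "\<theta> \<in> param_box" "p \<in> S"
    show "\<bar>f \<theta> p * g \<theta> p\<bar> \<le> K * L" unfolding abs_mult using K(1)[OF *] L(1)[OF *] pos by (intro mult_mono) auto
    assume **: "\<theta>' \<in> param_box"
    have "f \<theta> p * g \<theta> p - f \<theta>' p * g \<theta>' p = (f \<theta> p - f \<theta>' p) * g \<theta> p + f \<theta>' p * (g \<theta> p - g \<theta>' p)"
      by (simp add: algebra_simps)
    also have "\<bar>\<dots>\<bar> \<le> \<bar>f \<theta> p - f \<theta>' p\<bar> * \<bar>g \<theta> p\<bar> + \<bar>f \<theta>' p\<bar> * \<bar>g \<theta> p - g \<theta>' p\<bar>"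
      using abs_triangle_ineq by (simp flip: abs_mult)
    also have "\<dots> \<le> (K * norm (\<theta> - \<theta>')) * L + K * (L * norm (\<theta> - \<theta>'))"
      using K(1)[OF ** *(2)] L(1)[OF *] K(2)[OF *(1) ** *(2)] L(2)[OF *(1) ** *(2)] pos
      by (intro add_mono mult_mono) auto
    finally show "\<bar>f \<theta> p * g \<theta> p - f \<theta>' p * g \<theta>' p\<bar> \<le> (K * L + K * L) * norm (\<theta> - \<theta>')" by (simp add: algebra_simps)
  qed
qed

lemma bl_sum:
  assumes "finite I" "\<And>i. i \<in> I \<Longrightarrow> bounded_lipschitz S (f i)"
  shows "bounded_lipschitz S (\<lambda>\<theta> p. \<Sum>i\<in>I. f i \<theta> p)"
  using assms
proof (induction I)
  case empty
  show ?case using bl_point[of S "\<lambda>_. 0" 0] by simp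
next
  case (insert i I)
  then show ?case using bl_add[of S "f i"] by simp
qed

lemma bl_max0:
  assumes "bounded_lipschitz S f"
  shows "bounded_lipschitz S (\<lambda>\<theta> p. max 0 (f \<theta> p))"
proof -
  obtain K where K0: "K > 0" and K: "\<And>\<theta> p. \<theta> \<in> param_box \<Longrightarrow> p \<in> S \<Longrightarrow> \<bar>f \<theta> p\<bar> \<le> K"
    "\<And>\<theta> \<theta>' p. \<theta> \<in> param_box \<Longrightarrow> \<theta>' \<in> param_box \<Longrightarrow> p \<in> S \<Longrightarrow> \<bar>f \<theta> p - f \<theta>' p\<bar> \<le> K * norm (\<theta> - \<theta>')"
    using assms(1) unfolding bounded_lipschitz_def by blast
  show ?thesis
  proof (rule bounded_lipschitzI[where K = K and L = K])
    fix \<theta> \<theta>' :: 'b and p assume *: "\<theta> \<in> param_box" "p \<in> S"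
    show "\<bar>max 0 (f \<theta> p)\<bar> \<le> K" using K(1)[OF *] by linarith
    assume **: "\<theta>' \<in> param_box"
    show "\<bar>max 0 (f \<theta> p) - max 0 (f \<theta>' p)\<bar> \<le> K * norm (\<theta> - \<theta>')" using K(2)[OF *(1) ** *(2)] by linarith
  qed
qed

type_synonym 'd param = "real \<times> real \<times> real \<times> real \<times> (real^'d) \<times> real"

text \<open>One parametrised family contains all summands of the residuals of a network. At a point
  \<open>(x, y, t)\<close> the number \<open>y\<close> is the value of the data at \<open>x\<close>, and the vector \<open>t\<close> represents the
  differential operator that is applied to the activation function.\<close>

fun feature :: "'d::finite param \<Rightarrow> (real^'d) \<times> real \<times> 'd jet \<Rightarrow> real" where
  "feature (\<alpha>, \<beta>, \<gamma>, \<delta>, w, b) (x, y, t) = \<alpha> + \<beta> * y + \<gamma> * (t \<bullet> act_jet w b x) + \<delta> * val (act_jet w b x)"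

definition feature_points :: "real \<Rightarrow> ((real^'d) \<times> real \<times> 'd jet) set" where
  "feature_points \<tau> = {(x, y, t). x \<in> cube \<and> \<bar>y\<bar> \<le> 1 \<and> norm t \<le> \<tau>}"

text \<open>Written out, a feature is a polynomial in the parameters, in bounded functions of the
  point and in one positive part. The positive part is Lipschitz, and this suffices even for the
  Laplacian, because the second derivative of the activation is six times a positive part.\<close>

lemma bounded_lipschitz_feature: "bounded_lipschitz (feature_points \<tau>) (feature :: 'd::finite param \<Rightarrow> _)"
proof -
  let ?S = "feature_points \<tau> :: ((real^'d) \<times> real \<times> 'd jet) set"
  let ?a = "\<lambda>\<theta>::'d param. fst \<theta>" and ?b = "\<lambda>\<theta>::'d param. fst (snd \<theta>)" and ?c = "\<lambda>\<theta>::'d param. fst (snd (snd \<theta>))"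
    and ?e = "\<lambda>\<theta>::'d param. fst (snd (snd (snd \<theta>)))" and ?w = "\<lambda>\<theta>::'d param. fst (snd (snd (snd (snd \<theta>))))"
    and ?\<beta> = "\<lambda>\<theta>::'d param. snd (snd (snd (snd (snd \<theta>))))"
  let ?z = "\<lambda>(\<theta>::'d param) (p::(real^'d) \<times> real \<times> 'd jet). max 0 ((\<Sum>i\<in>UNIV. ?w \<theta> $ i * fst p $ i) + ?\<beta> \<theta>)"
  have lin: "bounded_lipschitz ?S (\<lambda>\<theta> p. ?a \<theta>)" "bounded_lipschitz ?S (\<lambda>\<theta> p. ?b \<theta>)" "bounded_lipschitz ?S (\<lambda>\<theta> p. ?c \<theta>)"
    "bounded_lipschitz ?S (\<lambda>\<theta> p. ?e \<theta>)" "bounded_lipschitz ?S (\<lambda>\<theta> p. ?\<beta> \<theta>)"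
    by (intro bl_linear bounded_linear_intros)+
  have w: "bounded_lipschitz ?S (\<lambda>\<theta> p. ?w \<theta> $ i)" for i
    by (intro bl_linear bounded_linear_compose[OF bounded_linear_vec_nth] bounded_linear_intros)
  have x: "bounded_lipschitz ?S (\<lambda>(\<theta>::'d param) p. fst p $ i)" for i
    by (rule bl_point[where K = 1]) (auto simp: feature_points_def mem_cube)
  have y: "bounded_lipschitz ?S (\<lambda>(\<theta>::'d param) p. fst (snd p))"
    by (rule bl_point[where K = 1]) (auto simp: feature_points_def)
  have t1: "bounded_lipschitz ?S (\<lambda>(\<theta>::'d param) p. val (snd (snd p)))"
    by (rule bl_point[where K = \<tau>]) (auto simp: feature_points_def intro!: order_trans[OF norm_component_jet(3)])
  have t2: "bounded_lipschitz ?S (\<lambda>(\<theta>::'d param) p. grd (snd (snd p)) $ i)" for i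
    by (rule bl_point[where K = \<tau>])
      (auto simp: feature_points_def intro!: order_trans[OF component_le_norm_cart] order_trans[OF norm_component_jet(1)])
  have t3: "bounded_lipschitz ?S (\<lambda>(\<theta>::'d param) p. hes (snd (snd p)) $ i)" for i
    by (rule bl_point[where K = \<tau>])
      (auto simp: feature_points_def intro!: order_trans[OF component_le_norm_cart] order_trans[OF norm_component_jet(2)])
  have c: "bounded_lipschitz ?S (\<lambda>(\<theta>::'d param) p. r)" for r :: real
    by (rule bl_point[where K = "\<bar>r\<bar>"]) simp
  have z: "bounded_lipschitz ?S ?z"
    by (intro bl_max0 bl_add bl_sum bl_mult w x lin) simp
  have "bounded_lipschitz ?S (\<lambda>\<theta> p. ?a \<theta> + ?b \<theta> * fst (snd p)
     + ?c \<theta> * (val (snd (snd p)) * (?z \<theta> p * ?z \<theta> p * ?z \<theta> p)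
        + (\<Sum>i\<in>UNIV. grd (snd (snd p)) $ i * (3 * (?z \<theta> p * ?z \<theta> p) * ?w \<theta> $ i))
        + (\<Sum>i\<in>UNIV. hes (snd (snd p)) $ i * (6 * ?z \<theta> p * (?w \<theta> $ i * ?w \<theta> $ i))))
     + ?e \<theta> * (?z \<theta> p * ?z \<theta> p * ?z \<theta> p))" (is "bounded_lipschitz ?S ?f")
    by (intro bl_add bl_mult bl_sum lin w y t1 t2 t3 c z) simp_all
  moreover have "?f = feature"
  proof (intro ext)
    fix \<theta> :: "'d param" and p :: "(real^'d) \<times> real \<times> 'd jet"
    obtain \<alpha> \<beta> \<gamma> \<delta> w b where \<theta>: "\<theta> = (\<alpha>, \<beta>, \<gamma>, \<delta>, w, b)" by (cases \<theta>) auto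
    obtain x y t where p: "p = (x, y, t)" by (cases p) auto
    have "(\<Sum>i\<in>UNIV. w $ i * x $ i) = w \<bullet> x" by (simp add: inner_vec_def)
    then show "?f \<theta> p = feature \<theta> p"
      by (simp add: \<theta> p act_jet_def ridge_jet_def ReCU_pos_part inner_prod_def inner_vec_def power3_eq_cube power2_eq_square mult.assoc)
  qed
  ultimately show ?thesis by simp
qed

text \<open>The deviation of a sum of squares is quadratic in the weights, so pairs of features suffice.\<close>

lemma (in prob_space) quadratic_deviation:
  fixes X :: "nat \<Rightarrow> 'a \<Rightarrow> real^'d" and F :: "real^'d \<Rightarrow> real" and T :: "real^'d \<Rightarrow> 'd jet"
  assumes X: "indep_vars (\<lambda>_. borel) X {..<N}" and law: "\<And>j. j < N \<Longrightarrow> distr M borel (X j) = \<mu>" and N: "N \<ge> 1"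
    and S: "S \<in> sets borel" "S \<subseteq> cube" "AE x in \<mu>. x \<in> S"
    and F: "F \<in> borel_measurable borel" "\<And>x. x \<in> S \<Longrightarrow> \<bar>F x\<bar> \<le> 1"
    and T: "T \<in> borel_measurable borel" "\<And>x. x \<in> S \<Longrightarrow> norm (T x) \<le> \<tau>"
    and K: "K > 0" "\<And>\<theta> p. \<theta> \<in> param_box \<Longrightarrow> p \<in> feature_points \<tau> \<Longrightarrow> \<bar>(feature :: 'd param \<Rightarrow> _) \<theta> p\<bar> \<le> K"
      "\<And>\<theta> \<theta>' p. \<theta> \<in> param_box \<Longrightarrow> \<theta>' \<in> param_box \<Longrightarrow> p \<in> feature_points \<tau> \<Longrightarrow> \<bar>(feature :: 'd param \<Rightarrow> _) \<theta> p - feature \<theta>' p\<bar> \<le> K * norm (\<theta> - \<theta>')"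
  defines "C \<equiv> chain_const DIM('d param \<times> 'd param) * (2 * K\<^sup>2)"
  obtains G where "G \<in> borel_measurable M" "(\<integral>\<^sup>+\<omega>. G \<omega> \<partial>M) \<le> ennreal (C / sqrt N)"
    "\<And>\<omega> I w \<theta> r R. (\<And>j. j < N \<Longrightarrow> X j \<omega> \<in> S) \<Longrightarrow> finite (I :: nat set) \<Longrightarrow> (\<And>i. i \<in> I \<Longrightarrow> \<theta> i \<in> param_box) \<Longrightarrow> r \<in> borel_measurable borel \<Longrightarrow>
       (\<And>x. x \<in> S \<Longrightarrow> r x = (\<Sum>i\<in>I. w i * feature (\<theta> i) (x, F x, T x))) \<Longrightarrow> (\<Sum>i\<in>I. \<bar>w i\<bar>) \<le> R \<Longrightarrow>
       ennreal \<bar>(\<Sum>j<N. (r (X j \<omega>))\<^sup>2) / real N - (\<integral>x. (r x)\<^sup>2 \<partial>\<mu>)\<bar> \<le> ennreal (R\<^sup>2) * G \<omega> \<and>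
       ennreal \<bar>(\<Sum>j<N. r (X j \<omega>)) / real N - (\<integral>x. r x \<partial>\<mu>)\<bar> \<le> ennreal R * G \<omega>"
proof -
  interpret \<mu>: prob_space \<mu>
    using X law[of 0] N prob_space_distr[of "X 0" borel] by (auto simp: indep_vars_def)
  have sets\<mu>: "sets \<mu> = sets borel" using law[of 0] N by auto
  define f where "f \<theta> x = feature \<theta> (x, F x, T x)" for \<theta> :: "'d param" and x
  \<comment> \<open>The indicator makes the products bounded and Lipschitz at all points of the
    space, whereas the features are controlled on \<open>S\<close> only; \<open>S\<close> has full
    measure, so no integral changes.\<close>
  define h where "h q x = indicator S x * (f (fst q) x * f (snd q) x)" for q x
  have pt: "(x, F x, T x) \<in> feature_points \<tau>" if "x \<in> S" for x
    using that F(2) T(2) S(2) by (auto simp: feature_points_def)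
  have fK: "\<bar>f \<theta> x\<bar> \<le> K" if "\<theta> \<in> param_box" "x \<in> S" for \<theta> x
    unfolding f_def by (rule K(2)[OF that(1) pt[OF that(2)]])
  have mf: "f \<theta> \<in> borel_measurable borel" for \<theta>
  proof -
    obtain \<alpha> \<beta> \<gamma> \<delta> w b where \<theta>: "\<theta> = (\<alpha>, \<beta>, \<gamma>, \<delta>, w, b)" by (cases \<theta>) auto
    have [measurable]: "act_jet w b \<in> borel_measurable borel" "(\<lambda>x. val (act_jet w b x)) \<in> borel_measurable borel"
      by (intro borel_measurable_continuous_onI C2_continuous C2_act_jet)+
    show ?thesis unfolding f_def \<theta> feature.simps using F(1) T(1) by measurable
  qed
  have mh: "h q \<in> borel_measurable borel" for q
    unfolding h_def[abs_def] using mf S(1) by measurable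
  have hb: "\<bar>h q x\<bar> \<le> 2 * K\<^sup>2" if "q \<in> cbox (- One) One" for q x
  proof (cases "x \<in> S")
    case True
    have q: "fst q \<in> param_box" "snd q \<in> param_box"
      using that param_box_Pair[of "fst q" "snd q"] by (simp_all add: param_box_def)
    have "\<bar>f (fst q) x * f (snd q) x\<bar> \<le> K * K"
      unfolding abs_mult using fK[OF q(1) True] fK[OF q(2) True] K(1) by (intro mult_mono) auto
    then show ?thesis using True by (simp add: h_def power2_eq_square)
  qed (simp add: h_def)
  have hl: "\<bar>h q x - h q' x\<bar> \<le> 2 * K\<^sup>2 * norm (q - q')" if "q \<in> cbox (- One) One" "q' \<in> cbox (- One) One" for q q' x
  proof (cases "x \<in> S")
    case True
    have q: "fst q \<in> param_box" "snd q \<in> param_box" "fst q' \<in> param_box" "snd q' \<in> param_box"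
      using that param_box_Pair[of "fst q" "snd q"] param_box_Pair[of "fst q'" "snd q'"] by (simp_all add: param_box_def)
    have d: "\<bar>f \<theta> x - f \<theta>' x\<bar> \<le> K * norm (\<theta> - \<theta>')" if "\<theta> \<in> param_box" "\<theta>' \<in> param_box" for \<theta> \<theta>'
      unfolding f_def by (rule K(3)[OF that pt[OF True]])
    have n: "norm (fst q - fst q') \<le> norm (q - q')" "norm (snd q - snd q') \<le> norm (q - q')"
      using norm_fst_le[of "fst (q - q')" "snd (q - q')"] norm_snd_le[of "snd (q - q')" "fst (q - q')"]
      unfolding prod.collapse by simp_all
    have "f (fst q) x * f (snd q) x - f (fst q') x * f (snd q') x
        = (f (fst q) x - f (fst q') x) * f (snd q) x + f (fst q') x * (f (snd q) x - f (snd q') x)"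
      by (simp add: algebra_simps)
    also have "\<bar>\<dots>\<bar> \<le> \<bar>f (fst q) x - f (fst q') x\<bar> * \<bar>f (snd q) x\<bar> + \<bar>f (fst q') x\<bar> * \<bar>f (snd q) x - f (snd q') x\<bar>"
      using abs_triangle_ineq by (simp flip: abs_mult)
    also have "\<dots> \<le> (K * norm (q - q')) * K + K * (K * norm (q - q'))"
    proof (intro add_mono mult_mono)
      show "\<bar>f (fst q) x - f (fst q') x\<bar> \<le> K * norm (q - q')"
        by (rule order_trans[OF d[OF q(1,3)] mult_left_mono[OF n(1)]]) (use K in simp)
      show "\<bar>f (snd q) x - f (snd q') x\<bar> \<le> K * norm (q - q')"
        by (rule order_trans[OF d[OF q(2,4)] mult_left_mono[OF n(2)]]) (use K in simp)
    qed (use fK[OF q(2) True] fK[OF q(3) True] K(1) in auto)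
    finally show ?thesis using True by (simp add: h_def power2_eq_square)
  qed (simp add: h_def)
  have K2: "2 * K\<^sup>2 > 0" using K(1) by simp
  obtain G where G: "G \<in> borel_measurable M" "(\<integral>\<^sup>+\<omega>. G \<omega> \<partial>M) \<le> ennreal (chain_const DIM('d param \<times> 'd param) * (2 * K\<^sup>2) / sqrt N)"
    and dev: "\<And>q \<omega>. q \<in> cbox (- One) One \<Longrightarrow> ennreal \<bar>(\<Sum>j<N. h q (X j \<omega>)) / real N - (\<integral>x. h q x \<partial>\<mu>)\<bar> \<le> G \<omega>"
    using uniform_deviation[where h = h and K = "2 * K\<^sup>2" and X = X and N = N and \<mu> = \<mu>, OF X law N mh K2 hb hl] by blast
  have inth: "integrable \<mu> (h q)" if "q \<in> cbox (- One) One" for q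
    by (rule \<mu>.integrable_const_bound[where B = "2 * K\<^sup>2"])
      (use hb[OF that] mh in \<open>auto simp: measurable_cong_sets[OF sets\<mu> refl]\<close>)
  \<comment> \<open>Both the empirical mean and the integral are linear in the weights, so the
    deviation of a combination is at most the absolute sum of the weights times the uniform
    deviation \<open>G\<close>.\<close>
  have pair: "ennreal \<bar>(\<Sum>j<N. g (X j \<omega>)) / real N - (\<integral>x. g x \<partial>\<mu>)\<bar> \<le> ennreal R * G \<omega>"
    if XS: "\<And>j. j < N \<Longrightarrow> X j \<omega> \<in> S" and q: "\<And>i. i \<in> I \<Longrightarrow> q i \<in> cbox (- One) One"
      and mg: "g \<in> borel_measurable borel" and g: "\<And>x. x \<in> S \<Longrightarrow> g x = (\<Sum>i\<in>I. w i * h (q i) x)" and R: "(\<Sum>i\<in>I. \<bar>w i\<bar>) \<le> R"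
    for \<omega> and I :: "'i set" and q w g R
  proof -
    let ?dev = "\<lambda>i. (\<Sum>j<N. h (q i) (X j \<omega>)) / real N - (\<integral>x. h (q i) x \<partial>\<mu>)"
    have "(\<integral>x. g x \<partial>\<mu>) = (\<integral>x. (\<Sum>i\<in>I. w i * h (q i) x) \<partial>\<mu>)"
    proof (rule integral_cong_AE)
      show "g \<in> borel_measurable \<mu>" using mg by (simp add: measurable_cong_sets[OF sets\<mu> refl])
      show "(\<lambda>x. \<Sum>i\<in>I. w i * h (q i) x) \<in> borel_measurable \<mu>"
        unfolding measurable_cong_sets[OF sets\<mu> refl] using mh by (intro borel_measurable_sum borel_measurable_times) auto
      show "AE x in \<mu>. g x = (\<Sum>i\<in>I. w i * h (q i) x)" using S(3) by (rule AE_mp) (simp add: g)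
    qed
    also have "\<dots> = (\<Sum>i\<in>I. w i * (\<integral>x. h (q i) x \<partial>\<mu>))"
      using inth[OF q] by (subst Bochner_Integration.integral_sum) auto
    moreover have "(\<Sum>j<N. g (X j \<omega>)) = (\<Sum>i\<in>I. w i * (\<Sum>j<N. h (q i) (X j \<omega>)))"
      using g[OF XS] by (simp add: sum_distrib_left sum.swap[of _ I])
    ultimately have "(\<Sum>j<N. g (X j \<omega>)) / real N - (\<integral>x. g x \<partial>\<mu>) = (\<Sum>i\<in>I. w i * ?dev i)"
      by (simp add: sum_subtractf sum_divide_distrib[of _ I] right_diff_distrib)
    then have "\<bar>(\<Sum>j<N. g (X j \<omega>)) / real N - (\<integral>x. g x \<partial>\<mu>)\<bar> \<le> (\<Sum>i\<in>I. \<bar>w i\<bar> * \<bar>?dev i\<bar>)"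
      using sum_abs[of "\<lambda>i. w i * ?dev i" I] by (simp add: abs_mult)
    then have "ennreal \<bar>(\<Sum>j<N. g (X j \<omega>)) / real N - (\<integral>x. g x \<partial>\<mu>)\<bar> \<le> (\<Sum>i\<in>I. ennreal \<bar>w i\<bar> * ennreal \<bar>?dev i\<bar>)"
      by (simp flip: ennreal_mult)
    also have "\<dots> \<le> (\<Sum>i\<in>I. ennreal \<bar>w i\<bar> * G \<omega>)" using dev[OF q] by (intro sum_mono mult_left_mono) auto
    also have "\<dots> = ennreal (\<Sum>i\<in>I. \<bar>w i\<bar>) * G \<omega>" by (simp flip: sum_distrib_right)
    also have "\<dots> \<le> ennreal R * G \<omega>" using R by (intro mult_right_mono ennreal_leI) auto
    finally show ?thesis .
  qed
  have hS: "h (\<theta>, \<theta>') x = f \<theta> x * f \<theta>' x" if "x \<in> S" for \<theta> \<theta>' x using that by (simp add: h_def)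
  have pb: "(\<theta>, \<theta>') \<in> cbox (- One) One" if "\<theta> \<in> param_box" "\<theta>' \<in> param_box" for \<theta> \<theta>' :: "'d param"
    using that param_box_Pair[of \<theta> \<theta>'] by (simp add: param_box_def)
  \<comment> \<open>The parameter whose feature is constantly 1: pairing with it turns a linear
    functional into a product of two features.\<close>
  let ?one = "(1, 0, 0, 0, 0, 0) :: 'd param"
  have one: "?one \<in> param_box" "f ?one x = 1" for x
    by (simp_all add: param_box_Pair param_box_real param_box_vec f_def)
  show thesis
  proof (rule that[OF G(1)])
    show "(\<integral>\<^sup>+\<omega>. G \<omega> \<partial>M) \<le> ennreal (C / sqrt N)" using G(2) unfolding C_def .
    fix \<omega> w \<theta> r R and I :: "nat set"
    assume XS: "\<And>j. j < N \<Longrightarrow> X j \<omega> \<in> S" and I: "finite I" and \<theta>: "\<And>i. i \<in> I \<Longrightarrow> \<theta> i \<in> param_box"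
      and mr: "r \<in> borel_measurable borel"
      and r: "\<And>x. x \<in> S \<Longrightarrow> r x = (\<Sum>i\<in>I. w i * feature (\<theta> i) (x, F x, T x))" and R: "(\<Sum>i\<in>I. \<bar>w i\<bar>) \<le> R"
    have rf: "r x = (\<Sum>i\<in>I. w i * f (\<theta> i) x)" if "x \<in> S" for x unfolding f_def using r[OF that] .
    have "ennreal \<bar>(\<Sum>j<N. (r (X j \<omega>))\<^sup>2) / real N - (\<integral>x. (r x)\<^sup>2 \<partial>\<mu>)\<bar> \<le> ennreal (R\<^sup>2) * G \<omega>"
    proof (rule pair[of \<omega> "I \<times> I" "\<lambda>(i, k). (\<theta> i, \<theta> k)" "\<lambda>x. (r x)\<^sup>2" "\<lambda>(i, k). w i * w k", OF XS])
      show "(case i of (i, k) \<Rightarrow> (\<theta> i, \<theta> k)) \<in> cbox (- One) One" if "i \<in> I \<times> I" for i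
        using that \<theta> by (auto intro!: pb simp del: cbox_Pair_eq)
      show "(r x)\<^sup>2 = (\<Sum>i\<in>I \<times> I. (case i of (i, k) \<Rightarrow> w i * w k) * h (case i of (i, k) \<Rightarrow> (\<theta> i, \<theta> k)) x)" if "x \<in> S" for x
        unfolding rf[OF that] power2_eq_square sum_product sum.cartesian_product
        by (intro sum.cong refl) (auto simp: hS[OF that])
      have "(\<Sum>i\<in>I \<times> I. \<bar>case i of (i, k) \<Rightarrow> w i * w k\<bar>) = (\<Sum>i\<in>I. \<bar>w i\<bar>)\<^sup>2"
        unfolding power2_eq_square sum_product sum.cartesian_product by (intro sum.cong refl) (auto simp: abs_mult)
      also have "\<dots> \<le> R\<^sup>2" using R by (intro power_mono sum_nonneg) auto
      finally show "(\<Sum>i\<in>I \<times> I. \<bar>case i of (i, k) \<Rightarrow> w i * w k\<bar>) \<le> R\<^sup>2" .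
    qed (use mr in measurable)
    moreover have "ennreal \<bar>(\<Sum>j<N. r (X j \<omega>)) / real N - (\<integral>x. r x \<partial>\<mu>)\<bar> \<le> ennreal R * G \<omega>"
      by (rule pair[of \<omega> I "\<lambda>i. (\<theta> i, ?one)" r w, OF XS])
        (use \<theta> R one mr in \<open>auto simp: rf hS intro!: pb simp del: cbox_Pair_eq\<close>)
    ultimately show "ennreal \<bar>(\<Sum>j<N. (r (X j \<omega>))\<^sup>2) / real N - (\<integral>x. (r x)\<^sup>2 \<partial>\<mu>)\<bar> \<le> ennreal (R\<^sup>2) * G \<omega> \<and>
       ennreal \<bar>(\<Sum>j<N. r (X j \<omega>)) / real N - (\<integral>x. r x \<partial>\<mu>)\<bar> \<le> ennreal R * G \<omega>" ..
  qed
qed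

section \<open>The empirical loss\<close>

text \<open>Serves to extract the interior and the boundary sample from the joint family, whose
  index set is a disjoint sum.\<close>

lemma (in prob_space) indep_vars_inj:
  assumes X: "indep_vars M' X (h ` I)" and h: "inj_on h I"
  shows "indep_vars (\<lambda>i. M' (h i)) (\<lambda>i. X (h i)) I"
proof -
  let ?F = "\<lambda>i. {X i -` A \<inter> space M | A. A \<in> sets (M' i)}"
  have F: "indep_sets ?F (h ` I)" and rv: "\<forall>i\<in>h ` I. random_variable (M' i) (X i)"
    using X unfolding indep_vars_def2 by auto
  have "indep_sets (\<lambda>i. ?F (h i)) I"
    unfolding indep_sets_def
  proof (intro conjI allI impI ballI)
    fix i assume "i \<in> I"
    then show "?F (h i) \<subseteq> events" using F unfolding indep_sets_def by blast
  next
    fix J A assume J: "J \<subseteq> I" "J \<noteq> {}" "finite J" and A: "A \<in> (\<Pi> j\<in>J. ?F (h j))"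
    let ?A = "\<lambda>i. A (inv_into J h i)"
    have inj: "inj_on h J" using h J(1) by (rule inj_on_subset)
    have "prob (\<Inter>i\<in>h ` J. ?A i) = (\<Prod>i\<in>h ` J. prob (?A i))"
    proof (rule indep_setsD[OF F])
      show "\<forall>j\<in>h ` J. ?A j \<in> ?F j" using A inj by (auto simp: Pi_iff inv_into_f_f)
    qed (use J in auto)
    then show "prob (\<Inter>j\<in>J. A j) = (\<Prod>j\<in>J. prob (A j))"
      using inj by (simp add: prod.reindex inv_into_f_f)
  qed
  then show ?thesis using rv unfolding indep_vars_def2 by auto
qed

lemma sample_pointsD:
  assumes "sample_points M N X N' X'"
  shows "prob_space M" "prob_space.indep_vars M (\<lambda>_. borel) X {..<N}" "prob_space.indep_vars M (\<lambda>_. borel) X' {..<N'}"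
    "j < N \<Longrightarrow> distr M borel (X j) = cube_measure" "j < N' \<Longrightarrow> distr M borel (X' j) = boundary_measure"
proof -
  interpret prob_space M using assms by (simp add: sample_points_def)
  have ind: "indep_vars (\<lambda>_. borel) (case_sum X X') ({..<N} <+> {..<N'})" using assms by (simp add: sample_points_def)
  show "prob_space M" by (rule prob_space_axioms)
  show "indep_vars (\<lambda>_. borel) X {..<N}"
    using indep_vars_inj[OF indep_vars_subset[OF ind], of Inl "{..<N}"] by auto
  show "indep_vars (\<lambda>_. borel) X' {..<N'}"
    using indep_vars_inj[OF indep_vars_subset[OF ind], of Inr "{..<N'}"] by auto
  show "j < N \<Longrightarrow> distr M borel (X j) = cube_measure" "j < N' \<Longrightarrow> distr M borel (X' j) = boundary_measure"
    using assms by (auto simp: sample_points_def)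
qed

lemma (in prob_space) AE_all_lessThan:
  fixes N :: nat
  assumes "\<And>j. j < N \<Longrightarrow> distr M borel (X j) = \<mu>" "indep_vars (\<lambda>_. borel) X {..<N}" "AE x in \<mu>. x \<in> S" "S \<in> sets borel"
  shows "AE \<omega> in M. \<forall>j<N. X j \<omega> \<in> S"
proof -
  have "AE \<omega> in M. X j \<omega> \<in> S" if j: "j < N" for j
  proof -
    have "X j \<in> borel_measurable M" using assms(2) j by (auto simp: indep_vars_def)
    moreover have "AE x in distr M borel (X j). x \<in> S" unfolding assms(1)[OF j] by (rule assms(3))
    ultimately show ?thesis using assms(4) by (simp add: AE_distr_iff)
  qed
  then have "AE \<omega> in M. \<forall>j\<in>{..<N}. X j \<omega> \<in> S" by (intro AE_finite_allI) auto
  then show ?thesis unfolding Ball_def lessThan_iff .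
qed

text \<open>The boundary operator as a vector in the space of jets: applying the operator is taking
  the inner product with the jet. This is the form in which \<open>feature\<close> receives a
  differential operator.\<close>

fun bc_op :: "bc \<Rightarrow> real^'d \<Rightarrow> 'd jet" where
  "bc_op Dirichlet y = (1, 0, 0)"
| "bc_op Neumann y = (0, outer_normal y, 0)"
| "bc_op Robin y = (1, outer_normal y, 0)"

lemma bc_op_upd:
  assumes "x \<in> interior cube" "s \<in> {0, 1}"
  shows "bc_op \<alpha> (upd i s x) \<bullet> j = bc_jet \<alpha> i s j"
  by (cases \<alpha>) (simp_all add: upd_regular(2)[OF assms] inner_prod_def inner_axis')

lemma boundary_op_jet:
  assumes "C2_jet J" "\<And>y. y \<in> cube \<Longrightarrow> v y = val (J y)" "y \<in> cube"
  shows "boundary_op \<alpha> v y = bc_op \<alpha> y \<bullet> J y"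
  using assms by (cases \<alpha>) (simp_all add: inner_prod_def normal_deriv_def gradient_C2[OF assms])

lemma outer_normal_regular:
  assumes "y \<in> regular_boundary"
  shows "norm (outer_normal y) \<le> 1"
proof -
  have "\<exists>i. (y $ i = 0 \<or> y $ i = 1) \<and> (\<forall>j. y $ j = 0 \<or> y $ j = 1 \<longrightarrow> j = i)"
    using assms unfolding regular_boundary_def Ex1_def mem_Collect_eq by (rule conjunct2)
  then obtain i where iu: "(y $ i = 0 \<or> y $ i = 1) \<and> (\<forall>j. y $ j = 0 \<or> y $ j = 1 \<longrightarrow> j = i)" by (rule exE)
  note i = conjunct1[OF iu] and u = mp[OF spec[OF conjunct2[OF iu]]]
  have "outer_normal y $ j = ((if y $ i = 1 then 1 else - 1) *\<^sub>R axis i 1) $ j" for j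
  proof (cases "j = i")
    case True
    then show ?thesis using i by (auto simp: outer_normal_def axis_def)
  next
    case False
    then have "y $ j \<noteq> 0" "y $ j \<noteq> 1" using u[of j] by argo+
    then show ?thesis using False by (simp add: outer_normal_def axis_def)
  qed
  then have "outer_normal y = (if y $ i = 1 then 1 else - 1) *\<^sub>R axis i 1" by (simp add: vec_eq_iff)
  then show ?thesis by simp
qed

lemma norm_bc_op:
  assumes "norm (outer_normal y) \<le> r"
  shows "norm (bc_op \<alpha> y) \<le> r + 1"
proof -
  have "norm (bc_op \<alpha> y) \<le> norm (outer_normal y) + 1"
    by (cases \<alpha>) (auto simp: norm_Pair intro: order_trans[OF sqrt_add_le_add_sqrt])
  then show ?thesis using assms by simp
qed

text \<open>A crude bound valid at every point, also at corners and edges where the vector is no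
  unit normal; \<open>integral_boundary\<close> asks for a bound on the whole cube.\<close>

lemma norm_outer_normal: "norm (outer_normal (y :: real^'d)) \<le> real CARD('d)"
proof -
  have "norm (outer_normal y) \<le> (\<Sum>i\<in>UNIV. \<bar>outer_normal y $ i\<bar>)" by (rule norm_le_l1_cart)
  also have "\<dots> \<le> (\<Sum>i\<in>(UNIV :: 'd set). 1)" by (intro sum_mono) (simp add: outer_normal_def)
  finally show ?thesis by simp
qed

lemma measurable_outer_normal [measurable]: "outer_normal \<in> borel_measurable (borel :: (real^'d) measure)"
proof (subst borel_measurable_euclidean_space, intro ballI)
  fix b :: "real^'d" assume "b \<in> Basis"
  then obtain i where b: "b = axis i 1" by (auto simp: Basis_vec_def)
  have [measurable]: "(\<lambda>x::real^'d. x $ i) \<in> borel_measurable borel" by (intro borel_measurable_continuous_onI continuous_intros)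
  show "(\<lambda>x. outer_normal x \<bullet> b) \<in> borel_measurable borel"
    unfolding b by (simp add: inner_axis outer_normal_def)
qed

lemma measurable_bc_op [measurable]: "(bc_op \<alpha> :: real^'d \<Rightarrow> 'd jet) \<in> borel_measurable borel"
proof -
  have "bc_op Dirichlet = (\<lambda>y :: real^'d. (1, 0, 0) :: 'd jet)" "bc_op Neumann = (\<lambda>y :: real^'d. (0, outer_normal y, 0) :: 'd jet)"
    "bc_op Robin = (\<lambda>y :: real^'d. (1, outer_normal y, 0) :: 'd jet)"
    by (simp_all add: fun_eq_iff)
  then show ?thesis by (cases \<alpha>) simp_all
qed

lemma regular_boundary_borel [measurable]: "(regular_boundary :: (real^'d) set) \<in> sets borel"
proof -
  have [measurable]: "(\<lambda>x::real^'d. x $ i) \<in> borel_measurable borel" for i by (intro borel_measurable_continuous_onI continuous_intros)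
  have "regular_boundary = frontier cube \<inter> {x :: real^'d. \<exists>i. (x $ i = 0 \<or> x $ i = 1) \<and> (\<forall>j. x $ j = 0 \<or> x $ j = 1 \<longrightarrow> j = i)}"
    by (auto simp: regular_boundary_def Ex1_def)
  also have "\<dots> \<in> sets borel" by (intro sets.Int borel_closed[OF frontier_closed]) measurable
  finally show ?thesis .
qed

lemma residual_measurable:
  assumes "\<And>k. k < n \<Longrightarrow> C2_jet (e k)" "k < n"
  shows "continuous_on UNIV (residual n e k)"
  unfolding residual_def[abs_def]
  by (cases "Suc k < n") (auto intro!: continuous_intros C2_continuous assms)

lemma integral_bc_op:
  fixes J :: "real^'d \<Rightarrow> 'd jet"
  assumes J: "C2_jet J"
  shows "2 * real CARD('d) * (\<integral>y. (bc_op \<alpha> y \<bullet> J y)\<^sup>2 \<partial>boundary_measure) = bc_sq \<alpha> J"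
proof -
  have Jm [measurable]: "J \<in> borel_measurable borel" by (intro borel_measurable_continuous_onI C2_continuous J)
  have m [measurable]: "(\<lambda>y. (bc_op \<alpha> y \<bullet> J y)\<^sup>2) \<in> borel_measurable borel" by measurable
  have "bounded (J ` cube)" by (intro compact_imp_bounded compact_continuous_image C2_continuous J compact_cube)
  then obtain K where K: "\<And>x. x \<in> cube \<Longrightarrow> norm (J x) \<le> K" unfolding bounded_iff by auto
  have b: "\<bar>(bc_op \<alpha> y \<bullet> J y)\<^sup>2\<bar> \<le> ((real CARD('d) + 1) * K)\<^sup>2" if y: "y \<in> cube" for y
  proof -
    have "\<bar>bc_op \<alpha> y \<bullet> J y\<bar> \<le> norm (bc_op \<alpha> y) * norm (J y)" by (rule Cauchy_Schwarz_ineq2)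
    also have "\<dots> \<le> (real CARD('d) + 1) * K"
      by (intro mult_mono norm_bc_op norm_outer_normal K y) auto
    finally show ?thesis by (simp add: abs_le_square_iff[symmetric] abs_le_iff power2_le_iff_abs_le power_mono)
  qed
  have sb: "sets cube_measure = sets (borel :: (real^'d) measure)" by simp
  have eq: "(\<integral>x. (bc_op \<alpha> (upd i s x) \<bullet> J (upd i s x))\<^sup>2 \<partial>cube_measure) = (\<integral>x. (bc_jet \<alpha> i s (J (upd i s x)))\<^sup>2 \<partial>cube_measure)"
    if s: "s \<in> {0, 1}" for i :: 'd and s :: real
  proof (rule integral_cong_AE)
    have u: "upd i s \<in> borel_measurable borel"
      by (intro borel_measurable_continuous_onI continuous_intros)
    have c: "continuous_on UNIV (\<lambda>x. (bc_jet \<alpha> i s (J (upd i s x)))\<^sup>2)"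
      by (intro continuous_intros continuous_on_compose2[OF continuous_bc_jet[OF J], of UNIV "upd i s"]) auto
    show "AE x in cube_measure. (bc_op \<alpha> (upd i s x) \<bullet> J (upd i s x))\<^sup>2 = (bc_jet \<alpha> i s (J (upd i s x)))\<^sup>2"
      by (rule AE_mp[OF AE_interior_cube], rule AE_I2) (simp add: bc_op_upd[OF _ s])
    show "(\<lambda>x. (bc_op \<alpha> (upd i s x) \<bullet> J (upd i s x))\<^sup>2) \<in> borel_measurable cube_measure"
      unfolding measurable_cong_sets[OF sb refl] by (rule measurable_compose[OF u m])
    show "(\<lambda>x. (bc_jet \<alpha> i s (J (upd i s x)))\<^sup>2) \<in> borel_measurable cube_measure"
      unfolding measurable_cong_sets[OF sb refl] by (rule borel_measurable_continuous_onI[OF c])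
  qed
  have "(\<integral>y. (bc_op \<alpha> y \<bullet> J y)\<^sup>2 \<partial>boundary_measure) = face_integral (\<lambda>i s y. (bc_op \<alpha> y \<bullet> J y)\<^sup>2) / (2 * real CARD('d))"
    by (rule integral_boundary[OF m b])
  also have "face_integral (\<lambda>i s y. (bc_op \<alpha> y \<bullet> J y)\<^sup>2) = bc_sq \<alpha> J"
    unfolding face_integral_def bc_sq_def by (intro sum.cong refl eq)
  finally show ?thesis by simp
qed

text \<open>The weight of atom \<open>i\<close> is the norm of its outer weight vector, and the
  ratios \<open>a i k / ?L i\<close>, which lie in [-1, 1], become parameters. One extra feature of
  weight \<open>6 * B\<close> carries constants and data. The total is at most
  \<open>4 * B + 6 * B\<close>, whatever the width. A constant jet meets \<open>t\<close> only
  through \<open>val t\<close>, which must therefore be the fixed number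
  \<open>\<kappa>\<close>.\<close>

lemma net_features:
  fixes W :: "nat \<Rightarrow> real^'d"
  assumes net: "net_params n m B c a W b" and k: "k < n" and l: "l < n"
    and r: "\<bar>\<rho>\<bar> \<le> 1" "\<bar>\<delta>\<bar> \<le> 1" "\<bar>\<beta>\<bar> \<le> 1" "\<bar>\<kappa>\<bar> \<le> 1"
  obtains w \<theta> where "\<And>i. i < Suc m \<Longrightarrow> \<theta> i \<in> param_box" "(\<Sum>i<Suc m. \<bar>w i\<bar>) \<le> 10 * B"
    "\<And>x y t. val t = \<kappa> \<Longrightarrow> \<rho> * (t \<bullet> net_jet c a W b m k x) + \<delta> * val (net_jet c a W b m l x) + \<beta> * (6 * B * y)
       = (\<Sum>i<Suc m. w i * feature (\<theta> i) (x, y, t))"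
proof -
  let ?L = "\<lambda>i. L2_set (a i) {..<n}"
  define w where "w i = (if i < m then ?L i else 6 * B)" for i
  define \<theta> :: "nat \<Rightarrow> 'd param" where "\<theta> i = (if i < m then (0, 0, \<rho> * (a i k / ?L i), \<delta> * (a i l / ?L i), W i, b i)
     else ((\<rho> * (\<kappa> * c k) + \<delta> * c l) / (6 * B), \<beta>, 0, 0, 0, 0))" for i
  have c2: "\<bar>c j\<bar> \<le> 2 * B" if "j < n" for j
    using abs_le_L2_set[OF that, of c] net by (simp add: net_params_def)
  have B: "B \<ge> 0" using c2[OF k] by linarith
  have ratio: "\<bar>a i j / ?L i\<bar> \<le> 1" if "j < n" for i j
    using abs_le_L2_set[OF that, of "a i"] L2_set_nonneg[of "a i" "{..<n}"] by (cases "?L i = 0") (simp_all add: divide_le_eq)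
  \<comment> \<open>If the norm of the outer weight is 0, so is the component, and division by zero
    does no harm.\<close>
  have cancel: "?L i * (a i j / ?L i) = a i j" if "j < n" for i j
    using abs_le_L2_set[OF that, of "a i"] by (cases "?L i = 0") simp_all
  have mult1: "\<bar>p * q\<bar> \<le> z" if "\<bar>p\<bar> \<le> 1" "\<bar>q\<bar> \<le> z" for p q z :: real
    unfolding abs_mult using mult_mono[OF that(1) that(2)] that by simp
  let ?q = "\<rho> * (\<kappa> * c k) + \<delta> * c l"
  have "\<bar>\<rho> * (\<kappa> * c k)\<bar> \<le> 2 * B" "\<bar>\<delta> * c l\<bar> \<le> 2 * B"
    by (intro mult1 r c2 k l)+
  then have q: "\<bar>?q\<bar> \<le> 6 * B" using B by linarith
  have qr: "\<bar>?q / (6 * B)\<bar> \<le> 1" using q B by (cases "B = 0") (simp_all add: divide_le_eq)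
  have qc: "6 * B * (?q / (6 * B)) = ?q" using q by (cases "B = 0") simp_all
  show thesis
  proof (rule that)
    show "\<theta> i \<in> param_box" if "i < Suc m" for i
    proof (cases "i < m")
      case True
      then have "norm (W i) \<le> 1" "\<bar>b i\<bar> \<le> 1" using net by (auto simp: net_params_def)
      then show ?thesis using True mult1[OF r(1) ratio[OF k]] mult1[OF r(2) ratio[OF l]]
        by (simp add: \<theta>_def param_box_Pair param_box_real param_box_vec)
    next
      case False
      then show ?thesis using qr r(3) by (simp add: \<theta>_def param_box_Pair param_box_real param_box_vec)
    qed
    have "(\<Sum>i<m. \<bar>w i\<bar>) = (\<Sum>i<m. ?L i)" by (intro sum.cong refl) (simp add: w_def)
    then show "(\<Sum>i<Suc m. \<bar>w i\<bar>) \<le> 10 * B" using net B by (simp add: net_params_def) (simp add: w_def)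
    fix x y and t :: "'d jet" assume t: "val t = \<kappa>"
    let ?A = "\<lambda>i. act_jet (W i) (b i) x"
    have 0: "t \<bullet> (c k, 0, 0) = \<kappa> * c k" by (simp add: inner_prod_def t)
    have 1: "t \<bullet> net_jet c a W b m k x = \<kappa> * c k + (\<Sum>i<m. a i k * (t \<bullet> ?A i))"
      by (simp add: net_jet_def inner_add_right inner_sum_right 0)
    have 2: "val (net_jet c a W b m l x) = c l + (\<Sum>i<m. a i l * val (?A i))"
      by (simp add: net_jet_def fst_sum)
    have "(\<Sum>i<m. w i * feature (\<theta> i) (x, y, t)) = (\<Sum>i<m. \<rho> * (a i k * (t \<bullet> ?A i)) + \<delta> * (a i l * val (?A i)))"
    proof (intro sum.cong refl)
      fix i assume "i \<in> {..<m}"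
      then have "w i * feature (\<theta> i) (x, y, t) = ?L i * (\<rho> * (a i k / ?L i) * (t \<bullet> ?A i) + \<delta> * (a i l / ?L i) * val (?A i))"
        by (simp add: w_def \<theta>_def)
      also have "\<dots> = \<rho> * ((?L i * (a i k / ?L i)) * (t \<bullet> ?A i)) + \<delta> * ((?L i * (a i l / ?L i)) * val (?A i))"
        by (simp add: algebra_simps)
      finally show "w i * feature (\<theta> i) (x, y, t) = \<rho> * (a i k * (t \<bullet> ?A i)) + \<delta> * (a i l * val (?A i))"
        unfolding cancel[OF k] cancel[OF l] .
    qed
    moreover have "w m * feature (\<theta> m) (x, y, t) = ?q + \<beta> * (6 * B * y)"
    proof -
      have "w m * feature (\<theta> m) (x, y, t) = 6 * B * (?q / (6 * B)) + \<beta> * (6 * B * y)"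
        unfolding w_def \<theta>_def by (simp add: distrib_left)
      then show ?thesis unfolding qc .
    qed
    ultimately show "\<rho> * (t \<bullet> net_jet c a W b m k x) + \<delta> * val (net_jet c a W b m l x) + \<beta> * (6 * B * y)
       = (\<Sum>i<Suc m. w i * feature (\<theta> i) (x, y, t))"
      unfolding 1 2 by (simp add: sum.distrib sum_distrib_left distrib_left)
  qed
qed

definition lap_op :: "'d::finite jet" where "lap_op = (0, 0, One)"

lemma inner_lap_op: "lap_op \<bullet> j = lap j"
  by (simp add: lap_op_def inner_prod_def inner_vec_def lap_def del: sum_component)

text \<open>For \<open>B = 0\<close> the hypothesis forces \<open>z = 0\<close>, and division by
  zero returns 0, so both claims still hold.\<close>

lemma rescale:
  fixes z B :: real
  assumes "\<bar>z\<bar> \<le> 6 * B"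
  shows "\<bar>z / (6 * B)\<bar> \<le> 1" "6 * B * (z / (6 * B)) = z"
  using assms by (cases "B = 0"; simp add: divide_le_eq)+

definition dev_const :: "'d::finite itself \<Rightarrow> real \<Rightarrow> real" where
  "dev_const _ K = chain_const DIM('d param \<times> 'd param) * (2 * K\<^sup>2)"

text \<open>The radius \<open>norm lap_op + 2\<close> covers the interior operator
  \<open>lap_op\<close> as well as the boundary operators, whose norm is at most 2 on the regular
  boundary.\<close>

definition feature_const :: "'d::finite itself \<Rightarrow> real \<Rightarrow> bool" where
  "feature_const _ K \<longleftrightarrow> K > 0 \<and>
     (\<forall>\<theta>\<in>(param_box :: 'd param set). \<forall>\<theta>'\<in>param_box. \<forall>p\<in>feature_points (norm (lap_op :: 'd jet) + 2).
        \<bar>feature \<theta> p\<bar> \<le> K \<and> \<bar>feature \<theta> p - feature \<theta>' p\<bar> \<le> K * norm (\<theta> - \<theta>'))"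

lemma feature_const_exists: "\<exists>K. feature_const TYPE('d::finite) K"
  using bounded_lipschitz_feature[where 'd = 'd] unfolding bounded_lipschitz_def feature_const_def by blast

context
  fixes u :: "real^'d \<Rightarrow> real" and n :: nat and U :: "nat \<Rightarrow> real^'d \<Rightarrow> 'd jet" and B :: real
  assumes u: "u \<in> barron_space (2 * n + 3)" and n: "n \<ge> 1"
  defines "U \<equiv> barron_jet u" and "B \<equiv> barron_norm (2 * n + 3) u"
begin

lemma C2_U: "k \<le> n \<Longrightarrow> C2_jet (U k)"
  unfolding U_def using u by (intro C2_barron_jet) auto

lemma norm_U: "k \<le> n \<Longrightarrow> norm (U k x) \<le> 3 * B"
  unfolding U_def B_def using u by (intro norm_barron_jet) auto

lemma lap_U: "k < n \<Longrightarrow> lap (U k x) = val (U (Suc k) x)"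
  unfolding U_def using u by (intro lap_barron_jet) auto

lemma B_nonneg: "0 \<le> B"
  using norm_U[of 0 0] norm_ge_zero[of "U 0 0"] by linarith

text \<open>Brings the residual into the shape of \<open>net_features\<close>. Unless
  \<open>k\<close> is the last component, the exact jets cancel by \<open>lap_U\<close>; in the last
  one only \<open>val (U n x)\<close> stays. The index chosen in that case is a placeholder with
  coefficient 0.\<close>

lemma residual_net:
  assumes "k < n"
  shows "residual n (\<lambda>k x. net_jet c a W b m k x - U k x) k x =
    1 * (lap_op \<bullet> net_jet c a W b m k x) + (if Suc k < n then - 1 else 0) * val (net_jet c a W b m (if Suc k < n then Suc k else k) x)
      + (if Suc k < n then 0 else - 1) * val (U n x)"
  using assms lap_U[OF assms, of x] by (cases "Suc k < n") (auto simp: residual_def lap_linear inner_lap_op less_Suc_eq not_less dest: le_less_Suc_eq)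

text \<open>A single \<open>G\<close> serves all components: operator and data,
  \<open>lap_op\<close> and \<open>val (U n x)\<close>, do not depend on \<open>k\<close>. Hence it
  also controls the mean in the Neumann penalty.\<close>

lemma interior_deviation:
  fixes M :: "'w measure" and X :: "nat \<Rightarrow> 'w \<Rightarrow> real^'d"
  assumes M: "prob_space M" and X: "prob_space.indep_vars M (\<lambda>_. borel) X {..<N}" and law: "\<And>j. j < N \<Longrightarrow> distr M borel (X j) = cube_measure" and N: "N \<ge> 1"
    and K: "feature_const TYPE('d) K"
  obtains G where "G \<in> borel_measurable M" "(\<integral>\<^sup>+\<omega>. G \<omega> \<partial>M) \<le> ennreal (dev_const TYPE('d) K / sqrt N)"
    "\<And>\<omega> m c a W b k. (\<And>j. j < N \<Longrightarrow> X j \<omega> \<in> interior cube) \<Longrightarrow> net_params n m B c a W b \<Longrightarrow> k < n \<Longrightarrow>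
       ennreal \<bar>(\<Sum>j<N. (residual n (\<lambda>k x. net_jet c a W b m k x - U k x) k (X j \<omega>))\<^sup>2) / real N
          - residual_sq n (\<lambda>k x. net_jet c a W b m k x - U k x) k\<bar> \<le> ennreal ((10 * B)\<^sup>2) * G \<omega>"
    "\<And>\<omega> m c a W b. (\<And>j. j < N \<Longrightarrow> X j \<omega> \<in> interior cube) \<Longrightarrow> net_params n m B c a W b \<Longrightarrow>
       ennreal \<bar>(\<Sum>j<N. val (net_jet c a W b m 0 (X j \<omega>))) / real N - (\<integral>x. val (net_jet c a W b m 0 x) \<partial>cube_measure)\<bar>
         \<le> ennreal (10 * B) * G \<omega>"
proof -
  interpret prob_space M by (rule M)
  let ?F = "\<lambda>x. val (U n x) / (6 * B)"
  have vU: "\<bar>val (U n x)\<bar> \<le> 6 * B" for x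
    using order_trans[OF norm_component_jet(3) norm_U[OF order_refl], of x] B_nonneg by linarith
  have mF: "?F \<in> borel_measurable borel"
    by (intro borel_measurable_divide borel_measurable_const borel_measurable_continuous_onI C2_continuous C2_U) simp
  have K': "K > 0" "\<And>\<theta> p. \<theta> \<in> param_box \<Longrightarrow> p \<in> feature_points (norm (lap_op :: 'd jet) + 2) \<Longrightarrow> \<bar>(feature :: 'd param \<Rightarrow> _) \<theta> p\<bar> \<le> K"
      "\<And>\<theta> \<theta>' p. \<theta> \<in> param_box \<Longrightarrow> \<theta>' \<in> param_box \<Longrightarrow> p \<in> feature_points (norm (lap_op :: 'd jet) + 2) \<Longrightarrow> \<bar>(feature :: 'd param \<Rightarrow> _) \<theta> p - feature \<theta>' p\<bar> \<le> K * norm (\<theta> - \<theta>')"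
    using K unfolding feature_const_def by blast+
  have intS: "interior cube \<in> sets (borel :: (real^'d) measure)" "interior cube \<subseteq> (cube :: (real^'d) set)"
    by (simp_all add: interior_subset)
  have nl: "norm (lap_op :: 'd jet) \<le> norm (lap_op :: 'd jet) + 2" by simp
  obtain G where G: "G \<in> borel_measurable M" "(\<integral>\<^sup>+\<omega>. G \<omega> \<partial>M) \<le> ennreal (dev_const TYPE('d) K / sqrt N)"
    and dev: "\<And>\<omega> I w \<theta> r R. (\<And>j. j < N \<Longrightarrow> X j \<omega> \<in> interior cube) \<Longrightarrow> finite (I :: nat set) \<Longrightarrow> (\<And>i. i \<in> I \<Longrightarrow> \<theta> i \<in> param_box) \<Longrightarrow> r \<in> borel_measurable borel \<Longrightarrow>
       (\<And>x. x \<in> interior cube \<Longrightarrow> r x = (\<Sum>i\<in>I. w i * feature (\<theta> i) (x, ?F x, lap_op))) \<Longrightarrow> (\<Sum>i\<in>I. \<bar>w i\<bar>) \<le> R \<Longrightarrow>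
       ennreal \<bar>(\<Sum>j<N. (r (X j \<omega>))\<^sup>2) / real N - (\<integral>x. (r x)\<^sup>2 \<partial>cube_measure)\<bar> \<le> ennreal (R\<^sup>2) * G \<omega> \<and>
       ennreal \<bar>(\<Sum>j<N. r (X j \<omega>)) / real N - (\<integral>x. r x \<partial>cube_measure)\<bar> \<le> ennreal R * G \<omega>"
  proof (rule quadratic_deviation[where F = ?F and T = "\<lambda>_. lap_op" and S = "interior cube" and \<tau> = "norm (lap_op :: 'd jet) + 2" and K = K,
          OF X law N intS AE_interior_cube mF rescale(1)[OF vU] borel_measurable_const nl K'])
    fix G assume G: "G \<in> borel_measurable M" "(\<integral>\<^sup>+\<omega>. G \<omega> \<partial>M) \<le> ennreal (chain_const DIM('d param \<times> 'd param) * (2 * K\<^sup>2) / sqrt N)"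
      and dev: "\<And>\<omega> I w \<theta> r R. (\<And>j. j < N \<Longrightarrow> X j \<omega> \<in> interior cube) \<Longrightarrow> finite (I :: nat set) \<Longrightarrow> (\<And>i. i \<in> I \<Longrightarrow> \<theta> i \<in> param_box) \<Longrightarrow> r \<in> borel_measurable borel \<Longrightarrow>
       (\<And>x. x \<in> interior cube \<Longrightarrow> r x = (\<Sum>i\<in>I. w i * feature (\<theta> i) (x, ?F x, lap_op))) \<Longrightarrow> (\<Sum>i\<in>I. \<bar>w i\<bar>) \<le> R \<Longrightarrow>
       ennreal \<bar>(\<Sum>j<N. (r (X j \<omega>))\<^sup>2) / real N - (\<integral>x. (r x)\<^sup>2 \<partial>cube_measure)\<bar> \<le> ennreal (R\<^sup>2) * G \<omega> \<and>
       ennreal \<bar>(\<Sum>j<N. r (X j \<omega>)) / real N - (\<integral>x. r x \<partial>cube_measure)\<bar> \<le> ennreal R * G \<omega>"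
    show thesis by (rule that[unfolded dev_const_def, OF G]) (rule dev)
  qed
  have v0: "val (lap_op :: 'd jet) = 0" by (simp add: lap_op_def)
  show thesis
  proof (rule that[OF G])
    fix \<omega> m c a b k and W :: "nat \<Rightarrow> real^'d"
    assume S: "\<And>j. j < N \<Longrightarrow> X j \<omega> \<in> interior cube" and net: "net_params n m B c a W b" and k: "k < n"
    let ?\<delta> = "if Suc k < n then - 1 else 0 :: real" and ?l = "if Suc k < n then Suc k else k" and ?\<beta> = "if Suc k < n then 0 else - 1 :: real"
    obtain w \<theta> where w: "\<And>i. i < Suc m \<Longrightarrow> \<theta> i \<in> param_box" "(\<Sum>i<Suc m. \<bar>w i\<bar>) \<le> 10 * B"
      "\<And>x y t. val t = 0 \<Longrightarrow> 1 * (t \<bullet> net_jet c a W b m k x) + ?\<delta> * val (net_jet c a W b m ?l x) + ?\<beta> * (6 * B * y)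
         = (\<Sum>i<Suc m. w i * feature (\<theta> i) (x, y, t))"
      by (rule net_features[OF net k, of ?l 1 ?\<delta> ?\<beta> 0]) (use k in auto)
    show "ennreal \<bar>(\<Sum>j<N. (residual n (\<lambda>k x. net_jet c a W b m k x - U k x) k (X j \<omega>))\<^sup>2) / real N
          - residual_sq n (\<lambda>k x. net_jet c a W b m k x - U k x) k\<bar> \<le> ennreal ((10 * B)\<^sup>2) * G \<omega>"
      unfolding residual_sq_def
    proof (rule conjunct1[OF dev[of \<omega> "{..<Suc m}" \<theta> "residual n (\<lambda>k x. net_jet c a W b m k x - U k x) k" w, OF S]])
      show "residual n (\<lambda>k x. net_jet c a W b m k x - U k x) k \<in> borel_measurable borel"
        by (intro borel_measurable_continuous_onI residual_measurable C2_diff C2_net_jet C2_U k) simp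
      show "residual n (\<lambda>k x. net_jet c a W b m k x - U k x) k x = (\<Sum>i<Suc m. w i * feature (\<theta> i) (x, ?F x, lap_op))" for x
        unfolding residual_net[OF k] w(3)[OF v0, symmetric] rescale(2)[OF vU] ..
    qed (use w in auto)
  next
    fix \<omega> m c a b and W :: "nat \<Rightarrow> real^'d"
    assume S: "\<And>j. j < N \<Longrightarrow> X j \<omega> \<in> interior cube" and net: "net_params n m B c a W b"
    obtain w \<theta> where w: "\<And>i. i < Suc m \<Longrightarrow> \<theta> i \<in> param_box" "(\<Sum>i<Suc m. \<bar>w i\<bar>) \<le> 10 * B"
      "\<And>x y t. val t = 0 \<Longrightarrow> 0 * (t \<bullet> net_jet c a W b m 0 x) + 1 * val (net_jet c a W b m 0 x) + 0 * (6 * B * y)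
         = (\<Sum>i<Suc m. w i * feature (\<theta> i) (x, y, t))"
      by (rule net_features[OF net, of 0 0 0 1 0 0]) (use n in auto)
    show "ennreal \<bar>(\<Sum>j<N. val (net_jet c a W b m 0 (X j \<omega>))) / real N - (\<integral>x. val (net_jet c a W b m 0 x) \<partial>cube_measure)\<bar>
         \<le> ennreal (10 * B) * G \<omega>"
    proof (rule conjunct2[OF dev[of \<omega> "{..<Suc m}" \<theta> "\<lambda>x. val (net_jet c a W b m 0 x)" w, OF S]])
      show "(\<lambda>x. val (net_jet c a W b m 0 x)) \<in> borel_measurable borel"
        by (intro borel_measurable_continuous_onI C2_continuous C2_net_jet)
      show "val (net_jet c a W b m 0 x) = (\<Sum>i<Suc m. w i * feature (\<theta> i) (x, ?F x, lap_op))" for x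
        unfolding w(3)[OF v0, symmetric] by simp
    qed (use w in auto)
  qed
qed

text \<open>Here the data depend on the component, so there is one majorant for each
  \<open>k\<close>. The scale \<open>6 * B\<close> is the product of the bounds 2 for the operator
  and \<open>3 * B\<close> for the exact jets.\<close>

lemma boundary_deviation:
  fixes M :: "'w measure" and X :: "nat \<Rightarrow> 'w \<Rightarrow> real^'d"
  assumes M: "prob_space M" and X: "prob_space.indep_vars M (\<lambda>_. borel) X {..<N}" and law: "\<And>j. j < N \<Longrightarrow> distr M borel (X j) = boundary_measure" and N: "N \<ge> 1"
    and K: "feature_const TYPE('d) K" and k: "k < n"
  obtains G where "G \<in> borel_measurable M" "(\<integral>\<^sup>+\<omega>. G \<omega> \<partial>M) \<le> ennreal (dev_const TYPE('d) K / sqrt N)"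
    "\<And>\<omega> m c a W b. (\<And>j. j < N \<Longrightarrow> X j \<omega> \<in> regular_boundary) \<Longrightarrow> net_params n m B c a W b \<Longrightarrow>
       ennreal \<bar>(\<Sum>j<N. (bc_op \<alpha> (X j \<omega>) \<bullet> (net_jet c a W b m k (X j \<omega>) - U k (X j \<omega>)))\<^sup>2) / real N
          - (\<integral>x. (bc_op \<alpha> x \<bullet> (net_jet c a W b m k x - U k x))\<^sup>2 \<partial>boundary_measure)\<bar> \<le> ennreal ((10 * B)\<^sup>2) * G \<omega>"
proof -
  interpret prob_space M by (rule M)
  let ?F = "\<lambda>x. (bc_op \<alpha> x \<bullet> U k x) / (6 * B)"
  have nb: "norm (bc_op \<alpha> x) \<le> 2" if "x \<in> regular_boundary" for x :: "real^'d"
    using norm_bc_op[OF outer_normal_regular[OF that], of \<alpha>] by simp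
  have vU: "\<bar>bc_op \<alpha> x \<bullet> U k x\<bar> \<le> 6 * B" if "x \<in> regular_boundary" for x
  proof -
    have "norm (bc_op \<alpha> x) * norm (U k x) \<le> 2 * (3 * B)"
      using k by (intro mult_mono nb that norm_U) auto
    then show ?thesis using Cauchy_Schwarz_ineq2[of "bc_op \<alpha> x" "U k x"] by linarith
  qed
  have mU [measurable]: "U k \<in> borel_measurable borel"
    using k by (intro borel_measurable_continuous_onI C2_continuous C2_U) simp
  have mF: "?F \<in> borel_measurable borel" by measurable
  have K': "K > 0" "\<And>\<theta> p. \<theta> \<in> param_box \<Longrightarrow> p \<in> feature_points (norm (lap_op :: 'd jet) + 2) \<Longrightarrow> \<bar>(feature :: 'd param \<Rightarrow> _) \<theta> p\<bar> \<le> K"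
      "\<And>\<theta> \<theta>' p. \<theta> \<in> param_box \<Longrightarrow> \<theta>' \<in> param_box \<Longrightarrow> p \<in> feature_points (norm (lap_op :: 'd jet) + 2) \<Longrightarrow> \<bar>(feature :: 'd param \<Rightarrow> _) \<theta> p - feature \<theta>' p\<bar> \<le> K * norm (\<theta> - \<theta>')"
    using K unfolding feature_const_def by blast+
  have nb': "norm (bc_op \<alpha> x) \<le> norm (lap_op :: 'd jet) + 2" if "x \<in> regular_boundary" for x :: "real^'d"
    using nb[OF that] norm_ge_zero[of "lap_op :: 'd jet"] by linarith
  have intS: "regular_boundary \<subseteq> (cube :: (real^'d) set)" by (auto simp: regular_boundary_subset)
  obtain G where G: "G \<in> borel_measurable M" "(\<integral>\<^sup>+\<omega>. G \<omega> \<partial>M) \<le> ennreal (dev_const TYPE('d) K / sqrt N)"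
    and dev: "\<And>\<omega> I w \<theta> r R. (\<And>j. j < N \<Longrightarrow> X j \<omega> \<in> regular_boundary) \<Longrightarrow> finite (I :: nat set) \<Longrightarrow> (\<And>i. i \<in> I \<Longrightarrow> \<theta> i \<in> param_box) \<Longrightarrow> r \<in> borel_measurable borel \<Longrightarrow>
       (\<And>x. x \<in> regular_boundary \<Longrightarrow> r x = (\<Sum>i\<in>I. w i * feature (\<theta> i) (x, ?F x, bc_op \<alpha> x))) \<Longrightarrow> (\<Sum>i\<in>I. \<bar>w i\<bar>) \<le> R \<Longrightarrow>
       ennreal \<bar>(\<Sum>j<N. (r (X j \<omega>))\<^sup>2) / real N - (\<integral>x. (r x)\<^sup>2 \<partial>boundary_measure)\<bar> \<le> ennreal (R\<^sup>2) * G \<omega> \<and>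
       ennreal \<bar>(\<Sum>j<N. r (X j \<omega>)) / real N - (\<integral>x. r x \<partial>boundary_measure)\<bar> \<le> ennreal R * G \<omega>"
  proof (rule quadratic_deviation[where F = ?F and T = "bc_op \<alpha>" and S = regular_boundary and \<tau> = "norm (lap_op :: 'd jet) + 2" and K = K,
          OF X law N regular_boundary_borel intS AE_boundary mF rescale(1)[OF vU] measurable_bc_op nb' K'])
    fix G assume G: "G \<in> borel_measurable M" "(\<integral>\<^sup>+\<omega>. G \<omega> \<partial>M) \<le> ennreal (chain_const DIM('d param \<times> 'd param) * (2 * K\<^sup>2) / sqrt N)"
      and dev: "\<And>\<omega> I w \<theta> r R. (\<And>j. j < N \<Longrightarrow> X j \<omega> \<in> regular_boundary) \<Longrightarrow> finite (I :: nat set) \<Longrightarrow> (\<And>i. i \<in> I \<Longrightarrow> \<theta> i \<in> param_box) \<Longrightarrow> r \<in> borel_measurable borel \<Longrightarrow>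
       (\<And>x. x \<in> regular_boundary \<Longrightarrow> r x = (\<Sum>i\<in>I. w i * feature (\<theta> i) (x, ?F x, bc_op \<alpha> x))) \<Longrightarrow> (\<Sum>i\<in>I. \<bar>w i\<bar>) \<le> R \<Longrightarrow>
       ennreal \<bar>(\<Sum>j<N. (r (X j \<omega>))\<^sup>2) / real N - (\<integral>x. (r x)\<^sup>2 \<partial>boundary_measure)\<bar> \<le> ennreal (R\<^sup>2) * G \<omega> \<and>
       ennreal \<bar>(\<Sum>j<N. r (X j \<omega>)) / real N - (\<integral>x. r x \<partial>boundary_measure)\<bar> \<le> ennreal R * G \<omega>"
    show thesis by (rule that[unfolded dev_const_def, OF G]) (rule dev)
  qed
  let ?\<kappa> = "if \<alpha> = Neumann then 0 else 1 :: real"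
  have v0: "val (bc_op \<alpha> x :: 'd jet) = ?\<kappa>" for x by (cases \<alpha>) simp_all
  show thesis
  proof (rule that[OF G])
    fix \<omega> m c a b and W :: "nat \<Rightarrow> real^'d"
    assume S: "\<And>j. j < N \<Longrightarrow> X j \<omega> \<in> regular_boundary" and net: "net_params n m B c a W b"
    obtain w \<theta> where w: "\<And>i. i < Suc m \<Longrightarrow> \<theta> i \<in> param_box" "(\<Sum>i<Suc m. \<bar>w i\<bar>) \<le> 10 * B"
      "\<And>x y t. val t = ?\<kappa> \<Longrightarrow> 1 * (t \<bullet> net_jet c a W b m k x) + 0 * val (net_jet c a W b m k x) + (- 1) * (6 * B * y)
         = (\<Sum>i<Suc m. w i * feature (\<theta> i) (x, y, t))"
      by (rule net_features[OF net k k, of 1 0 "- 1" ?\<kappa>]) auto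
    show "ennreal \<bar>(\<Sum>j<N. (bc_op \<alpha> (X j \<omega>) \<bullet> (net_jet c a W b m k (X j \<omega>) - U k (X j \<omega>)))\<^sup>2) / real N
          - (\<integral>x. (bc_op \<alpha> x \<bullet> (net_jet c a W b m k x - U k x))\<^sup>2 \<partial>boundary_measure)\<bar> \<le> ennreal ((10 * B)\<^sup>2) * G \<omega>"
    proof (rule conjunct1[OF dev[of \<omega> "{..<Suc m}" \<theta> "\<lambda>x. bc_op \<alpha> x \<bullet> (net_jet c a W b m k x - U k x)" w, OF S]])
      have [measurable]: "net_jet c a W b m k \<in> borel_measurable borel"
        by (intro borel_measurable_continuous_onI C2_continuous C2_net_jet)
      show "(\<lambda>x. bc_op \<alpha> x \<bullet> (net_jet c a W b m k x - U k x)) \<in> borel_measurable borel" by measurable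
      show "bc_op \<alpha> x \<bullet> (net_jet c a W b m k x - U k x) = (\<Sum>i<Suc m. w i * feature (\<theta> i) (x, ?F x, bc_op \<alpha> x))"
        if "x \<in> regular_boundary" for x
        unfolding w(3)[OF v0, symmetric] rescale(2)[OF vU[OF that]] by (simp add: inner_diff_right)
    qed (use w in auto)
  qed
qed

end

section \<open>Empirical and population loss in terms of jets\<close>

definition emp_jet_loss :: "bc \<Rightarrow> nat \<Rightarrow> real \<Rightarrow> real \<Rightarrow> (nat \<Rightarrow> real^'d \<Rightarrow> 'd jet) \<Rightarrow> (nat \<Rightarrow> real^'d \<Rightarrow> 'd jet) \<Rightarrow>
    nat \<Rightarrow> (nat \<Rightarrow> real^'d) \<Rightarrow> nat \<Rightarrow> (nat \<Rightarrow> real^'d) \<Rightarrow> real" where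
  "emp_jet_loss \<alpha> n lam mu V U N x N' x' =
     (\<Sum>k<n. (\<Sum>j<N. (residual n (\<lambda>k x. V k x - U k x) k (x j))\<^sup>2) / real N) +
     2 * real CARD('d) * lam * (\<Sum>k<n. (\<Sum>j<N'. (bc_op \<alpha> (x' j) \<bullet> (V k (x' j) - U k (x' j)))\<^sup>2) / real N') +
     (if \<alpha> = Neumann then mu * ((\<Sum>j<N. val (V 0 (x j))) / real N)\<^sup>2 else 0)"

text \<open>The Neumann term contains the network alone, as in the empirical loss; since the exact
  solution has mean zero, it is the squared mean of the error as well.\<close>

definition pop_jet_loss :: "bc \<Rightarrow> nat \<Rightarrow> real \<Rightarrow> real \<Rightarrow> (nat \<Rightarrow> real^'d \<Rightarrow> 'd jet) \<Rightarrow> (nat \<Rightarrow> real^'d \<Rightarrow> 'd jet) \<Rightarrow> real" where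
  "pop_jet_loss \<alpha> n lam mu V U =
     (\<Sum>k<n. residual_sq n (\<lambda>k x. V k x - U k x) k) + lam * (\<Sum>k<n. bc_sq \<alpha> (\<lambda>x. V k x - U k x)) +
     (if \<alpha> = Neumann then mu * (\<integral>x. val (V 0 x) \<partial>cube_measure)\<^sup>2 else 0)"

lemma L2_set_sq: "(L2_set a {..<n})\<^sup>2 = (\<Sum>k<n. (a k)\<^sup>2)" for n :: nat
  by (simp add: L2_set_def sum_nonneg)

text \<open>The samples have to avoid the boundary and the edges, because there \<open>f\<close> and
  \<open>g\<close> are not determined by \<open>u\<close>. Elsewhere the data can be replaced by the
  jets of \<open>u\<close>, and the loss depends on the error alone, apart from the Neumann
  mean.\<close>

lemma empirical_loss_jets:
  fixes u :: "real^'d \<Rightarrow> real"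
  assumes u: "u \<in> barron_space (2 * n + 3)" "continuous_on cube u" and n: "n \<ge> 1" and bvp: "solves_bvp \<alpha> n u f g"
    and x: "\<And>j. j < N \<Longrightarrow> x j \<in> interior cube" and x': "\<And>j. j < N' \<Longrightarrow> x' j \<in> regular_boundary"
    and V: "\<And>k. k < n \<Longrightarrow> C2_jet (V k)" and w: "\<And>k y. k < n \<Longrightarrow> w k y = val (V k y)"
  shows "empirical_loss \<alpha> n lam mu f g N x N' x' w = emp_jet_loss \<alpha> n lam mu V (barron_jet u) N x N' x'"
proof -
  let ?U = "barron_jet u"
  have uk: "(laplacian ^^ k) u y = val (?U k y)" if "k \<le> n" "y \<in> cube" for k y
    by (rule iterated_laplacian_barron[OF u]) (use that in auto)
  have int: "P_op n w k (x j) - f_vec n f k (x j) = residual n (\<lambda>k x. V k x - ?U k x) k (x j)" if k: "k < n" and j: "j < N" for k j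
  proof -
    have xc: "x j \<in> cube" using x[OF j] interior_subset by blast
    have l: "laplacian (w k) (x j) = lap (V k (x j))" by (rule laplacian_C2[OF V[OF k] w[OF k] xc])
    have lu: "lap (?U k (x j)) = val (?U (Suc k) (x j))" using k by (intro lap_barron_jet[OF u(1)]) simp
    have fx: "f (x j) = val (?U n (x j))" using bvp x[OF j] uk[OF order_refl xc] by (auto simp: solves_bvp_def)
    show ?thesis
    proof (cases "Suc k < n")
      case True
      then show ?thesis using l lu by (simp add: P_op_def f_vec_def residual_def w lap_linear)
    next
      case False
      then have "Suc k = n" using k by simp
      then show ?thesis using l lu fx by (auto simp: P_op_def f_vec_def residual_def lap_linear)
    qed
  qed
  have bd: "boundary_op \<alpha> (w k) (x' j) - g k (x' j) = bc_op \<alpha> (x' j) \<bullet> (V k (x' j) - ?U k (x' j))" if k: "k < n" and j: "j < N'" for k j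
  proof -
    have yc: "x' j \<in> cube" by (rule regular_boundary_subset[OF x'[OF j]])
    have "g k (x' j) = boundary_op \<alpha> ((laplacian ^^ k) u) (x' j)" using bvp x'[OF j] k by (auto simp: solves_bvp_def)
    also have "\<dots> = bc_op \<alpha> (x' j) \<bullet> ?U k (x' j)"
      using k by (intro boundary_op_jet[OF C2_barron_jet[OF u(1)] uk yc]) auto
    finally show ?thesis using boundary_op_jet[OF V[OF k] w[OF k] yc, of \<alpha>] by (simp add: inner_diff_right)
  qed
  have "(\<Sum>j<N. (L2_set (\<lambda>k. P_op n w k (x j) - f_vec n f k (x j)) {..<n})\<^sup>2)
      = (\<Sum>k<n. \<Sum>j<N. (residual n (\<lambda>k x. V k x - ?U k x) k (x j))\<^sup>2)"
    unfolding L2_set_sq by (subst sum.swap) (intro sum.cong refl, simp add: int)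
  moreover have "(\<Sum>j<N'. lam * (L2_set (\<lambda>k. boundary_op \<alpha> (w k) (x' j) - g k (x' j)) {..<n})\<^sup>2)
      = lam * (\<Sum>k<n. \<Sum>j<N'. (bc_op \<alpha> (x' j) \<bullet> (V k (x' j) - ?U k (x' j)))\<^sup>2)"
    unfolding L2_set_sq sum_distrib_left[symmetric] by (subst sum.swap) (intro arg_cong2[where f = times] sum.cong refl, simp add: bd)
  moreover have "w 0 y = val (V 0 y)" for y using w[of 0] n by simp
  ultimately show ?thesis
    unfolding empirical_loss_def emp_jet_loss_def by (simp add: measure_frontier sum_divide_distrib[symmetric])
qed

text \<open>The first two terms are the squared weight bound \<open>10 * B\<close> for
  \<open>n\<close> interior residuals and for the boundary of area \<open>2 * d\<close>; the last
  comes from factoring the difference of two squared means.\<close>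

definition loss_const :: "nat \<Rightarrow> nat \<Rightarrow> real \<Rightarrow> real \<Rightarrow> real" where
  "loss_const n d lam mu = 100 * real n + 200 * real d * lam + 20 * (2 + 4 * act_bound d) * mu"

lemma loss_deviation:
  fixes u :: "real^'d \<Rightarrow> real" and M :: "'w measure"
  assumes u: "u \<in> barron_space (2 * n + 3)" and n: "n \<ge> 1" and sp: "sample_points M N X N' X'" and N: "N \<ge> 1" "N' \<ge> 1"
    and K: "feature_const TYPE('d) K" and lm: "lam > 0" "mu > 0"
  shows "\<exists>H. H \<in> borel_measurable M \<and>
    (\<integral>\<^sup>+\<omega>. H \<omega> \<partial>M) \<le> ennreal (dev_const TYPE('d) K / sqrt N) + of_nat n * ennreal (dev_const TYPE('d) K / sqrt N') \<and>
    (\<forall>\<omega> m c a W b. (\<forall>j<N. X j \<omega> \<in> interior cube) \<longrightarrow> (\<forall>j<N'. X' j \<omega> \<in> regular_boundary) \<longrightarrow>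
       net_params n m (barron_norm (2 * n + 3) u) c a W b \<longrightarrow>
       ennreal \<bar>emp_jet_loss \<alpha> n lam mu (net_jet c a W b m) (barron_jet u) N (\<lambda>j. X j \<omega>) N' (\<lambda>j. X' j \<omega>)
         - pop_jet_loss \<alpha> n lam mu (net_jet c a W b m) (barron_jet u)\<bar>
       \<le> ennreal (loss_const n CARD('d) lam mu * (barron_norm (2 * n + 3) u)\<^sup>2) * H \<omega>)"
proof -
  note sp = sample_pointsD[OF sp]
  let ?B = "barron_norm (2 * n + 3) u" and ?U = "barron_jet u" and ?D = "dev_const TYPE('d) K"
  have B: "?B \<ge> 0" by (rule B_nonneg[OF u n])
  define P where "P k G \<longleftrightarrow> G \<in> borel_measurable M \<and> (\<integral>\<^sup>+\<omega>. G \<omega> \<partial>M) \<le> ennreal (?D / sqrt N') \<and>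
    (\<forall>\<omega> m c a W b. (\<forall>j<N'. X' j \<omega> \<in> regular_boundary) \<longrightarrow> net_params n m ?B c a W b \<longrightarrow>
       ennreal \<bar>(\<Sum>j<N'. (bc_op \<alpha> (X' j \<omega>) \<bullet> (net_jet c a W b m k (X' j \<omega>) - ?U k (X' j \<omega>)))\<^sup>2) / real N'
          - (\<integral>x. (bc_op \<alpha> x \<bullet> (net_jet c a W b m k x - ?U k x))\<^sup>2 \<partial>boundary_measure)\<bar> \<le> ennreal ((10 * ?B)\<^sup>2) * G \<omega>)" for k G
  have "\<exists>G. P k G" if k: "k < n" for k
  proof (rule boundary_deviation[OF u n sp(1,3) sp(5) N(2) K k, of \<alpha>])
    fix G assume 1: "G \<in> borel_measurable M" and 2: "(\<integral>\<^sup>+\<omega>. G \<omega> \<partial>M) \<le> ennreal (?D / sqrt N')"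
      and 3: "\<And>\<omega> m c a W b. (\<And>j. j < N' \<Longrightarrow> X' j \<omega> \<in> regular_boundary) \<Longrightarrow> net_params n m ?B c a W b \<Longrightarrow>
       ennreal \<bar>(\<Sum>j<N'. (bc_op \<alpha> (X' j \<omega>) \<bullet> (net_jet c a W b m k (X' j \<omega>) - ?U k (X' j \<omega>)))\<^sup>2) / real N'
          - (\<integral>x. (bc_op \<alpha> x \<bullet> (net_jet c a W b m k x - ?U k x))\<^sup>2 \<partial>boundary_measure)\<bar> \<le> ennreal ((10 * ?B)\<^sup>2) * G \<omega>"
    show ?thesis unfolding P_def by (intro exI[of _ G] conjI allI impI 1 2 3) auto
  qed auto
  then obtain G' where G': "\<And>k. k < n \<Longrightarrow> P k (G' k)" by metis
  show ?thesis
  proof (rule interior_deviation[OF u n sp(1,2) sp(4) N(1) K])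
    fix G assume G: "G \<in> borel_measurable M" "(\<integral>\<^sup>+\<omega>. G \<omega> \<partial>M) \<le> ennreal (?D / sqrt N)"
      and res: "\<And>\<omega> m c a W b k. (\<And>j. j < N \<Longrightarrow> X j \<omega> \<in> interior cube) \<Longrightarrow> net_params n m ?B c a W b \<Longrightarrow> k < n \<Longrightarrow>
       ennreal \<bar>(\<Sum>j<N. (residual n (\<lambda>k x. net_jet c a W b m k x - ?U k x) k (X j \<omega>))\<^sup>2) / real N
          - residual_sq n (\<lambda>k x. net_jet c a W b m k x - ?U k x) k\<bar> \<le> ennreal ((10 * ?B)\<^sup>2) * G \<omega>"
      and mean: "\<And>\<omega> m c a W b. (\<And>j. j < N \<Longrightarrow> X j \<omega> \<in> interior cube) \<Longrightarrow> net_params n m ?B c a W b \<Longrightarrow>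
       ennreal \<bar>(\<Sum>j<N. val (net_jet c a W b m 0 (X j \<omega>))) / real N - (\<integral>x. val (net_jet c a W b m 0 x) \<partial>cube_measure)\<bar>
         \<le> ennreal (10 * ?B) * G \<omega>"
    define H where "H \<omega> = G \<omega> + (\<Sum>k<n. G' k \<omega>)" for \<omega>
    have mG': "G' k \<in> borel_measurable M" if "k < n" for k using G'[OF that] by (simp add: P_def)
    have "(\<integral>\<^sup>+\<omega>. H \<omega> \<partial>M) = (\<integral>\<^sup>+\<omega>. G \<omega> \<partial>M) + (\<Sum>k<n. \<integral>\<^sup>+\<omega>. G' k \<omega> \<partial>M)"
    proof -
      have "(\<integral>\<^sup>+\<omega>. (\<Sum>k<n. G' k \<omega>) \<partial>M) = (\<Sum>k<n. \<integral>\<^sup>+\<omega>. G' k \<omega> \<partial>M)"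
        by (rule nn_integral_sum) (simp add: mG')
      moreover have "(\<lambda>\<omega>. \<Sum>k<n. G' k \<omega>) \<in> borel_measurable M" by (intro borel_measurable_sum mG') simp
      ultimately show ?thesis unfolding H_def using G(1) by (simp add: nn_integral_add)
    qed
    also have "\<dots> \<le> ennreal (?D / sqrt N) + (\<Sum>k<n. ennreal (?D / sqrt N'))"
      using G(2) G' by (intro add_mono sum_mono) (auto simp: P_def)
    finally have int: "(\<integral>\<^sup>+\<omega>. H \<omega> \<partial>M) \<le> ennreal (?D / sqrt N) + of_nat n * ennreal (?D / sqrt N')" by simp
    have mH: "H \<in> borel_measurable M" unfolding H_def[abs_def] using G(1) mG' by simp
    have "ennreal \<bar>emp_jet_loss \<alpha> n lam mu (net_jet c a W b m) ?U N (\<lambda>j. X j \<omega>) N' (\<lambda>j. X' j \<omega>)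
         - pop_jet_loss \<alpha> n lam mu (net_jet c a W b m) ?U\<bar>
       \<le> ennreal (loss_const n CARD('d) lam mu * ?B\<^sup>2) * H \<omega>"
      if good: "\<forall>j<N. X j \<omega> \<in> interior cube" "\<forall>j<N'. X' j \<omega> \<in> regular_boundary" and net: "net_params n m ?B c a W b"
      for \<omega> m c a W b
    proof -
      let ?V = "net_jet c a W b m"
      define D where "D k = (\<Sum>j<N. (residual n (\<lambda>k x. ?V k x - ?U k x) k (X j \<omega>))\<^sup>2) / real N
          - residual_sq n (\<lambda>k x. ?V k x - ?U k x) k" for k
      define D' where "D' k = (\<Sum>j<N'. (bc_op \<alpha> (X' j \<omega>) \<bullet> (?V k (X' j \<omega>) - ?U k (X' j \<omega>)))\<^sup>2) / real N'
          - (\<integral>x. (bc_op \<alpha> x \<bullet> (?V k x - ?U k x))\<^sup>2 \<partial>boundary_measure)" for k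
      define p q where "p = (\<Sum>j<N. val (?V 0 (X j \<omega>))) / real N" and "q = (\<integral>x. val (?V 0 x) \<partial>cube_measure)"
      let ?A = "(2 + 4 * act_bound CARD('d)) * ?B"
      have bc: "bc_sq \<alpha> (\<lambda>x. ?V k x - ?U k x) = 2 * real CARD('d) * (\<integral>x. (bc_op \<alpha> x \<bullet> (?V k x - ?U k x))\<^sup>2 \<partial>boundary_measure)" if "k < n" for k
        using that by (intro integral_bc_op[symmetric] C2_diff C2_net_jet C2_barron_jet[OF u]) simp
      have "emp_jet_loss \<alpha> n lam mu ?V ?U N (\<lambda>j. X j \<omega>) N' (\<lambda>j. X' j \<omega>) - pop_jet_loss \<alpha> n lam mu ?V ?U
         = (\<Sum>k<n. D k) + 2 * real CARD('d) * lam * (\<Sum>k<n. D' k) + (if \<alpha> = Neumann then mu * (p\<^sup>2 - q\<^sup>2) else 0)"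
        unfolding emp_jet_loss_def pop_jet_loss_def D_def D'_def p_def q_def
        by (simp add: bc sum_subtractf sum_distrib_left algebra_simps)
      also have "\<bar>\<dots>\<bar> \<le> (\<Sum>k<n. \<bar>D k\<bar>) + 2 * real CARD('d) * lam * (\<Sum>k<n. \<bar>D' k\<bar>) + mu * \<bar>p\<^sup>2 - q\<^sup>2\<bar>"
      proof -
        have "\<bar>2 * real CARD('d) * lam * (\<Sum>k<n. D' k)\<bar> \<le> 2 * real CARD('d) * lam * (\<Sum>k<n. \<bar>D' k\<bar>)"
          using lm by (simp add: abs_mult mult_left_mono)
        moreover have "\<bar>if \<alpha> = Neumann then mu * (p\<^sup>2 - q\<^sup>2) else 0\<bar> \<le> mu * \<bar>p\<^sup>2 - q\<^sup>2\<bar>"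
          using lm by (simp add: abs_mult)
        ultimately show ?thesis using sum_abs[of D "{..<n}"] by linarith
      qed
      \<comment> \<open>The penalty is the square of a mean, not a mean of squares, so it is
        factored: \<open>p + q\<close> is bounded through the size of the network, and
        \<open>p - q\<close> is a linear deviation.\<close>
      also have "mu * \<bar>p\<^sup>2 - q\<^sup>2\<bar> \<le> (2 * ?A * mu) * \<bar>p - q\<bar>"
      proof -
        have nv: "\<bar>val (?V 0 x)\<bar> \<le> ?A" if "x \<in> cube" for x
          using order_trans[OF norm_component_jet(3) norm_net_jet[OF net _ that]] n by simp
        have "\<bar>p\<bar> \<le> (\<Sum>j<N. \<bar>val (?V 0 (X j \<omega>))\<bar>) / real N" unfolding p_def by (simp add: divide_right_mono)
        also have "\<dots> \<le> (\<Sum>j<N. ?A) / real N"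
          using good interior_subset by (intro divide_right_mono sum_mono nv) auto
        finally have pA: "\<bar>p\<bar> \<le> ?A" using N by simp
        interpret c: prob_space "cube_measure :: (real^'d) measure" by (rule prob_space_cube)
        have ci: "integrable cube_measure (\<lambda>x. val (?V 0 x))"
          by (intro integrable_cube_continuous C2_continuous C2_net_jet)
        have "\<bar>q\<bar> \<le> (\<integral>x. \<bar>val (?V 0 x)\<bar> \<partial>cube_measure)" unfolding q_def by (rule integral_abs_bound)
        also have "\<dots> \<le> (\<integral>x. ?A \<partial>(cube_measure :: (real^'d) measure))"
          by (intro integral_mono_AE integrable_abs ci AE_cubeI nv) auto
        finally have qA: "\<bar>q\<bar> \<le> ?A" by (simp add: c.prob_space)
        have "\<bar>p\<^sup>2 - q\<^sup>2\<bar> = \<bar>p + q\<bar> * \<bar>p - q\<bar>" by (simp add: power2_eq_square algebra_simps flip: abs_mult)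
        also have "\<dots> \<le> (2 * ?A) * \<bar>p - q\<bar>" using pA qA by (intro mult_right_mono) linarith+
        finally have "mu * \<bar>p\<^sup>2 - q\<^sup>2\<bar> \<le> mu * ((2 * ?A) * \<bar>p - q\<bar>)" using lm by (intro mult_left_mono) auto
        then show ?thesis by (simp add: mult_ac)
      qed
      finally have "ennreal \<bar>emp_jet_loss \<alpha> n lam mu ?V ?U N (\<lambda>j. X j \<omega>) N' (\<lambda>j. X' j \<omega>) - pop_jet_loss \<alpha> n lam mu ?V ?U\<bar>
        \<le> ennreal ((\<Sum>k<n. \<bar>D k\<bar>) + 2 * real CARD('d) * lam * (\<Sum>k<n. \<bar>D' k\<bar>) + (2 * ?A * mu) * \<bar>p - q\<bar>)"
        by (intro ennreal_leI) linarith
      also have "\<dots> = (\<Sum>k<n. ennreal \<bar>D k\<bar>) + ennreal (2 * real CARD('d) * lam) * (\<Sum>k<n. ennreal \<bar>D' k\<bar>) + ennreal (2 * ?A * mu) * ennreal \<bar>p - q\<bar>"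
      proof -
        have "0 \<le> 2 * ?A * mu" "0 \<le> 2 * real CARD('d) * lam" using B lm act_bound_pos[of "CARD('d)"] by auto
        then show ?thesis by (simp add: ennreal_plus[symmetric] ennreal_mult[symmetric] sum_nonneg del: ennreal_plus)
      qed
      also have "\<dots> \<le> (\<Sum>k<n. ennreal ((10 * ?B)\<^sup>2) * H \<omega>) + ennreal (2 * real CARD('d) * lam) * (ennreal ((10 * ?B)\<^sup>2) * H \<omega>)
          + ennreal (2 * ?A * mu) * (ennreal (10 * ?B) * H \<omega>)"
      proof (intro add_mono sum_mono mult_left_mono)
        have GH: "G \<omega> \<le> H \<omega>" by (simp add: H_def)
        show "ennreal \<bar>D k\<bar> \<le> ennreal ((10 * ?B)\<^sup>2) * H \<omega>" if "k \<in> {..<n}" for k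
          unfolding D_def using good net that by (intro order_trans[OF res mult_left_mono[OF GH]]) auto
        show "ennreal \<bar>p - q\<bar> \<le> ennreal (10 * ?B) * H \<omega>"
          unfolding p_def q_def using good net by (intro order_trans[OF mean mult_left_mono[OF GH]]) auto
        have "(\<Sum>k<n. ennreal \<bar>D' k\<bar>) \<le> (\<Sum>k<n. ennreal ((10 * ?B)\<^sup>2) * G' k \<omega>)"
          unfolding D'_def using G' good net by (intro sum_mono) (auto simp: P_def)
        also have "\<dots> \<le> ennreal ((10 * ?B)\<^sup>2) * H \<omega>"
          unfolding sum_distrib_left[symmetric] H_def by (intro mult_left_mono) auto
        finally show "(\<Sum>k<n. ennreal \<bar>D' k\<bar>) \<le> ennreal ((10 * ?B)\<^sup>2) * H \<omega>" .
      qed auto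
      also have "\<dots> = ennreal (loss_const n CARD('d) lam mu * ?B\<^sup>2) * H \<omega>"
      proof -
        have nn: "0 \<le> 2 * ?A * mu" "0 \<le> 2 * real CARD('d) * lam" "0 \<le> 10 * ?B" using B lm act_bound_pos[of "CARD('d)"] by auto
        have "(\<Sum>k<n. ennreal ((10 * ?B)\<^sup>2) * H \<omega>) = ennreal (real n * (10 * ?B)\<^sup>2) * H \<omega>"
          by (simp add: ennreal_mult mult.assoc ennreal_of_nat_eq_real_of_nat)
        moreover have "ennreal (real n * (10 * ?B)\<^sup>2) * H \<omega> + ennreal (2 * real CARD('d) * lam) * (ennreal ((10 * ?B)\<^sup>2) * H \<omega>)
            + ennreal (2 * ?A * mu) * (ennreal (10 * ?B) * H \<omega>)
          = ennreal (real n * (10 * ?B)\<^sup>2 + 2 * real CARD('d) * lam * (10 * ?B)\<^sup>2 + 2 * ?A * mu * (10 * ?B)) * H \<omega>"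
        proof -
          have *: "ennreal p * z + ennreal q * (ennreal r * z) + ennreal s * (ennreal t * z) = ennreal (p + q * r + s * t) * z"
            if "0 \<le> p" "0 \<le> q" "0 \<le> r" "0 \<le> s" "0 \<le> t" for p q r s t z
            using that by (simp add: ennreal_plus ennreal_mult distrib_right mult.assoc)
          show ?thesis by (rule *[OF _ nn(2) _ nn(1) nn(3)]) auto
        qed
        moreover have "real n * (10 * ?B)\<^sup>2 + 2 * real CARD('d) * lam * (10 * ?B)\<^sup>2 + 2 * ?A * mu * (10 * ?B) = loss_const n CARD('d) lam mu * ?B\<^sup>2"
          by (simp add: loss_const_def power2_eq_square algebra_simps)
        ultimately show ?thesis by simp
      qed
      finally show ?thesis .
    qed
    then show ?thesis using mH int by blast
  qed auto
qed

section \<open>Expected errors\<close>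

lemma L2_norm_cube_eq:
  fixes w :: "real^'d \<Rightarrow> 'b::real_normed_vector"
  assumes "\<And>x. x \<in> cube \<Longrightarrow> (norm (w x))\<^sup>2 = F x" "continuous_on UNIV F"
  shows "(L2_norm_cube w)\<^sup>2 = (\<integral>x. F x \<partial>cube_measure)"
proof -
  have "0 \<le> (LINT x:cube|lborel. (norm (w x))\<^sup>2)"
    unfolding set_lebesgue_integral_def by (intro integral_nonneg_AE AE_I2) simp
  moreover have "(LINT x:cube|lborel. (norm (w x))\<^sup>2) = (LINT x:cube|lborel. F x)"
    using assms(1) by (intro set_lebesgue_integral_cong) auto
  ultimately show ?thesis unfolding L2_norm_cube_def using LINT_cube_measure[OF assms(2)] by simp
qed

lemma H1_Hdiv_jet_error:
  fixes u :: "real^'d \<Rightarrow> real"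
  assumes u: "u \<in> barron_space (2 * n + 3)" "continuous_on cube u" and k: "k < n" and V: "C2_jet (V k)"
    and v: "\<And>x. v k x = val (V k x)"
  shows "(H1_norm (\<lambda>x. v k x - (laplacian ^^ k) u x))\<^sup>2
     + (Hdiv_norm (\<lambda>x. gradient (v k) x - gradient ((laplacian ^^ k) u) x))\<^sup>2 = jet_error (\<lambda>k x. V k x - barron_jet u k x) k"
proof -
  let ?U = "barron_jet u k" and ?l = "(laplacian ^^ k) u"
  define e where "e x = V k x - ?U x" for x
  have U: "C2_jet ?U" by (rule C2_barron_jet[OF u(1)]) (use k in simp)
  have e: "C2_jet e" unfolding e_def[abs_def] by (intro C2_diff V U)
  have l: "?l x = val (?U x)" if "x \<in> cube" for x
    by (rule iterated_laplacian_barron[OF u _ that]) (use k in simp)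
  have d: "v k x - ?l x = val (e x)" if "x \<in> cube" for x using l[OF that] by (simp add: e_def v)
  have g: "gradient (\<lambda>x. v k x - ?l x) x = grd (e x)" if "x \<in> cube" for x
    by (rule gradient_C2[OF e d that])
  have g': "gradient (v k) x - gradient ?l x = grd (e x)" if "x \<in> cube" for x
    using gradient_C2[OF V v that] gradient_C2[OF U l that] by (simp add: e_def)
  have dv: "divergence (\<lambda>x. gradient (v k) x - gradient ?l x) x = lap (e x)" if x: "x \<in> cube" for x
    unfolding divergence_def lap_def
  proof (intro sum.cong refl)
    fix i
    show "partial_deriv i (\<lambda>y. (gradient (v k) y - gradient ?l y) $ i) x = hes (e x) $ i"
      by (rule partial_deriv_cube[OF x _ C2_jetD(3)[OF e]]) (simp only: g')
  qed
  have 1: "(L2_norm_cube (\<lambda>x. v k x - ?l x))\<^sup>2 = val_sq e"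
    unfolding val_sq_def by (rule L2_norm_cube_eq) (auto simp: d intro!: continuous_intros C2_continuous e)
  have 2: "(L2_norm_cube (gradient (\<lambda>x. v k x - ?l x)))\<^sup>2 = grd_sq e"
    unfolding grd_sq_def by (rule L2_norm_cube_eq) (auto simp: g power2_norm_eq_inner intro!: continuous_intros C2_continuous e)
  have 3: "(L2_norm_cube (\<lambda>x. gradient (v k) x - gradient ?l x))\<^sup>2 = grd_sq e"
    unfolding grd_sq_def by (rule L2_norm_cube_eq) (auto simp: g' power2_norm_eq_inner intro!: continuous_intros C2_continuous e)
  have 4: "(L2_norm_cube (divergence (\<lambda>x. gradient (v k) x - gradient ?l x)))\<^sup>2 = lap_sq e"
    unfolding lap_sq_def by (rule L2_norm_cube_eq) (auto simp: dv intro!: continuous_intros C2_continuous e)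
  have "jet_error (\<lambda>k x. V k x - barron_jet u k x) k = val_sq e + 2 * grd_sq e + lap_sq e"
    by (simp add: jet_error_def e_def[abs_def])
  then show ?thesis
    unfolding H1_norm_def Hdiv_norm_def 1 2 3 4 using sq_nonneg(1-3)[of e] by simp
qed

text \<open>The integrands inherit an arbitrary dependence on the outcome from \<open>v\<close>;
  they are bounded almost everywhere through the measurable \<open>H\<close>. Each of the
  \<open>2 * n\<close> expectations is bounded by the full sum of errors, whence the factor.\<close>

lemma expected_error_le:
  fixes u :: "real^'d \<Rightarrow> real" and M :: "'w measure"
  assumes u: "u \<in> barron_space (2 * n + 3)" "continuous_on cube u" and M: "prob_space M"
    and H: "H \<in> borel_measurable M" "(\<integral>\<^sup>+\<omega>. H \<omega> \<partial>M) \<le> ennreal h" and pos: "0 \<le> P" "0 \<le> Q" "0 \<le> h"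
    and AE: "AE \<omega> in M. \<exists>V. (\<forall>k<n. C2_jet (V k)) \<and> (\<forall>k<n. \<forall>x. v \<omega> k x = val (V k x)) \<and>
      ennreal (\<Sum>k<n. jet_error (\<lambda>k x. V k x - barron_jet u k x) k) \<le> ennreal P + ennreal Q * H \<omega>"
  shows "expected_error M n u v \<le> ennreal (2 * real n * (P + Q * h))"
proof -
  interpret prob_space M by (rule M)
  have bound: "(\<integral>\<^sup>+\<omega>. f \<omega> \<partial>M) \<le> ennreal (P + Q * h)" if f: "AE \<omega> in M. f \<omega> \<le> ennreal P + ennreal Q * H \<omega>" for f
  proof -
    have "(\<integral>\<^sup>+\<omega>. f \<omega> \<partial>M) \<le> (\<integral>\<^sup>+\<omega>. ennreal P + ennreal Q * H \<omega> \<partial>M)" by (rule nn_integral_mono_AE[OF f])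
    also have "\<dots> = ennreal P + ennreal Q * (\<integral>\<^sup>+\<omega>. H \<omega> \<partial>M)"
      using H(1) by (simp add: nn_integral_add nn_integral_cmult emeasure_space_1)
    also have "\<dots> \<le> ennreal P + ennreal Q * ennreal h" by (intro add_left_mono mult_left_mono H(2)) simp
    also have "\<dots> = ennreal (P + Q * h)" using pos by (simp add: ennreal_mult ennreal_plus)
    finally show ?thesis .
  qed
  have terms: "AE \<omega> in M. ennreal ((H1_norm (\<lambda>x. v \<omega> k x - (laplacian ^^ k) u x))\<^sup>2) \<le> ennreal P + ennreal Q * H \<omega> \<and>
      ennreal ((Hdiv_norm (\<lambda>x. gradient (v \<omega> k) x - gradient ((laplacian ^^ k) u) x))\<^sup>2) \<le> ennreal P + ennreal Q * H \<omega>"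
    if k: "k < n" for k
    using AE
  proof (rule AE_mp, intro AE_I2 impI)
    fix \<omega>
    assume "\<exists>V. (\<forall>k<n. C2_jet (V k)) \<and> (\<forall>k<n. \<forall>x. v \<omega> k x = val (V k x)) \<and>
      ennreal (\<Sum>k<n. jet_error (\<lambda>k x. V k x - barron_jet u k x) k) \<le> ennreal P + ennreal Q * H \<omega>"
    then obtain V where V: "\<forall>k<n. C2_jet (V k)" "\<forall>k<n. \<forall>x. v \<omega> k x = val (V k x)"
      and le: "ennreal (\<Sum>k<n. jet_error (\<lambda>k x. V k x - barron_jet u k x) k) \<le> ennreal P + ennreal Q * H \<omega>" by blast
    let ?a = "(H1_norm (\<lambda>x. v \<omega> k x - (laplacian ^^ k) u x))\<^sup>2"
    let ?b = "(Hdiv_norm (\<lambda>x. gradient (v \<omega> k) x - gradient ((laplacian ^^ k) u) x))\<^sup>2"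
    have "?a + ?b = jet_error (\<lambda>k x. V k x - barron_jet u k x) k"
      using V k by (intro H1_Hdiv_jet_error[OF u k]) auto
    moreover have "jet_error (\<lambda>k x. V k x - barron_jet u k x) k \<le> (\<Sum>k<n. jet_error (\<lambda>k x. V k x - barron_jet u k x) k)"
      using k by (intro member_le_sum jet_error_nonneg) auto
    ultimately have "?a \<le> (\<Sum>k<n. jet_error (\<lambda>k x. V k x - barron_jet u k x) k)" "?b \<le> (\<Sum>k<n. jet_error (\<lambda>k x. V k x - barron_jet u k x) k)"
      using zero_le_power2[of "H1_norm (\<lambda>x. v \<omega> k x - (laplacian ^^ k) u x)"]
        zero_le_power2[of "Hdiv_norm (\<lambda>x. gradient (v \<omega> k) x - gradient ((laplacian ^^ k) u) x)"] by linarith+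
    then show "ennreal ?a \<le> ennreal P + ennreal Q * H \<omega> \<and> ennreal ?b \<le> ennreal P + ennreal Q * H \<omega>"
      using order_trans[OF ennreal_leI le] by blast
  qed
  have "expected_error M n u v \<le> (\<Sum>k<n. ennreal (P + Q * h) + ennreal (P + Q * h))"
    unfolding expected_error_def using terms by (intro sum_mono add_mono bound) (auto intro: AE_mp)
  also have "\<dots> = ennreal (2 * real n * (P + Q * h))"
    using pos by (simp add: ennreal_plus[symmetric] ennreal_of_nat_eq_real_of_nat ennreal_mult[symmetric] mult_ac del: ennreal_plus)
  finally show ?thesis .
qed

text \<open>The penalty weights change the loss only by constants. The sums
  \<open>1 + 1 / lam + 1 / mu\<close> and \<open>1 + lam + mu\<close> dominate every single ratio of
  weights, which makes the differences sums of nonnegative terms.\<close>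

lemma jet_loss_pop:
  fixes u :: "real^'d \<Rightarrow> real"
  assumes lm: "lam > 0" "mu > 0" and mean: "\<alpha> = Neumann \<Longrightarrow> (\<integral>x. val (V 0 x - U 0 x) \<partial>cube_measure) = (\<integral>x. val (V 0 x) \<partial>cube_measure)"
  shows "jet_loss \<alpha> n (\<lambda>k x. V k x - U k x) \<le> (1 + 1 / lam + 1 / mu) * pop_jet_loss \<alpha> n lam mu V U"
    and "pop_jet_loss \<alpha> n lam mu V U \<le> (1 + lam + mu) * jet_loss \<alpha> n (\<lambda>k x. V k x - U k x)"
proof -
  let ?e = "\<lambda>k x. V k x - U k x"
  define r b t where "r = (\<Sum>k<n. residual_sq n ?e k)" and "b = (\<Sum>k<n. bc_sq \<alpha> (?e k))"
    and "t = (if \<alpha> = Neumann then (\<integral>x. val (V 0 x) \<partial>cube_measure)\<^sup>2 else 0)"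
  have nn: "0 \<le> r" "0 \<le> b" "0 \<le> t"
    by (auto simp: r_def b_def t_def intro!: sum_nonneg residual_sq_nonneg sq_nonneg)
  have 1: "jet_loss \<alpha> n ?e = r + b + t" using mean by (simp add: jet_loss_def r_def b_def t_def)
  have 2: "pop_jet_loss \<alpha> n lam mu V U = r + lam * b + mu * t" by (simp add: pop_jet_loss_def r_def b_def t_def)
  have "(1 + 1 / lam + 1 / mu) * (r + lam * b + mu * t)
      = (r + b + t) + (lam * b + mu * t + r / lam + mu / lam * t + r / mu + lam / mu * b)"
    using lm by (simp add: field_simps)
  moreover have "0 \<le> lam * b + mu * t + r / lam + mu / lam * t + r / mu + lam / mu * b"
    using lm nn by (intro add_nonneg_nonneg) auto
  ultimately show "jet_loss \<alpha> n ?e \<le> (1 + 1 / lam + 1 / mu) * pop_jet_loss \<alpha> n lam mu V U" unfolding 1 2 by linarith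
  have "(1 + lam + mu) * (r + b + t) = (r + lam * b + mu * t) + (lam * r + mu * r + b + mu * b + t + lam * t)"
    by (simp add: algebra_simps)
  moreover have "0 \<le> lam * r + mu * r + b + mu * b + t + lam * t"
    using lm nn by (intro add_nonneg_nonneg) auto
  ultimately show "pop_jet_loss \<alpha> n lam mu V U \<le> (1 + lam + mu) * jet_loss \<alpha> n ?e" unfolding 1 2 by linarith
qed

text \<open>The population loss of the minimiser is at most its empirical loss plus a deviation,
  hence at most the empirical loss of the competitor plus a deviation, hence at most the population
  loss of the competitor plus two deviations. Both deviations are bounded by the same
  \<open>H\<close>.\<close>

lemma minimiser_jet_loss:
  fixes u :: "real^'d \<Rightarrow> real" and M :: "'w measure"
  assumes n: "n \<ge> 1" and lm: "lam > 0" "mu > 0" and m: "m \<ge> 1" and N: "N \<ge> 1" "N' \<ge> 1"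
    and u: "u \<in> barron_space (2 * n + 3)" "continuous_on cube u" and bvp: "solves_bvp \<alpha> n u f g"
    and mean: "\<alpha> = Neumann \<longrightarrow> (LINT x:cube|lborel. u x) = 0" and sp: "sample_points M N X N' X'"
    and min: "AE \<omega> in M. is_arg_min (empirical_loss \<alpha> n lam mu f g N (\<lambda>j. X j \<omega>) N' (\<lambda>j. X' j \<omega>))
        (\<lambda>w. w \<in> ReCU_nets n m (barron_norm (2 * n + 3) u)) (v \<omega>)"
    and K: "feature_const TYPE('d) K"
  defines "B \<equiv> barron_norm (2 * n + 3) u"
  defines "\<kappa> \<equiv> 1 + 1 / lam + 1 / mu"
  shows "\<exists>H. H \<in> borel_measurable M \<and>
    (\<integral>\<^sup>+\<omega>. H \<omega> \<partial>M) \<le> ennreal (dev_const TYPE('d) K / sqrt N) + of_nat n * ennreal (dev_const TYPE('d) K / sqrt N') \<and>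
    (AE \<omega> in M. \<exists>c a W b. net_params n m B c a W b \<and> (\<forall>k<n. \<forall>x. v \<omega> k x = val (net_jet c a W b m k x)) \<and>
       ennreal (jet_loss \<alpha> n (\<lambda>k x. net_jet c a W b m k x - barron_jet u k x))
         \<le> ennreal (\<kappa> * ((1 + lam + mu) * approx_const n CARD('d)) * (B\<^sup>2 / real m))
           + ennreal (\<kappa> * (2 * loss_const n CARD('d) lam mu) * B\<^sup>2) * H \<omega>)"
proof -
  let ?U = "barron_jet u" and ?Q = "loss_const n CARD('d) lam mu * B\<^sup>2"
  note spD = sample_pointsD[OF sp]
  interpret prob_space M by (rule spD(1))
  obtain H where H: "H \<in> borel_measurable M"
    "(\<integral>\<^sup>+\<omega>. H \<omega> \<partial>M) \<le> ennreal (dev_const TYPE('d) K / sqrt N) + of_nat n * ennreal (dev_const TYPE('d) K / sqrt N')"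
    and dev: "\<And>\<omega> m c a W b. (\<forall>j<N. X j \<omega> \<in> interior cube) \<Longrightarrow> (\<forall>j<N'. X' j \<omega> \<in> regular_boundary) \<Longrightarrow>
       net_params n m B c a W b \<Longrightarrow>
       ennreal \<bar>emp_jet_loss \<alpha> n lam mu (net_jet c a W b m) ?U N (\<lambda>j. X j \<omega>) N' (\<lambda>j. X' j \<omega>)
         - pop_jet_loss \<alpha> n lam mu (net_jet c a W b m) ?U\<bar> \<le> ennreal ?Q * H \<omega>"
    using loss_deviation[OF u(1) n sp N K lm, of \<alpha>] unfolding B_def by metis
  have Q0: "0 \<le> ?Q" using lm act_bound_pos[of "CARD('d)"] by (simp add: loss_const_def)
  have \<kappa>0: "0 \<le> \<kappa>" using lm by (simp add: \<kappa>_def)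
  have U0: "(\<integral>x. val (net_jet c a W b m 0 x - ?U 0 x) \<partial>cube_measure) = (\<integral>x. val (net_jet c a W b m 0 x) \<partial>cube_measure)"
    if "\<alpha> = Neumann" for c a b and W :: "nat \<Rightarrow> real^'d"
  proof -
    have c: "continuous_on UNIV (\<lambda>x. val (?U 0 x))" by (intro C2_continuous C2_barron_jet[OF u(1)]) simp
    have "(\<integral>x. val (?U 0 x) \<partial>cube_measure) = (LINT x:cube|lborel. val (?U 0 x))" by (rule LINT_cube_measure[OF c, symmetric])
    also have "\<dots> = (LINT x:cube|lborel. u x)"
      using iterated_laplacian_barron[OF u, of 0] by (intro set_lebesgue_integral_cong) auto
    finally have "(\<integral>x. val (?U 0 x) \<partial>cube_measure) = 0" using mean that by simp
    moreover have "integrable cube_measure (\<lambda>x. val (net_jet c a W b m 0 x))"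
      by (intro integrable_cube_continuous C2_continuous C2_net_jet)
    ultimately show ?thesis
      using integrable_cube_continuous[OF c] by (simp add: fst_diff)
  qed
  \<comment> \<open>The competitor is chosen before sampling and does not depend on the
    outcome.\<close>
  obtain c a W b where net: "net_params n m B c a W b"
    and good: "jet_loss \<alpha> n (\<lambda>k x. net_jet c a W b m k x - ?U k x) \<le> approx_const n CARD('d) * B\<^sup>2 / real m"
    using good_network[OF n _ u(1) m, of \<alpha>] unfolding B_def by auto
  let ?V = "net_jet c a W b m"
  have popV: "pop_jet_loss \<alpha> n lam mu ?V ?U \<le> (1 + lam + mu) * approx_const n CARD('d) * (B\<^sup>2 / real m)"
  proof -
    have "pop_jet_loss \<alpha> n lam mu ?V ?U \<le> (1 + lam + mu) * (approx_const n CARD('d) * B\<^sup>2 / real m)"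
    proof (rule order_trans)
      show "pop_jet_loss \<alpha> n lam mu ?V ?U \<le> (1 + lam + mu) * jet_loss \<alpha> n (\<lambda>k x. ?V k x - ?U k x)"
        by (rule jet_loss_pop(2)[where V = ?V and U = ?U, OF lm U0])
      show "(1 + lam + mu) * jet_loss \<alpha> n (\<lambda>k x. ?V k x - ?U k x) \<le> (1 + lam + mu) * (approx_const n CARD('d) * B\<^sup>2 / real m)"
        using lm by (intro mult_left_mono good) auto
    qed
    then show ?thesis by simp
  qed
  have xs: "AE \<omega> in M. \<forall>j<N. X j \<omega> \<in> interior cube"
    by (rule AE_all_lessThan[OF spD(4) spD(2) AE_interior_cube]) auto
  have xs': "AE \<omega> in M. \<forall>j<N'. X' j \<omega> \<in> regular_boundary"
    by (rule AE_all_lessThan[OF spD(5) spD(3) AE_boundary]) auto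
  have "AE \<omega> in M. \<exists>c a W b. net_params n m B c a W b \<and> (\<forall>k<n. \<forall>x. v \<omega> k x = val (net_jet c a W b m k x)) \<and>
       ennreal (jet_loss \<alpha> n (\<lambda>k x. net_jet c a W b m k x - ?U k x))
         \<le> ennreal (\<kappa> * ((1 + lam + mu) * approx_const n CARD('d)) * (B\<^sup>2 / real m))
           + ennreal (\<kappa> * (2 * loss_const n CARD('d) lam mu) * B\<^sup>2) * H \<omega>"
    using min xs xs'
  proof eventually_elim
    case (elim \<omega>)
    have xs: "\<And>j. j < N \<Longrightarrow> X j \<omega> \<in> interior cube" "\<And>j. j < N' \<Longrightarrow> X' j \<omega> \<in> regular_boundary" using elim(2,3) by auto
    let ?E = "empirical_loss \<alpha> n lam mu f g N (\<lambda>j. X j \<omega>) N' (\<lambda>j. X' j \<omega>)"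
    have "v \<omega> \<in> ReCU_nets n m B" using elim(1) by (simp add: is_arg_min_def B_def)
    then obtain c' a' W' b' where net': "net_params n m B c' a' W' b'" and v: "\<forall>k<n. \<forall>x. v \<omega> k x = val (net_jet c' a' W' b' m k x)"
      unfolding ReCU_nets_iff by blast
    let ?V' = "net_jet c' a' W' b' m"
    let ?w = "\<lambda>k x. val (?V k x)"
    have "?w \<in> ReCU_nets n m B" unfolding ReCU_nets_iff using net by blast
    then have "?E (v \<omega>) \<le> ?E ?w" using elim(1) by (auto simp: is_arg_min_def B_def not_less)
    moreover have "?E (v \<omega>) = emp_jet_loss \<alpha> n lam mu ?V' ?U N (\<lambda>j. X j \<omega>) N' (\<lambda>j. X' j \<omega>)"
      using v by (intro empirical_loss_jets[OF u n bvp xs C2_net_jet]) auto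
    moreover have "?E ?w = emp_jet_loss \<alpha> n lam mu ?V ?U N (\<lambda>j. X j \<omega>) N' (\<lambda>j. X' j \<omega>)"
      by (intro empirical_loss_jets[OF u n bvp xs C2_net_jet]) auto
    ultimately have emp: "emp_jet_loss \<alpha> n lam mu ?V' ?U N (\<lambda>j. X j \<omega>) N' (\<lambda>j. X' j \<omega>) \<le> emp_jet_loss \<alpha> n lam mu ?V ?U N (\<lambda>j. X j \<omega>) N' (\<lambda>j. X' j \<omega>)"
      by simp
    define d d' where "d = \<bar>emp_jet_loss \<alpha> n lam mu ?V ?U N (\<lambda>j. X j \<omega>) N' (\<lambda>j. X' j \<omega>) - pop_jet_loss \<alpha> n lam mu ?V ?U\<bar>"
      and "d' = \<bar>emp_jet_loss \<alpha> n lam mu ?V' ?U N (\<lambda>j. X j \<omega>) N' (\<lambda>j. X' j \<omega>) - pop_jet_loss \<alpha> n lam mu ?V' ?U\<bar>"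
    let ?p = "(1 + lam + mu) * approx_const n CARD('d) * (B\<^sup>2 / real m)"
    have p0: "0 \<le> ?p" using lm energy_const_pos[of n "CARD('d)"] by (auto simp: approx_const_def)
    have "pop_jet_loss \<alpha> n lam mu ?V' ?U \<le> ?p + d + d'" using emp popV unfolding d_def d'_def by linarith
    then have "\<kappa> * pop_jet_loss \<alpha> n lam mu ?V' ?U \<le> \<kappa> * (?p + d + d')" by (rule mult_left_mono[OF _ \<kappa>0])
    moreover have "jet_loss \<alpha> n (\<lambda>k x. ?V' k x - ?U k x) \<le> \<kappa> * pop_jet_loss \<alpha> n lam mu ?V' ?U"
      unfolding \<kappa>_def by (rule jet_loss_pop(1)[where V = ?V' and U = ?U, OF lm U0])
    ultimately have "jet_loss \<alpha> n (\<lambda>k x. ?V' k x - ?U k x) \<le> \<kappa> * (?p + d + d')" by linarith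
    then have "ennreal (jet_loss \<alpha> n (\<lambda>k x. ?V' k x - ?U k x)) \<le> ennreal (\<kappa> * (?p + d + d'))" by (rule ennreal_leI)
    also have "\<dots> = ennreal \<kappa> * ennreal ?p + ennreal \<kappa> * (ennreal d + ennreal d')"
    proof -
      have *: "ennreal (\<kappa> * (p + q + r)) = ennreal \<kappa> * ennreal p + ennreal \<kappa> * (ennreal q + ennreal r)"
        if "0 \<le> p" "0 \<le> q" "0 \<le> r" for p q r
        using that \<kappa>0 by (simp add: ennreal_plus ennreal_mult distrib_left add.assoc)
      show ?thesis by (rule *[OF p0]) (simp_all add: d_def d'_def)
    qed
    also have "\<dots> \<le> ennreal \<kappa> * ennreal ?p + ennreal \<kappa> * (ennreal ?Q * H \<omega> + ennreal ?Q * H \<omega>)"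
      unfolding d_def d'_def using elim(2,3) by (intro add_left_mono mult_left_mono add_mono dev net net') auto
    also have "\<dots> = ennreal (\<kappa> * ((1 + lam + mu) * approx_const n CARD('d)) * (B\<^sup>2 / real m))
           + ennreal (\<kappa> * (2 * loss_const n CARD('d) lam mu) * B\<^sup>2) * H \<omega>"
    proof -
      have "ennreal \<kappa> * ennreal ?p = ennreal (\<kappa> * ((1 + lam + mu) * approx_const n CARD('d)) * (B\<^sup>2 / real m))"
        using \<kappa>0 p0 by (subst ennreal_mult[symmetric]) (auto simp: mult_ac)
      moreover have "ennreal \<kappa> * (ennreal ?Q * H \<omega> + ennreal ?Q * H \<omega>) = ennreal (\<kappa> * (?Q + ?Q)) * H \<omega>"
      proof -
        have *: "ennreal \<kappa> * (ennreal q * z + ennreal q * z) = ennreal (\<kappa> * (q + q)) * z" if "0 \<le> q" for q z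
        proof -
          have "ennreal q * z + ennreal q * z = ennreal (q + q) * z" using that by (simp only: ennreal_plus distrib_right)
          moreover have "ennreal (\<kappa> * (q + q)) = ennreal \<kappa> * ennreal (q + q)" using that \<kappa>0 by (intro ennreal_mult) auto
          ultimately show ?thesis by (simp only: mult.assoc)
        qed
        show ?thesis by (rule *[OF Q0])
      qed
      moreover have "\<kappa> * (?Q + ?Q) = \<kappa> * (2 * loss_const n CARD('d) lam mu) * B\<^sup>2" by (simp add: algebra_simps)
      ultimately show ?thesis by (simp only:)
    qed
    finally show ?case using net' v by blast
  qed
  then show ?thesis using H by blast
qed

section \<open>Balancing the rates and collecting the constants\<close>

lemma inverse_sqrt_boundary_points:
  fixes N N' d c1 :: real
  assumes "c1 * N / d\<^sup>2 \<le> N'" "c1 > 0" "N > 0" "d > 0"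
  shows "1 / sqrt N' \<le> (d / sqrt c1) / sqrt N"
proof -
  have 1: "sqrt c1 * sqrt N / d \<le> sqrt N'"
    using real_sqrt_le_mono[OF assms(1)] assms by (simp add: real_sqrt_mult real_sqrt_divide)
  have 2: "0 < sqrt c1 * sqrt N / d" using assms by simp
  have "1 / sqrt N' \<le> 1 / (sqrt c1 * sqrt N / d)"
    by (rule divide_left_mono[OF 1 zero_le_one mult_pos_pos[OF less_le_trans[OF 2 1] 2]])
  then show ?thesis by (simp add: mult.commute)
qed

text \<open>For \<open>z\<close> equal to \<open>x\<close> or \<open>y\<close>, the square of
  \<open>z\<close> divided by the mean of \<open>x\<close> and \<open>y\<close> is at most twice
  \<open>x + y\<close>. So with this mean as weight, all terms have the order of
  \<open>x + y\<close>.\<close>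

lemma dirichlet_balance:
  fixes x y A E F S :: real
  assumes x: "0 < x" and y: "0 < y" and nn: "0 \<le> A" "0 \<le> E" "0 \<le> F" "0 \<le> S"
  shows "S * (A * ((x + y) / 2) + E * x\<^sup>2 / ((x + y) / 2)) + S * (F / ((x + y) / 2)) * y\<^sup>2 \<le> S * (A + 4 * E + 4 * F) * (x + y)"
proof -
  have le: "z\<^sup>2 / ((x + y) / 2) \<le> 2 * (x + y)" if "0 < z" "z \<le> x + y" for z
  proof -
    have "z\<^sup>2 \<le> (x + y)\<^sup>2" using that by (intro power_mono) auto
    then have "z\<^sup>2 / ((x + y) / 2) \<le> (x + y)\<^sup>2 / ((x + y) / 2)" using x y by (intro divide_right_mono) auto
    also have "\<dots> = 2 * (x + y)" using x y by (simp add: power2_eq_square)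
    finally show ?thesis .
  qed
  have "E * (x\<^sup>2 / ((x + y) / 2)) \<le> E * (2 * (x + y))" "F * (y\<^sup>2 / ((x + y) / 2)) \<le> F * (2 * (x + y))"
    using le[of x] le[of y] x y nn by (intro mult_left_mono; simp)+
  moreover have "0 \<le> A * (x + y)" "0 \<le> E * (x + y)" "0 \<le> F * (x + y)" using nn x y by auto
  moreover have "A * (s / 2) + E * p + F * q \<le> (A + 4 * E + 4 * F) * s"
    if "E * p \<le> E * (2 * s)" "F * q \<le> F * (2 * s)" "0 \<le> A * s" "0 \<le> E * s" "0 \<le> F * s" for p q s
    using that unfolding distrib_right mult.assoc mult.left_commute[of _ 2] by linarith
  ultimately have "A * ((x + y) / 2) + E * (x\<^sup>2 / ((x + y) / 2)) + F * (y\<^sup>2 / ((x + y) / 2)) \<le> (A + 4 * E + 4 * F) * (x + y)"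
    by blast
  then have "S * (A * ((x + y) / 2) + E * (x\<^sup>2 / ((x + y) / 2)) + F * (y\<^sup>2 / ((x + y) / 2))) \<le> S * ((A + 4 * E + 4 * F) * (x + y))"
    using nn by (intro mult_left_mono) auto
  moreover have "S * (A * t + E * x\<^sup>2 / t) + S * (F / t) * y\<^sup>2 = S * (A * t + E * (x\<^sup>2 / t) + F * (y\<^sup>2 / t))" for t
    by (simp add: divide_inverse algebra_simps)
  ultimately show ?thesis by (simp only: mult.assoc)
qed

theorem theorem2p2:
  fixes n :: nat and lam mu c1 c2 :: real
  assumes "n \<ge> 1" and "lam > 0" and "mu > 0" and "c1 > 0" and "c2 > 0"
  shows "\<exists>C>0. \<forall>(\<alpha> :: bc) (m :: nat) (N :: nat) (N' :: nat)
      (u :: real^'d \<Rightarrow> real) (f :: real^'d \<Rightarrow> real) (g :: nat \<Rightarrow> real^'d \<Rightarrow> real)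
      (M :: 'w measure) (X :: nat \<Rightarrow> 'w \<Rightarrow> real^'d) (X' :: nat \<Rightarrow> 'w \<Rightarrow> real^'d)
      (v :: 'w \<Rightarrow> nat \<Rightarrow> real^'d \<Rightarrow> real).
    m \<ge> 1 \<and> N \<ge> 1 \<and> N' \<ge> 1 \<and>
    c1 * real N / (real CARD('d))\<^sup>2 \<le> real N' \<and>
    real N' \<le> c2 * real N / (real CARD('d))\<^sup>2 \<and>
    u \<in> barron_space (2 * n + 3) \<and> continuous_on cube u \<and>
    solves_bvp \<alpha> n u f g \<and>
    (\<alpha> = Neumann \<longrightarrow> (LINT x:cube|lborel. u x) = 0) \<and>
    sample_points M N X N' X' \<and>
    (AE \<omega> in M. is_arg_min
        (empirical_loss \<alpha> n lam mu f g N (\<lambda>j. X j \<omega>) N' (\<lambda>j. X' j \<omega>))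
        (\<lambda>w. w \<in> ReCU_nets n m (barron_norm (2 * n + 3) u)) (v \<omega>))
    \<longrightarrow>
    (\<alpha> \<in> {Neumann, Robin} \<longrightarrow>
       expected_error M n u v \<le>
         ennreal (C * ((barron_norm (2 * n + 3) u)\<^sup>2 / real m +
                       (barron_norm (2 * n + 3) u)\<^sup>2 / sqrt (real N)))) \<and>
    (\<alpha> = Dirichlet \<longrightarrow>
       expected_error M n u v \<le>
         ennreal (C * ((barron_norm (2 * n + 3) u)\<^sup>2 / sqrt (real m) +
                       (barron_norm (2 * n + 3) u)\<^sup>2 / root 4 (real N))))"
proof -
  obtain K where K: "feature_const TYPE('d) K" using feature_const_exists by blast
  let ?d = "real CARD('d)"
  \<comment> \<open>The absolute value makes nonnegativity immediate.\<close>
  define D where "D = \<bar>dev_const TYPE('d) K\<bar>"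
  \<comment> \<open>One interior majorant and \<open>n\<close> boundary majorants; the factor
    \<open>?d / sqrt c1\<close> converts the boundary sample size into \<open>N\<close>.\<close>
  define h where "h = D * (1 + real n * (?d / sqrt c1))"
  define E1 where "E1 = (1 + 1 / lam + 1 / mu) * ((1 + lam + mu) * approx_const n CARD('d))"
  define E2 where "E2 = (1 + 1 / lam + 1 / mu) * (2 * loss_const n CARD('d) lam mu)"
  \<comment> \<open>The sum covers the stability constants of all three boundary conditions at
    once.\<close>
  define S where "S = real n * (real n * 400 ^ n) + real n * (real n * neumann_const CARD('d) ^ n)"
  \<comment> \<open>Times the Barron norm, this bounds the gradient of the error:
    \<open>2 + 4 * act_bound CARD('d)\<close> for the network and 3 for the exact jets.\<close>
  define b where "b = 5 + 4 * act_bound CARD('d)"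
  define C where "C = 2 * real n * (S * (?d * b\<^sup>2 + 4 * E1 + 4 * (E2 * h))) + 1"
  have lm: "lam > 0" "mu > 0" and c1: "c1 > 0" and n: "n \<ge> 1" using assms by auto
  have h0: "0 \<le> h" using c1 by (simp add: h_def D_def)
  have E1: "0 \<le> E1" using lm energy_const_pos[of n "CARD('d)"] by (simp add: E1_def approx_const_def)
  have E2: "0 \<le> E2" using lm act_bound_pos[of "CARD('d)"] by (simp add: E2_def loss_const_def)
  have nc: "0 \<le> neumann_const CARD('d)" by (simp add: neumann_const_def)
  have S0: "0 \<le> S" using nc by (simp add: S_def)
  have C0: "C > 0" using S0 E1 E2 h0 unfolding C_def by (intro add_nonneg_pos mult_nonneg_nonneg add_nonneg_nonneg) auto
  show ?thesis
  proof (intro exI[of _ C] conjI[OF C0] allI impI; elim conjE)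
    fix \<alpha> :: bc and m N N' :: nat and u f :: "real^'d \<Rightarrow> real" and g :: "nat \<Rightarrow> real^'d \<Rightarrow> real"
      and M :: "'w measure" and X X' :: "nat \<Rightarrow> 'w \<Rightarrow> real^'d" and v :: "'w \<Rightarrow> nat \<Rightarrow> real^'d \<Rightarrow> real"
    assume m: "m \<ge> 1" and N: "N \<ge> 1" "N' \<ge> 1" and NN: "c1 * real N / ?d\<^sup>2 \<le> real N'"
      and u: "u \<in> barron_space (2 * n + 3)" "continuous_on cube u" and bvp: "solves_bvp \<alpha> n u f g"
      and mean: "\<alpha> = Neumann \<longrightarrow> (LINT x:cube|lborel. u x) = 0" and sp: "sample_points M N X N' X'"
      and min: "AE \<omega> in M. is_arg_min (empirical_loss \<alpha> n lam mu f g N (\<lambda>j. X j \<omega>) N' (\<lambda>j. X' j \<omega>))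
        (\<lambda>w. w \<in> ReCU_nets n m (barron_norm (2 * n + 3) u)) (v \<omega>)"
    define B where "B = barron_norm (2 * n + 3) u"
    let ?U = "barron_jet u"
    obtain H where H: "H \<in> borel_measurable M"
      and intH: "(\<integral>\<^sup>+\<omega>. H \<omega> \<partial>M) \<le> ennreal (dev_const TYPE('d) K / sqrt N) + of_nat n * ennreal (dev_const TYPE('d) K / sqrt N')"
      and AE: "AE \<omega> in M. \<exists>c a W b. net_params n m B c a W b \<and> (\<forall>k<n. \<forall>x. v \<omega> k x = val (net_jet c a W b m k x)) \<and>
       ennreal (jet_loss \<alpha> n (\<lambda>k x. net_jet c a W b m k x - ?U k x)) \<le> ennreal (E1 * (B\<^sup>2 / real m)) + ennreal (E2 * B\<^sup>2) * H \<omega>"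
      using minimiser_jet_loss[OF n lm m N u bvp mean sp min K] unfolding B_def E1_def E2_def by blast
    have sqN: "0 < sqrt (real N)" using N by simp
    have "(\<integral>\<^sup>+\<omega>. H \<omega> \<partial>M) \<le> ennreal (h / sqrt N)"
    proof -
      have r: "1 / sqrt (real N') \<le> (?d / sqrt c1) / sqrt (real N)"
        by (rule inverse_sqrt_boundary_points[OF NN c1]) (use N in auto)
      have "dev_const TYPE('d) K / sqrt N' \<le> D * (1 / sqrt (real N'))"
        unfolding D_def by (simp add: divide_right_mono)
      also have "\<dots> \<le> D * ((?d / sqrt c1) / sqrt (real N))" by (intro mult_left_mono r) (simp add: D_def)
      finally have 1: "dev_const TYPE('d) K / sqrt N' \<le> D * ((?d / sqrt c1) / sqrt (real N))" .
      have 2: "dev_const TYPE('d) K / sqrt N \<le> D / sqrt (real N)" unfolding D_def by (intro divide_right_mono) auto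
      have "ennreal (dev_const TYPE('d) K / sqrt N) + of_nat n * ennreal (dev_const TYPE('d) K / sqrt N')
          \<le> ennreal (D / sqrt (real N)) + of_nat n * ennreal (D * ((?d / sqrt c1) / sqrt (real N)))"
        by (intro add_mono mult_left_mono ennreal_leI 1 2) simp
      also have "\<dots> = ennreal (D / sqrt (real N) + real n * (D * ((?d / sqrt c1) / sqrt (real N))))"
      proof -
        have nn: "0 \<le> D / sqrt (real N)" "0 \<le> D * ((?d / sqrt c1) / sqrt (real N))" using c1 by (auto simp: D_def)
        have *: "ennreal p + of_nat n * ennreal q = ennreal (p + real n * q)" if "0 \<le> p" "0 \<le> q" for p q
          using that by (simp add: ennreal_plus ennreal_mult ennreal_of_nat_eq_real_of_nat)
        show ?thesis by (rule *[OF nn])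
      qed
      also have "D / sqrt (real N) + real n * (D * ((?d / sqrt c1) / sqrt (real N))) = h / sqrt N"
        by (simp add: h_def algebra_simps add_divide_distrib)
      finally show ?thesis using intH by (rule order_trans[rotated])
    qed
    note H = H this
    have hN: "0 \<le> h / sqrt N" using h0 by simp
    have B0: "0 \<le> B" unfolding B_def by (rule B_nonneg[OF u(1) n])
    have M: "prob_space M" by (rule sample_pointsD(1)[OF sp])
    \<comment> \<open>Any stability estimate with additive term \<open>T\<close> and factor
      \<open>s\<close> is turned into an expectation bound: \<open>T = 0\<close> and
      \<open>s = S\<close> for Neumann and Robin, while Dirichlet uses a \<open>T\<close>
      proportional to \<open>\<eta>\<close> and \<open>s = S / \<eta>\<close>.\<close>
    have transfer: "expected_error M n u v \<le> ennreal (2 * real n * ((T + s * (E1 * (B\<^sup>2 / real m))) + s * (E2 * B\<^sup>2) * (h / sqrt N)))"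
      if T: "0 \<le> T" "0 \<le> s" and stab: "\<And>c a W b. net_params n m B c a W b \<Longrightarrow>
        (\<Sum>k<n. jet_error (\<lambda>k x. net_jet c a W b m k x - ?U k x) k) \<le> T + s * jet_loss \<alpha> n (\<lambda>k x. net_jet c a W b m k x - ?U k x)" for T s
    proof (rule expected_error_le[OF u M H])
      show "AE \<omega> in M. \<exists>V. (\<forall>k<n. C2_jet (V k)) \<and> (\<forall>k<n. \<forall>x. v \<omega> k x = val (V k x)) \<and>
        ennreal (\<Sum>k<n. jet_error (\<lambda>k x. V k x - ?U k x) k) \<le> ennreal (T + s * (E1 * (B\<^sup>2 / real m))) + ennreal (s * (E2 * B\<^sup>2)) * H \<omega>"
        using AE
      proof (rule AE_mp, intro AE_I2 impI)
        fix \<omega> assume "\<exists>c a W b. net_params n m B c a W b \<and> (\<forall>k<n. \<forall>x. v \<omega> k x = val (net_jet c a W b m k x)) \<and>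
         ennreal (jet_loss \<alpha> n (\<lambda>k x. net_jet c a W b m k x - ?U k x)) \<le> ennreal (E1 * (B\<^sup>2 / real m)) + ennreal (E2 * B\<^sup>2) * H \<omega>"
        then obtain c a W b where net: "net_params n m B c a W b" and v: "\<forall>k<n. \<forall>x. v \<omega> k x = val (net_jet c a W b m k x)"
          and le: "ennreal (jet_loss \<alpha> n (\<lambda>k x. net_jet c a W b m k x - ?U k x)) \<le> ennreal (E1 * (B\<^sup>2 / real m)) + ennreal (E2 * B\<^sup>2) * H \<omega>"
          by blast
        let ?j = "jet_loss \<alpha> n (\<lambda>k x. net_jet c a W b m k x - ?U k x)"
        have "ennreal (\<Sum>k<n. jet_error (\<lambda>k x. net_jet c a W b m k x - ?U k x) k) \<le> ennreal (T + s * ?j)"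
          by (rule ennreal_leI[OF stab[OF net]])
        also have "\<dots> = ennreal T + ennreal s * ennreal ?j"
          using T jet_loss_nonneg[of \<alpha> n "\<lambda>k x. net_jet c a W b m k x - ?U k x"] by (simp add: ennreal_plus ennreal_mult)
        also have "\<dots> \<le> ennreal T + ennreal s * (ennreal (E1 * (B\<^sup>2 / real m)) + ennreal (E2 * B\<^sup>2) * H \<omega>)"
          by (intro add_left_mono mult_left_mono le) simp
        also have "\<dots> = ennreal (T + s * (E1 * (B\<^sup>2 / real m))) + ennreal (s * (E2 * B\<^sup>2)) * H \<omega>"
        proof -
          have *: "ennreal T + ennreal s * (ennreal p + ennreal q * z) = ennreal (T + s * p) + ennreal (s * q) * z"
            if "0 \<le> p" "0 \<le> q" for p q z
            using that T by (simp add: ennreal_plus ennreal_mult distrib_left mult.assoc add.assoc)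
          show ?thesis using E1 E2 by (intro *) auto
        qed
        finally show "\<exists>V. (\<forall>k<n. C2_jet (V k)) \<and> (\<forall>k<n. \<forall>x. v \<omega> k x = val (V k x)) \<and>
          ennreal (\<Sum>k<n. jet_error (\<lambda>k x. V k x - ?U k x) k) \<le> ennreal (T + s * (E1 * (B\<^sup>2 / real m))) + ennreal (s * (E2 * B\<^sup>2)) * H \<omega>"
          using v by (intro exI[of _ "net_jet c a W b m"]) (simp add: C2_net_jet)
      qed
    qed (use T E1 E2 hN in auto)
    have C2: "C2_jet (\<lambda>x. net_jet c a W b m k x - ?U k x)" if "k < n" for c a b k and W :: "nat \<Rightarrow> real^'d"
      using that by (intro C2_diff C2_net_jet C2_barron_jet[OF u(1)]) simp
    show "(\<alpha> \<in> {Neumann, Robin} \<longrightarrow> expected_error M n u v \<le>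
         ennreal (C * ((barron_norm (2 * n + 3) u)\<^sup>2 / real m + (barron_norm (2 * n + 3) u)\<^sup>2 / sqrt (real N)))) \<and>
      (\<alpha> = Dirichlet \<longrightarrow> expected_error M n u v \<le>
         ennreal (C * ((barron_norm (2 * n + 3) u)\<^sup>2 / sqrt (real m) + (barron_norm (2 * n + 3) u)\<^sup>2 / root 4 (real N))))"
      unfolding B_def[symmetric]
    proof (intro conjI impI)
      assume \<alpha>: "\<alpha> \<in> {Neumann, Robin}"
      have "expected_error M n u v \<le> ennreal (2 * real n * ((0 + S * (E1 * (B\<^sup>2 / real m))) + S * (E2 * B\<^sup>2) * (h / sqrt N)))"
      proof (rule transfer)
        fix c a b and W :: "nat \<Rightarrow> real^'d"
        let ?e = "\<lambda>k x. net_jet c a W b m k x - ?U k x"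
        have "(\<Sum>k<n. jet_error ?e k) \<le> real n * (real n * 400 ^ n) * jet_loss \<alpha> n ?e \<or>
            (\<Sum>k<n. jet_error ?e k) \<le> real n * (real n * neumann_const CARD('d) ^ n) * jet_loss \<alpha> n ?e"
          using \<alpha> stability_Robin[of n ?e, OF C2] stability_Neumann[of n ?e, OF C2] by auto
        moreover have "0 \<le> real n * (real n * 400 ^ n) * jet_loss \<alpha> n ?e" "0 \<le> real n * (real n * neumann_const CARD('d) ^ n) * jet_loss \<alpha> n ?e"
          using nc jet_loss_nonneg[of \<alpha> n ?e] by auto
        ultimately show "(\<Sum>k<n. jet_error ?e k) \<le> 0 + S * jet_loss \<alpha> n ?e" unfolding S_def distrib_right by linarith
      qed (use S0 in auto)
      also have "\<dots> \<le> ennreal (C * (B\<^sup>2 / real m + B\<^sup>2 / sqrt (real N)))"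
      proof (rule ennreal_leI)
        let ?c1 = "2 * real n * (S * E1)" and ?c2 = "2 * real n * (S * (E2 * h))"
        have nn: "0 \<le> real n * (S * (?d * b\<^sup>2))" "0 \<le> real n * (S * E1)" "0 \<le> real n * (S * (E2 * h))"
          using S0 E1 E2 h0 by auto
        have "C = 2 * (real n * (S * (?d * b\<^sup>2))) + 8 * (real n * (S * E1)) + 8 * (real n * (S * (E2 * h))) + 1"
          by (simp add: C_def algebra_simps)
        then have "?c1 \<le> C" "?c2 \<le> C" using nn by linarith+
        then have "?c1 * (B\<^sup>2 / real m) + ?c2 * (B\<^sup>2 / sqrt (real N)) \<le> C * (B\<^sup>2 / real m) + C * (B\<^sup>2 / sqrt (real N))"
          by (intro add_mono mult_right_mono) auto
        then show "2 * real n * ((0 + S * (E1 * (B\<^sup>2 / real m))) + S * (E2 * B\<^sup>2) * (h / sqrt N)) \<le> C * (B\<^sup>2 / real m + B\<^sup>2 / sqrt (real N))"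
          by (simp add: algebra_simps)
      qed
      finally show "expected_error M n u v \<le> ennreal (C * (B\<^sup>2 / real m + B\<^sup>2 / sqrt (real N)))" .
    next
      assume \<alpha>: "\<alpha> = Dirichlet"
      define x y where "x = 1 / sqrt (real m)" and "y = 1 / root 4 (real N)"
      \<comment> \<open>As \<open>m\<close> and \<open>N\<close> are at least 1, both
        \<open>x\<close> and \<open>y\<close> are at most 1, so this weight is admissible in
        \<open>stability_Dirichlet\<close>.\<close>
      define \<eta> where "\<eta> = (x + y) / 2"
      have x: "0 < x" "x \<le> 1" using m by (auto simp: x_def)
      have y: "0 < y" "y \<le> 1" using N by (auto simp: y_def)
      have \<eta>: "0 < \<eta>" "\<eta> \<le> 1" using x y by (auto simp: \<eta>_def)
      have x2: "B\<^sup>2 / real m = B\<^sup>2 * x\<^sup>2" by (simp add: x_def power_divide)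
      have "sqrt (real N) = (root 4 (real N))\<^sup>2"
      proof -
        have "((root 4 (real N))\<^sup>2)\<^sup>2 = real N" using real_root_pow_pos2[of 4 "real N"] by (simp flip: power_mult)
        then show ?thesis by (intro real_sqrt_unique) auto
      qed
      then have y2: "h / sqrt N = h * y\<^sup>2" by (simp add: y_def power_divide)
      have "expected_error M n u v \<le> ennreal (2 * real n * ((S * (?d * (b * B)\<^sup>2 * \<eta>) + S / \<eta> * (E1 * (B\<^sup>2 / real m))) + S / \<eta> * (E2 * B\<^sup>2) * (h / sqrt N)))"
      proof (rule transfer)
        fix c a b' and W :: "nat \<Rightarrow> real^'d" assume net: "net_params n m B c a W b'"
        let ?e = "\<lambda>k x. net_jet c a W b' m k x - ?U k x"
        have "norm (grd (?e k x)) \<le> b * B" if "k < n" "x \<in> cube" for k x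
        proof -
          have "norm (grd (?e k x)) \<le> norm (?e k x)" by (rule norm_component_jet)
          also have "\<dots> \<le> norm (net_jet c a W b' m k x) + norm (?U k x)" by (rule norm_triangle_ineq4)
          also have "\<dots> \<le> (2 + 4 * act_bound CARD('d)) * B + 3 * B"
            unfolding B_def using norm_net_jet[OF net[unfolded B_def] that] that(1)
            by (intro add_mono norm_barron_jet[OF u(1)]) auto
          also have "\<dots> = b * B" by (simp add: b_def algebra_simps)
          finally show ?thesis .
        qed
        then have "(\<Sum>k<n. jet_error ?e k) \<le> real n * (real n * 400 ^ n) * (?d * (b * B)\<^sup>2 * \<eta> + jet_loss \<alpha> n ?e / \<eta>)"
          unfolding \<alpha> by (intro stability_Dirichlet C2 \<eta>)
        also have "\<dots> \<le> S * (?d * (b * B)\<^sup>2 * \<eta> + jet_loss \<alpha> n ?e / \<eta>)"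
          using \<eta> nc jet_loss_nonneg[of \<alpha> n ?e] by (intro mult_right_mono) (auto simp: S_def)
        finally show "(\<Sum>k<n. jet_error ?e k) \<le> S * (?d * (b * B)\<^sup>2 * \<eta>) + S / \<eta> * jet_loss \<alpha> n ?e"
          by (simp add: distrib_left)
      qed (use S0 \<eta> in auto)
      also have "\<dots> \<le> ennreal (C * (B\<^sup>2 / sqrt (real m) + B\<^sup>2 / root 4 (real N)))"
      proof (rule ennreal_leI)
        let ?R = "S * (?d * b\<^sup>2 + 4 * E1 + 4 * (E2 * h)) * (x + y)"
        have "S * (?d * b\<^sup>2 * \<eta> + E1 * x\<^sup>2 / \<eta>) + S * (E2 * h / \<eta>) * y\<^sup>2 \<le> ?R"
          unfolding \<eta>_def using x y E1 E2 h0 S0 by (intro dirichlet_balance) auto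
        then have "(2 * real n * B\<^sup>2) * (S * (?d * b\<^sup>2 * \<eta> + E1 * x\<^sup>2 / \<eta>) + S * (E2 * h / \<eta>) * y\<^sup>2) \<le> (2 * real n * B\<^sup>2) * ?R"
          by (intro mult_left_mono) auto
        also have "(2 * real n * B\<^sup>2) * ?R = (C - 1) * (B\<^sup>2 * (x + y))" by (simp add: C_def)
        also have "\<dots> \<le> C * (B\<^sup>2 * (x + y))" using x y by (intro mult_right_mono) auto
        also have "B\<^sup>2 * (x + y) = B\<^sup>2 / sqrt (real m) + B\<^sup>2 / root 4 (real N)" by (simp add: x_def y_def distrib_left)
        also have "(2 * real n * B\<^sup>2) * (S * (?d * b\<^sup>2 * \<eta> + E1 * x\<^sup>2 / \<eta>) + S * (E2 * h / \<eta>) * y\<^sup>2)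
            = 2 * real n * ((S * (?d * (b * B)\<^sup>2 * \<eta>) + S / \<eta> * (E1 * (B\<^sup>2 / real m))) + S / \<eta> * (E2 * B\<^sup>2) * (h / sqrt N))"
          unfolding x2 y2 using \<eta> by (simp add: field_simps power_mult_distrib)
        finally show "2 * real n * ((S * (?d * (b * B)\<^sup>2 * \<eta>) + S / \<eta> * (E1 * (B\<^sup>2 / real m))) + S / \<eta> * (E2 * B\<^sup>2) * (h / sqrt N))
          \<le> C * (B\<^sup>2 / sqrt (real m) + B\<^sup>2 / root 4 (real N))" .
      qed
      finally show "expected_error M n u v \<le> ennreal (C * (B\<^sup>2 / sqrt (real m) + B\<^sup>2 / root 4 (real N)))" .
    qed
  qed
qed

end
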